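(* Let $\widehat E\subset\mathbb R^n$ be the closure of a bounded Lipschitz domain, let $U\supset\widehat E$ be open and $\varphi:U\to\mathbb R^n$ a $C^1$ diffeomorphism onto its image, and $E:=\varphi(\widehat E)$ (assumed again to be the closure of a bounded Lipschitz domain). Let $\mathscr V(E)\subset\mathscr D_0^k(E)$ be an $N$-dimensional subspace and $\mathscr V(\widehat E):=\varphi^*\mathscr V(E)$. Let $S_1,\dots,S_N\subset\widehat E$ be oriented $k$-rectifiable sets, $\widehat{\mathcal T}=\{T_{S_1},\dots,T_{S_N}\}$ and $\mathcal T=\{T_{\varphi(S_1)},\dots,T_{\varphi(S_N)}\}$ (with $\varphi(S_i)$ carrying the orientation induced by $\varphi$), and assume $\mathcal T$ is unisolvent for $\mathscr V(E)$ (equivalently $\widehat{\mathcal T}$ is unisolvent for $\mathscr V(\widehat E)$). Then, with $\sigma_j^{(\varphi)}$ as below and $\|\cdot\|_\infty$ the supremum over $U$, $$\mathcal L(\mathcal T,\mathscr V(E))\le\frac{\big\|\prod_{j=1}^k\sigma_j^{(\varphi)}\big\|_\infty}{\Big(\big\|\prod_{j=n-k+1}^n(\sigma_j^{(\varphi)})^{-1}\big\|_\infty\Big)^{-1}}\ \mathcal L(\widehat{\mathcal T},\mathscr V(\widehat E)).$$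
   Context: For $x\in U$, $\sigma_1^{(\varphi)}(x)\ge\dots\ge\sigma_n^{(\varphi)}(x)>0$ are the singular values of $D\varphi(x)$. $\mathscr D_0^k(E)$ is the Banach space of continuous maps $E\to\Lambda^k$ with norm $\|\omega\|_0=\sup_S\mathcal H^k(S)^{-1}|\int_S\omega|$ over oriented $\mathcal H^k$-measurable $k$-rectifiable $S\subset E$ with $0<\mathcal H^k(S)<\infty$, where $\int_S\omega=\int_S\langle\omega(x);\tau(x)\rangle d\mathcal H^k(x)$, $\tau$ the orientation. $T_S(\omega):=\mathcal H^k(S)^{-1}\int_S\omega$ is the averaging current and $\mathscr A^k(E)$ the set of all such currents. $\varphi^*$ is the pullback of forms, so that $\int_{\varphi(S)}\omega=\int_S\varphi^*\omega$. For a unisolvent set $\mathcal T=\{T_1,\dots,T_N\}$ (i.e. $T_i(\omega)=0\ \forall i$, $\omega\in\mathscr V$ imply $\omega=0$) the Lagrange basis $\{\omega_i\}\subset\mathscr V$ satisfies $T_i(\omega_j)=\delta_{ij}$, and the Lebesgue constant is $\mathcal L(\mathcal T,\mathscr V(E)):=\sup_{T\in\mathscr A^k(E)}\sum_{i=1}^N|T(\omega_i)|$ (analogously on $\widehat E$ with $\mathscr A^k(\widehat E)$). *)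

theory Defs
  imports "HOL-Analysis.Analysis"
begin

definition hausdorff_pre :: "nat \<Rightarrow> real \<Rightarrow> 'a::euclidean_space set \<Rightarrow> ennreal" where
  "hausdorff_pre k \<delta> A =
     (INF C \<in> {C :: nat \<Rightarrow> 'a set. A \<subseteq> (\<Union>i. C i) \<and> (\<forall>i. bounded (C i) \<and> diameter (C i) \<le> \<delta>)}.
        (\<Sum>i. if C i = {} then 0
              else ennreal (unit_ball_vol (real k) / 2 ^ k * diameter (C i) ^ k)))"

definition hausdorff_outer :: "nat \<Rightarrow> 'a::euclidean_space set \<Rightarrow> ennreal" where
  "hausdorff_outer k A = (SUP \<delta> \<in> {0<..}. hausdorff_pre k \<delta> A)"

definition hausdorff_measure :: "nat \<Rightarrow> 'a::euclidean_space measure" where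
  "hausdorff_measure k =
     measure_of UNIV
       {A. \<forall>B. hausdorff_outer k B = hausdorff_outer k (B \<inter> A) + hausdorff_outer k (B - A)}
       (hausdorff_outer k)"

text \<open>Countably k-rectifiable, H^k-measurable: covered up to an H^k-null set by countably many
  Lipschitz images of (a copy of) R^k, realised as a k-dimensional subspace V.\<close>
definition is_rectifiable :: "nat \<Rightarrow> 'a::euclidean_space set \<Rightarrow> bool" where
  "is_rectifiable k S \<longleftrightarrow>
     S \<in> sets (hausdorff_measure k) \<and>
     (\<exists>V (g :: nat \<Rightarrow> 'a \<Rightarrow> 'a). subspace V \<and> dim V = k \<and> (\<forall>i. \<exists>L. lipschitz_on L V (g i)) \<and>
        hausdorff_outer k (S - (\<Union>i. g i ` V)) = 0)"

definition approx_tangent :: "nat \<Rightarrow> 'a::euclidean_space set \<Rightarrow> 'a \<Rightarrow> 'a set \<Rightarrow> bool" where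
  "approx_tangent k S x P \<longleftrightarrow> subspace P \<and> dim P = k \<and>
     (\<forall>g :: 'a \<Rightarrow> real. continuous_on UNIV g \<and> bounded {y. g y \<noteq> 0} \<longrightarrow>
        ((\<lambda>r. set_lebesgue_integral (hausdorff_measure k) S (\<lambda>y. g ((1 / r) *\<^sub>R (y - x)) / r ^ k))
          \<longlongrightarrow> set_lebesgue_integral (hausdorff_measure k) P g) (at_right 0))"

definition orthonormal_frame :: "nat \<Rightarrow> (nat \<Rightarrow> 'a::euclidean_space) \<Rightarrow> bool" where
  "orthonormal_frame k v \<longleftrightarrow> (\<forall>i<k. \<forall>j<k. v i \<bullet> v j = (if i = j then 1 else 0))"

text \<open>An orientation is the unit simple k-vector  s x * (f x 0 \<and> ... \<and> f x (k-1)),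
  with s x = +1 or -1 and f x an orthonormal frame spanning the approximate tangent space.\<close>
definition oriented_rect ::
  "nat \<Rightarrow> 'a::euclidean_space set \<Rightarrow> ('a \<Rightarrow> real) \<Rightarrow> ('a \<Rightarrow> nat \<Rightarrow> 'a) \<Rightarrow> bool" where
  "oriented_rect k S s f \<longleftrightarrow>
     is_rectifiable k S \<and>
     0 < emeasure (hausdorff_measure k) S \<and> emeasure (hausdorff_measure k) S < \<infinity> \<and>
     s \<in> borel_measurable (hausdorff_measure k) \<and>
     (\<forall>i<k. (\<lambda>x. f x i) \<in> borel_measurable (hausdorff_measure k)) \<and>
     (\<forall>x\<in>S. s x \<in> {-1, 1} \<and> orthonormal_frame k (f x)) \<and>
     (AE x in hausdorff_measure k. x \<in> S \<longrightarrow> approx_tangent k S x (span (f x ` {..<k})))"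

definition covector :: "nat \<Rightarrow> ((nat \<Rightarrow> 'a::euclidean_space) \<Rightarrow> real) \<Rightarrow> bool" where
  "covector k c \<longleftrightarrow>
     (\<forall>v w. (\<forall>i<k. v i = w i) \<longrightarrow> c v = c w) \<and>
     (\<forall>i<k. \<forall>v. linear (\<lambda>y. c (v(i := y)))) \<and>
     (\<forall>i<k. \<forall>j<k. \<forall>v. i \<noteq> j \<and> v i = v j \<longrightarrow> c v = 0)"

type_synonym 'a kform = "'a \<Rightarrow> (nat \<Rightarrow> 'a) \<Rightarrow> real"

definition is_form :: "nat \<Rightarrow> 'a::euclidean_space set \<Rightarrow> 'a kform \<Rightarrow> bool" where
  "is_form k E \<omega> \<longleftrightarrow> (\<forall>x\<in>E. covector k (\<omega> x)) \<and> (\<forall>v. continuous_on E (\<lambda>x. \<omega> x v))"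

text \<open>V is an N-dimensional subspace of D_0^k(E) (forms identified when they agree on E).\<close>
definition form_subspace_dim :: "nat \<Rightarrow> 'a::euclidean_space set \<Rightarrow> 'a kform set \<Rightarrow> nat \<Rightarrow> bool" where
  "form_subspace_dim k E V N \<longleftrightarrow>
     (\<exists>\<beta> :: nat \<Rightarrow> 'a kform. (\<forall>i<N. is_form k E (\<beta> i)) \<and>
        (\<forall>c. (\<forall>x\<in>E. \<forall>v. (\<Sum>i<N. c i * \<beta> i x v) = 0) \<longrightarrow> (\<forall>i<N. c i = 0)) \<and>
        V = {\<omega>. \<exists>c. \<omega> = (\<lambda>x v. \<Sum>i<N. c i * \<beta> i x v)})"

definition pullback :: "('a \<Rightarrow> 'a) \<Rightarrow> ('a \<Rightarrow> 'a \<Rightarrow>\<^sub>L 'a) \<Rightarrow> 'a::euclidean_space kform \<Rightarrow> 'a kform" where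
  "pullback \<phi> \<phi>' \<omega> = (\<lambda>x v. \<omega> (\<phi> x) (\<lambda>i. blinfun_apply (\<phi>' x) (v i)))"

definition integ_form ::
  "nat \<Rightarrow> 'a::euclidean_space set \<Rightarrow> ('a \<Rightarrow> real) \<Rightarrow> ('a \<Rightarrow> nat \<Rightarrow> 'a) \<Rightarrow> 'a kform \<Rightarrow> real" where
  "integ_form k S s f \<omega> = set_lebesgue_integral (hausdorff_measure k) S (\<lambda>x. s x * \<omega> x (f x))"

definition avg_current ::
  "nat \<Rightarrow> 'a::euclidean_space set \<Rightarrow> ('a \<Rightarrow> real) \<Rightarrow> ('a \<Rightarrow> nat \<Rightarrow> 'a) \<Rightarrow> 'a kform \<Rightarrow> real" where
  "avg_current k S s f \<omega> = integ_form k S s f \<omega> / measure (hausdorff_measure k) S"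

definition unisolvent ::
  "'a::euclidean_space set \<Rightarrow> nat \<Rightarrow> (nat \<Rightarrow> 'a kform \<Rightarrow> real) \<Rightarrow> 'a kform set \<Rightarrow> bool" where
  "unisolvent E N T V \<longleftrightarrow>
     (\<forall>\<omega>\<in>V. (\<forall>i<N. T i \<omega> = 0) \<longrightarrow> (\<forall>x\<in>E. \<forall>v. \<omega> x v = 0))"

definition lagrange_basis ::
  "nat \<Rightarrow> (nat \<Rightarrow> 'a kform \<Rightarrow> real) \<Rightarrow> 'a kform set \<Rightarrow> (nat \<Rightarrow> 'a kform) \<Rightarrow> bool" where
  "lagrange_basis N T V \<omega> \<longleftrightarrow>
     (\<forall>j<N. \<omega> j \<in> V) \<and> (\<forall>i<N. \<forall>j<N. T i (\<omega> j) = (if i = j then 1 else 0))"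

definition lebesgue_const ::
  "nat \<Rightarrow> 'a::euclidean_space set \<Rightarrow> nat \<Rightarrow> (nat \<Rightarrow> 'a kform \<Rightarrow> real) \<Rightarrow> 'a kform set \<Rightarrow> real" where
  "lebesgue_const k E N T V =
     (let \<omega> = (SOME \<omega>. lagrange_basis N T V \<omega>) in
      Sup {(\<Sum>i<N. \<bar>avg_current k S s f (\<omega> i)\<bar>) | S s f. S \<subseteq> E \<and> oriented_rect k S s f})"

text \<open>(s',f') on \<phi>(S) is induced by (s,f): tau'(\<phi> x) = \<Lambda>_k D\<phi>(x) tau(x) / |\<Lambda>_k D\<phi>(x) tau(x)|,
  tested against all k-covectors.\<close>
definition induced_orient ::
  "nat \<Rightarrow> 'a::euclidean_space set \<Rightarrow> ('a \<Rightarrow> real) \<Rightarrow> ('a \<Rightarrow> nat \<Rightarrow> 'a) \<Rightarrow> ('a \<Rightarrow> 'a)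
   \<Rightarrow> ('a \<Rightarrow> 'a \<Rightarrow>\<^sub>L 'a) \<Rightarrow> ('a \<Rightarrow> real) \<Rightarrow> ('a \<Rightarrow> nat \<Rightarrow> 'a) \<Rightarrow> bool" where
  "induced_orient k S s f \<phi> \<phi>' s' f' \<longleftrightarrow>
     (\<forall>x\<in>S. s' (\<phi> x) \<in> {-1, 1} \<and> orthonormal_frame k (f' (\<phi> x)) \<and>
        (\<exists>J>0. \<forall>c. covector k c \<longrightarrow>
           s' (\<phi> x) * c (f' (\<phi> x)) = s x * c (\<lambda>i. blinfun_apply (\<phi>' x) (f x i)) / J))"

text \<open>Singular values \<sigma>_1 \<ge> ... \<ge> \<sigma>_n (list indices 0..n-1), via the SVD.\<close>
definition sing_vals :: "('a::euclidean_space \<Rightarrow>\<^sub>L 'a) \<Rightarrow> real list" where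
  "sing_vals A = (THE s. length s = DIM('a) \<and> sorted_wrt (\<ge>) s \<and> (\<forall>\<sigma>\<in>set s. \<sigma> \<ge> 0) \<and>
     (\<exists>u v :: nat \<Rightarrow> 'a. orthonormal_frame DIM('a) u \<and> orthonormal_frame DIM('a) v \<and>
        (\<forall>i<DIM('a). blinfun_apply A (v i) = (s ! i) *\<^sub>R u i)))"

definition C1_diffeo :: "'a::euclidean_space set \<Rightarrow> ('a \<Rightarrow> 'a) \<Rightarrow> ('a \<Rightarrow> 'a \<Rightarrow>\<^sub>L 'a) \<Rightarrow> bool" where
  "C1_diffeo U \<phi> \<phi>' \<longleftrightarrow> open U \<and>
     (\<forall>x\<in>U. (\<phi> has_derivative blinfun_apply (\<phi>' x)) (at x)) \<and> continuous_on U \<phi>' \<and>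
     inj_on \<phi> U \<and> open (\<phi> ` U) \<and>
     (\<exists>\<psi> \<psi>'. (\<forall>x\<in>U. \<psi> (\<phi> x) = x) \<and>
        (\<forall>y\<in>\<phi> ` U. (\<psi> has_derivative blinfun_apply (\<psi>' y)) (at y)) \<and> continuous_on (\<phi> ` U) \<psi>')"

text \<open>Bounded Lipschitz domain: bounded connected open set whose boundary is locally
  (in rotated coordinates, direction e) the graph of a Lipschitz function, with the domain below.\<close>
definition lipschitz_domain :: "'a::euclidean_space set \<Rightarrow> bool" where
  "lipschitz_domain \<Omega> \<longleftrightarrow> open \<Omega> \<and> connected \<Omega> \<and> bounded \<Omega> \<and> \<Omega> \<noteq> {} \<and>
     (\<forall>x\<in>frontier \<Omega>. \<exists>r>0. \<exists>e (h :: 'a \<Rightarrow> real) L. norm e = 1 \<and> lipschitz_on L {y. y \<bullet> e = 0} h \<and>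
        \<Omega> \<inter> ball x r = {y \<in> ball x r. y \<bullet> e < h (y - (y \<bullet> e) *\<^sub>R e)})"

end

(* The pullback identity transports averaging currents: if T = phi(R) with the induced orientation,
   then T_T(w) is H^k(R) / H^k(T) times T_R(phi^* w).  Hence the Lagrange basis on E and the one on the
   reference set satisfy phi^* w_i = (H^k(phi(S_i)) / H^k(S_i)) * (i-th reference basis form), and each
   |T_T(w_i)| is a reference term multiplied by (H^k(phi(S_i)) / H^k(S_i)) * (H^k(R) / H^k(T)).  By the
   area formula the first ratio is an average of the tangential Jacobian and the second one is at most
   the supremum of its inverse; Courant-Fischer bounds the Jacobian by products of the k largest and
   of the k smallest singular values.

   The area formula comes from the approximate tangent planes: up to a null set, S splits into
   countably many pieces lying in narrow cones about a fixed plane, on which phi is nearly linear.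
   That phi(S) again has approximate tangent planes follows by changing variables in the defining
   integrals at Lebesgue points of the Jacobian. *)

theory Submission
  imports Defs "Jordan_Normal_Form.Determinant"
begin

no_notation scalar_prod (infix "\<bullet>" 70)
hide_const (open) Matrix.orthogonal Order.top
hide_fact (open) Matrix.orthogonal_def Congruence.set_eqI

subsection \<open>Hausdorff outer measure\<close>

text \<open>The Lebesgue constant on the image of \<open>Eh\<close> is a supremum over all
  competitors there, so every admissible one has to be exhibited as the image of an admissible one
  in \<open>Eh\<close>, complete with rectifiability, measurable orientation and approximate tangent
  planes. The transport results are therefore stated for a map together with its inverse and used in
  both directions. Orientations travel by Gram-Schmidt, an explicit recursion that is measurable in
  the frame and changes a k-vector only by a positive factor; testing against Gram determinants
  identifies such a factor with the Jacobian, so that it cancels in the change of variables.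

  On k-planes Hausdorff measure is compared with Lebesgue measure only up to a constant, which drops
  out of the scaling law of linear maps.

  Since \<open>lebesgue_const\<close> is a real supremum for a basis picked by choice, both bases
  must be shown to exist, unisolvence must determine their values, the sums on \<open>Eh\<close>
  must be bounded above, and some competitor must exist on the image: a small flat disc.\<close>

definition hausdorff_weight :: "nat \<Rightarrow> 'a::euclidean_space set \<Rightarrow> ennreal" where
  "hausdorff_weight k C =
     (if C = {} then 0 else ennreal (unit_ball_vol (real k) / 2 ^ k * diameter C ^ k))"

definition delta_cover :: "real \<Rightarrow> 'a::euclidean_space set \<Rightarrow> (nat \<Rightarrow> 'a set) \<Rightarrow> bool" where
  "delta_cover \<delta> A C \<longleftrightarrow> A \<subseteq> (\<Union>i. C i) \<and> (\<forall>i. bounded (C i) \<and> diameter (C i) \<le> \<delta>)"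

lemma hausdorff_pre_alt:
  "hausdorff_pre k \<delta> A = (INF C\<in>{C. delta_cover \<delta> A C}. \<Sum>i. hausdorff_weight k (C i))"
  unfolding hausdorff_pre_def hausdorff_weight_def delta_cover_def by simp

lemma hausdorff_weight_empty [simp]: "hausdorff_weight k {} = 0"
  by (simp add: hausdorff_weight_def)

lemma hausdorff_pre_le:
  "delta_cover \<delta> A C \<Longrightarrow> hausdorff_pre k \<delta> A \<le> (\<Sum>i. hausdorff_weight k (C i))"
  unfolding hausdorff_pre_alt by (rule INF_lower) simp

lemma hausdorff_pre_approx:
  assumes "hausdorff_pre k \<delta> A < \<infinity>" "0 < (e::real)"
  obtains C where "delta_cover \<delta> A C"
    "(\<Sum>i. hausdorff_weight k (C i)) < hausdorff_pre k \<delta> A + ennreal e"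
proof -
  have "\<exists>C\<in>{C. delta_cover \<delta> A C}. (\<Sum>i. hausdorff_weight k (C i)) < hausdorff_pre k \<delta> A + ennreal e"
    by (rule INF_approx_ennreal[OF assms(2) hausdorff_pre_alt]) (use assms(1) in auto)
  then show ?thesis using that by blast
qed

lemma delta_cover_mono: "delta_cover \<delta> B C \<Longrightarrow> \<delta> \<le> \<delta>' \<Longrightarrow> A \<subseteq> B \<Longrightarrow> delta_cover \<delta>' A C"
  unfolding delta_cover_def by (meson order_trans)

lemma hausdorff_pre_mono: "A \<subseteq> B \<Longrightarrow> hausdorff_pre k \<delta> A \<le> hausdorff_pre k \<delta> B"
  unfolding hausdorff_pre_alt using delta_cover_mono[of \<delta> B _ \<delta> A] by (intro INF_superset_mono) auto

lemma hausdorff_pre_antimono: "\<delta> \<le> \<delta>' \<Longrightarrow> hausdorff_pre k \<delta>' A \<le> hausdorff_pre k \<delta> A"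
  unfolding hausdorff_pre_alt using delta_cover_mono[of \<delta> A _ \<delta>' A] by (intro INF_superset_mono) auto

text \<open>Near-optimal covers of the sets \<open>A n\<close>, with excess
  \<open>e * (1/2)^Suc n\<close>, are merged into one cover through \<open>prod_decode\<close>; the
  excesses add up to \<open>e\<close>.\<close>

lemma hausdorff_pre_countable_subadditive:
  "hausdorff_pre k \<delta> (\<Union>n. A n) \<le> (\<Sum>n. hausdorff_pre k \<delta> (A n))"
proof (rule ennreal_le_epsilon)
  fix e :: real assume fin: "(\<Sum>n. hausdorff_pre k \<delta> (A n)) < top" and e: "0 < e"
  have "hausdorff_pre k \<delta> (A n) < \<infinity>" for n
    using fin ennreal_suminf_lessD by (metis infinity_ennreal_def)
  then have "\<exists>C. delta_cover \<delta> (A n) C \<and>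
     (\<Sum>i. hausdorff_weight k (C i)) < hausdorff_pre k \<delta> (A n) + ennreal (e * (1/2)^Suc n)" for n
    using hausdorff_pre_approx[of k \<delta> "A n" "e * (1/2)^Suc n"] e by (metis mult_pos_pos zero_less_divide_1_iff zero_less_numeral zero_less_power)
  then obtain C where C: "\<And>n. delta_cover \<delta> (A n) (C n)"
    "\<And>n. (\<Sum>i. hausdorff_weight k (C n i)) < hausdorff_pre k \<delta> (A n) + ennreal (e * (1/2)^Suc n)" by metis
  define D where "D = (\<lambda>m. case prod_decode m of (a, b) \<Rightarrow> C a b)"
  have "\<exists>m. x \<in> D m" if "x \<in> A n" for x n
  proof -
    have "x \<in> (\<Union>i. C n i)" using C(1)[of n] that unfolding delta_cover_def by blast
    then obtain i where "x \<in> C n i" by blast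
    then show ?thesis by (intro exI[of _ "prod_encode (n, i)"]) (simp add: D_def)
  qed
  then have "delta_cover \<delta> (\<Union>n. A n) D"
    using C(1) by (auto simp: delta_cover_def D_def split: prod.split)
  then have "hausdorff_pre k \<delta> (\<Union>n. A n) \<le> (\<Sum>m. hausdorff_weight k (D m))" by (rule hausdorff_pre_le)
  also have "\<dots> = (\<Sum>m. (\<lambda>(a,b). hausdorff_weight k (C a b)) (prod_decode m))"
    by (simp add: D_def case_prod_unfold)
  also have "\<dots> = (\<Sum>n. \<Sum>i. hausdorff_weight k (C n i))"
    by (rule suminf_ennreal_2dimen) simp
  also have "\<dots> \<le> (\<Sum>n. hausdorff_pre k \<delta> (A n) + ennreal (e * (1/2)^Suc n))"
    by (intro suminf_le summableI less_imp_le C(2))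
  also have "\<dots> = (\<Sum>n. hausdorff_pre k \<delta> (A n)) + (\<Sum>n. ennreal (e * (1/2)^Suc n))"
    by (intro suminf_add[symmetric] summableI)
  also have "(\<Sum>n. ennreal (e * (1/2)^Suc n)) = ennreal e"
    using sums_mult[OF power_half_series, of e] e
    by (intro suminf_ennreal_eq) (auto simp: mult.commute)
  finally show "hausdorff_pre k \<delta> (\<Union>n. A n) \<le> (\<Sum>n. hausdorff_pre k \<delta> (A n)) + ennreal e" .
qed

lemma hausdorff_pre_le_outer: "0 < \<delta> \<Longrightarrow> hausdorff_pre k \<delta> A \<le> hausdorff_outer k A"
  unfolding hausdorff_outer_def by (rule SUP_upper) simp

lemma hausdorff_outer_least:
  "(\<And>\<delta>. 0 < \<delta> \<Longrightarrow> hausdorff_pre k \<delta> A \<le> c) \<Longrightarrow> hausdorff_outer k A \<le> c"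
  unfolding hausdorff_outer_def by (rule SUP_least) simp

lemma hausdorff_outer_mono: "A \<subseteq> B \<Longrightarrow> hausdorff_outer k A \<le> hausdorff_outer k B"
  by (rule hausdorff_outer_least) (meson hausdorff_pre_le_outer hausdorff_pre_mono order_trans)

lemma hausdorff_outer_empty [simp]: "hausdorff_outer k {} = 0"
proof -
  have "hausdorff_pre k \<delta> {} \<le> 0" if "0 < \<delta>" for \<delta>
    using hausdorff_pre_le[of \<delta> "{}" "\<lambda>_. {}" k] that by (simp add: delta_cover_def)
  then show ?thesis by (metis hausdorff_outer_least le_zero_eq)
qed

lemma hausdorff_outer_countable_subadditive:
  "hausdorff_outer k (\<Union>n. A n) \<le> (\<Sum>n. hausdorff_outer k (A n))"
proof (rule hausdorff_outer_least)
  fix \<delta> :: real assume "0 < \<delta>"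
  then have "(\<Sum>n. hausdorff_pre k \<delta> (A n)) \<le> (\<Sum>n. hausdorff_outer k (A n))"
    by (intro suminf_le summableI hausdorff_pre_le_outer)
  then show "hausdorff_pre k \<delta> (\<Union>n. A n) \<le> (\<Sum>n. hausdorff_outer k (A n))"
    using hausdorff_pre_countable_subadditive order_trans by blast
qed

lemma hausdorff_outer_null_UN:
  "(\<And>n::nat. hausdorff_outer k (A n) = 0) \<Longrightarrow> hausdorff_outer k (\<Union>n. A n) = 0"
  using hausdorff_outer_countable_subadditive[of k A] by simp

lemma hausdorff_outer_Un: "hausdorff_outer k (A \<union> B) \<le> hausdorff_outer k A + hausdorff_outer k B"
proof -
  let ?C = "\<lambda>n::nat. if n = 0 then A else if n = 1 then B else {}"
  have "A \<union> B = (\<Union>n. ?C n)" by (auto split: if_splits)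
  then have "hausdorff_outer k (A \<union> B) \<le> (\<Sum>n. hausdorff_outer k (?C n))"
    using hausdorff_outer_countable_subadditive[of k ?C] by simp
  also have "\<dots> = (\<Sum>n\<in>{0,1}. hausdorff_outer k (?C n))"
    by (rule suminf_finite) auto
  finally show ?thesis by simp
qed

lemma hausdorff_outer_Un_null:
  "hausdorff_outer k A = 0 \<Longrightarrow> hausdorff_outer k B = 0 \<Longrightarrow> hausdorff_outer k (A \<union> B) = 0"
  using hausdorff_outer_Un[of k A B] by simp

lemma hausdorff_outer_null_subset:
  "hausdorff_outer k B = 0 \<Longrightarrow> A \<subseteq> B \<Longrightarrow> hausdorff_outer k A = 0"
  using hausdorff_outer_mono[of A B k] by simp

section \<open>Measurable sets of the Hausdorff outer measure\<close>

lemma outer_measure_space_hausdorff: "outer_measure_space (Pow UNIV) (hausdorff_outer k)"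
  unfolding outer_measure_space_def positive_def increasing_def countably_subadditive_def
  using hausdorff_outer_mono hausdorff_outer_countable_subadditive by auto

definition hausdorff_sets :: "nat \<Rightarrow> 'a::euclidean_space set set" where
  "hausdorff_sets k = {A. \<forall>B. hausdorff_outer k B = hausdorff_outer k (B \<inter> A) + hausdorff_outer k (B - A)}"

text \<open>Caratheodory's construction speaks of lambda systems. This identification turns its
  conclusion into the sigma-algebra and the measure behind \<open>hausdorff_measure\<close>.\<close>

lemma hausdorff_sets_lambda: "hausdorff_sets k = lambda_system UNIV (Pow UNIV) (hausdorff_outer k)"
proof (rule set_eqI)
  fix A :: "'a set"
  have *: "(UNIV - A) \<inter> B = B - A" for B by auto
  show "A \<in> hausdorff_sets k \<longleftrightarrow> A \<in> lambda_system UNIV (Pow UNIV) (hausdorff_outer k)"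
    unfolding hausdorff_sets_def lambda_system_def mem_Collect_eq * Int_commute[of A] Pow_UNIV ball_UNIV
    by (metis UNIV_I)
qed

lemma measure_space_hausdorff: "measure_space UNIV (hausdorff_sets k) (hausdorff_outer k)"
  unfolding hausdorff_sets_lambda
  by (rule sigma_algebra.caratheodory_lemma[OF sigma_algebra_Pow outer_measure_space_hausdorff])

lemma hausdorff_measure_alt: "hausdorff_measure k = measure_of UNIV (hausdorff_sets k) (hausdorff_outer k)"
  by (simp add: hausdorff_measure_def hausdorff_sets_def)

lemma space_hausdorff [simp]: "space (hausdorff_measure k) = UNIV"
  by (simp add: hausdorff_measure_alt space_measure_of_conv)

lemma sets_hausdorff: "sets (hausdorff_measure k) = hausdorff_sets k"
  using measure_space_hausdorff[of k] sigma_algebra.sets_measure_of_eq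
  unfolding hausdorff_measure_alt measure_space_def by blast

lemma emeasure_hausdorff:
  "A \<in> sets (hausdorff_measure k) \<Longrightarrow> emeasure (hausdorff_measure k) A = hausdorff_outer k A"
  using measure_space_hausdorff[of k]
  by (intro emeasure_measure_of[OF hausdorff_measure_alt]) (auto simp: sets_hausdorff measure_space_def)

text \<open>Subadditivity supplies one half of the splitting equation, and the other half is trivial
  for test sets of infinite outer measure.\<close>

lemma hausdorff_setsI:
  assumes "\<And>B. hausdorff_outer k B < \<infinity> \<Longrightarrow> hausdorff_outer k (B \<inter> A) + hausdorff_outer k (B - A) \<le> hausdorff_outer k B"
  shows "A \<in> sets (hausdorff_measure k)"
proof -
  have "hausdorff_outer k B = hausdorff_outer k (B \<inter> A) + hausdorff_outer k (B - A)" for B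
  proof (rule antisym)
    show "hausdorff_outer k B \<le> hausdorff_outer k (B \<inter> A) + hausdorff_outer k (B - A)"
      using hausdorff_outer_Un[of k "B \<inter> A" "B - A"] by (simp add: Int_Diff_Un)
    show "hausdorff_outer k (B \<inter> A) + hausdorff_outer k (B - A) \<le> hausdorff_outer k B"
      using assms[of B] by (cases "hausdorff_outer k B < \<infinity>") (auto simp: not_less top_unique)
  qed
  then show ?thesis unfolding sets_hausdorff hausdorff_sets_def by blast
qed

lemma hausdorff_split:
  "A \<in> sets (hausdorff_measure k) \<Longrightarrow> hausdorff_outer k B = hausdorff_outer k (B \<inter> A) + hausdorff_outer k (B - A)"
  unfolding sets_hausdorff hausdorff_sets_def by blast

lemma hausdorff_null_sets: "hausdorff_outer k A = 0 \<Longrightarrow> A \<in> sets (hausdorff_measure k)"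
proof (rule hausdorff_setsI)
  fix B assume "hausdorff_outer k A = 0"
  then have "hausdorff_outer k (B \<inter> A) = 0" by (meson Int_lower2 hausdorff_outer_null_subset)
  then show "hausdorff_outer k (B \<inter> A) + hausdorff_outer k (B - A) \<le> hausdorff_outer k B"
    by (simp add: hausdorff_outer_mono)
qed

lemma null_sets_hausdorff_iff: "A \<in> null_sets (hausdorff_measure k) \<longleftrightarrow> hausdorff_outer k A = 0"
  using hausdorff_null_sets[of k A] emeasure_hausdorff[of A k] by (auto simp: null_sets_def)

text \<open>Sets of outer measure zero are measurable, so the exceptional set can be measured
  directly, without first enclosing it in a measurable null set.\<close>

lemma AE_hausdorff_iff: "(AE x in hausdorff_measure k. P x) \<longleftrightarrow> hausdorff_outer k {x. \<not> P x} = 0"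
proof -
  have "(AE x in hausdorff_measure k. P x) \<longleftrightarrow> (\<exists>N\<in>null_sets (hausdorff_measure k). {x. \<not> P x} \<subseteq> N)"
    by (simp add: eventually_ae_filter)
  then show ?thesis unfolding null_sets_hausdorff_iff Bex_def
    using hausdorff_outer_null_subset by blast
qed

section \<open>Borel sets are Hausdorff measurable\<close>

text \<open>A cover of mesh below \<open>d\<close> has no member meeting both \<open>A\<close> and
  \<open>B\<close>, so it splits into a cover of \<open>A\<close> and a cover of \<open>B\<close>
  without sharing any weight.\<close>

lemma hausdorff_outer_metric:
  assumes "0 < d" "\<And>x y. x \<in> A \<Longrightarrow> y \<in> B \<Longrightarrow> d \<le> dist x y"
  shows "hausdorff_outer k A + hausdorff_outer k B \<le> hausdorff_outer k (A \<union> B)"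
proof -
  have 1: "hausdorff_pre k \<delta> A + hausdorff_pre k \<delta> B \<le> hausdorff_outer k (A \<union> B)" if \<delta>: "0 < \<delta>" "\<delta> < d" for \<delta>
  proof -
    have "hausdorff_pre k \<delta> A + hausdorff_pre k \<delta> B \<le> hausdorff_pre k \<delta> (A \<union> B)"
      unfolding hausdorff_pre_alt[of k \<delta> "A \<union> B"]
    proof (rule INF_greatest)
      fix C assume "C \<in> {C. delta_cover \<delta> (A \<union> B) C}"
      then have C: "A \<union> B \<subseteq> (\<Union>i. C i)" "\<And>i. bounded (C i)" "\<And>i. diameter (C i) \<le> \<delta>" by (auto simp: delta_cover_def)
      define CA where "CA = (\<lambda>i. if C i \<inter> A = {} then {} else C i)"
      define CB where "CB = (\<lambda>i. if C i \<inter> B = {} then {} else C i)"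
      have cov: "x \<in> (\<Union>i. CA i)" if "x \<in> A" for x
      proof -
        have "x \<in> (\<Union>i. C i)" using C(1) that by blast
        then obtain i where "x \<in> C i" by blast
        then show ?thesis using that by (auto simp: CA_def intro!: exI[of _ i])
      qed
      have cov': "x \<in> (\<Union>i. CB i)" if "x \<in> B" for x
      proof -
        have "x \<in> (\<Union>i. C i)" using C(1) that by blast
        then obtain i where "x \<in> C i" by blast
        then show ?thesis using that by (auto simp: CB_def intro!: exI[of _ i])
      qed
      have "delta_cover \<delta> A CA" "delta_cover \<delta> B CB"
        using C \<delta> subsetI[OF cov] subsetI[OF cov'] unfolding delta_cover_def by (auto simp: CA_def CB_def)
      then have "hausdorff_pre k \<delta> A + hausdorff_pre k \<delta> B
          \<le> (\<Sum>i. hausdorff_weight k (CA i)) + (\<Sum>i. hausdorff_weight k (CB i))"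
        by (intro add_mono hausdorff_pre_le)
      also have "\<dots> = (\<Sum>i. hausdorff_weight k (CA i) + hausdorff_weight k (CB i))"
        by (intro suminf_add summableI)
      also have "\<dots> \<le> (\<Sum>i. hausdorff_weight k (C i))"
      proof (intro suminf_le summableI)
        fix i
        have "C i \<inter> A = {} \<or> C i \<inter> B = {}"
          using assms(2) diameter_bounded_bound[OF C(2)[of i]] C(3)[of i] \<delta>(2)
          by (meson disjoint_iff IntE not_less order_less_le_trans order_trans)
        then show "hausdorff_weight k (CA i) + hausdorff_weight k (CB i) \<le> hausdorff_weight k (C i)"
          by (auto simp: CA_def CB_def)
      qed
      finally show "hausdorff_pre k \<delta> A + hausdorff_pre k \<delta> B \<le> (\<Sum>i. hausdorff_weight k (C i))" .
    qed
    then show ?thesis using hausdorff_pre_le_outer[OF \<delta>(1)] order_trans by blast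
  qed
  have "(SUP \<delta>\<in>{0<..}. hausdorff_pre k \<delta> A) + (SUP \<delta>\<in>{0<..}. hausdorff_pre k \<delta> B)
      = (SUP \<delta>\<in>{0<..}. hausdorff_pre k \<delta> A + hausdorff_pre k \<delta> B)"
  \<comment> \<open>The supremum of the sum splits because \<open>hausdorff_pre\<close> grows as the
    mesh shrinks: the smaller of two meshes serves both summands.\<close>
  proof (rule SUP_add_directed_ennreal[symmetric])
    fix i j :: real assume "i \<in> {0<..}" "j \<in> {0<..}"
    then show "\<exists>l\<in>{0<..}. hausdorff_pre k i A + hausdorff_pre k j B \<le> hausdorff_pre k l A + hausdorff_pre k l B"
      by (intro bexI[of _ "min i j"] add_mono hausdorff_pre_antimono) auto
  qed
  also have "\<dots> \<le> hausdorff_outer k (A \<union> B)"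
  proof (rule SUP_least)
    fix \<delta> :: real assume "\<delta> \<in> {0<..}"
    then have m: "0 < min \<delta> (d/2)" "min \<delta> (d/2) < d" using assms(1) by auto
    have "hausdorff_pre k \<delta> A + hausdorff_pre k \<delta> B
        \<le> hausdorff_pre k (min \<delta> (d/2)) A + hausdorff_pre k (min \<delta> (d/2)) B"
      by (intro add_mono hausdorff_pre_antimono) auto
    then show "hausdorff_pre k \<delta> A + hausdorff_pre k \<delta> B \<le> hausdorff_outer k (A \<union> B)"
      using 1[OF m] by simp
  qed
  finally show ?thesis by (simp add: hausdorff_outer_def)
qed

text \<open>Caratheodory's criterion: the annuli \<open>R m\<close> with indices of equal parity are pairwise at
  positive distance, so the measures of all annuli are summable.\<close>

lemma closed_hausdorff_measurable:
  assumes C: "closed (C :: 'a::euclidean_space set)"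
  shows "C \<in> sets (hausdorff_measure k)"
proof (cases "C = {}")
  case False
  show ?thesis
  proof (rule hausdorff_setsI)
    fix B :: "'a set" assume fin: "hausdorff_outer k B < \<infinity>"
    \<comment> \<open>\<open>Bn n\<close> keeps a positive distance from \<open>C\<close>, so
      additivity on separated sets applies to it; the annuli \<open>R m\<close> take up the rest of
      \<open>B - C\<close>.\<close>
    define Bn where "Bn = (\<lambda>n::nat. {x\<in>B. 1 / (real n + 1) \<le> infdist x C})"
    define R where "R = (\<lambda>m::nat. {x\<in>B. 1 / (real m + 2) \<le> infdist x C \<and> infdist x C < 1 / (real m + 1)})"
    have Csep: "hausdorff_outer k (B \<inter> C) + hausdorff_outer k (Bn n) \<le> hausdorff_outer k B" for n
    proof -
      have "hausdorff_outer k (B \<inter> C) + hausdorff_outer k (Bn n) \<le> hausdorff_outer k ((B \<inter> C) \<union> Bn n)"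
      proof (rule hausdorff_outer_metric[of "1 / (real n + 1)"])
        fix x y assume "x \<in> B \<inter> C" "y \<in> Bn n"
        then have "1 / (real n + 1) \<le> infdist y C" "infdist y C \<le> dist y x"
          by (auto simp: Bn_def intro: infdist_le)
        then show "1 / (real n + 1) \<le> dist x y" by (simp add: dist_commute)
      qed simp
      also have "\<dots> \<le> hausdorff_outer k B" by (rule hausdorff_outer_mono) (auto simp: Bn_def)
      finally show ?thesis .
    qed
    have par: "(\<Sum>m<N. hausdorff_outer k (R (2*m+p))) \<le> hausdorff_outer k (\<Union>m<N. R (2*m+p))" for N p
    proof (induction N)
      case (Suc N)
      have "(\<Sum>m<Suc N. hausdorff_outer k (R (2*m+p)))
          \<le> hausdorff_outer k (\<Union>m<N. R (2*m+p)) + hausdorff_outer k (R (2*N+p))"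
        using Suc by (simp add: add_right_mono)
      also have "\<dots> \<le> hausdorff_outer k ((\<Union>m<N. R (2*m+p)) \<union> R (2*N+p))"
      proof (cases "N = 0")
        case False
        \<comment> \<open>For \<open>m < N\<close> the points of the earlier annulus have distance
          at least \<open>1 / (2*m+p+2)\<close>, hence at least \<open>1 / (2*N+p)\<close>, from
          \<open>C\<close>, while those of \<open>R (2*N+p)\<close> are nearer than
          \<open>1 / (2*N+p+1)\<close>. For \<open>N = 0\<close> the union is empty and nothing has
          to be separated.\<close>
        let ?d = "1 / real (2*N+p) - 1 / (real (2*N+p) + 1)"
        show ?thesis
        proof (rule hausdorff_outer_metric[of ?d])
          have "1 / (real (2*N+p) + 1) < 1 / real (2*N+p)"
            using False by (intro divide_strict_left_mono) auto
          then show "0 < ?d" by simp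
          fix x y assume "x \<in> (\<Union>m<N. R (2*m+p))" and y: "y \<in> R (2*N+p)"
          then obtain m where m: "m < N" "x \<in> R (2*m+p)" by auto
          have "1 / real (2*N+p) \<le> 1 / (real (2*m+p) + 2)"
            using m(1) by (intro divide_left_mono) (auto intro!: mult_pos_pos)
          also have "\<dots> \<le> infdist x C" using m(2) by (simp add: R_def)
          also have "\<dots> \<le> infdist y C + dist x y" by (rule infdist_triangle)
          also have "infdist y C < 1 / (real (2*N+p) + 1)" using y by (simp add: R_def)
          finally show "?d \<le> dist x y" by simp
        qed
      qed simp
      also have "(\<Union>m<N. R (2*m+p)) \<union> R (2*N+p) = (\<Union>m<Suc N. R (2*m+p))"
        by (auto simp: lessThan_Suc)
      finally show ?case .
    qed simp
    have par_le: "(\<Sum>m. hausdorff_outer k (R (2*m+p))) \<le> hausdorff_outer k B" for p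
    proof (rule suminf_le_const[OF summableI])
      fix N
      have "hausdorff_outer k (\<Union>m<N. R (2*m+p)) \<le> hausdorff_outer k B"
        by (rule hausdorff_outer_mono) (auto simp: R_def)
      then show "(\<Sum>m<N. hausdorff_outer k (R (2*m+p))) \<le> hausdorff_outer k B"
        using par[of p N] by (rule order_trans[rotated])
    qed
    have fl: "(\<Sum>m<2*N. hausdorff_outer k (R m)) =
        (\<Sum>m<N. hausdorff_outer k (R (2*m+0))) + (\<Sum>m<N. hausdorff_outer k (R (2*m+1)))" for N
      by (induction N) (auto simp: algebra_simps)
    have sumR: "(\<Sum>m. hausdorff_outer k (R m)) \<le> hausdorff_outer k B + hausdorff_outer k B"
    proof (rule suminf_le_const[OF summableI])
      fix N
      have "(\<Sum>m<N. hausdorff_outer k (R m)) \<le> (\<Sum>m<2*N. hausdorff_outer k (R m))"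
        by (intro sum_mono2) auto
      also have "\<dots> \<le> (\<Sum>m. hausdorff_outer k (R (2*m+0))) + (\<Sum>m. hausdorff_outer k (R (2*m+1)))"
        unfolding fl by (intro add_mono sum_le_suminf summableI) auto
      also have "\<dots> \<le> hausdorff_outer k B + hausdorff_outer k B" by (intro add_mono par_le)
      finally show "(\<Sum>m<N. hausdorff_outer k (R m)) \<le> hausdorff_outer k B + hausdorff_outer k B" .
    qed
    then have finR: "(\<Sum>m. hausdorff_outer k (R m)) < top"
      using fin by (metis ennreal_add_less_top infinity_ennreal_def order_le_less_trans)
    \<comment> \<open>Only the tails of the convergent series matter: the annuli of index at least
      \<open>n\<close> cover what \<open>Bn n\<close> misses of \<open>B - C\<close>.\<close>
    have tail: "(\<lambda>n. \<Sum>m. hausdorff_outer k (R (m + n))) \<longlonglongrightarrow> 0"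
    proof -
      have "hausdorff_outer k (R m) \<noteq> top" for m
        using finR ennreal_suminf_lessD[of "\<lambda>m. hausdorff_outer k (R m)" top m] by simp
      then have r: "hausdorff_outer k (R m) = ennreal (enn2real (hausdorff_outer k (R m)))" for m
        by (simp add: less_top)
      have s: "summable (\<lambda>m. enn2real (hausdorff_outer k (R m)))"
        using finR r by (intro summable_suminf_not_top) (auto simp: r[symmetric])
      have "(\<lambda>n. ennreal (\<Sum>m. enn2real (hausdorff_outer k (R (m + n))))) \<longlonglongrightarrow> ennreal 0"
        by (intro tendsto_ennrealI suminf_exist_split2[OF s])
      moreover have "ennreal (\<Sum>m. enn2real (hausdorff_outer k (R (m + n)))) = (\<Sum>m. hausdorff_outer k (R (m + n)))" for n
        using summable_ignore_initial_segment[OF s, of n]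
        by (subst suminf_ennreal2[symmetric]) (auto simp: r[symmetric])
      ultimately show ?thesis by simp
    qed
    have main: "hausdorff_outer k (B \<inter> C) + hausdorff_outer k (B - C)
        \<le> hausdorff_outer k B + (\<Sum>m. hausdorff_outer k (R (m + n)))" for n
    proof -
      have sub: "B - C \<subseteq> Bn n \<union> (\<Union>m. R (m + n))"
      proof
        fix x assume x: "x \<in> B - C"
        then have pos: "0 < infdist x C" using C False infdist_pos_not_in_closed[of C x] by auto
        show "x \<in> Bn n \<union> (\<Union>m. R (m + n))"
        proof (cases "1 / (real n + 1) \<le> infdist x C")
          case True then show ?thesis using x by (auto simp: Bn_def)
        next
          case F: False
          obtain l0 :: nat where "1 / infdist x C \<le> real l0" using real_arch_simple by blast
          then have "1 / (real l0 + 2) \<le> infdist x C" using pos by (simp add: field_simps)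
          then have ex: "\<exists>l. 1 / (real l + 2) \<le> infdist x C" by blast
          \<comment> \<open>The least such \<open>l\<close> names the annulus of \<open>x\<close>:
            minimality gives the strict upper bound on the distance, and the failure of the bound
            defining \<open>Bn n\<close> forces \<open>n \<le> l\<close>, which also settles the
            case \<open>l = 0\<close>.\<close>
          define l where "l = (LEAST l::nat. 1 / (real l + 2) \<le> infdist x C)"
          have l1: "1 / (real l + 2) \<le> infdist x C" unfolding l_def using ex by (rule LeastI_ex)
          have "n \<le> l"
          proof (rule ccontr)
            assume "\<not> n \<le> l"
            then have "1 / (real n + 1) \<le> 1 / (real l + 2)" by (intro divide_left_mono) auto
            then show False using l1 F by linarith
          qed
          moreover have "infdist x C < 1 / (real l + 1)"
          proof (cases l)
            case 0 then show ?thesis using F \<open>n \<le> l\<close> by simp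
          next
            case (Suc l')
            then have "\<not> 1 / (real l' + 2) \<le> infdist x C"
              using not_less_Least[of l' "\<lambda>l. 1 / (real l + 2) \<le> infdist x C"] l_def by auto
            then show ?thesis using Suc by (simp add: add.commute)
          qed
          ultimately have "x \<in> R ((l - n) + n)" using l1 x by (simp add: R_def)
          then show ?thesis by blast
        qed
      qed
      have "hausdorff_outer k (B - C) \<le> hausdorff_outer k (Bn n) + (\<Sum>m. hausdorff_outer k (R (m + n)))"
        by (rule order_trans[OF hausdorff_outer_mono[OF sub] order_trans[OF hausdorff_outer_Un]])
           (intro add_left_mono hausdorff_outer_countable_subadditive)
      then have "hausdorff_outer k (B \<inter> C) + hausdorff_outer k (B - C)
          \<le> (hausdorff_outer k (B \<inter> C) + hausdorff_outer k (Bn n)) + (\<Sum>m. hausdorff_outer k (R (m + n)))"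
        by (simp add: add.assoc add_left_mono)
      also have "\<dots> \<le> hausdorff_outer k B + (\<Sum>m. hausdorff_outer k (R (m + n)))"
        by (intro add_right_mono Csep)
      finally show ?thesis .
    qed
    have "(\<lambda>n. hausdorff_outer k B + (\<Sum>m. hausdorff_outer k (R (m + n)))) \<longlonglongrightarrow> hausdorff_outer k B + 0"
      by (intro tendsto_add tendsto_const tail)
    then show "hausdorff_outer k (B \<inter> C) + hausdorff_outer k (B - C) \<le> hausdorff_outer k B"
      using main by (intro LIMSEQ_le_const[of _ "hausdorff_outer k B"]) auto
  qed
qed (simp)

lemma sets_borel_hausdorff: "sets (borel :: 'a::euclidean_space measure) \<subseteq> sets (hausdorff_measure k)"
proof -
  have "sets (borel :: 'a measure) = sigma_sets UNIV (Collect closed)"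
    by (simp add: borel_eq_closed)
  also have "\<dots> \<subseteq> sets (hausdorff_measure k)"
    using sets.sigma_sets_subset[of "Collect closed" "hausdorff_measure k"] closed_hausdorff_measurable by auto
  finally show ?thesis .
qed

lemma borel_hausdorffD: "A \<in> sets borel \<Longrightarrow> A \<in> sets (hausdorff_measure k)"
  using sets_borel_hausdorff by blast

lemma borel_measurable_hausdorffI:
  fixes f :: "'a::euclidean_space \<Rightarrow> 'b::topological_space"
  assumes "f \<in> borel_measurable borel" shows "f \<in> borel_measurable (hausdorff_measure k)"
proof (rule measurableI)
  fix A :: "'b set" assume "A \<in> sets borel"
  then show "f -` A \<inter> space (hausdorff_measure k) \<in> sets (hausdorff_measure k)"
    using measurable_sets[OF assms, of A] borel_hausdorffD by simp
qed simp

section \<open>Lipschitz maps\<close>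

text \<open>Images of the members of a cover form a cover of the image, with diameters multiplied by
  at most \<open>L\<close>. Infinite outer measure is treated apart: for \<open>L = 0\<close> and
  \<open>k \<noteq> 0\<close> the right-hand side is still 0, and then the image is at most one
  point.\<close>

lemma hausdorff_outer_Lipschitz:
  fixes g :: "'a::euclidean_space \<Rightarrow> 'b::euclidean_space"
  assumes L: "0 \<le> L" and g: "\<And>x y. x \<in> A \<Longrightarrow> y \<in> A \<Longrightarrow> dist (g x) (g y) \<le> L * dist x y"
  shows "hausdorff_outer k (g ` A) \<le> ennreal (L ^ k) * hausdorff_outer k A"
proof (cases "hausdorff_outer k A = top")
  case True
  show ?thesis
  proof (cases "L = 0 \<and> k \<noteq> 0")
    case True
    have "hausdorff_outer k (g ` A) \<le> 0"
    proof (rule hausdorff_outer_least)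
      fix \<delta> :: real assume "0 < \<delta>"
      have "diameter (g ` A) = 0" and b: "bounded (g ` A)"
      proof -
        have "g x = g y" if "x \<in> A" "y \<in> A" for x y using g[OF that] True by simp
        then have "g ` A = {} \<or> (\<exists>z. g ` A = {z})" by blast
        then show "diameter (g ` A) = 0" "bounded (g ` A)" by auto
      qed
      then have "delta_cover \<delta> (g ` A) (\<lambda>_. g ` A)" "hausdorff_weight k (g ` A) = 0"
        using \<open>0 < \<delta>\<close> True by (auto simp: delta_cover_def hausdorff_weight_def)
      then show "hausdorff_pre k \<delta> (g ` A) \<le> 0" using hausdorff_pre_le[of \<delta> "g ` A" "\<lambda>_. g ` A" k] by simp
    qed
    then show ?thesis by simp
  next
    case False
    then have "L ^ k > 0" using L by (cases "L = 0") auto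
    then show ?thesis using True False by (auto simp: ennreal_mult_top)
  qed
next
  case False
  show ?thesis
  proof (rule hausdorff_outer_least)
    fix \<delta> :: real assume \<delta>: "0 < \<delta>"
    \<comment> \<open>Dividing by \<open>L + 1\<close> instead of \<open>L\<close> keeps the mesh
      meaningful for \<open>L = 0\<close>; the same device gives the denominator of
      \<open>e'\<close>.\<close>
    define \<eta> where "\<eta> = \<delta> / (L + 1)"
    have \<eta>: "0 < \<eta>" "L * \<eta> \<le> \<delta>" using \<delta> L by (auto simp: \<eta>_def field_simps)
    show "hausdorff_pre k \<delta> (g ` A) \<le> ennreal (L ^ k) * hausdorff_outer k A"
    proof (rule ennreal_le_epsilon)
      fix e :: real assume e: "0 < e"
      define e' where "e' = e / (L ^ k + 1)"
      have Lk: "0 \<le> L ^ k" using L by simp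
      have e': "0 < e'" "L ^ k * e' \<le> e" using e Lk by (auto simp: e'_def field_simps)
      have "hausdorff_pre k \<eta> A < \<infinity>"
        using order_le_less_trans[OF hausdorff_pre_le_outer[OF \<eta>(1), of k A]] False by (simp add: less_top)
      then obtain C where C: "delta_cover \<eta> A C"
        and Cs: "(\<Sum>i. hausdorff_weight k (C i)) < hausdorff_pre k \<eta> A + ennreal e'"
        using hausdorff_pre_approx[OF _ e'(1)] by blast
      \<comment> \<open>The members are cut down to \<open>A\<close> first, as \<open>g\<close> is
        controlled only there.\<close>
      define D where "D = (\<lambda>i. g ` (C i \<inter> A))"
      have bC: "bounded (C i)" "diameter (C i) \<le> \<eta>" for i using C by (auto simp: delta_cover_def)
      have dD: "dist u v \<le> L * diameter (C i)" if uv: "u \<in> D i" "v \<in> D i" for u v i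
      proof -
        obtain x y where "x \<in> C i \<inter> A" "y \<in> C i \<inter> A" "u = g x" "v = g y" using uv unfolding D_def by blast
        then have "dist u v \<le> L * dist x y" "dist x y \<le> diameter (C i)"
          using g[of x y] diameter_bounded_bound[OF bC(1)[of i], of x y] by auto
        then show ?thesis using mult_left_mono[OF _ L] order_trans by blast
      qed
      have bD: "bounded (D i)" for i
      proof (cases "D i = {}")
        case False
        then obtain z where "z \<in> D i" by blast
        then show ?thesis using dD[of z i] unfolding bounded_def by blast
      qed simp
      have diD: "diameter (D i) \<le> L * diameter (C i)" for i
        using dD L diameter_ge_0[OF bC(1)] by (intro diameter_le) (auto simp: dist_norm)
      have "delta_cover \<delta> (g ` A) D" unfolding delta_cover_def
      proof (intro conjI allI)
        have "A \<subseteq> (\<Union>i. C i)" using C by (simp add: delta_cover_def)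
        then show "g ` A \<subseteq> (\<Union>i. D i)" unfolding D_def by blast
        fix i
        have "L * diameter (C i) \<le> L * \<eta>" using bC(2) L by (intro mult_left_mono)
        then show "diameter (D i) \<le> \<delta>" using diD[of i] \<eta>(2) by linarith
      qed (rule bD)
      then have "hausdorff_pre k \<delta> (g ` A) \<le> (\<Sum>i. hausdorff_weight k (D i))" by (rule hausdorff_pre_le)
      also have "\<dots> \<le> (\<Sum>i. ennreal (L ^ k) * hausdorff_weight k (C i))"
      proof (intro suminf_le summableI)
        fix i
        show "hausdorff_weight k (D i) \<le> ennreal (L ^ k) * hausdorff_weight k (C i)"
        proof (cases "D i = {}")
          case False
          then have ne: "C i \<noteq> {}" by (auto simp: D_def)
          have "diameter (D i) ^ k \<le> L ^ k * diameter (C i) ^ k"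
            using power_mono[OF diD diameter_ge_0[OF bD]] by (simp add: power_mult_distrib)
          then have "unit_ball_vol (real k) / 2 ^ k * diameter (D i) ^ k
              \<le> unit_ball_vol (real k) / 2 ^ k * (L ^ k * diameter (C i) ^ k)"
            by (intro mult_left_mono) auto
          then show ?thesis using False ne Lk
            by (auto simp: hausdorff_weight_def ennreal_mult'[symmetric] mult.left_commute intro!: ennreal_leI)
        qed simp
      qed
      also have "\<dots> = ennreal (L ^ k) * (\<Sum>i. hausdorff_weight k (C i))" by simp
      also have "\<dots> \<le> ennreal (L ^ k) * (hausdorff_pre k \<eta> A + ennreal e')"
        using Cs by (intro mult_left_mono) auto
      also have "\<dots> \<le> ennreal (L ^ k) * (hausdorff_outer k A + ennreal e')"
        by (intro mult_left_mono add_right_mono hausdorff_pre_le_outer \<eta>) auto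
      also have "\<dots> = ennreal (L ^ k) * hausdorff_outer k A + ennreal (L ^ k * e')"
        using Lk e'(1) by (simp add: distrib_left ennreal_mult')
      also have "\<dots> \<le> ennreal (L ^ k) * hausdorff_outer k A + ennreal e"
        using e' by (intro add_left_mono ennreal_leI)
      finally show "hausdorff_pre k \<delta> (g ` A) \<le> ennreal (L ^ k) * hausdorff_outer k A + ennreal e" .
    qed
  qed
qed

lemma hausdorff_outer_Lipschitz_null:
  fixes g :: "'a::euclidean_space \<Rightarrow> 'b::euclidean_space"
  assumes "\<And>x y. x \<in> A \<Longrightarrow> y \<in> A \<Longrightarrow> dist (g x) (g y) \<le> L * dist x y" "0 \<le> L" "hausdorff_outer k A = 0"
  shows "hausdorff_outer k (g ` A) = 0"
proof -
  have "hausdorff_outer k (g ` A) \<le> ennreal (L ^ k) * hausdorff_outer k A"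
    by (rule hausdorff_outer_Lipschitz[OF assms(2,1)])
  then show ?thesis unfolding assms(3) by simp
qed

lemma hausdorff_outer_isometry:
  fixes g :: "'a::euclidean_space \<Rightarrow> 'b::euclidean_space"
  assumes g: "\<And>x y. x \<in> A \<Longrightarrow> y \<in> A \<Longrightarrow> dist (g x) (g y) = dist x y"
  shows "hausdorff_outer k (g ` A) = hausdorff_outer k A"
proof (rule antisym)
  show "hausdorff_outer k (g ` A) \<le> hausdorff_outer k A"
    using hausdorff_outer_Lipschitz[of 1 A g k] g by simp
  have inj: "inj_on g A" using g by (metis inj_onI dist_eq_0_iff)
  have "inv_into A g ` g ` A = A" by (rule inv_into_image_cancel[OF inj order_refl])
  moreover have "hausdorff_outer k (inv_into A g ` g ` A) \<le> ennreal (1^k) * hausdorff_outer k (g ` A)"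
    using g inj by (intro hausdorff_outer_Lipschitz) auto
  ultimately show "hausdorff_outer k A \<le> hausdorff_outer k (g ` A)" by simp
qed

section \<open>Approximation by Borel and compact sets\<close>

text \<open>Taking closures changes no diameter, so nearly optimal covers of mesh
  \<open>1 / Suc n\<close> may be taken closed. The intersection over \<open>n\<close> of their
  unions is Borel and is covered as cheaply as \<open>A\<close> at every mesh.\<close>

lemma hausdorff_borel_hull:
  fixes A :: "'a::euclidean_space set"
  assumes fin: "hausdorff_outer k A < \<infinity>"
  obtains G where "G \<in> sets borel" "A \<subseteq> G" "hausdorff_outer k G = hausdorff_outer k A"
proof -
  have "\<exists>C. delta_cover (1 / Suc n) A C \<and> (\<Sum>i. hausdorff_weight k (C i)) < hausdorff_pre k (1 / Suc n) A + ennreal (1 / Suc n)" for n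
  proof -
    have "hausdorff_pre k (1 / Suc n) A < \<infinity>"
      using order_le_less_trans[OF hausdorff_pre_le_outer[of "1 / Suc n" k A]] fin by simp
    then show ?thesis by (rule hausdorff_pre_approx[where e="1 / Suc n"]) auto
  qed
  then obtain C where C: "\<And>n. delta_cover (1 / Suc n) A (C n)"
    "\<And>n. (\<Sum>i. hausdorff_weight k (C n i)) < hausdorff_pre k (1 / Suc n) A + ennreal (1 / Suc n)" by metis
  define G where "G = (\<Inter>n. \<Union>i. closure (C n i))"
  have AG: "A \<subseteq> G" unfolding G_def
  proof (intro INT_greatest)
    fix n
    have "A \<subseteq> (\<Union>i. C n i)" using C(1)[of n] by (simp add: delta_cover_def)
    also have "\<dots> \<subseteq> (\<Union>i. closure (C n i))" by (intro UN_mono closure_subset order_refl)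
    finally show "A \<subseteq> (\<Union>i. closure (C n i))" .
  qed
  have bo: "G \<in> sets borel" unfolding G_def by (intro sets.countable_INT'' sets.countable_UN) auto
  have "hausdorff_outer k G \<le> hausdorff_outer k A"
  proof (rule hausdorff_outer_least)
    fix \<delta> :: real assume \<delta>: "0 < \<delta>"
    have weq: "hausdorff_weight k (closure (C n i)) = hausdorff_weight k (C n i)" for n i
    proof -
      have "bounded (C n i)" using C(1)[of n] unfolding delta_cover_def by blast
      then show ?thesis by (simp add: hausdorff_weight_def diameter_closure)
    qed
    have step: "hausdorff_pre k \<delta> G \<le> hausdorff_outer k A + ennreal (1 / Suc n)" if n: "1 / Suc n \<le> \<delta>" for n
    proof -
      have "delta_cover (1 / Suc n) G (\<lambda>i. closure (C n i))"
        using C(1)[of n] by (auto simp: delta_cover_def G_def diameter_closure)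
      then have "hausdorff_pre k (1 / Suc n) G \<le> (\<Sum>i. hausdorff_weight k (closure (C n i)))" by (rule hausdorff_pre_le)
      also have "\<dots> = (\<Sum>i. hausdorff_weight k (C n i))"
        using weq by simp
      also have "\<dots> \<le> hausdorff_outer k A + ennreal (1 / Suc n)"
        by (rule order_trans[OF less_imp_le[OF C(2)] add_right_mono[OF hausdorff_pre_le_outer]]) simp
      finally show ?thesis using hausdorff_pre_antimono[OF n, of k G] by simp
    qed
    obtain N :: nat where N: "1 / Suc N < \<delta>" using \<delta> nat_approx_posE by blast
    show "hausdorff_pre k \<delta> G \<le> hausdorff_outer k A"
    proof (rule LIMSEQ_le_const)
      have "(\<lambda>n. hausdorff_outer k A + ennreal (1 / Suc n)) \<longlonglongrightarrow> hausdorff_outer k A + ennreal 0"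
        by (intro tendsto_add tendsto_const tendsto_ennrealI LIMSEQ_Suc[OF lim_1_over_n])
      then show "(\<lambda>n. hausdorff_outer k A + ennreal (1 / Suc n)) \<longlonglongrightarrow> hausdorff_outer k A" by simp
      have "1 / Suc n \<le> \<delta>" if "n \<ge> N" for n
      proof -
        have "1 / real (Suc n) \<le> 1 / Suc N" using that by (intro divide_left_mono) auto
        then show ?thesis using N by linarith
      qed
      then show "\<exists>N. \<forall>n\<ge>N. hausdorff_pre k \<delta> G \<le> hausdorff_outer k A + ennreal (1 / Suc n)"
        using step by blast
    qed
  qed
  then show ?thesis using that[OF bo AG] hausdorff_outer_mono[OF AG] antisym by blast
qed

lemma hausdorff_diff_null:
  assumes "A \<in> sets (hausdorff_measure k)" "A \<subseteq> G" "hausdorff_outer k G = hausdorff_outer k A" "hausdorff_outer k A < \<infinity>"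
  shows "hausdorff_outer k (G - A) = 0"
proof -
  have "hausdorff_outer k A + 0 = hausdorff_outer k A + hausdorff_outer k (G - A)"
    using hausdorff_split[OF assms(1), of G] assms(2,3) by (simp add: Int_absorb1)
  then show ?thesis using assms(4) by (metis ennreal_add_left_cancel infinity_ennreal_def less_irrefl)
qed

text \<open>The excess of a Borel hull of \<open>A\<close> is null and hence lies in a Borel null
  set; removing that set from the hull leaves a Borel subset of \<open>A\<close>.\<close>

lemma hausdorff_borel_kernel:
  fixes A :: "'a::euclidean_space set"
  assumes A: "A \<in> sets (hausdorff_measure k)" and fin: "hausdorff_outer k A < \<infinity>"
  obtains B where "B \<in> sets borel" "B \<subseteq> A" "hausdorff_outer k (A - B) = 0"
proof -
  obtain G where G: "G \<in> sets borel" "A \<subseteq> G" "hausdorff_outer k G = hausdorff_outer k A"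
    using hausdorff_borel_hull[OF fin] .
  have 0: "hausdorff_outer k (G - A) = 0" using hausdorff_diff_null[OF A G(2,3) fin] .
  then obtain N where N: "N \<in> sets borel" "G - A \<subseteq> N" "hausdorff_outer k N = 0"
    using hausdorff_borel_hull[of k "G - A"] by auto
  show ?thesis
  proof (rule that[of "G - N"])
    show "hausdorff_outer k (A - (G - N)) = 0"
      using G(2) by (intro hausdorff_outer_null_subset[OF N(3)]) auto
  qed (use G N in auto)
qed

text \<open>Inner regularity concerns finite Borel measures, so it is applied to \<open>M\<close>,
  the restriction of Hausdorff measure to a Borel kernel of \<open>A\<close>. Countably many compact
  sets with errors \<open>1 / Suc n\<close> then exhaust the kernel up to a null set.\<close>

lemma hausdorff_sigma_compact_approx:
  fixes A :: "'a::euclidean_space set"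
  assumes A: "A \<in> sets (hausdorff_measure k)" and fin: "hausdorff_outer k A < \<infinity>"
  obtains K :: "nat \<Rightarrow> 'a set" where "\<And>n. compact (K n)" "\<And>n. K n \<subseteq> A" "hausdorff_outer k (A - (\<Union>n. K n)) = 0"
proof -
  obtain B where B: "B \<in> sets borel" "B \<subseteq> A" "hausdorff_outer k (A - B) = 0"
    using hausdorff_borel_kernel[OF A fin] .
  define M where "M = measure_of UNIV (sets borel) (\<lambda>X. hausdorff_outer k (X \<inter> B))"
  have sM: "sets M = sets borel"
    unfolding M_def using sets.sets_measure_of_eq[of "borel :: 'a measure"] by simp
  then have spM: "space M = UNIV" using sets_eq_imp_space_eq by force
  have M: "emeasure M X = hausdorff_outer k (X \<inter> B)" if "X \<in> sets borel" for X
  proof (rule emeasure_measure_of[OF M_def])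
    show "positive (sets M) (\<lambda>X. hausdorff_outer k (X \<inter> B))" by (simp add: positive_def)
    show "countably_additive (sets M) (\<lambda>X. hausdorff_outer k (X \<inter> B))"
    proof (rule countably_additiveI)
      fix F :: "nat \<Rightarrow> 'a set" assume F: "range F \<subseteq> sets M" "disjoint_family F"
      have Fb: "F n \<in> sets borel" for n using F(1) sM by auto
      have m: "F n \<inter> B \<in> sets (hausdorff_measure k)" for n using Fb B(1) by (intro borel_hausdorffD) auto
      have "(\<Sum>n. emeasure (hausdorff_measure k) (F n \<inter> B)) = emeasure (hausdorff_measure k) (\<Union>n. F n \<inter> B)"
        using F(2) m by (intro suminf_emeasure) (auto simp: disjoint_family_on_def)
      moreover have "emeasure (hausdorff_measure k) (\<Union>n. F n \<inter> B) = hausdorff_outer k (\<Union>n. F n \<inter> B)"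
        by (rule emeasure_hausdorff, rule sets.countable_UN) (use m in blast)
      moreover have "(\<Union>n. F n \<inter> B) = (\<Union>n. F n) \<inter> B" by auto
      ultimately show "(\<Sum>n. hausdorff_outer k (F n \<inter> B)) = hausdorff_outer k ((\<Union>n. F n) \<inter> B)"
        by (simp only: emeasure_hausdorff[OF m])
    qed
  qed (use that sM in auto)
  have finB: "hausdorff_outer k B < \<infinity>" using fin hausdorff_outer_mono[OF B(2)] order_le_less_trans by blast
  have inn: "emeasure M B = (SUP K\<in>{K. K \<subseteq> B \<and> compact K}. emeasure M K)"
    using finB M[of UNIV] B(1) by (intro inner_regular) (auto simp: sM spM)
  have eB: "emeasure M B = hausdorff_outer k B" using M[OF B(1)] by simp
  have "\<exists>K. compact K \<and> K \<subseteq> B \<and> hausdorff_outer k (B - K) \<le> ennreal (1 / Suc n)" for n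
  proof -
    have "\<exists>K\<in>{K. K \<subseteq> B \<and> compact K}. emeasure M B < emeasure M K + ennreal (1 / Suc n)"
      using finB eB inn by (intro SUP_approx_ennreal) (auto intro: exI[of _ "{}"])
    then obtain K where K: "K \<subseteq> B" "compact K" "emeasure M B < emeasure M K + ennreal (1 / Suc n)" by blast
    have Kb: "K \<in> sets borel" using K(2) by (simp add: borel_compact)
    have eK: "emeasure M K = hausdorff_outer k K" using M[OF Kb] K(1) by (simp add: Int_absorb2)
    have "hausdorff_outer k B = hausdorff_outer k K + hausdorff_outer k (B - K)"
      using hausdorff_split[OF borel_hausdorffD[OF Kb], where B=B] K(1) by (simp add: Int_absorb1)
    then have "hausdorff_outer k K + hausdorff_outer k (B - K) < hausdorff_outer k K + ennreal (1 / Suc n)"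
      using K(3) eB eK by simp
    then have "hausdorff_outer k (B - K) \<le> ennreal (1 / Suc n)"
      using add_left_mono[of "ennreal (1 / Suc n)" "hausdorff_outer k (B - K)" "hausdorff_outer k K"]
      by (simp only: not_less[symmetric]) (metis nle_le not_less)
    then show ?thesis using K by blast
  qed
  then obtain K where K: "\<And>n. compact (K n)" "\<And>n. K n \<subseteq> B" "\<And>n. hausdorff_outer k (B - K n) \<le> ennreal (1 / Suc n)" by metis
  have "hausdorff_outer k (B - (\<Union>n. K n)) \<le> ennreal (1 / Suc n)" for n
    using K(3)[of n] hausdorff_outer_mono[of "B - (\<Union>n. K n)" "B - K n" k] order_trans by blast
  then have "hausdorff_outer k (B - (\<Union>n. K n)) \<le> 0"
    using tendsto_ennrealI[OF LIMSEQ_Suc[OF lim_1_over_n]]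
    by (intro LIMSEQ_le_const[of "\<lambda>n. ennreal (1 / Suc n)" 0]) (simp_all only: ennreal_0, blast)
  then have 0: "hausdorff_outer k (B - (\<Union>n. K n)) = 0" by simp
  have "hausdorff_outer k (A - (\<Union>n. K n)) = 0"
    by (rule hausdorff_outer_null_subset[OF hausdorff_outer_Un_null[OF B(3) 0]]) auto
  then show ?thesis using that[of K] K B(2) by blast
qed

text \<open>Compact subsets have compact images and null sets have null images; a measurable set of
  finite measure is a countable union of the former and one of the latter.\<close>

lemma Lipschitz_image_hausdorff_measurable:
  fixes g :: "'a::euclidean_space \<Rightarrow> 'b::euclidean_space"
  assumes A: "A \<in> sets (hausdorff_measure k)" and fin: "hausdorff_outer k A < \<infinity>"
    and L: "0 \<le> L" and g: "\<And>x y. x \<in> A \<Longrightarrow> y \<in> A \<Longrightarrow> dist (g x) (g y) \<le> L * dist x y"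
  shows "g ` A \<in> sets (hausdorff_measure k)"
proof -
  obtain K :: "nat \<Rightarrow> 'a set" where K: "\<And>n. compact (K n)" "\<And>n. K n \<subseteq> A" "hausdorff_outer k (A - (\<Union>n. K n)) = 0"
    by (rule hausdorff_sigma_compact_approx[OF A fin]) blast
  have "continuous_on A g"
    using L g by (intro lipschitz_on_continuous_on[of L]) (auto simp: lipschitz_on_def)
  then have "compact (g ` K n)" for n
    using K by (meson compact_continuous_image continuous_on_subset)
  then have 1: "(\<Union>n. g ` K n) \<in> sets (hausdorff_measure k)"
    by (intro sets.countable_UN) (auto intro!: borel_hausdorffD borel_compact)
  have "hausdorff_outer k (g ` (A - (\<Union>n. K n))) = 0"
    using g by (intro hausdorff_outer_Lipschitz_null[OF _ L K(3)]) auto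
  then have 2: "g ` (A - (\<Union>n. K n)) \<in> sets (hausdorff_measure k)" by (rule hausdorff_null_sets)
  have "(\<Union>n. K n) \<subseteq> A" using K(2) by (rule UN_least)
  then have "A = (\<Union>n. K n) \<union> (A - (\<Union>n. K n))" by blast
  then have "g ` A = (\<Union>n. g ` K n) \<union> g ` (A - (\<Union>n. K n))"
    by (metis image_Un image_UN)
  then show ?thesis using 1 2 by (simp add: sets.Un)
qed

subsection \<open>Orthonormal families and singular values\<close>

text \<open>The index set is arbitrary because both initial and final segments of a frame are needed
  in the Courant-Fischer comparison.\<close>

definition orthonormal_on :: "'i set \<Rightarrow> ('i \<Rightarrow> 'a::euclidean_space) \<Rightarrow> bool" where
  "orthonormal_on I v \<longleftrightarrow> (\<forall>i\<in>I. \<forall>j\<in>I. v i \<bullet> v j = (if i = j then 1 else 0))"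

lemma orthonormal_frame_on: "orthonormal_frame k v \<longleftrightarrow> orthonormal_on {..<k} v"
  by (auto simp: orthonormal_frame_def orthonormal_on_def)

lemma orthonormal_on_subset: "orthonormal_on I v \<Longrightarrow> J \<subseteq> I \<Longrightarrow> orthonormal_on J v"
  unfolding orthonormal_on_def by blast

lemma orthonormal_onD:
  assumes "orthonormal_on I v" "i \<in> I"
  shows "norm (v i) = 1" "v i \<noteq> 0" "v i \<bullet> v i = 1"
proof -
  show *: "v i \<bullet> v i = 1" using assms by (simp add: orthonormal_on_def)
  then show "norm (v i) = 1" by (simp add: norm_eq_1)
  then show "v i \<noteq> 0" by auto
qed

lemma orthonormal_on_inj: assumes "orthonormal_on I v" shows "inj_on v I"
proof (rule inj_onI)
  fix i j assume ij: "i \<in> I" "j \<in> I" "v i = v j"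
  then have "v i \<bullet> v j = 1" using orthonormal_onD(3)[OF assms ij(2)] by simp
  then show "i = j" using assms ij(1,2) unfolding orthonormal_on_def by (metis zero_neq_one)
qed

lemma orthonormal_on_independent: assumes "orthonormal_on I v" shows "independent (v ` I)"
proof (rule pairwise_orthogonal_independent)
  show "pairwise orthogonal (v ` I)"
    using assms unfolding pairwise_def orthogonal_def orthonormal_on_def by (metis imageE)
  show "0 \<notin> v ` I" using orthonormal_onD(2)[OF assms] by force
qed

lemma orthonormal_on_dim: assumes "orthonormal_on I v" shows "dim (span (v ` I)) = card I"
  using dim_span_eq_card_independent[OF orthonormal_on_independent[OF assms]]
    card_image[OF orthonormal_on_inj[OF assms]] by simp

lemma orthonormal_on_finite: "orthonormal_on I v \<Longrightarrow> finite I"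
  using independent_imp_finite[OF orthonormal_on_independent] orthonormal_on_inj finite_imageD by blast

lemma orthonormal_on_expand:
  assumes o: "orthonormal_on I v" and x: "x \<in> span (v ` I)"
  shows "x = (\<Sum>i\<in>I. (x \<bullet> v i) *\<^sub>R v i)"
proof -
  have fin: "finite I" by (rule orthonormal_on_finite[OF o])
  have "x - (\<Sum>i\<in>I. (x \<bullet> v i) *\<^sub>R v i) \<in> span (v ` I)" (is "?y \<in> _")
    by (intro span_diff[OF x] span_sum span_scale span_base) auto
  moreover have "orthogonal ?y b" if b: "b \<in> v ` I" for b
  proof -
    obtain j where j: "j \<in> I" "b = v j" using b by blast
    have "(\<Sum>i\<in>I. (x \<bullet> v i) *\<^sub>R v i) \<bullet> v j = (\<Sum>i\<in>I. (x \<bullet> v i) * (if i = j then 1 else 0))"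
      unfolding inner_sum_left inner_scaleR_left using o j
      by (intro sum.cong) (auto simp: orthonormal_on_def)
    also have "\<dots> = x \<bullet> v j" using fin j by (simp add: if_distrib[of "\<lambda>z. _ * z"] cong: if_cong)
    finally show ?thesis by (simp add: orthogonal_def inner_diff_left j)
  qed
  ultimately have "orthogonal ?y ?y" using orthogonal_to_span by blast
  then show ?thesis by (simp add: orthogonal_self)
qed

lemma orthonormal_on_sum_norm:
  assumes o: "orthonormal_on I v"
  shows "(norm (\<Sum>i\<in>I. c i *\<^sub>R v i))\<^sup>2 = (\<Sum>i\<in>I. (c i)\<^sup>2)"
proof -
  have fin: "finite I" by (rule orthonormal_on_finite[OF o])
  have "(norm (\<Sum>i\<in>I. c i *\<^sub>R v i))\<^sup>2 = (\<Sum>i\<in>I. (norm (c i *\<^sub>R v i))\<^sup>2)"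
    using o by (intro norm_sum_Pythagorean fin) (auto simp: orthonormal_on_def pairwise_def orthogonal_def)
  also have "\<dots> = (\<Sum>i\<in>I. (c i)\<^sup>2)"
    using orthonormal_onD(1)[OF o] by (intro sum.cong) auto
  finally show ?thesis .
qed

text \<open>When \<open>A\<close> keeps an orthonormal family orthogonal, Pythagoras applies before
  and after \<open>A\<close>, so \<open>A\<close> acts like a diagonal map on the span.\<close>

lemma orthogonal_images_norm:
  assumes o: "orthonormal_on I v" and A: "linear A"
    and orth: "\<And>i j. i \<in> I \<Longrightarrow> j \<in> I \<Longrightarrow> i \<noteq> j \<Longrightarrow> A (v i) \<bullet> A (v j) = 0"
    and x: "x \<in> span (v ` I)"
  shows "(norm x)\<^sup>2 = (\<Sum>i\<in>I. (x \<bullet> v i)\<^sup>2)"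
    and "(norm (A x))\<^sup>2 = (\<Sum>i\<in>I. (x \<bullet> v i)\<^sup>2 * (norm (A (v i)))\<^sup>2)"
proof -
  have fin: "finite I" by (rule orthonormal_on_finite[OF o])
  have xe: "x = (\<Sum>i\<in>I. (x \<bullet> v i) *\<^sub>R v i)" by (rule orthonormal_on_expand[OF o x])
  show "(norm x)\<^sup>2 = (\<Sum>i\<in>I. (x \<bullet> v i)\<^sup>2)"
    using orthonormal_on_sum_norm[OF o, of "\<lambda>i. x \<bullet> v i"] xe by simp
  have "A x = A (\<Sum>i\<in>I. (x \<bullet> v i) *\<^sub>R v i)" using xe by simp
  also have "\<dots> = (\<Sum>i\<in>I. (x \<bullet> v i) *\<^sub>R A (v i))" using A by (simp add: linear_sum linear_cmul)
  finally have "(norm (A x))\<^sup>2 = (norm (\<Sum>i\<in>I. (x \<bullet> v i) *\<^sub>R A (v i)))\<^sup>2" by simp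
  also have "\<dots> = (\<Sum>i\<in>I. (norm ((x \<bullet> v i) *\<^sub>R A (v i)))\<^sup>2)"
    using orth by (intro norm_sum_Pythagorean fin) (auto simp: pairwise_def orthogonal_def)
  also have "\<dots> = (\<Sum>i\<in>I. (x \<bullet> v i)\<^sup>2 * (norm (A (v i)))\<^sup>2)"
    by (simp add: power_mult_distrib)
  finally show "(norm (A x))\<^sup>2 = (\<Sum>i\<in>I. (x \<bullet> v i)\<^sup>2 * (norm (A (v i)))\<^sup>2)" .
qed

lemma orthogonal_images_upper:
  assumes o: "orthonormal_on I v" and A: "linear A"
    and orth: "\<And>i j. i \<in> I \<Longrightarrow> j \<in> I \<Longrightarrow> i \<noteq> j \<Longrightarrow> A (v i) \<bullet> A (v j) = 0"
    and x: "x \<in> span (v ` I)" and c: "\<And>i. i \<in> I \<Longrightarrow> norm (A (v i)) \<le> c" "0 \<le> c"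
  shows "norm (A x) \<le> c * norm x"
proof -
  have n: "(norm x)\<^sup>2 = (\<Sum>i\<in>I. (x \<bullet> v i)\<^sup>2)"
    "(norm (A x))\<^sup>2 = (\<Sum>i\<in>I. (x \<bullet> v i)\<^sup>2 * (norm (A (v i)))\<^sup>2)"
    using orth by (intro orthogonal_images_norm[OF o A _ x]; simp)+
  have "(norm (A x))\<^sup>2 \<le> (\<Sum>i\<in>I. (x \<bullet> v i)\<^sup>2 * c\<^sup>2)"
    unfolding n(2) using c by (intro sum_mono mult_left_mono power_mono) auto
  also have "\<dots> = (c * norm x)\<^sup>2" by (simp add: power_mult_distrib n(1) sum_distrib_left mult.commute)
  finally show ?thesis using c(2) by (simp add: power2_le_iff_abs_le)
qed

lemma orthogonal_images_lower:
  assumes o: "orthonormal_on I v" and A: "linear A"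
    and orth: "\<And>i j. i \<in> I \<Longrightarrow> j \<in> I \<Longrightarrow> i \<noteq> j \<Longrightarrow> A (v i) \<bullet> A (v j) = 0"
    and x: "x \<in> span (v ` I)" and c: "\<And>i. i \<in> I \<Longrightarrow> c \<le> norm (A (v i))" "0 \<le> c"
  shows "c * norm x \<le> norm (A x)"
proof -
  have n: "(norm x)\<^sup>2 = (\<Sum>i\<in>I. (x \<bullet> v i)\<^sup>2)"
    "(norm (A x))\<^sup>2 = (\<Sum>i\<in>I. (x \<bullet> v i)\<^sup>2 * (norm (A (v i)))\<^sup>2)"
    using orth by (intro orthogonal_images_norm[OF o A _ x]; simp)+
  have "(c * norm x)\<^sup>2 = (\<Sum>i\<in>I. (x \<bullet> v i)\<^sup>2 * c\<^sup>2)"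
    by (simp add: power_mult_distrib n(1) sum_distrib_left mult.commute)
  also have "\<dots> \<le> (norm (A x))\<^sup>2"
    unfolding n(2) using c by (intro sum_mono mult_left_mono power_mono) auto
  finally show ?thesis by (rule power2_le_imp_le) simp
qed

section \<open>Singular vectors on a subspace\<close>

text \<open>Right singular vectors of the restriction of \<open>A\<close> to their span; the
  singular values are the decreasing numbers \<open>norm (A (v i))\<close>. Left singular vectors
  are not recorded, so \<open>A\<close> may have a kernel.\<close>

definition svd_frame :: "nat \<Rightarrow> ('a::euclidean_space \<Rightarrow> 'a) \<Rightarrow> (nat \<Rightarrow> 'a) \<Rightarrow> bool" where
  "svd_frame m A v \<longleftrightarrow> orthonormal_on {..<m} v \<and>
     (\<forall>i<m. \<forall>j<m. i \<noteq> j \<longrightarrow> A (v i) \<bullet> A (v j) = 0) \<and>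
     (\<forall>i j. i \<le> j \<longrightarrow> j < m \<longrightarrow> norm (A (v j)) \<le> norm (A (v i)))"

text \<open>The first-order condition at a maximum. A nonzero \<open>b\<close> is refuted at
  \<open>t = b / d\<close>, where the positive \<open>d = \<bar>c\<bar> + 1\<close> dominates
  \<open>c\<close>.\<close>

lemma quadratic_max_linear_zero:
  fixes b c :: real
  assumes "\<And>t. 2 * t * b \<le> t\<^sup>2 * c"
  shows "b = 0"
proof (rule ccontr)
  assume b: "b \<noteq> 0"
  define d where "d = \<bar>c\<bar> + 1"
  have d: "d > 0" "c \<le> d" by (auto simp: d_def)
  have "2 * (b / d) * b \<le> (b / d)\<^sup>2 * c" by (rule assms)
  also have "\<dots> \<le> (b / d)\<^sup>2 * d" using d by (intro mult_left_mono) auto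
  also have "\<dots> = b\<^sup>2 / d" using d by (simp add: power2_eq_square)
  finally have "2 * (b\<^sup>2 / d) \<le> b\<^sup>2 / d" by (simp add: power2_eq_square)
  moreover have "b\<^sup>2 / d > 0" using b d by simp
  ultimately show False by linarith
qed

text \<open>A unit vector of \<open>P\<close> maximising \<open>norm (A x)\<close> is split off.
  Varying it in an orthogonal direction \<open>w\<close> shows that the images stay orthogonal, so
  the induction continues in its orthogonal complement inside \<open>P\<close>; maxima over smaller
  spaces are smaller, which gives the order.\<close>

lemma svd_frame_exists:
  fixes A :: "'a::euclidean_space \<Rightarrow> 'a"
  assumes A: "linear A"
  shows "subspace P \<Longrightarrow> dim P = m \<Longrightarrow> \<exists>v. svd_frame m A v \<and> span (v ` {..<m}) = P"
proof (induction m arbitrary: P)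
  case 0
  then have "P = {0}" using subspace_0 dim_eq_0 by blast
  then show ?case by (intro exI[of _ "\<lambda>_. 0"]) (simp add: svd_frame_def orthonormal_on_def)
next
  case (Suc m)
  let ?S = "P \<inter> sphere 0 1"
  have "compact ?S" using Suc.prems(1) by (intro closed_Int_compact closed_subspace) auto
  moreover have "?S \<noteq> {}"
  proof -
    have "P \<noteq> {0}" using Suc.prems(2) by auto
    then obtain p where "p \<in> P" "p \<noteq> 0" using Suc.prems(1) subspace_0 by fastforce
    then have "p /\<^sub>R norm p \<in> ?S" using Suc.prems(1) by (simp add: subspace_scale)
    then show ?thesis by blast
  qed
  moreover have "continuous_on ?S (\<lambda>x. norm (A x))"
    using A by (intro continuous_intros linear_continuous_on) (simp add: linear_conv_bounded_linear)
  ultimately obtain v0 where v0: "v0 \<in> ?S" and max: "\<And>x. x \<in> ?S \<Longrightarrow> norm (A x) \<le> norm (A v0)"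
    using continuous_attains_sup by meson
  have v0P: "v0 \<in> P" and nv0: "norm v0 = 1" using v0 by auto
  have bound: "norm (A x) \<le> norm (A v0) * norm x" if "x \<in> P" for x
  proof (cases "x = 0")
    case False
    then have "norm (A (x /\<^sub>R norm x)) \<le> norm (A v0)"
      using that Suc.prems(1) by (intro max) (simp add: subspace_scale)
    then show ?thesis using False A by (simp add: linear_cmul field_simps)
  qed (simp add: linear_0[OF A])
  \<comment> \<open>The maximality inequality along \<open>v0 + t *\<^sub>R w\<close>, expanded in
    \<open>t\<close>, has the inner product as its linear coefficient.\<close>
  have perp: "A v0 \<bullet> A w = 0" if w: "w \<in> P" "v0 \<bullet> w = 0" for w
  proof (rule quadratic_max_linear_zero)
    fix t :: real
    have "v0 + t *\<^sub>R w \<in> P" using v0P w Suc.prems(1) by (simp add: subspace_add subspace_scale)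
    then have "(norm (A (v0 + t *\<^sub>R w)))\<^sup>2 \<le> (norm (A v0) * norm (v0 + t *\<^sub>R w))\<^sup>2"
      using bound by (intro power_mono) auto
    also have "\<dots> = (norm (A v0))\<^sup>2 * (1 + t\<^sup>2 * (norm w)\<^sup>2)"
    proof -
      have "(norm (v0 + t *\<^sub>R w))\<^sup>2 = 1 + t\<^sup>2 * (norm w)\<^sup>2"
        using w(2) nv0 unfolding power2_norm_eq_inner
        by (simp add: inner_add_left inner_add_right inner_commute[of w v0] power2_eq_square[of t] norm_eq_1)
      then show ?thesis by (simp add: power_mult_distrib)
    qed
    finally have le: "(norm (A (v0 + t *\<^sub>R w)))\<^sup>2 \<le> (norm (A v0))\<^sup>2 * (1 + t\<^sup>2 * (norm w)\<^sup>2)" .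
    have "(norm (A (v0 + t *\<^sub>R w)))\<^sup>2 = (norm (A v0))\<^sup>2 + 2 * t * (A v0 \<bullet> A w) + t\<^sup>2 * (norm (A w))\<^sup>2"
      unfolding power2_norm_eq_inner
      by (simp add: linear_add[OF A] linear_cmul[OF A] inner_add_left inner_add_right
          inner_commute[of "A w" "A v0"] power2_eq_square[of t] algebra_simps)
    with le show "2 * t * (A v0 \<bullet> A w) \<le> t\<^sup>2 * ((norm (A v0))\<^sup>2 * (norm w)\<^sup>2 - (norm (A w))\<^sup>2)"
      by (simp add: algebra_simps)
  qed
  define Q where "Q = {y \<in> P. \<forall>x\<in>span {v0}. orthogonal x y}"
  have Qv: "v0 \<bullet> y = 0" if "y \<in> Q" for y using that by (auto simp: Q_def orthogonal_def span_base)
  have QP: "Q \<subseteq> P" by (auto simp: Q_def)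
  have sQ: "subspace Q" unfolding Q_def
    using Suc.prems(1) by (auto simp: subspace_def orthogonal_def inner_add_right)
  have "dim Q + dim (span {v0}) = dim P" unfolding Q_def
    using Suc.prems(1) v0P by (intro dim_subspace_orthogonal_to_vectors) (auto simp: span_minimal)
  moreover have "dim (span {v0}) = 1" using nv0 by (auto simp: dim_insert)
  ultimately have "dim Q = m" using Suc.prems(2) by simp
  then obtain v where v: "svd_frame m A v" "span (v ` {..<m}) = Q" using Suc.IH[OF sQ] by blast
  define u where "u = case_nat v0 v"
  have u: "u 0 = v0" "\<And>i. u (Suc i) = v i" by (auto simp: u_def)
  have vQ: "v i \<in> Q" if "i < m" for i using that v(2) by (metis imageI lessThan_iff span_base)
  have im: "u ` {..<Suc m} = insert v0 (v ` {..<m})" by (simp add: lessThan_Suc_eq_insert_0 image_image u)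
  have z1: "v0 \<bullet> v i = 0" "v i \<bullet> v0 = 0" "v i \<in> P" if "i < m" for i
    using Qv[OF vQ[OF that]] vQ[OF that] QP by (auto simp: inner_commute[of "v i"])
  have z2: "A v0 \<bullet> A (v i) = 0" "A (v i) \<bullet> A v0 = 0" if "i < m" for i
    using perp[OF z1(3)[OF that] z1(1)[OF that]] by (auto simp: inner_commute[of "A (v i)"])
  have vo: "v i \<bullet> v j = (if i = j then 1 else 0)" if "i < m" "j < m" for i j
    using v(1) that by (simp add: svd_frame_def orthonormal_on_def)
  have vA: "A (v i) \<bullet> A (v j) = 0" if "i < m" "j < m" "i \<noteq> j" for i j
    using v(1) that by (simp add: svd_frame_def)
  have v00: "v0 \<bullet> v0 = 1" using nv0 by (simp add: norm_eq_1)
  have "svd_frame (Suc m) A u"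
    unfolding svd_frame_def orthonormal_on_def
  proof (intro conjI ballI allI impI)
    fix i j assume ij: "i \<in> {..<Suc m}" "j \<in> {..<Suc m}"
    show "u i \<bullet> u j = (if i = j then 1 else 0)"
      using ij by (cases i; cases j) (simp_all add: u z1 vo v00)
  next
    fix i j assume ij: "i < Suc m" "j < Suc m" "i \<noteq> j"
    show "A (u i) \<bullet> A (u j) = 0"
      using ij by (cases i; cases j) (simp_all add: u z2 vA)
  next
    fix i j assume ij: "i \<le> j" "j < Suc m"
    show "norm (A (u j)) \<le> norm (A (u i))"
    proof (cases j)
      case (Suc j')
      show ?thesis
      proof (cases i)
        case 0
        have "v j' \<in> ?S" using z1(3)[of j'] vo[of j' j'] ij Suc by (simp add: norm_eq_1)
        then show ?thesis using max 0 Suc by (simp add: u)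
      next
        case (Suc i')
        then show ?thesis using \<open>j = Suc j'\<close> ij v(1) by (simp add: u svd_frame_def)
      qed
    qed (use ij in simp)
  qed
  moreover have "span (u ` {..<Suc m}) = P"
  proof -
    have o: "orthonormal_on {..<Suc m} u" using calculation by (simp add: svd_frame_def)
    have c: "card (u ` {..<Suc m}) = Suc m" using card_image[OF orthonormal_on_inj[OF o]] by simp
    have sub: "u ` {..<Suc m} \<subseteq> P" unfolding im using v0P z1(3) by blast
    have "P \<subseteq> span (u ` {..<Suc m})"
      by (rule card_ge_dim_independent[OF sub orthonormal_on_independent[OF o]]) (simp only: c Suc.prems(2) order_refl)
    then show ?thesis using span_minimal[OF sub Suc.prems(1)] by (rule subset_antisym[rotated])
  qed
  ultimately show ?case by blast
qed

lemma nonzero_in_Int: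
  fixes W Z :: "'a::euclidean_space set"
  assumes "subspace W" "subspace Z" "DIM('a) < dim W + dim Z"
  obtains x where "x \<in> W" "x \<in> Z" "x \<noteq> 0"
proof -
  have "\<exists>d. d + dim (W \<inter> Z) = dim W + dim Z \<and> d \<le> DIM('a)"
    using dim_sums_Int[OF assms(1,2)] dim_subset_UNIV by blast
  then obtain d where d: "d + dim (W \<inter> Z) = dim W + dim Z" "d \<le> DIM('a)" by blast
  have "dim (W \<inter> Z) \<noteq> 0"
  proof
    assume "dim (W \<inter> Z) = 0"
    then have "d = dim W + dim Z" using d(1) by (simp only: add_0_right)
    then show False using d(2) assms(3) by simp
  qed
  then have nsub: "\<not> W \<inter> Z \<subseteq> {0}" by (simp only: dim_eq_0 not_False_eq_True)
  show ?thesis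
  proof (rule ccontr)
    assume n: "\<not> thesis"
    have "W \<inter> Z \<subseteq> {0}"
    proof
      fix x assume x: "x \<in> W \<inter> Z"
      show "x \<in> {0}"
      proof (rule ccontr)
        assume "x \<notin> {0}"
        then have "x \<noteq> 0" by simp
        then have thesis by (rule that[OF IntD1[OF x] IntD2[OF x]])
        then show False using n by contradiction
      qed
    qed
    then show False using nsub by contradiction
  qed
qed

text \<open>Courant--Fischer: a space spanned by the first frame vectors on one side meets a space spanned by
  the last ones on the other side.\<close>

lemma svd_frame_compare:
  fixes A :: "'a::euclidean_space \<Rightarrow> 'a"
  assumes A: "linear A" and v: "svd_frame m A v" and V: "svd_frame p A V"
    and ij: "i < m" "j < p" and big: "DIM('a) < Suc i + (p - j)"
  shows "norm (A (v i)) \<le> norm (A (V j))"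
proof -
  have ov: "orthonormal_on {..i} v" using v ij(1) by (auto simp: svd_frame_def intro: orthonormal_on_subset)
  have oV: "orthonormal_on {j..<p} V" using V by (auto simp: svd_frame_def intro: orthonormal_on_subset)
  have "DIM('a) < dim (span (v ` {..i})) + dim (span (V ` {j..<p}))"
    using orthonormal_on_dim[OF ov] orthonormal_on_dim[OF oV] big by simp
  then obtain x where x: "x \<in> span (v ` {..i})" "x \<in> span (V ` {j..<p})" "x \<noteq> 0"
    using nonzero_in_Int[of "span (v ` {..i})" "span (V ` {j..<p})"] by auto
  have "norm (A (v i)) * norm x \<le> norm (A x)"
    using v ij(1) by (intro orthogonal_images_lower[OF ov A _ x(1)]) (auto simp: svd_frame_def)
  also have "\<dots> \<le> norm (A (V j)) * norm x"
    using V ij(2) by (intro orthogonal_images_upper[OF oV A _ x(2)]) (auto simp: svd_frame_def)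
  finally show ?thesis using x(3) by simp
qed

text \<open>Resolves the definite description in \<open>sing_vals\<close>. Every admissible list
  consists of the norms along some full \<open>svd_frame\<close>, and two such frames have equal
  norms by comparison in both directions. For existence, injectivity makes the norms positive, so
  the normalised images serve as left singular vectors.\<close>

lemma svd_frame_sing_vals:
  fixes A :: "'a::euclidean_space \<Rightarrow>\<^sub>L 'a"
  assumes inj: "inj (blinfun_apply A)"
  obtains V where "svd_frame DIM('a) (blinfun_apply A) V"
    "\<And>i. i < DIM('a) \<Longrightarrow> sing_vals A ! i = norm (A (V i))"
proof -
  let ?n = "DIM('a)" let ?A = "blinfun_apply A"
  have A: "linear ?A" by (simp add: blinfun.bounded_linear_right bounded_linear.linear)
  define Q where "Q = (\<lambda>s. length s = ?n \<and> sorted_wrt (\<ge>) s \<and> (\<forall>\<sigma>\<in>set s. \<sigma> \<ge> 0) \<and>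
     (\<exists>u v :: nat \<Rightarrow> 'a. orthonormal_frame ?n u \<and> orthonormal_frame ?n v \<and>
        (\<forall>i<?n. ?A (v i) = (s ! i) *\<^sub>R u i)))"
  obtain V where V: "svd_frame ?n ?A V"
    using svd_frame_exists[OF A subspace_UNIV dim_UNIV] by blast
  have Qf: "s ! i = norm (?A (V i))" if s: "Q s" and i: "i < ?n" for s i
  proof -
    obtain u v :: "nat \<Rightarrow> 'a" where uv: "orthonormal_frame ?n u" "orthonormal_frame ?n v"
      "\<And>i. i < ?n \<Longrightarrow> ?A (v i) = (s ! i) *\<^sub>R u i" using s unfolding Q_def by blast
    have len: "length s = ?n" and nn: "\<And>i. i < ?n \<Longrightarrow> 0 \<le> s ! i" and so: "sorted_wrt (\<ge>) s"
      using s by (auto simp: Q_def)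
    have nAv: "norm (?A (v i)) = s ! i" if "i < ?n" for i
      using uv(1) uv(3)[OF that] nn[OF that] that by (simp add: orthonormal_frame_on orthonormal_onD)
    have "svd_frame ?n ?A v" unfolding svd_frame_def
    proof (intro conjI allI impI)
      fix i j assume "i < ?n" "j < ?n" "i \<noteq> j"
      then show "?A (v i) \<bullet> ?A (v j) = 0" using uv(1,3) by (simp add: orthonormal_frame_def)
    next
      fix i j assume "i \<le> j" "j < ?n"
      then show "norm (?A (v j)) \<le> norm (?A (v i))"
        using so len by (cases "i = j") (auto simp: nAv sorted_wrt_iff_nth_less)
    qed (use uv in \<open>simp add: orthonormal_frame_on\<close>)
    then have "norm (?A (v i)) = norm (?A (V i))"
      using V i by (intro antisym svd_frame_compare[OF A]) auto
    then show ?thesis using nAv i by simp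
  qed
  define s where "s = map (\<lambda>i. norm (?A (V i))) [0..<?n]"
  have sn: "s ! i = norm (?A (V i))" if "i < ?n" for i using that by (simp add: s_def)
  have pos: "norm (?A (V i)) > 0" if "i < ?n" for i
  proof -
    have "V i \<noteq> 0" using V that by (auto simp: svd_frame_def orthonormal_onD)
    then show ?thesis using inj A by (metis injD linear_0 zero_less_norm_iff)
  qed
  have Qs: "Q s" unfolding Q_def
  proof (intro conjI)
    show "sorted_wrt (\<ge>) s" using V by (auto simp: sorted_wrt_iff_nth_less s_def svd_frame_def)
    show "\<exists>u v :: nat \<Rightarrow> 'a. orthonormal_frame ?n u \<and> orthonormal_frame ?n v \<and>
        (\<forall>i<?n. ?A (v i) = (s ! i) *\<^sub>R u i)"
    proof (rule exI[of _ "\<lambda>i. ?A (V i) /\<^sub>R norm (?A (V i))"], rule exI[of _ V], intro conjI allI impI)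
      show "orthonormal_frame ?n V" using V by (simp add: svd_frame_def orthonormal_frame_on)
      show "orthonormal_frame ?n (\<lambda>i. ?A (V i) /\<^sub>R norm (?A (V i)))"
        unfolding orthonormal_frame_def
      proof (intro allI impI)
        fix i j assume ij: "i < ?n" "j < ?n"
        show "(?A (V i) /\<^sub>R norm (?A (V i))) \<bullet> (?A (V j) /\<^sub>R norm (?A (V j))) = (if i = j then 1 else 0)"
        proof (cases "i = j")
          case True
          then show ?thesis using pos[OF ij(1)]
            by (simp add: power2_norm_eq_inner[symmetric] power2_eq_square)
        next
          case False
          then show ?thesis using V ij by (simp add: svd_frame_def)
        qed
      qed
      fix i assume "i < ?n"
      then show "?A (V i) = (s ! i) *\<^sub>R (?A (V i) /\<^sub>R norm (?A (V i)))"
        using pos[of i] by (simp add: sn)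
    qed
  qed (auto simp: s_def)
  have uniq: "t = s" if "Q t" for t
    using Qf[OF that] Qf[OF Qs] that Qs by (intro nth_equalityI) (auto simp: Q_def)
  have "sing_vals A = (THE s. Q s)" unfolding sing_vals_def Q_def ..
  also have "\<dots> = s" using Qs uniq by (rule the_equality)
  finally show ?thesis using that[OF V] sn by simp
qed

subsection \<open>Gram determinants and the Jacobian on a frame\<close>

text \<open>The inner product of the simple k-vectors formed from the first \<open>k\<close> entries
  of \<open>v\<close> and of \<open>w\<close>.\<close>

definition gram :: "nat \<Rightarrow> (nat \<Rightarrow> 'a::euclidean_space) \<Rightarrow> (nat \<Rightarrow> 'a) \<Rightarrow> real" where
  "gram k v w = Determinant.det (Matrix.mat k k (\<lambda>(i, j). v i \<bullet> w j))"

lemma gram_commute: "gram k v w = gram k w v"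
proof -
  have "transpose_mat (Matrix.mat k k (\<lambda>(i, j). v i \<bullet> w j)) = Matrix.mat k k (\<lambda>(i, j). w i \<bullet> v j)"
    by (rule eq_matI) (auto simp: inner_commute)
  then show ?thesis unfolding gram_def by (metis Determinant.det_transpose mat_carrier)
qed

lemma gram_cong: "(\<And>i. i < k \<Longrightarrow> v i = v' i) \<Longrightarrow> (\<And>i. i < k \<Longrightarrow> w i = w' i) \<Longrightarrow> gram k v w = gram k v' w'"
  unfolding gram_def by (intro arg_cong[of _ _ Determinant.det] eq_matI) auto

lemma gram_orthonormal: "orthonormal_frame k f \<Longrightarrow> gram k f f = 1"
proof -
  assume "orthonormal_frame k f"
  then have "Matrix.mat k k (\<lambda>(i, j). f i \<bullet> f j) = 1\<^sub>m k"
    by (intro eq_matI) (auto simp: orthonormal_frame_def)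
  then show ?thesis by (simp add: gram_def)
qed

lemma gram_laplace:
  assumes i: "i < k"
  shows "gram k (v(i := y)) w
    = (\<Sum>j<k. (y \<bullet> w j) * cofactor (Matrix.mat k k (\<lambda>(i, j). v i \<bullet> w j)) i j)"
proof -
  let ?M = "Matrix.mat k k (\<lambda>(l, j). (v(i := y)) l \<bullet> w j)"
  have "gram k (v(i := y)) w = (\<Sum>j<k. ?M $$ (i, j) * cofactor ?M i j)"
    unfolding gram_def by (rule laplace_expansion_row[OF _ i]) simp
  also have "\<dots> = (\<Sum>j<k. (y \<bullet> w j) * cofactor (Matrix.mat k k (\<lambda>(i, j). v i \<bullet> w j)) i j)"
  proof (intro sum.cong refl)
    fix j assume "j \<in> {..<k}"
    moreover have "mat_delete ?M i j = mat_delete (Matrix.mat k k (\<lambda>(i, j). v i \<bullet> w j)) i j"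
      unfolding mat_delete_def by (rule eq_matI) auto
    ultimately show "?M $$ (i, j) * cofactor ?M i j
      = (y \<bullet> w j) * cofactor (Matrix.mat k k (\<lambda>(i, j). v i \<bullet> w j)) i j"
      using i by (simp add: cofactor_def)
  qed
  finally show ?thesis .
qed

text \<open>Pairing with a fixed simple k-vector is thereby an admissible test in
  \<open>induced_orient\<close>. Linearity in a slot comes from expansion along that row,
  alternation from equal rows.\<close>

lemma covector_gram: "covector k (\<lambda>v. gram k v w)"
  unfolding covector_def
proof (intro conjI allI impI)
  fix v v' :: "nat \<Rightarrow> 'a" assume "\<forall>i<k. v i = v' i"
  then show "gram k v w = gram k v' w" by (intro gram_cong) auto
next
  fix i and v :: "nat \<Rightarrow> 'a" assume "i < k"
  then show "linear (\<lambda>y. gram k (v(i := y)) w)"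
    unfolding gram_laplace[OF \<open>i < k\<close>]
    by (intro linearI) (auto simp: inner_add_left algebra_simps sum.distrib sum_distrib_left)
next
  fix i j and v :: "nat \<Rightarrow> 'a" assume ij: "i < k" "j < k" "i \<noteq> j \<and> v i = v j"
  show "gram k v w = 0" unfolding gram_def
    by (rule det_identical_rows[of _ k i j]) (use ij in \<open>auto simp: row_def\<close>)
qed

lemma continuous_on_gram:
  assumes "\<And>i. i < k \<Longrightarrow> continuous_on X (\<lambda>x. v x i)" "\<And>i. i < k \<Longrightarrow> continuous_on X (\<lambda>x. w x i)"
  shows "continuous_on X (\<lambda>x. gram k (v x) (w x))"
proof -
  have "gram k (v x) (w x) = (\<Sum>p\<in>{p. p permutes {0..<k}}. signof p * (\<Prod>i = 0..<k. v x i \<bullet> w x (p i)))" for x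
  proof -
    have "p i < k" if "p permutes {0..<k}" "i < k" for p i using permutes_in_image[OF that(1), of i] that(2) by simp
    then show ?thesis unfolding gram_def
      by (subst Determinant.det_def') (auto intro!: sum.cong prod.cong)
  qed
  moreover have "continuous_on X (\<lambda>x. \<Sum>p\<in>{p. p permutes {0..<k}}. signof p * (\<Prod>i = 0..<k. v x i \<bullet> w x (p i)))"
  proof (intro continuous_intros)
    fix p i assume p: "p \<in> {p. p permutes {0..<k}}" "i \<in> {0..<k}"
    then have "p i < k" using permutes_in_image[of p "{0..<k}" i] by simp
    then show "continuous_on X (\<lambda>x. v x i)" "continuous_on X (\<lambda>x. w x (p i))" using assms p by auto
  qed
  ultimately show ?thesis by simp
qed

text \<open>If \<open>R\<close> expresses \<open>f\<close> in terms of \<open>v\<close>, the Gram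
  matrix of the images is \<open>R * D * transpose_mat R\<close> with \<open>R\<close> orthogonal
  and \<open>D\<close> diagonal. The value therefore depends on the plane and not on the frame
  chosen in it.\<close>

lemma gram_linear_image:
  fixes A :: "'a::euclidean_space \<Rightarrow> 'a"
  assumes A: "linear A" and f: "orthonormal_frame k f" and v: "svd_frame k A v"
    and sp: "span (f ` {..<k}) = span (v ` {..<k})"
  shows "gram k (\<lambda>i. A (f i)) (\<lambda>i. A (f i)) = (\<Prod>i<k. norm (A (v i)))\<^sup>2"
proof -
  define R where "R = Matrix.mat k k (\<lambda>(i, j). f i \<bullet> v j)"
  define D where "D = Matrix.mat k k (\<lambda>(i, j). A (v i) \<bullet> A (v j))"
  have R: "R \<in> carrier_mat k k" and D: "D \<in> carrier_mat k k" by (auto simp: R_def D_def)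
  have ov: "orthonormal_on {..<k} v" using v by (simp add: svd_frame_def)
  have fe: "f i = (\<Sum>j<k. (f i \<bullet> v j) *\<^sub>R v j)" if "i < k" for i
    using that by (intro orthonormal_on_expand[OF ov]) (simp add: sp[symmetric] span_base)
  have ff: "f i \<bullet> f j = (\<Sum>l<k. (f i \<bullet> v l) * (f j \<bullet> v l))" if "i < k" "j < k" for i j
  proof -
    have "f i \<bullet> f j = f i \<bullet> (\<Sum>l<k. (f j \<bullet> v l) *\<^sub>R v l)" using fe[OF that(2)] by simp
    then show ?thesis by (simp add: inner_sum_right mult.commute)
  qed
  have RR: "R * transpose_mat R = 1\<^sub>m k"
  proof (rule eq_matI)
    fix i j assume ij: "i < dim_row (1\<^sub>m k)" "j < dim_col (1\<^sub>m k)"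
    then have "(R * transpose_mat R) $$ (i, j) = (\<Sum>l = 0..<k. (f i \<bullet> v l) * (f j \<bullet> v l))"
      by (simp add: R_def scalar_prod_def)
    also have "\<dots> = f i \<bullet> f j" using ij ff by (simp add: atLeast0LessThan)
    also have "\<dots> = 1\<^sub>m k $$ (i, j)" using ij f by (simp add: orthonormal_frame_def)
    finally show "(R * transpose_mat R) $$ (i, j) = 1\<^sub>m k $$ (i, j)" .
  qed (auto simp: R_def)
  have Af: "A (f i) = (\<Sum>j<k. (f i \<bullet> v j) *\<^sub>R A (v j))" if "i < k" for i
  proof -
    have "A (f i) = A (\<Sum>j<k. (f i \<bullet> v j) *\<^sub>R v j)" using fe[OF that] by simp
    then show ?thesis using A by (simp add: linear_sum linear_cmul)
  qed
  have G: "Matrix.mat k k (\<lambda>(i, j). A (f i) \<bullet> A (f j)) = R * (D * transpose_mat R)"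
  proof (rule eq_matI)
    fix i j assume "i < dim_row (R * (D * transpose_mat R))" "j < dim_col (R * (D * transpose_mat R))"
    then have ij: "i < k" "j < k" by (auto simp: R_def)
    have DR: "(D * transpose_mat R) $$ (l, j) = (\<Sum>r<k. (A (v l) \<bullet> A (v r)) * (f j \<bullet> v r))" if "l < k" for l
      using that ij by (simp add: D_def R_def scalar_prod_def atLeast0LessThan)
    have "(R * (D * transpose_mat R)) $$ (i, j) = (\<Sum>l = 0..<k. (f i \<bullet> v l) * (D * transpose_mat R) $$ (l, j))"
      using ij by (simp add: R_def D_def scalar_prod_def)
    also have "\<dots> = (\<Sum>l<k. (f i \<bullet> v l) * (\<Sum>r<k. (A (v l) \<bullet> A (v r)) * (f j \<bullet> v r)))"
      unfolding atLeast0LessThan using DR by (intro sum.cong) auto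
    also have "\<dots> = A (f i) \<bullet> A (f j)"
      using ij by (simp add: Af inner_sum_left inner_sum_right sum_distrib_left mult_ac) (rule sum.swap)
    finally show "Matrix.mat k k (\<lambda>(i, j). A (f i) \<bullet> A (f j)) $$ (i, j) = (R * (D * transpose_mat R)) $$ (i, j)"
      using ij by simp
  qed (auto simp: R_def D_def)
  have dD: "Determinant.det D = (\<Prod>i<k. (norm (A (v i)))\<^sup>2)"
  proof -
    have "upper_triangular D" using v by (auto simp: D_def upper_triangular_def svd_frame_def)
    then have "Determinant.det D = prod_list (diag_mat D)" by (rule det_upper_triangular[OF _ D])
    also have "\<dots> = (\<Prod>i<k. (norm (A (v i)))\<^sup>2)"
      by (simp add: prod_list_diag_prod D_def atLeast0LessThan power2_norm_eq_inner)
    finally show ?thesis .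
  qed
  have "Determinant.det R * Determinant.det (transpose_mat R) = 1"
    using det_mult[OF R transpose_carrier_mat[THEN iffD2, OF R]] RR by simp
  moreover have "Determinant.det (R * (D * transpose_mat R))
      = Determinant.det R * (Determinant.det D * Determinant.det (transpose_mat R))"
    using R D by (simp add: det_mult[of _ k])
  ultimately have "Determinant.det (R * (D * transpose_mat R)) = Determinant.det D"
    by (simp add: mult.left_commute)
  then show ?thesis unfolding gram_def G dD by (simp add: prod_power_distrib)
qed

text \<open>The k-dimensional Jacobian of \<open>A\<close> on the plane spanned by \<open>f\<close>:
  the factor by which k-volume in that plane is multiplied, as \<open>hausdorff_linear_image\<close>
  will confirm.\<close>

definition jac :: "nat \<Rightarrow> ('a::euclidean_space \<Rightarrow> 'a) \<Rightarrow> (nat \<Rightarrow> 'a) \<Rightarrow> real" where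
  "jac k A f = sqrt (gram k (\<lambda>i. A (f i)) (\<lambda>i. A (f i)))"

lemma jac_svd:
  assumes "linear A" "orthonormal_frame k f" "svd_frame k A v" "span (f ` {..<k}) = span (v ` {..<k})"
  shows "jac k A f = (\<Prod>i<k. norm (A (v i)))"
  unfolding jac_def gram_linear_image[OF assms] by (simp add: prod_nonneg)

lemma jac_svd_obtain:
  assumes A: "linear A" and f: "orthonormal_frame k f"
  obtains v where "svd_frame k A v" "span (v ` {..<k}) = span (f ` {..<k})" "jac k A f = (\<Prod>i<k. norm (A (v i)))"
proof -
  have "dim (span (f ` {..<k})) = k" using f orthonormal_on_dim[of "{..<k}" f] by (simp add: orthonormal_frame_on)
  then obtain v where v: "svd_frame k A v" "span (v ` {..<k}) = span (f ` {..<k})"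
    using svd_frame_exists[OF A subspace_span] by blast
  then show ?thesis using that jac_svd[OF A f v(1)] by simp
qed

lemma jac_pos:
  assumes A: "linear A" "inj A" and f: "orthonormal_frame k f"
  shows "0 < jac k A f"
proof -
  obtain v where v: "svd_frame k A v" "jac k A f = (\<Prod>i<k. norm (A (v i)))" using jac_svd_obtain[OF A(1) f] by blast
  have "0 < norm (A (v i))" if "i < k" for i
  proof -
    have "v i \<noteq> 0" using v(1) that by (auto simp: svd_frame_def orthonormal_onD)
    then show ?thesis using A by (metis injD linear_0 zero_less_norm_iff)
  qed
  then show ?thesis unfolding v(2) by (intro prod_pos) auto
qed

text \<open>Interlacing, factor by factor: the singular value of index \<open>i\<close> on a k-plane
  lies between those of index \<open>i + (DIM('a) - k)\<close> and \<open>i\<close> of the whole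
  map.\<close>

lemma jac_le_sing_vals:
  fixes A :: "'a::euclidean_space \<Rightarrow>\<^sub>L 'a"
  assumes inj: "inj (blinfun_apply A)" and f: "orthonormal_frame k f" and k: "k \<le> DIM('a)"
  shows "jac k (blinfun_apply A) f \<le> (\<Prod>j<k. sing_vals A ! j)"
    and "inverse (jac k (blinfun_apply A) f) \<le> (\<Prod>j\<in>{DIM('a) - k..<DIM('a)}. inverse (sing_vals A ! j))"
proof -
  have A: "linear (blinfun_apply A)" by (simp add: blinfun.bounded_linear_right bounded_linear.linear)
  obtain v where v: "svd_frame k (blinfun_apply A) v" "jac k (blinfun_apply A) f = (\<Prod>i<k. norm (A (v i)))"
    using jac_svd_obtain[OF A f] by blast
  obtain V where V: "svd_frame DIM('a) (blinfun_apply A) V"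
    "\<And>i. i < DIM('a) \<Longrightarrow> sing_vals A ! i = norm (A (V i))" using svd_frame_sing_vals[OF inj] by blast
  show "jac k (blinfun_apply A) f \<le> (\<Prod>j<k. sing_vals A ! j)" unfolding v(2)
  proof (intro prod_mono conjI)
    fix i assume "i \<in> {..<k}"
    then show "norm (A (v i)) \<le> sing_vals A ! i"
      using V(2)[of i] k svd_frame_compare[OF A v(1) V(1), of i i] by simp
  qed simp
  have pos: "0 < norm (A (V i))" if "i < DIM('a)" for i
  proof -
    have "V i \<noteq> 0" using V(1) that by (auto simp: svd_frame_def orthonormal_onD)
    then show ?thesis using inj A by (metis injD linear_0 zero_less_norm_iff)
  qed
  have "(\<Prod>i<k. sing_vals A ! (i + (DIM('a) - k))) \<le> (\<Prod>i<k. norm (A (v i)))"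
  proof (intro prod_mono conjI)
    fix i assume i: "i \<in> {..<k}"
    then show "sing_vals A ! (i + (DIM('a) - k)) \<le> norm (A (v i))"
      using V(2)[of "i + (DIM('a) - k)"] k svd_frame_compare[OF A V(1) v(1), of "i + (DIM('a) - k)" i] by simp
    show "0 \<le> sing_vals A ! (i + (DIM('a) - k))" using i k V(2)[of "i + (DIM('a) - k)"] by simp
  qed
  moreover have "(\<Prod>i<k. sing_vals A ! (i + (DIM('a) - k))) = (\<Prod>j\<in>{DIM('a) - k..<DIM('a)}. sing_vals A ! j)"
    using prod.shift_bounds_nat_ivl[of "\<lambda>j. sing_vals A ! j" 0 "DIM('a) - k" k] k
    by (simp add: atLeast0LessThan)
  moreover have "0 < (\<Prod>j\<in>{DIM('a) - k..<DIM('a)}. sing_vals A ! j)"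
    using V(2) pos by (intro prod_pos) auto
  ultimately have "inverse (jac k (blinfun_apply A) f) \<le> inverse (\<Prod>j\<in>{DIM('a) - k..<DIM('a)}. sing_vals A ! j)"
    unfolding v(2) by (intro le_imp_inverse_le) auto
  also have "\<dots> = (\<Prod>j\<in>{DIM('a) - k..<DIM('a)}. inverse (sing_vals A ! j))"
    using prod_inversef[of "\<lambda>j. sing_vals A ! j"] by (simp add: o_def)
  finally show "inverse (jac k (blinfun_apply A) f) \<le> (\<Prod>j\<in>{DIM('a) - k..<DIM('a)}. inverse (sing_vals A ! j))" .
qed

text \<open>Testing against \<open>f'\<close> and against the image frame yields two equations that
  share the mixed Gram determinant; eliminating it leaves \<open>J * J = gram k ?w ?w\<close>, and
  \<open>J\<close> is positive.\<close>

lemma induced_orientation_factor: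
  assumes f': "orthonormal_frame k f'" and s: "s \<in> {-1, 1::real}" "s' \<in> {-1, 1}" and J: "0 < J"
    and eq: "\<And>c. covector k c \<Longrightarrow> s' * c f' = s * c (\<lambda>i. A (f i)) / J"
  shows "J = jac k A f"
proof -
  let ?w = "\<lambda>i. A (f i)"
  have 1: "s' * 1 = s * gram k ?w f' / J"
    using eq[OF covector_gram[of k f']] gram_orthonormal[OF f'] by simp
  have 2: "s' * gram k f' ?w = s * gram k ?w ?w / J" using eq[OF covector_gram[of k ?w]] by simp
  have ss: "s * s = 1" "s' * s' = 1" using s by auto
  have a: "s * gram k ?w f' = s' * J" using 1 J by (simp add: field_simps)
  have b: "s * gram k ?w ?w = J * (s' * gram k ?w f')" using 2 J by (simp add: field_simps gram_commute[of k f'])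
  have "gram k ?w ?w = s * (s * gram k ?w ?w)" using ss by (simp add: mult.assoc[symmetric])
  also have "\<dots> = J * s' * (s * gram k ?w f')" by (simp add: b mult_ac)
  also have "\<dots> = J * J" using ss by (simp add: a mult_ac)
  finally show ?thesis using J by (simp add: jac_def)
qed

subsection \<open>Gram--Schmidt\<close>

text \<open>An explicit recursion, so that the result depends measurably on \<open>w\<close>.
  Normalising by \<open>sgn\<close> makes it total, with value 0 where a vector depends on its
  predecessors.\<close>

function gram_schmidt :: "(nat \<Rightarrow> 'a::euclidean_space) \<Rightarrow> nat \<Rightarrow> 'a" where
  "gram_schmidt w i = sgn (w i - (\<Sum>j\<in>{..<i}. (w i \<bullet> gram_schmidt w j) *\<^sub>R gram_schmidt w j))"
  by auto
termination by (relation "Wellfounded.measure snd") auto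

declare gram_schmidt.simps [simp del]

definition gs_residual :: "(nat \<Rightarrow> 'a::euclidean_space) \<Rightarrow> nat \<Rightarrow> 'a" where
  "gs_residual w i = w i - (\<Sum>j\<in>{..<i}. (w i \<bullet> gram_schmidt w j) *\<^sub>R gram_schmidt w j)"

lemma gram_schmidt_eq: "gram_schmidt w i = sgn (gs_residual w i)"
  unfolding gs_residual_def by (rule gram_schmidt.simps)

lemma gram_schmidt_decompose:
  "w i = norm (gs_residual w i) *\<^sub>R gram_schmidt w i + (\<Sum>j\<in>{..<i}. (w i \<bullet> gram_schmidt w j) *\<^sub>R gram_schmidt w j)"
proof -
  have "norm (gs_residual w i) *\<^sub>R gram_schmidt w i = gs_residual w i"
    by (cases "gs_residual w i = 0") (auto simp: gram_schmidt_eq sgn_div_norm)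
  then show ?thesis by (simp add: gs_residual_def)
qed

lemma gram_schmidt_frame:
  assumes ind: "\<And>i. i < k \<Longrightarrow> w i \<notin> span (w ` {..<i})"
  shows "m \<le> k \<Longrightarrow> orthonormal_on {..<m} (gram_schmidt w) \<and> span (gram_schmidt w ` {..<m}) = span (w ` {..<m})
     \<and> (\<forall>i<m. 0 < norm (gs_residual w i))"
proof (induction m)
  case 0 show ?case by (simp add: orthonormal_on_def)
next
  case (Suc m)
  let ?g = "gram_schmidt w"
  have IH: "orthonormal_on {..<m} ?g" "span (?g ` {..<m}) = span (w ` {..<m})" "\<And>i. i < m \<Longrightarrow> 0 < norm (gs_residual w i)"
    using Suc by auto
  let ?s = "\<Sum>j\<in>{..<m}. (w m \<bullet> ?g j) *\<^sub>R ?g j"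
  have s: "?s \<in> span (?g ` {..<m})" by (intro span_sum span_scale span_base) auto
  have r0: "gs_residual w m \<noteq> 0"
  proof
    assume "gs_residual w m = 0"
    then have "w m \<in> span (w ` {..<m})" using s IH(2) by (simp add: gs_residual_def)
    then show False using ind[of m] Suc.prems by simp
  qed
  have orth: "gs_residual w m \<bullet> ?g j = 0" if j: "j < m" for j
  proof -
    have "?s \<bullet> ?g j = (\<Sum>i<m. (w m \<bullet> ?g i) * (if i = j then 1 else 0))"
      unfolding inner_sum_left inner_scaleR_left using IH(1) j by (intro sum.cong) (auto simp: orthonormal_on_def)
    also have "\<dots> = w m \<bullet> ?g j" using j by (simp add: if_distrib[of "\<lambda>z. _ * z"] cong: if_cong)
    finally show ?thesis by (simp add: gs_residual_def inner_diff_left)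
  qed
  have gm: "?g m \<bullet> ?g j = 0" if "j < m" for j using orth[OF that] by (simp add: gram_schmidt_eq[of w m] sgn_div_norm)
  have n1: "norm (?g m) = 1" using r0 by (simp add: gram_schmidt_eq norm_sgn)
  have "orthonormal_on {..<Suc m} ?g"
    using IH(1) gm n1 by (auto simp: orthonormal_on_def less_Suc_eq norm_eq_1 inner_commute)
  moreover have "span (?g ` {..<Suc m}) = span (w ` {..<Suc m})"
  proof -
    have a: "w m \<in> span (insert (?g m) (?g ` {..<m}))"
      by (subst gram_schmidt_decompose) (intro span_add span_scale span_sum span_base; simp)
    have b: "?g m \<in> span (insert (w m) (w ` {..<m}))"
    proof -
      have "gs_residual w m \<in> span (insert (w m) (w ` {..<m}))" unfolding gs_residual_def
      proof (rule span_diff)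
        show "?s \<in> span (insert (w m) (w ` {..<m}))" using s IH(2) span_mono[of "w ` {..<m}" "insert (w m) (w ` {..<m})"] by auto
      qed (simp add: span_base)
      then show ?thesis by (simp add: gram_schmidt_eq sgn_div_norm span_scale)
    qed
    have "?g ` {..<Suc m} \<subseteq> span (w ` {..<Suc m})"
      using b IH(2) span_superset[of "?g ` {..<m}"] span_mono[of "w ` {..<m}" "insert (w m) (w ` {..<m})"]
      by (simp add: lessThan_Suc) blast
    moreover have "w ` {..<Suc m} \<subseteq> span (?g ` {..<Suc m})"
      using a IH(2) span_superset[of "w ` {..<m}"] span_mono[of "?g ` {..<m}" "insert (?g m) (?g ` {..<m})"]
      by (simp add: lessThan_Suc) blast
    ultimately show ?thesis by (simp add: span_minimal subset_antisym)
  qed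
  moreover have "\<forall>i<Suc m. 0 < norm (gs_residual w i)" using IH(3) r0 by (auto simp: less_Suc_eq)
  ultimately show ?case by blast
qed

lemma independent_images:
  assumes f: "orthonormal_frame k f" and A: "linear A" "inj A" and i: "i < k"
  shows "A (f i) \<notin> span ((\<lambda>i. A (f i)) ` {..<i})"
proof
  have o: "orthonormal_on {..<i} f" using f i by (auto simp: orthonormal_frame_on intro: orthonormal_on_subset)
  assume "A (f i) \<in> span ((\<lambda>i. A (f i)) ` {..<i})"
  moreover have "span ((\<lambda>i. A (f i)) ` {..<i}) = A ` span (f ` {..<i})"
    using linear_span_image[OF A(1), of "f ` {..<i}"] by (simp add: image_image)
  ultimately have "A (f i) \<in> A ` span (f ` {..<i})" by simp
  then have "f i \<in> span (f ` {..<i})" using A(2) by (meson inj_image_mem_iff)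
  then have "f i = (\<Sum>j<i. (f i \<bullet> f j) *\<^sub>R f j)" by (rule orthonormal_on_expand[OF o])
  also have "\<dots> = 0" using f i by (intro sum.neutral) (auto simp: orthonormal_frame_def)
  finally show False using f i by (auto simp: orthonormal_frame_on orthonormal_onD)
qed

text \<open>The passage from \<open>w\<close> to its orthonormalisation is triangular with the
  residual norms on the diagonal. Slots are replaced one at a time; the off-diagonal terms repeat an
  earlier vector and vanish by alternation. When all residuals are nonzero the factor is positive,
  which is why the orientation is kept.\<close>

lemma covector_gram_schmidt:
  assumes c: "covector k c"
  shows "c w = (\<Prod>i<k. norm (gs_residual w i)) * c (gram_schmidt w)"
proof -
  let ?g = "gram_schmidt w"
  have "m \<le> k \<Longrightarrow> c w = (\<Prod>i<m. norm (gs_residual w i)) * c (\<lambda>i. if i < m then ?g i else w i)" for m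
  proof (induction m)
    case (Suc m)
    let ?v = "\<lambda>i. if i < m then ?g i else w i"
    have lin: "linear (\<lambda>y. c (?v(m := y)))" using c Suc.prems by (simp add: covector_def)
    have v: "?v = ?v(m := w m)" by auto
    have z: "c (?v(m := ?g j)) = 0" if "j < m" for j
    proof -
      have "(?v(m := ?g j)) m = (?v(m := ?g j)) j" "m \<noteq> j" using that by auto
      then show ?thesis using c that Suc.prems unfolding covector_def by (meson Suc_le_lessD less_trans)
    qed
    have "c ?v = c (?v(m := norm (gs_residual w m) *\<^sub>R ?g m + (\<Sum>j\<in>{..<m}. (w m \<bullet> ?g j) *\<^sub>R ?g j)))"
      using v gram_schmidt_decompose[of w m] by simp
    also have "\<dots> = norm (gs_residual w m) * c (?v(m := ?g m)) + (\<Sum>j\<in>{..<m}. (w m \<bullet> ?g j) * c (?v(m := ?g j)))"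
    proof -
      define F where "F = (\<lambda>y. c (?v(m := y)))"
      have F: "linear F" unfolding F_def by (rule lin)
      have "F (norm (gs_residual w m) *\<^sub>R ?g m + (\<Sum>j\<in>{..<m}. (w m \<bullet> ?g j) *\<^sub>R ?g j))
        = norm (gs_residual w m) * F (?g m) + (\<Sum>j\<in>{..<m}. (w m \<bullet> ?g j) * F (?g j))"
        by (simp add: linear_add[OF F] linear_cmul[OF F] linear_sum[OF F])
      then show ?thesis unfolding F_def .
    qed
    also have "\<dots> = norm (gs_residual w m) * c (?v(m := ?g m))" using z by simp
    also have "?v(m := ?g m) = (\<lambda>i. if i < Suc m then ?g i else w i)" by (auto simp: less_Suc_eq)
    finally show ?case using Suc by (simp add: mult.assoc)
  qed simp
  from this[of k] have "c w = (\<Prod>i<k. norm (gs_residual w i)) * c (\<lambda>i. if i < k then ?g i else w i)" by simp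
  moreover have "c (\<lambda>i. if i < k then ?g i else w i) = c ?g" using c unfolding covector_def by auto
  ultimately show ?thesis by simp
qed

lemma borel_measurable_gram_schmidt:
  assumes "\<And>j. j \<le> i \<Longrightarrow> (\<lambda>x. w x j) \<in> borel_measurable M"
  shows "(\<lambda>x. gram_schmidt (w x) i) \<in> borel_measurable M"
  using assms
proof (induction i rule: less_induct)
  case (less i)
  have g: "(\<lambda>x. gram_schmidt (w x) j) \<in> borel_measurable M" if "j < i" for j
    using that less by auto
  have [measurable]: "(\<lambda>x. gs_residual (w x) i) \<in> borel_measurable M"
    unfolding gs_residual_def using g less.prems[of i] by (intro borel_measurable_diff borel_measurable_sum borel_measurable_scaleR borel_measurable_inner) auto
  then show ?case unfolding gram_schmidt_eq sgn_div_norm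
    by measurable
qed

text \<open>A square matrix with trivial kernel has nonzero determinant and so a right inverse. The
  columns of \<open>b\<close> will be the coefficients of a Lagrange basis.\<close>

lemma real_matrix_left_kernel_trivial:
  fixes a :: "nat \<Rightarrow> nat \<Rightarrow> real"
  assumes "\<And>c. (\<forall>i<N. (\<Sum>j<N. a i j * c j) = 0) \<Longrightarrow> \<forall>j<N. c j = 0"
  obtains b where "\<And>i j. i < N \<Longrightarrow> j < N \<Longrightarrow> (\<Sum>l<N. a i l * b l j) = (if i = j then 1 else 0)"
proof -
  define M where "M = Matrix.mat N N (\<lambda>(i, j). a i j)"
  have M: "M \<in> carrier_mat N N" by (simp add: M_def)
  have "Determinant.det M \<noteq> 0"
  proof
    assume "Determinant.det M = 0"
    then obtain v where v: "v \<in> carrier_vec N" "v \<noteq> 0\<^sub>v N" "M *\<^sub>v v = 0\<^sub>v N"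
      using det_0_iff_vec_prod_zero[OF M] by blast
    have "(\<Sum>j<N. a i j * vec_index v j) = 0" if "i < N" for i
    proof -
      have "vec_index (M *\<^sub>v v) i = (\<Sum>j<N. a i j * vec_index v j)"
        using that v(1) by (simp add: M_def scalar_prod_def atLeast0LessThan)
      then show ?thesis using v(3) that by simp
    qed
    then have "\<forall>j<N. vec_index v j = 0" using assms[of "vec_index v"] by blast
    then have "v = 0\<^sub>v N" using v(1) by (intro eq_vecI) auto
    then show False using v(2) by simp
  qed
  then have "M \<in> Units (ring_mat TYPE(real) N ())" by (rule det_non_zero_imp_unit[OF M])
  then obtain B where B: "B \<in> carrier_mat N N" "M * B = 1\<^sub>m N"
    by (auto simp: Units_def ring_mat_def)
  have "(\<Sum>l<N. a i l * B $$ (l, j)) = (if i = j then 1 else 0)" if "i < N" "j < N" for i j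
  proof -
    have "(M * B) $$ (i, j) = (\<Sum>l<N. a i l * B $$ (l, j))"
      using that B(1) by (simp add: M_def scalar_prod_def atLeast0LessThan)
    then show ?thesis using B(2) that by simp
  qed
  then show ?thesis using that[of "\<lambda>l j. B $$ (l, j)"] by blast
qed

subsection \<open>Hausdorff measure on coordinate subspaces\<close>

text \<open>An enumeration of the standard basis, fixed once and for all, which gives meaning to the
  first \<open>k\<close> coordinates of an abstract Euclidean space.\<close>

definition bas :: "nat \<Rightarrow> 'a::euclidean_space" where
  "bas = (SOME b. bij_betw b {..<DIM('a)} Basis)"

lemma bas_bij: "bij_betw (bas :: nat \<Rightarrow> 'a::euclidean_space) {..<DIM('a)} Basis"
proof -
  have "\<exists>b :: nat \<Rightarrow> 'a. bij_betw b {..<DIM('a)} Basis"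
    using ex_bij_betw_nat_finite[OF finite_Basis] by (simp add: atLeast0LessThan)
  then show ?thesis unfolding bas_def by (rule someI_ex)
qed

lemma bas_orthonormal: "orthonormal_on {..<DIM('a)} (bas :: nat \<Rightarrow> 'a::euclidean_space)"
  unfolding orthonormal_on_def
proof (intro ballI)
  fix i j assume ij: "i \<in> {..<DIM('a)}" "j \<in> {..<DIM('a)}"
  then have "(bas i :: 'a) \<in> Basis" "(bas j :: 'a) \<in> Basis" using bas_bij by (auto simp: bij_betw_def)
  moreover have "(bas i :: 'a) = bas j \<longleftrightarrow> i = j"
    using bas_bij ij by (auto simp: bij_betw_def inj_on_def)
  ultimately show "(bas i :: 'a) \<bullet> bas j = (if i = j then 1 else 0)" by (simp add: inner_Basis)
qed

lemma bas_inner: "i < DIM('a) \<Longrightarrow> j < DIM('a) \<Longrightarrow> (bas i :: 'a::euclidean_space) \<bullet> bas j = (if i = j then 1 else 0)"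
  using bas_orthonormal unfolding orthonormal_on_def by blast

lemma Basis_bas: assumes "b \<in> Basis" obtains i where "i < DIM('a)" "b = (bas i :: 'a::euclidean_space)"
proof -
  have "b \<in> bas ` {..<DIM('a)}" using assms bas_bij[where 'a='a] by (simp add: bij_betw_def)
  then show ?thesis using that by blast
qed

lemma norm_bas: "i < DIM('a) \<Longrightarrow> norm (bas i :: 'a::euclidean_space) = 1"
  by (rule orthonormal_onD(1)[OF bas_orthonormal]) simp

lemma bas_sum_inner:
  assumes "I \<subseteq> {..<DIM('a)}" "j < DIM('a)"
  shows "(\<Sum>i\<in>I. c i *\<^sub>R (bas i :: 'a::euclidean_space)) \<bullet> bas j = (if j \<in> I then c j else 0)"
proof -
  have fin: "finite I" using assms(1) finite_subset by blast
  have "(\<Sum>i\<in>I. c i *\<^sub>R (bas i :: 'a)) \<bullet> bas j = (\<Sum>i\<in>I. c i * (if i = j then 1 else 0))"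
    unfolding inner_sum_left inner_scaleR_left using assms by (intro sum.cong) (auto simp: bas_inner)
  also have "\<dots> = (\<Sum>i\<in>I. if i = j then c i else 0)" by (intro sum.cong) auto
  also have "\<dots> = (if j \<in> I then c j else 0)" using fin by (simp add: sum.delta)
  finally show ?thesis .
qed

lemma bas_eqI:
  assumes "\<And>i. i < DIM('a) \<Longrightarrow> x \<bullet> bas i = y \<bullet> (bas i :: 'a::euclidean_space)"
  shows "x = y"
proof (rule euclidean_eqI)
  fix b :: 'a assume "b \<in> Basis"
  then obtain i where "i < DIM('a)" "b = bas i" by (rule Basis_bas)
  then show "x \<bullet> b = y \<bullet> b" using assms by simp
qed

definition coord_proj :: "nat \<Rightarrow> 'a::euclidean_space \<Rightarrow> 'a" where
  "coord_proj k x = (\<Sum>i<k. (x \<bullet> bas i) *\<^sub>R bas i)"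

definition coord_space :: "nat \<Rightarrow> 'a::euclidean_space set" where
  "coord_space k = {x. \<forall>i\<in>{k..<DIM('a)}. x \<bullet> bas i = 0}"

lemma coord_proj_inner:
  "k \<le> DIM('a) \<Longrightarrow> i < DIM('a) \<Longrightarrow> coord_proj k (x::'a::euclidean_space) \<bullet> bas i = (if i < k then x \<bullet> bas i else 0)"
  unfolding coord_proj_def by (subst bas_sum_inner) auto

lemma coord_proj_in: "k \<le> DIM('a) \<Longrightarrow> coord_proj k (x::'a::euclidean_space) \<in> coord_space k"
  by (auto simp: coord_space_def coord_proj_inner)

lemma coord_proj_id: "k \<le> DIM('a) \<Longrightarrow> (x::'a::euclidean_space) \<in> coord_space k \<Longrightarrow> coord_proj k x = x"
  by (rule bas_eqI) (auto simp: coord_space_def coord_proj_inner)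

lemma subspace_coord_space: "subspace (coord_space k)"
  by (auto simp: subspace_def coord_space_def inner_add_left)

lemma closed_coord_space: "closed (coord_space k)"
  by (rule closed_subspace[OF subspace_coord_space])

lemma linear_coord_proj: "linear (coord_proj k)"
  unfolding coord_proj_def by (intro linearI) (auto simp: inner_add_left scaleR_add_left sum.distrib scaleR_sum_right)

lemma borel_coord_proj [measurable]: "coord_proj k \<in> borel_measurable borel"
  by (intro borel_measurable_continuous_onI linear_continuous_on) (simp add: linear_coord_proj linear_conv_bounded_linear[symmetric])

lemma coord_space_norm_le:
  assumes "k \<le> DIM('a)" "(x::'a::euclidean_space) \<in> coord_space k" "\<And>i. i < k \<Longrightarrow> \<bar>x \<bullet> bas i\<bar> \<le> c"
  shows "norm x \<le> real k * c"
proof -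
  have "norm x = norm (\<Sum>i<k. (x \<bullet> bas i) *\<^sub>R (bas i :: 'a))"
    by (simp only: coord_proj_id[OF assms(1,2), unfolded coord_proj_def])
  also have "\<dots> \<le> (\<Sum>i<k. norm ((x \<bullet> bas i) *\<^sub>R (bas i :: 'a)))" by (rule norm_sum)
  also have "\<dots> \<le> (\<Sum>i<k. c)"
  proof (rule sum_mono)
    fix i assume i: "i \<in> {..<k}"
    then have "norm (bas i :: 'a) = 1" using assms(1) by (simp add: norm_bas)
    then show "norm ((x \<bullet> bas i) *\<^sub>R (bas i :: 'a)) \<le> c" using assms(3) i by simp
  qed
  finally show ?thesis by simp
qed

lemma hausdorff_pre_finite_cover:
  fixes C :: "'i \<Rightarrow> 'a::euclidean_space set"
  assumes "finite I" "A \<subseteq> (\<Union>i\<in>I. C i)" "0 \<le> \<delta>" "\<And>i. i \<in> I \<Longrightarrow> bounded (C i) \<and> diameter (C i) \<le> \<delta>"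
  shows "hausdorff_pre k \<delta> A \<le> (\<Sum>i\<in>I. hausdorff_weight k (C i))"
proof -
  obtain h where h: "bij_betw h {..<card I} I"
    using ex_bij_betw_nat_finite[OF assms(1)] by (auto simp: atLeast0LessThan)
  define D where "D = (\<lambda>n. if n < card I then C (h n) else {})"
  have hI: "h n \<in> I" if "n < card I" for n using h that by (auto simp: bij_betw_def)
  have "A \<subseteq> (\<Union>n. D n)"
  proof
    fix x assume "x \<in> A"
    then obtain i where i: "i \<in> I" "x \<in> C i" using assms(2) by blast
    then obtain n where "n < card I" "i = h n" using h by (auto simp: bij_betw_def)
    then have "x \<in> D n" using i by (simp add: D_def)
    then show "x \<in> (\<Union>n. D n)" by blast
  qed
  moreover have "bounded (D n) \<and> diameter (D n) \<le> \<delta>" for n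
    using assms(3) assms(4)[OF hI[of n]] by (cases "n < card I") (simp_all add: D_def)
  ultimately have "delta_cover \<delta> A D" unfolding delta_cover_def by blast
  then have "hausdorff_pre k \<delta> A \<le> (\<Sum>n. hausdorff_weight k (D n))" by (rule hausdorff_pre_le)
  also have "\<dots> = (\<Sum>n<card I. hausdorff_weight k (D n))"
    by (rule suminf_finite) (auto simp: D_def)
  also have "\<dots> = (\<Sum>n<card I. hausdorff_weight k (C (h n)))" by (intro sum.cong) (auto simp: D_def)
  also have "\<dots> = (\<Sum>i\<in>I. hausdorff_weight k (C i))" by (rule sum.reindex_bij_betw[OF h])
  finally show ?thesis .
qed

text \<open>A grid of \<open>m ^ k\<close> cells of side \<open>2 / m\<close> covers the cube.
  Summing over coordinates bounds the diameter of a cell by \<open>2 * k / m\<close>, so the weights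
  total \<open>unit_ball_vol k * k ^ k\<close> whatever \<open>m\<close> is.\<close>

lemma hausdorff_unit_cell_finite:
  assumes k: "k \<le> DIM('a::euclidean_space)"
  shows "hausdorff_outer k {x\<in>coord_space k :: 'a set. \<forall>i<k. -1 \<le> x \<bullet> bas i \<and> x \<bullet> bas i < 1} < \<infinity>"
    (is "hausdorff_outer k ?Q < _")
proof -
  have "hausdorff_outer k ?Q \<le> ennreal (unit_ball_vol (real k) * real k ^ k)"
  proof (rule hausdorff_outer_least)
    fix \<delta> :: real assume \<delta>: "0 < \<delta>"
    obtain m :: nat where m: "m > 0" "2 * real k / real m \<le> \<delta>"
    proof -
      obtain m :: nat where "2 * real k / \<delta> < real m" using reals_Archimedean2 by blast
      then have "2 * real k / real (Suc m) \<le> \<delta>" using \<delta> by (simp add: field_simps)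
      then show ?thesis using that[of "Suc m"] by blast
    qed
    define I where "I = PiE {..<k} (\<lambda>_. {..<m})"
    define C where "C = (\<lambda>t::nat\<Rightarrow>nat. {x\<in>coord_space k :: 'a set. \<forall>i<k.
      -1 + 2 * real (t i) / real m \<le> x \<bullet> bas i \<and> x \<bullet> bas i \<le> -1 + 2 * (real (t i) + 1) / real m})"
    have fin: "finite I" unfolding I_def by (intro finite_PiE) auto
    have card: "card I = m ^ k" by (simp add: I_def card_PiE)
    have nm: "norm (x - y) \<le> 2 * real k / real m" if "x \<in> C t" "y \<in> C t" for x y t
    proof -
      have "norm (x - y) \<le> real k * (2 / real m)"
      proof (rule coord_space_norm_le[OF k])
        show "x - y \<in> coord_space k" using that subspace_diff[OF subspace_coord_space] by (auto simp: C_def)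
        fix i assume i: "i < k"
        have "2 * (real (t i) + 1) / real m = 2 * real (t i) / real m + 2 / real m"
          by (simp add: add_divide_distrib)
        moreover have "-1 + 2 * real (t i) / real m \<le> x \<bullet> bas i" "x \<bullet> bas i \<le> -1 + 2 * (real (t i) + 1) / real m"
          "-1 + 2 * real (t i) / real m \<le> y \<bullet> bas i" "y \<bullet> bas i \<le> -1 + 2 * (real (t i) + 1) / real m"
          using that i by (auto simp: C_def)
        ultimately show "\<bar>(x - y) \<bullet> bas i\<bar> \<le> 2 / real m" by (simp add: inner_diff_left abs_le_iff)
      qed
      then show ?thesis by (simp add: mult.commute)
    qed
    have bC: "bounded (C t)" for t
    proof (cases "C t = {}")
      case False
      then obtain z where "z \<in> C t" by blast
      then show ?thesis using nm[of z t] unfolding bounded_def dist_norm by blast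
    qed simp
    have dC: "diameter (C t) \<le> 2 * real k / real m" for t
      using nm by (intro diameter_le) auto
    have cov: "?Q \<subseteq> (\<Union>t\<in>I. C t)"
    proof
      fix x assume x: "x \<in> ?Q"
      \<comment> \<open>The index of the grid cell along each axis; it stays below \<open>m\<close>
        because the cube is open at its upper faces.\<close>
      define t where "t = (\<lambda>i\<in>{..<k}. nat \<lfloor>(x \<bullet> bas i + 1) * real m / 2\<rfloor>)"
      have t: "t i < m \<and> -1 + 2 * real (t i) / real m \<le> x \<bullet> bas i \<and> x \<bullet> bas i \<le> -1 + 2 * (real (t i) + 1) / real m"
        if i: "i < k" for i
      proof -
        define z where "z = (x \<bullet> bas i + 1) * real m / 2"
        have xi: "-1 \<le> x \<bullet> bas i" "x \<bullet> bas i < 1" using x i by auto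
        have z0: "0 \<le> z" using xi by (simp add: z_def)
        have "(x \<bullet> bas i + 1) * real m < 2 * real m" using xi m by (intro mult_strict_right_mono) auto
        then have zm: "z < real m" by (simp add: z_def)
        have ti: "real (t i) = of_int \<lfloor>z\<rfloor>" using z0 i by (simp add: t_def z_def)
        have "of_int \<lfloor>z\<rfloor> \<le> z" "z < of_int \<lfloor>z\<rfloor> + 1" by linarith+
        then have b: "real (t i) \<le> z" "z < real (t i) + 1" using ti by auto
        have xz: "x \<bullet> bas i = -1 + 2 * z / real m" using m by (simp add: z_def field_simps)
        have "real (t i) < real m" using b zm by linarith
        moreover have "2 * real (t i) / real m \<le> 2 * z / real m" "2 * z / real m \<le> 2 * (real (t i) + 1) / real m"
          using b by (auto intro!: divide_right_mono)
        ultimately show ?thesis using xz by auto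
      qed
      then have "t \<in> I" "x \<in> C t" using x by (auto simp: I_def C_def t_def)
      then show "x \<in> (\<Union>t\<in>I. C t)" by blast
    qed
    have "hausdorff_pre k \<delta> ?Q \<le> (\<Sum>t\<in>I. hausdorff_weight k (C t))"
      using bC dC m(2) \<delta> by (intro hausdorff_pre_finite_cover[OF fin cov]) (auto intro: order_trans)
    also have "\<dots> \<le> (\<Sum>t\<in>I. ennreal (unit_ball_vol (real k) / 2 ^ k * (2 * real k / real m) ^ k))"
    proof (rule sum_mono)
      fix t
      have "unit_ball_vol (real k) / 2 ^ k * diameter (C t) ^ k \<le> unit_ball_vol (real k) / 2 ^ k * (2 * real k / real m) ^ k"
        using dC diameter_ge_0[OF bC] by (intro mult_left_mono power_mono) auto
      then show "hausdorff_weight k (C t) \<le> ennreal (unit_ball_vol (real k) / 2 ^ k * (2 * real k / real m) ^ k)"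
        by (auto simp: hausdorff_weight_def intro!: ennreal_leI)
    qed
    also have "\<dots> = of_nat (m ^ k) * ennreal (unit_ball_vol (real k) / 2 ^ k * (2 * real k / real m) ^ k)"
      by (simp add: card)
    also have "\<dots> = ennreal (real (m ^ k) * (unit_ball_vol (real k) / 2 ^ k * (2 * real k / real m) ^ k))"
      by (subst ennreal_mult) (auto simp: ennreal_of_nat_eq_real_of_nat)
    also have "real (m ^ k) * (unit_ball_vol (real k) / 2 ^ k * (2 * real k / real m) ^ k) = unit_ball_vol (real k) * real k ^ k"
      using m by (simp add: power_divide power_mult_distrib)
    finally show "hausdorff_pre k \<delta> ?Q \<le> ennreal (unit_ball_vol (real k) * real k ^ k)" .
  qed
  then show ?thesis by (simp add: order_le_less_trans)
qed

lemma coord_space_bounded_finite: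
  assumes k: "k \<le> DIM('a::euclidean_space)" and B: "bounded B" "B \<subseteq> (coord_space k :: 'a set)"
  shows "hausdorff_outer k B < \<infinity>"
proof -
  let ?Q = "{x\<in>coord_space k :: 'a set. \<forall>i<k. -1 \<le> x \<bullet> bas i \<and> x \<bullet> bas i < 1}"
  obtain R where R: "R > 0" "\<And>x. x \<in> B \<Longrightarrow> norm x < R"
    using bounded_pos_less B(1) by metis
  have "B \<subseteq> (\<lambda>x. R *\<^sub>R x) ` ?Q"
  proof
    fix x assume x: "x \<in> B"
    have "-1 \<le> (x /\<^sub>R R) \<bullet> bas i \<and> (x /\<^sub>R R) \<bullet> bas i < 1" if "i < k" for i
    proof -
      have "norm (bas i :: 'a) = 1" using that k by (simp add: norm_bas)
      then have "\<bar>x \<bullet> bas i\<bar> < R" using Cauchy_Schwarz_ineq2[of x "bas i"] R(2)[OF x] by simp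
      then show ?thesis using R(1) by (simp add: field_simps abs_less_iff)
    qed
    moreover have "x /\<^sub>R R \<in> coord_space k" using x B(2) subspace_scale[OF subspace_coord_space] by blast
    ultimately have "x /\<^sub>R R \<in> ?Q" by blast
    then show "x \<in> (\<lambda>x. R *\<^sub>R x) ` ?Q" using R(1) by (intro image_eqI[of _ _ "x /\<^sub>R R"]) auto
  qed
  then have "hausdorff_outer k B \<le> hausdorff_outer k ((\<lambda>x. R *\<^sub>R x) ` ?Q)" by (rule hausdorff_outer_mono)
  also have "\<dots> \<le> ennreal (R ^ k) * hausdorff_outer k ?Q"
    using R(1) by (intro hausdorff_outer_Lipschitz) (auto simp: dist_norm scaleR_diff_right[symmetric])
  also have "\<dots> < \<infinity>" using hausdorff_unit_cell_finite[OF k] by (simp add: ennreal_mult_less_top)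
  finally show ?thesis .
qed

section \<open>Hausdorff and Lebesgue measure on a coordinate plane\<close>

text \<open>Lebesgue measure of the slab over a subset of the coordinate space plays the role of
  k-dimensional Lebesgue measure there.\<close>

definition slab :: "nat \<Rightarrow> 'a::euclidean_space set" where
  "slab k = {x. \<forall>i\<in>{k..<DIM('a)}. 0 \<le> x \<bullet> bas i \<and> x \<bullet> bas i \<le> 1}"

definition slab_measure :: "nat \<Rightarrow> 'a::euclidean_space measure" where
  "slab_measure k = distr (restrict_space lborel (slab k)) borel (coord_proj k)"

lemma borel_slab [measurable]: "slab k \<in> sets borel"
proof -
  have "slab k = (\<Inter>i\<in>{k..<DIM('a)}. {x::'a. 0 \<le> x \<bullet> bas i} \<inter> {x. x \<bullet> bas i \<le> 1})"
    by (auto simp: slab_def)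
  also have "closed \<dots>" by (intro closed_INT ballI closed_Int closed_Collect_le continuous_intros)
  finally show ?thesis by simp
qed

lemma emeasure_slab_measure:
  assumes A: "A \<in> sets borel"
  shows "emeasure (slab_measure k) A = emeasure lborel (coord_proj k -` A \<inter> slab k)"
proof -
  have 1: "coord_proj k \<in> measurable (restrict_space lborel (slab k)) borel"
    by (rule measurable_restrict_space1) simp
  have "emeasure (slab_measure k) A = emeasure (restrict_space lborel (slab k)) (coord_proj k -` A \<inter> slab k)"
    unfolding slab_measure_def using A 1 by (subst emeasure_distr) (auto simp: space_restrict_space)
  also have "\<dots> = emeasure lborel (coord_proj k -` A \<inter> slab k)"
    by (rule emeasure_restrict_space) auto
  finally show ?thesis .
qed

lemma sets_slab_measure [simp]: "sets (slab_measure k) = sets borel"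
  and space_slab_measure [simp]: "space (slab_measure k) = UNIV"
  by (simp_all add: slab_measure_def)

lemma emeasure_lborel_coord_box:
  assumes "\<And>i. i < DIM('a) \<Longrightarrow> l i \<le> u i"
  shows "emeasure lborel {x::'a::euclidean_space. \<forall>i<DIM('a). l i \<le> x \<bullet> bas i \<and> x \<bullet> bas i \<le> u i}
      = ennreal (\<Prod>i<DIM('a). u i - l i)"
proof -
  define a where "a = (\<Sum>i<DIM('a). l i *\<^sub>R (bas i :: 'a))"
  define b where "b = (\<Sum>i<DIM('a). u i *\<^sub>R (bas i :: 'a))"
  have ab: "a \<bullet> bas i = l i" "b \<bullet> bas i = u i" if "i < DIM('a)" for i
    using that by (simp_all add: a_def b_def bas_sum_inner)
  have eq: "{x::'a. \<forall>i<DIM('a). l i \<le> x \<bullet> bas i \<and> x \<bullet> bas i \<le> u i} = cbox a b"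
    unfolding cbox_def
  proof (intro set_eqI iffI)
    fix x :: 'a assume x: "x \<in> {x. \<forall>i<DIM('a). l i \<le> x \<bullet> bas i \<and> x \<bullet> bas i \<le> u i}"
    have "a \<bullet> c \<le> x \<bullet> c \<and> x \<bullet> c \<le> b \<bullet> c" if cB: "c \<in> Basis" for c
    proof -
      obtain i where "i < DIM('a)" "c = bas i" by (rule Basis_bas[OF cB])
      then show ?thesis using ab x by simp
    qed
    then show "x \<in> {x. \<forall>i\<in>Basis. a \<bullet> i \<le> x \<bullet> i \<and> x \<bullet> i \<le> b \<bullet> i}" by blast
  next
    fix x :: 'a assume "x \<in> {x. \<forall>i\<in>Basis. a \<bullet> i \<le> x \<bullet> i \<and> x \<bullet> i \<le> b \<bullet> i}"
    then have x: "a \<bullet> c \<le> x \<bullet> c \<and> x \<bullet> c \<le> b \<bullet> c" if "c \<in> Basis" for c using that by blast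
    have "bas i \<in> (Basis :: 'a set)" if "i < DIM('a)" for i
      using that bas_bij[where 'a='a] by (auto simp: bij_betw_def)
    then show "x \<in> {x. \<forall>i<DIM('a). l i \<le> x \<bullet> bas i \<and> x \<bullet> bas i \<le> u i}" using x ab by fastforce
  qed
  have "emeasure lborel (cbox a b) = (\<Prod>c\<in>Basis. (b - a) \<bullet> c)"
  proof (rule emeasure_lborel_cbox)
    fix c :: 'a assume "c \<in> Basis"
    then obtain i where "i < DIM('a)" "c = bas i" by (rule Basis_bas)
    then show "a \<bullet> c \<le> b \<bullet> c" using ab assms by simp
  qed
  also have "(\<Prod>c\<in>Basis. (b - a) \<bullet> c) = (\<Prod>i<DIM('a). (b - a) \<bullet> bas i)"
    by (rule prod.reindex_bij_betw[OF bas_bij, symmetric])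
  also have "\<dots> = (\<Prod>i<DIM('a). u i - l i)" using ab by (intro prod.cong) (auto simp: inner_diff_left)
  finally show ?thesis using eq by simp
qed

lemma slab_measure_box:
  assumes k: "k \<le> DIM('a)" and lu: "\<And>i. i < k \<Longrightarrow> l i \<le> u i"
  shows "emeasure (slab_measure k) {x::'a::euclidean_space. \<forall>i<k. l i \<le> x \<bullet> bas i \<and> x \<bullet> bas i \<le> u i}
      = ennreal (\<Prod>i<k. u i - l i)" (is "emeasure _ ?B = _")
proof -
  let ?l = "\<lambda>i. if i < k then l i else 0" let ?u = "\<lambda>i. if i < k then u i else 1"
  have "?B = (\<Inter>i\<in>{..<k}. {x::'a. l i \<le> x \<bullet> bas i} \<inter> {x. x \<bullet> bas i \<le> u i})" by auto
  also have "closed \<dots>" by (intro closed_INT ballI closed_Int closed_Collect_le continuous_intros)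
  finally have B: "?B \<in> sets borel" by simp
  have "coord_proj k -` ?B \<inter> slab k = {x::'a. \<forall>i<DIM('a). ?l i \<le> x \<bullet> bas i \<and> x \<bullet> bas i \<le> ?u i}"
  proof (intro set_eqI iffI)
    fix x :: 'a assume x: "x \<in> coord_proj k -` ?B \<inter> slab k"
    have "?l i \<le> x \<bullet> bas i \<and> x \<bullet> bas i \<le> ?u i" if "i < DIM('a)" for i
      using x that k by (cases "i < k") (auto simp: coord_proj_inner slab_def)
    then show "x \<in> {x::'a. \<forall>i<DIM('a). ?l i \<le> x \<bullet> bas i \<and> x \<bullet> bas i \<le> ?u i}" by blast
  next
    fix x :: 'a assume "x \<in> {x::'a. \<forall>i<DIM('a). ?l i \<le> x \<bullet> bas i \<and> x \<bullet> bas i \<le> ?u i}"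
    then have x: "?l i \<le> x \<bullet> bas i \<and> x \<bullet> bas i \<le> ?u i" if "i < DIM('a)" for i using that by blast
    have "l i \<le> x \<bullet> bas i \<and> x \<bullet> bas i \<le> u i" if "i < k" for i using x[of i] that k by simp
    moreover have "0 \<le> x \<bullet> bas i \<and> x \<bullet> bas i \<le> 1" if "i \<in> {k..<DIM('a)}" for i using x[of i] that by simp
    ultimately show "x \<in> coord_proj k -` ?B \<inter> slab k"
      using k by (auto simp: coord_proj_inner slab_def)
  qed
  then have "emeasure (slab_measure k) ?B = emeasure lborel {x::'a. \<forall>i<DIM('a). ?l i \<le> x \<bullet> bas i \<and> x \<bullet> bas i \<le> ?u i}"
    by (simp only: emeasure_slab_measure[OF B])
  also have "\<dots> = ennreal (\<Prod>i<DIM('a). ?u i - ?l i)"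
    by (rule emeasure_lborel_coord_box) (use lu in auto)
  also have "(\<Prod>i<DIM('a). ?u i - ?l i) = (\<Prod>i<k. ?u i - ?l i)"
    using k by (intro prod.mono_neutral_right) auto
  also have "\<dots> = (\<Prod>i<k. u i - l i)" by (intro prod.cong) auto
  finally show ?thesis .
qed

lemma slab_measure_ball_le:
  assumes k: "k \<le> DIM('a)" and d: "0 \<le> d"
  shows "emeasure (slab_measure k) (cball (x::'a::euclidean_space) d) \<le> ennreal ((2 * d) ^ k)"
proof -
  let ?B = "{y::'a. \<forall>i<k. x \<bullet> bas i - d \<le> y \<bullet> bas i \<and> y \<bullet> bas i \<le> x \<bullet> bas i + d}"
  have "?B = (\<Inter>i\<in>{..<k}. {y::'a. x \<bullet> bas i - d \<le> y \<bullet> bas i} \<inter> {y. y \<bullet> bas i \<le> x \<bullet> bas i + d})" by auto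
  also have "closed \<dots>" by (intro closed_INT ballI closed_Int closed_Collect_le continuous_intros)
  finally have B: "?B \<in> sets borel" by simp
  have "cball x d \<subseteq> ?B"
  proof
    fix y assume y: "y \<in> cball x d"
    have "\<bar>(x - y) \<bullet> bas i\<bar> \<le> d" if "i < k" for i
    proof -
      have "norm (bas i :: 'a) = 1" using that k by (simp add: norm_bas)
      then show ?thesis using Cauchy_Schwarz_ineq2[of "x - y" "bas i"] y by (simp add: dist_norm)
    qed
    then have "x \<bullet> bas i - d \<le> y \<bullet> bas i \<and> y \<bullet> bas i \<le> x \<bullet> bas i + d" if "i < k" for i
      using that by (fastforce simp: inner_diff_left abs_le_iff)
    then show "y \<in> ?B" by blast
  qed
  then have "emeasure (slab_measure k) (cball x d) \<le> emeasure (slab_measure k) ?B"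
    using B by (intro emeasure_mono) auto
  also have "\<dots> = ennreal (\<Prod>i<k. (x \<bullet> bas i + d) - (x \<bullet> bas i - d))"
    using d by (intro slab_measure_box[OF k]) auto
  also have "\<dots> = ennreal ((2 * d) ^ k)" by simp
  finally show ?thesis .
qed

text \<open>Symmetric about the origin, so the reflection appearing in
  \<open>translation_invariant_unique\<close> leaves it fixed. It becomes bounded only after
  intersection with \<open>coord_space k\<close>.\<close>

definition coord_cube :: "nat \<Rightarrow> 'a::euclidean_space set" where
  "coord_cube k = {x. \<forall>i<k. - 1 \<le> x \<bullet> bas i \<and> x \<bullet> bas i \<le> 1}"

lemma closed_coord_cube: "closed (coord_cube k)"
proof -
  have "coord_cube k = (\<Inter>i\<in>{..<k}. {x::'a. -1 \<le> x \<bullet> bas i} \<inter> {x. x \<bullet> bas i \<le> 1})"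
    by (auto simp: coord_cube_def)
  also have "closed \<dots>" by (intro closed_INT ballI closed_Int closed_Collect_le continuous_intros)
  finally show ?thesis .
qed

lemma slab_measure_cube:
  "k \<le> DIM('a) \<Longrightarrow> emeasure (slab_measure k) (coord_cube k :: 'a::euclidean_space set) = ennreal (2 ^ k)"
  using slab_measure_box[of k "\<lambda>_. -1" "\<lambda>_. 1", where 'a='a] by (simp add: coord_cube_def)

lemma slab_measure_coord_space:
  assumes k: "k \<le> DIM('a)" and A: "A \<in> sets borel"
  shows "emeasure (slab_measure k) (A \<inter> coord_space k) = emeasure (slab_measure k) (A :: 'a::euclidean_space set)"
proof -
  have "coord_proj k -` (A \<inter> coord_space k) \<inter> slab k = coord_proj k -` A \<inter> slab k"
    using coord_proj_in[OF k] by auto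
  moreover have "A \<inter> coord_space k \<in> sets borel"
    using A borel_closed[OF closed_coord_space[of k, where 'a='a]] by (rule sets.Int)
  ultimately show ?thesis using A by (simp only: emeasure_slab_measure)
qed

text \<open>The mass distribution principle. The slab measure of the cube is \<open>2 ^ k\<close>,
  and a set of diameter \<open>d\<close> carries at most \<open>(2 * d) ^ k\<close> of it, which is
  \<open>4 ^ k / unit_ball_vol k\<close> times its weight; hence the weights of a cover cannot be
  small in total.\<close>

lemma hausdorff_cube_pos:
  assumes k: "k \<le> DIM('a)"
  shows "0 < hausdorff_outer k (coord_space k \<inter> coord_cube k :: 'a::euclidean_space set)" (is "0 < hausdorff_outer k ?Q")
proof -
  have "0 < unit_ball_vol (real k)" by simp
  then have ubn: "unit_ball_vol (real k) \<noteq> 0" by (rule less_imp_neq[symmetric])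
  have "ennreal (unit_ball_vol (real k) / 2 ^ k) \<le> hausdorff_pre k 1 ?Q"
    unfolding hausdorff_pre_alt
  proof (rule INF_greatest)
    fix C assume "C \<in> {C. delta_cover 1 ?Q C}"
    then have C: "?Q \<subseteq> (\<Union>i. C i)" "\<And>i. bounded (C i)" unfolding delta_cover_def by auto
    \<comment> \<open>A bounded set lies in the closed ball about any of its points with its
      diameter as radius. The balls are Borel, so slab measure is countably subadditive on
      them.\<close>
    define D where "D = (\<lambda>i. if C i = {} then {} else cball (SOME x. x \<in> C i) (diameter (C i)))"
    have CD: "C i \<subseteq> D i" for i
    proof (cases "C i = {}")
      case False
      then have "(SOME x. x \<in> C i) \<in> C i" by (rule some_in_eq[THEN iffD2])
      then show ?thesis using diameter_bounded_bound[OF C(2)[of i]] by (auto simp: D_def)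
    qed (simp add: D_def)
    have Db: "D i \<in> sets borel" for i by (simp add: D_def)
    have Dm: "emeasure (slab_measure k) (D i) \<le> ennreal (4 ^ k / unit_ball_vol (real k)) * hausdorff_weight k (C i)" for i
    proof (cases "C i = {}")
      case False
      have d: "0 \<le> diameter (C i)" by (rule diameter_ge_0[OF C(2)])
      have "emeasure (slab_measure k) (D i) \<le> ennreal ((2 * diameter (C i)) ^ k)"
        using False slab_measure_ball_le[OF k d] by (simp add: D_def)
      also have "(2 * diameter (C i)) ^ k = 4 ^ k / unit_ball_vol (real k) * (unit_ball_vol (real k) / 2 ^ k * diameter (C i) ^ k)"
      proof -
        define w where "w = unit_ball_vol (real k)"
        have "w \<noteq> 0" by (simp add: w_def less_imp_neq[symmetric])
        moreover have "(4::real) ^ k = 2 ^ k * 2 ^ k" by (simp add: power_mult_distrib[symmetric])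
        ultimately show ?thesis unfolding w_def[symmetric] by (simp add: power_mult_distrib)
      qed
      also have "ennreal \<dots> = ennreal (4 ^ k / unit_ball_vol (real k)) * hausdorff_weight k (C i)"
        unfolding hausdorff_weight_def using False by (simp only: if_False) (rule ennreal_mult', simp add: less_imp_le)
      finally show ?thesis .
    qed (simp add: D_def)
    have "ennreal (2 ^ k) = emeasure (slab_measure k) (coord_cube k \<inter> coord_space k :: 'a set)"
      using slab_measure_coord_space[OF k borel_closed[OF closed_coord_cube[of k, where 'a='a]]] slab_measure_cube[OF k]
      by (simp only:)
    also have "\<dots> \<le> emeasure (slab_measure k) (\<Union>i. D i)"
    proof (rule emeasure_mono)
      have "(\<Union>i. C i) \<subseteq> (\<Union>i. D i)" by (rule UN_mono[OF order_refl CD])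
      then show "coord_cube k \<inter> coord_space k \<subseteq> (\<Union>i. D i)" using C(1) by (metis Int_commute order_trans)
      show "(\<Union>i. D i) \<in> sets (slab_measure k)"
        unfolding sets_slab_measure by (rule sets.countable_UN) (use Db in blast)
    qed
    also have "\<dots> \<le> (\<Sum>i. emeasure (slab_measure k) (D i))"
      by (rule emeasure_subadditive_countably) (use Db in \<open>simp add: image_subset_iff\<close>)
    also have "\<dots> \<le> (\<Sum>i. ennreal (4 ^ k / unit_ball_vol (real k)) * hausdorff_weight k (C i))"
      by (intro suminf_le summableI Dm)
    also have "\<dots> = ennreal (4 ^ k / unit_ball_vol (real k)) * (\<Sum>i. hausdorff_weight k (C i))" by simp
    finally have le: "ennreal (2 ^ k) \<le> ennreal (4 ^ k / unit_ball_vol (real k)) * (\<Sum>i. hausdorff_weight k (C i))" .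
    have "ennreal (unit_ball_vol (real k) / 4 ^ k) * ennreal (2 ^ k)
        \<le> ennreal (unit_ball_vol (real k) / 4 ^ k) * (ennreal (4 ^ k / unit_ball_vol (real k)) * (\<Sum>i. hausdorff_weight k (C i)))"
      by (rule mult_left_mono[OF le]) simp
    also have "\<dots> = (\<Sum>i. hausdorff_weight k (C i))"
      using ubn by (subst mult.assoc[symmetric], subst ennreal_mult[symmetric]) (auto simp: less_imp_le)
    finally have fin: "ennreal (unit_ball_vol (real k) / 4 ^ k) * ennreal (2 ^ k) \<le> (\<Sum>i. hausdorff_weight k (C i))" .
    have "unit_ball_vol (real k) / 4 ^ k * 2 ^ k = unit_ball_vol (real k) / 2 ^ k"
      by (simp add: field_simps power_mult_distrib[symmetric])
    then have "ennreal (unit_ball_vol (real k) / 2 ^ k) = ennreal (unit_ball_vol (real k) / 4 ^ k) * ennreal (2 ^ k)"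
      by (simp add: ennreal_mult'[symmetric] less_imp_le)
    then show "ennreal (unit_ball_vol (real k) / 2 ^ k) \<le> (\<Sum>i. hausdorff_weight k (C i))"
      using fin by (simp only:)
  qed
  then have "ennreal (unit_ball_vol (real k) / 2 ^ k) \<le> hausdorff_outer k ?Q"
    by (rule order_trans[OF _ hausdorff_pre_le_outer[of 1]]) simp
  moreover have "0 < ennreal (unit_ball_vol (real k) / 2 ^ k)" by simp
  ultimately show ?thesis by (rule order_less_le_trans[rotated])
qed

text \<open>Uniqueness of Haar measure by Tonelli: both sides compute the same double integral of
  \<open>1\<^sub>A(x) 1\<^sub>B(x + y)\<close>.\<close>

lemma translation_invariant_unique:
  fixes M N :: "'a::euclidean_space measure"
  assumes sM: "sets M = sets borel" and sN: "sets N = sets borel"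
    and sf: "sigma_finite_measure M" "sigma_finite_measure N"
    and MP: "AE x in M. x \<in> P" and NP: "AE x in N. x \<in> P"
    and inv: "\<And>t X. t \<in> P \<Longrightarrow> X \<in> sets borel \<Longrightarrow> emeasure M {x. x + t \<in> X} = emeasure M X"
      "\<And>t X. t \<in> P \<Longrightarrow> X \<in> sets borel \<Longrightarrow> emeasure N {x. x + t \<in> X} = emeasure N X"
    and P: "subspace P"
    and A: "A \<in> sets borel" and B: "B \<in> sets borel"
  shows "emeasure M A * emeasure N B = emeasure M B * emeasure N {y. - y \<in> A}"
proof -
  interpret M: sigma_finite_measure M by fact
  interpret N: sigma_finite_measure N by fact
  interpret pair_sigma_finite M N ..
  note [measurable_cong] = sM sN
  have [measurable]: "A \<in> sets borel" "B \<in> sets borel" by fact+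
  have dM: "(\<integral>\<^sup>+x. f (x + t) \<partial>M) = (\<integral>\<^sup>+x. f x \<partial>M)" if t: "t \<in> P" and f[measurable]: "f \<in> borel_measurable borel"
    for t and f :: "'a \<Rightarrow> ennreal"
  proof -
    have "distr M borel (\<lambda>x. x + t) = M"
    proof (rule measure_eqI)
      fix X assume "X \<in> sets (distr M borel (\<lambda>x. x + t))"
      then have X: "X \<in> sets borel" by simp
      then have "emeasure (distr M borel (\<lambda>x. x + t)) X = emeasure M ((\<lambda>x. x + t) -` X \<inter> space M)"
        by (intro emeasure_distr) auto
      also have "(\<lambda>x. x + t) -` X \<inter> space M = {x. x + t \<in> X}" using sets_eq_imp_space_eq[OF sM] by auto
      finally show "emeasure (distr M borel (\<lambda>x. x + t)) X = emeasure M X" using inv(1)[OF t X] by simp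
    qed (simp add: sM)
    then have "(\<integral>\<^sup>+x. f x \<partial>M) = (\<integral>\<^sup>+x. f x \<partial>distr M borel (\<lambda>x. x + t))" by simp
    also have "\<dots> = (\<integral>\<^sup>+x. f (x + t) \<partial>M)" by (rule nn_integral_distr) auto
    finally show ?thesis ..
  qed
  have "emeasure M A * emeasure N B = (\<integral>\<^sup>+x. indicator A x * emeasure N B \<partial>M)"
    by (subst nn_integral_multc) (auto simp: sM nn_integral_indicator)
  also have "\<dots> = (\<integral>\<^sup>+x. (\<integral>\<^sup>+y. indicator A x * indicator B (y + x) \<partial>N) \<partial>M)"
  proof (rule nn_integral_cong_AE)
    show "AE x in M. indicator A x * emeasure N B = (\<integral>\<^sup>+y. indicator A x * indicator B (y + x) \<partial>N)"
      using MP
    proof eventually_elim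
      case (elim x)
      have "(\<integral>\<^sup>+y. indicator A x * indicator B (y + x) \<partial>N) = indicator A x * (\<integral>\<^sup>+y. indicator B (y + x) \<partial>N)"
        by (rule nn_integral_cmult) measurable
      also have "(\<integral>\<^sup>+y. indicator B (y + x) \<partial>N) = (\<integral>\<^sup>+y. indicator {y. y + x \<in> B} y \<partial>N)"
        by (intro nn_integral_cong) (auto simp: indicator_def)
      also have "\<dots> = emeasure N {y. y + x \<in> B}"
        by (rule nn_integral_indicator) measurable
      also have "\<dots> = emeasure N B" by (rule inv(2)[OF elim B])
      finally show ?case by simp
    qed
  qed
  also have "\<dots> = (\<integral>\<^sup>+y. (\<integral>\<^sup>+x. indicator A x * indicator B (y + x) \<partial>M) \<partial>N)"
    by (rule Fubini'[symmetric]) measurable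
  \<comment> \<open>For fixed \<open>y\<close> the inner variable is shifted by \<open>y\<close>,
    which is allowed because almost every \<open>y\<close> lies in \<open>P\<close>. After the next
    exchange of integrals, the inner one runs over a translate of the reflected set
    \<open>A\<close>.\<close>
  also have "\<dots> = (\<integral>\<^sup>+y. (\<integral>\<^sup>+x. indicator A (x - y) * indicator B x \<partial>M) \<partial>N)"
  proof (rule nn_integral_cong_AE)
    show "AE y in N. (\<integral>\<^sup>+x. indicator A x * indicator B (y + x) \<partial>M) = (\<integral>\<^sup>+x. indicator A (x - y) * indicator B x \<partial>M)"
      using NP
    proof eventually_elim
      case (elim y)
      have "(\<integral>\<^sup>+x. indicator A ((x + y) - y) * indicator B (x + y) \<partial>M) = (\<integral>\<^sup>+x. indicator A (x - y) * indicator B x \<partial>M)"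
        by (rule dM[OF elim]) measurable
      then show ?case by (simp add: add.commute)
    qed
  qed
  also have "\<dots> = (\<integral>\<^sup>+x. (\<integral>\<^sup>+y. indicator A (x - y) * indicator B x \<partial>N) \<partial>M)"
    by (rule Fubini') measurable
  also have "\<dots> = (\<integral>\<^sup>+x. emeasure N {y. - y \<in> A} * indicator B x \<partial>M)"
  proof (rule nn_integral_cong_AE)
    show "AE x in M. (\<integral>\<^sup>+y. indicator A (x - y) * indicator B x \<partial>N) = emeasure N {y. - y \<in> A} * indicator B x"
      using MP
    proof eventually_elim
      case (elim x)
      have "(\<integral>\<^sup>+y. indicator A (x - y) * indicator B x \<partial>N) = (\<integral>\<^sup>+y. indicator A (x - y) \<partial>N) * indicator B x"
        by (rule nn_integral_multc) measurable
      also have "(\<integral>\<^sup>+y. indicator A (x - y) \<partial>N) = (\<integral>\<^sup>+y. indicator {y. y + (- x) \<in> {y. - y \<in> A}} y \<partial>N)"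
        by (intro nn_integral_cong) (auto simp: indicator_def)
      also have "\<dots> = emeasure N {y. y + (- x) \<in> {y. - y \<in> A}}"
        by (rule nn_integral_indicator) measurable
      also have "\<dots> = emeasure N {y. - y \<in> A}"
        by (rule inv(2)) (use elim P in \<open>auto simp: subspace_neg\<close>)
      finally show ?case .
    qed
  qed
  also have "\<dots> = emeasure M B * emeasure N {y. - y \<in> A}"
    by (subst nn_integral_cmult) (auto simp: sM mult.commute)
  finally show ?thesis .
qed

text \<open>Hausdorff measure on \<open>S\<close> seen as a measure on the Borel sets, the form in
  which regularity and uniqueness theorems apply.\<close>

definition hausdorff_on :: "nat \<Rightarrow> 'a::euclidean_space set \<Rightarrow> 'a measure" where
  "hausdorff_on k S = distr (restrict_space (hausdorff_measure k) S) borel (\<lambda>x. x)"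

lemma sets_hausdorff_on [simp]: "sets (hausdorff_on k S) = sets borel"
  and space_hausdorff_on [simp]: "space (hausdorff_on k S) = UNIV"
  by (simp_all add: hausdorff_on_def)

lemma emeasure_hausdorff_on:
  assumes S: "S \<in> sets (hausdorff_measure k)" and X: "X \<in> sets borel"
  shows "emeasure (hausdorff_on k S) X = hausdorff_outer k (S \<inter> X)"
proof -
  have m: "(\<lambda>x. x) \<in> measurable (restrict_space (hausdorff_measure k) S) borel"
    by (intro measurable_restrict_space1 borel_measurable_hausdorffI) simp
  have "emeasure (hausdorff_on k S) X = emeasure (restrict_space (hausdorff_measure k) S) (X \<inter> S)"
    unfolding hausdorff_on_def using m X by (subst emeasure_distr) (auto simp: space_restrict_space)
  also have "\<dots> = emeasure (hausdorff_measure k) (X \<inter> S)"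
    using S by (intro emeasure_restrict_space) auto
  also have "\<dots> = hausdorff_outer k (X \<inter> S)"
    using S borel_hausdorffD[OF X, of k] by (intro emeasure_hausdorff) auto
  finally show ?thesis by (simp add: Int_commute)
qed

lemma hausdorff_outer_translate: "hausdorff_outer k ((\<lambda>x. x + t) ` A) = hausdorff_outer k A"
  by (rule hausdorff_outer_isometry) simp

text \<open>Both measures live on the coordinate plane, are invariant under its translations and
  sigma-finite, hence proportional. The factor is left unevaluated; only its being positive and
  finite is recorded, and it cancels in the scaling law.\<close>

lemma coord_space_hausdorff_eq_slab:
  assumes k: "k \<le> DIM('a::euclidean_space)"
  obtains c where "0 < c" "c < \<infinity>"
    "\<And>B. B \<in> sets borel \<Longrightarrow> hausdorff_outer k (coord_space k \<inter> B) = c * emeasure (slab_measure k) (B :: 'a set)"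
proof -
  let ?P = "coord_space k :: 'a set" let ?Q = "coord_cube k :: 'a set"
  let ?M = "slab_measure k :: 'a measure" let ?N = "hausdorff_on k ?P"
  have Pm: "?P \<in> sets (hausdorff_measure k)" by (rule closed_hausdorff_measurable[OF closed_coord_space])
  have Qb: "?Q \<in> sets borel" using closed_coord_cube[of k, where 'a='a] by simp
  have N: "emeasure ?N X = hausdorff_outer k (?P \<inter> X)" if "X \<in> sets borel" for X
    by (rule emeasure_hausdorff_on[OF Pm that])
  have cov: "(\<Union>n::nat. cball (0::'a) (real n)) = UNIV"
    using real_arch_simple by (auto simp: set_eq_iff)
  have sf: "sigma_finite_measure ?N"
  proof
    show "\<exists>A. countable A \<and> A \<subseteq> sets ?N \<and> \<Union> A = space ?N \<and> (\<forall>a\<in>A. emeasure ?N a \<noteq> \<infinity>)"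
    proof (intro exI[of _ "range (\<lambda>n. cball (0::'a) (real n))"] conjI ballI)
      fix a assume "a \<in> range (\<lambda>n. cball (0::'a) (real n))"
      then obtain n where a: "a = cball 0 (real n)" by blast
      have "hausdorff_outer k (?P \<inter> a) < \<infinity>"
        by (rule coord_space_bounded_finite[OF k]) (auto simp: a intro: bounded_Int)
      then show "emeasure ?N a \<noteq> \<infinity>" using N[of a] by (simp add: a)
    qed (use cov in auto)
  qed
  have sfM: "sigma_finite_measure ?M"
  proof
    show "\<exists>A. countable A \<and> A \<subseteq> sets ?M \<and> \<Union> A = space ?M \<and> (\<forall>a\<in>A. emeasure ?M a \<noteq> \<infinity>)"
    proof (intro exI[of _ "range (\<lambda>n. cball (0::'a) (real n))"] conjI ballI)
      fix a assume "a \<in> range (\<lambda>n. cball (0::'a) (real n))"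
      then obtain n where a: "a = cball 0 (real n)" by blast
      have "emeasure ?M a \<le> ennreal ((2 * real n) ^ k)" unfolding a by (rule slab_measure_ball_le[OF k]) simp
      then show "emeasure ?M a \<noteq> \<infinity>" by (metis ennreal_neq_top infinity_ennreal_def top.extremum_unique)
    qed (use cov in auto)
  qed
  have NP: "AE x in ?N. x \<in> ?P"
  proof (rule AE_I[of _ _ "- ?P"])
    show "emeasure ?N (- ?P) = 0" using N[of "- ?P"] closed_coord_space[of k, where 'a='a] by simp
  qed (use closed_coord_space[of k, where 'a='a] in auto)
  have MP: "AE x in ?M. x \<in> ?P"
  proof (rule AE_I[of _ _ "- ?P"])
    show "emeasure ?M (- ?P) = 0"
      using slab_measure_coord_space[OF k, of "- ?P"] closed_coord_space[of k, where 'a='a] by simp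
  qed (use closed_coord_space[of k, where 'a='a] in auto)
  have invN: "emeasure ?N {x. x + t \<in> X} = emeasure ?N X" if t: "t \<in> ?P" and X: "X \<in> sets borel" for t X
  proof -
    have X': "{x. x + t \<in> X} \<in> sets borel"
      using measurable_sets[of "\<lambda>x. x + t" borel borel X] X by (simp add: vimage_def)
    have "?P \<inter> X = (\<lambda>x. x + t) ` (?P \<inter> {x. x + t \<in> X})"
    proof (intro set_eqI iffI)
      fix y assume "y \<in> ?P \<inter> X"
      then show "y \<in> (\<lambda>x. x + t) ` (?P \<inter> {x. x + t \<in> X})"
        using t subspace_diff[OF subspace_coord_space] by (intro image_eqI[of _ _ "y - t"]) auto
    qed (use t subspace_add[OF subspace_coord_space] in auto)
    then show ?thesis using N[OF X] N[OF X'] hausdorff_outer_translate by metis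
  qed
  have invM: "emeasure ?M {x. x + t \<in> X} = emeasure ?M X" if t: "t \<in> ?P" and X: "X \<in> sets borel" for t X
  proof -
    have X': "{x. x + t \<in> X} \<in> sets borel"
      using measurable_sets[of "\<lambda>x. x + t" borel borel X] X by (simp add: vimage_def)
    let ?Y = "coord_proj k -` X \<inter> slab k"
    have Y: "?Y \<in> sets borel"
      using measurable_sets[OF borel_coord_proj X, of k] by (intro sets.Int borel_slab) simp
    \<comment> \<open>A translation inside the plane does not touch the coordinates from
      \<open>k\<close> on, so it preserves the slab and commutes with the projection up to
      \<open>t\<close>; the invariance of \<open>lborel\<close> descends.\<close>
    have "x + t \<in> slab k \<longleftrightarrow> x \<in> slab k" for x using t by (auto simp: slab_def coord_space_def inner_add_left)
    moreover have "coord_proj k (x + t) = coord_proj k x + t" for x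
      using linear_add[OF linear_coord_proj, of k x t] coord_proj_id[OF k t] by simp
    ultimately have "coord_proj k -` {x. x + t \<in> X} \<inter> slab k = (\<lambda>x. t + x) -` ?Y" by (auto simp: add.commute)
    then have "emeasure ?M {x. x + t \<in> X} = emeasure lborel ((\<lambda>x. t + x) -` ?Y)"
      by (simp only: emeasure_slab_measure[OF X'])
    also have "\<dots> = emeasure (distr lborel borel (\<lambda>x. t + x)) ?Y"
      using Y by (subst emeasure_distr) auto
    also have "distr lborel borel (\<lambda>x. t + x) = lborel" by (rule lborel_distr_plus)
    finally show ?thesis by (simp only: emeasure_slab_measure[OF X])
  qed
  define c where "c = emeasure ?N {y. - y \<in> ?Q} / emeasure ?M ?Q"
  have MQ: "emeasure ?M ?Q = ennreal (2 ^ k)" by (rule slab_measure_cube[OF k])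
  have sym: "{y. - y \<in> ?Q} = ?Q" by (force simp: coord_cube_def)
  have NQ: "emeasure ?N ?Q = hausdorff_outer k (?P \<inter> ?Q)" by (rule N[OF Qb])
  have bQ: "bounded (?P \<inter> ?Q)"
    using coord_space_norm_le[OF k, of _ 1] by (intro boundedI[of _ "real k * 1"]) (auto simp: coord_cube_def abs_le_iff)
  have NQfin: "emeasure ?N ?Q < \<infinity>" unfolding NQ by (rule coord_space_bounded_finite[OF k bQ]) simp
  have NQpos: "0 < emeasure ?N ?Q" unfolding NQ by (rule hausdorff_cube_pos[OF k])
  have main: "emeasure ?N B = c * emeasure ?M B" if B: "B \<in> sets borel" for B
  proof -
    have "emeasure ?M ?Q * emeasure ?N B = emeasure ?M B * emeasure ?N {y. - y \<in> ?Q}"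
      by (rule translation_invariant_unique[OF _ _ sfM sf MP NP invM invN subspace_coord_space Qb B]) simp_all
    then show ?thesis unfolding c_def MQ
      by (metis ennreal_mult_divide_eq ennreal_neq_top mult.commute ennreal_times_divide ennreal_eq_0_iff not_le zero_less_power zero_less_numeral)
  qed
  show ?thesis
  proof (rule that[of c])
    show "0 < c" unfolding c_def sym MQ using NQpos by (simp add: ennreal_zero_less_divide)
    show "c < \<infinity>" unfolding c_def sym MQ using NQfin
      by (metis ennreal_divide_eq_top_iff ennreal_eq_0_iff infinity_ennreal_def not_le top.not_eq_extremum zero_less_numeral zero_less_power)
  qed (use main N in simp)
qed

section \<open>Diagonal scalings of a coordinate plane\<close>

text \<open>Coordinates from \<open>k\<close> on are left alone, so the map preserves
  \<open>slab k\<close> and stays invertible on the whole space when the first \<open>k\<close>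
  factors are nonzero.\<close>

definition coord_scale :: "nat \<Rightarrow> (nat \<Rightarrow> real) \<Rightarrow> 'a::euclidean_space \<Rightarrow> 'a" where
  "coord_scale k \<sigma> x = (\<Sum>i<DIM('a). ((if i < k then \<sigma> i else 1) * (x \<bullet> bas i)) *\<^sub>R bas i)"

lemma coord_scale_inner:
  "i < DIM('a) \<Longrightarrow> coord_scale k \<sigma> (x::'a::euclidean_space) \<bullet> bas i = (if i < k then \<sigma> i else 1) * (x \<bullet> bas i)"
  unfolding coord_scale_def by (subst bas_sum_inner) auto

lemma slab_measure_scale:
  assumes k: "k \<le> DIM('a::euclidean_space)" and \<sigma>: "\<And>i. i < k \<Longrightarrow> 0 < \<sigma> i" and B: "B \<in> sets borel" "coord_scale k \<sigma> -` B \<in> sets borel"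
  shows "emeasure (slab_measure k) (B :: 'a set) = ennreal (\<Prod>i<k. \<sigma> i) * emeasure (slab_measure k) (coord_scale k \<sigma> -` B)"
proof -
  define c where "c = (\<lambda>b::'a. let i = inv_into {..<DIM('a)} bas b in if i < k then \<sigma> i else 1)"
  have cb: "c (bas i) = (if i < k then \<sigma> i else 1)" if "i < DIM('a)" for i
    using that bas_bij[where 'a='a] by (simp add: c_def bij_betw_def Let_def)
  have T: "(\<Sum>j\<in>Basis. (c j * (x \<bullet> j)) *\<^sub>R j) = coord_scale k \<sigma> x" for x :: 'a
    unfolding coord_scale_def using cb by (subst sum.reindex_bij_betw[OF bas_bij, symmetric]) (auto intro!: sum.cong)
  have c0: "c j \<noteq> 0" if jB: "j \<in> Basis" for j
  proof -
    obtain i where "i < DIM('a)" "j = bas i" by (rule Basis_bas[OF jB])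
    then show ?thesis using cb \<sigma>[of i] by auto
  qed
  have pr: "(\<Prod>j\<in>Basis. \<bar>c j\<bar>) = (\<Prod>i<k. \<sigma> i)"
  proof -
    have "(\<Prod>j\<in>Basis. \<bar>c j\<bar>) = (\<Prod>i<DIM('a). \<bar>c (bas i)\<bar>)" by (rule prod.reindex_bij_betw[OF bas_bij, symmetric])
    also have "\<dots> = (\<Prod>i<DIM('a). if i < k then \<sigma> i else 1)" using cb \<sigma> by (intro prod.cong) (auto simp: less_imp_le)
    also have "\<dots> = (\<Prod>i<k. if i < k then \<sigma> i else 1)" using k by (intro prod.mono_neutral_right) auto
    also have "\<dots> = (\<Prod>i<k. \<sigma> i)" by (intro prod.cong) auto
    finally show ?thesis .
  qed
  have lb: "lborel = density (distr lborel borel (coord_scale k \<sigma> :: 'a \<Rightarrow> 'a)) (\<lambda>_. ennreal (\<Prod>i<k. \<sigma> i))"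
    using lborel_affine_euclidean[of c 0] c0 pr by (simp add: T)
  have cm: "coord_scale k \<sigma> \<in> borel_measurable (borel :: 'a measure)"
    unfolding coord_scale_def by measurable
  let ?Y = "coord_proj k -` B \<inter> slab k :: 'a set"
  have Y: "?Y \<in> sets borel" using measurable_sets[OF borel_coord_proj B(1), of k] by (intro sets.Int borel_slab) simp
  have "emeasure (slab_measure k) B = emeasure lborel ?Y" by (rule emeasure_slab_measure[OF B(1)])
  also have "\<dots> = emeasure (density (distr lborel borel (coord_scale k \<sigma>)) (\<lambda>_. ennreal (\<Prod>i<k. \<sigma> i))) ?Y" using lb by simp
  also have "\<dots> = ennreal (\<Prod>i<k. \<sigma> i) * emeasure (distr lborel borel (coord_scale k \<sigma>)) ?Y"
    using Y by (subst emeasure_density_const) auto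
  also have "emeasure (distr lborel borel (coord_scale k \<sigma>)) ?Y = emeasure lborel (coord_scale k \<sigma> -` ?Y)"
    using Y cm by (subst emeasure_distr) auto
  also have "coord_scale k \<sigma> -` ?Y = coord_proj k -` (coord_scale k \<sigma> -` B) \<inter> slab k"
  proof -
    have "coord_scale k \<sigma> x \<in> slab k \<longleftrightarrow> x \<in> slab k" for x :: 'a by (auto simp: slab_def coord_scale_inner)
    moreover have "coord_proj k (coord_scale k \<sigma> x) = coord_scale k \<sigma> (coord_proj k x)" for x :: 'a
    proof (rule bas_eqI)
      fix i assume "i < DIM('a)"
      then show "coord_proj k (coord_scale k \<sigma> x) \<bullet> bas i = coord_scale k \<sigma> (coord_proj k x) \<bullet> bas i"
        using k by (simp add: coord_proj_inner coord_scale_inner)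
    qed
    ultimately show ?thesis by auto
  qed
  also have "emeasure lborel \<dots> = emeasure (slab_measure k) (coord_scale k \<sigma> -` B)"
    by (rule emeasure_slab_measure[OF B(2), symmetric])
  finally show ?thesis .
qed

lemma coord_scale_inverse:
  assumes "\<And>i. i < k \<Longrightarrow> 0 < \<sigma> i"
  shows "coord_scale k \<sigma> (coord_scale k (\<lambda>i. inverse (\<sigma> i)) x) = (x :: 'a::euclidean_space)"
    "coord_scale k (\<lambda>i. inverse (\<sigma> i)) (coord_scale k \<sigma> x) = x"
proof -
  have "\<sigma> i \<noteq> 0" if "i < k" for i using assms[OF that] by simp
  then have e: "coord_scale k \<sigma> (coord_scale k (\<lambda>i. inverse (\<sigma> i)) x) \<bullet> bas i = x \<bullet> bas i"
    "coord_scale k (\<lambda>i. inverse (\<sigma> i)) (coord_scale k \<sigma> x) \<bullet> bas i = x \<bullet> bas i" if "i < DIM('a)" for i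
    using that by (auto simp: coord_scale_inner)
  show "coord_scale k \<sigma> (coord_scale k (\<lambda>i. inverse (\<sigma> i)) x) = x" by (rule bas_eqI, rule e(1))
  show "coord_scale k (\<lambda>i. inverse (\<sigma> i)) (coord_scale k \<sigma> x) = x" by (rule bas_eqI, rule e(2))
qed

lemma coord_scale_coord_space: "coord_scale k \<sigma> (x::'a::euclidean_space) \<in> coord_space k \<longleftrightarrow> x \<in> coord_space k"
  by (auto simp: coord_space_def coord_scale_inner)

text \<open>An arbitrary \<open>B\<close> is replaced by a Borel hull inside the plane, where the
  proportionality with slab measure applies before and after scaling; its constant cancels.\<close>

lemma hausdorff_coord_scale_le:
  assumes k: "k \<le> DIM('a::euclidean_space)" and \<sigma>: "\<And>i. i < k \<Longrightarrow> 0 < \<sigma> i" and B: "B \<subseteq> (coord_space k :: 'a set)"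
  shows "hausdorff_outer k (coord_scale k \<sigma> ` B) \<le> ennreal (\<Prod>i<k. \<sigma> i) * hausdorff_outer k B"
proof (cases "hausdorff_outer k B < \<infinity>")
  case False
  define p where "p = (\<Prod>i<k. \<sigma> i)"
  have "0 < p" unfolding p_def using \<sigma> by (intro prod_pos) auto
  then show ?thesis using False unfolding p_def[symmetric] by (simp add: ennreal_mult_top not_less top_unique)
next
  case True
  let ?D = "coord_scale k \<sigma> :: 'a \<Rightarrow> 'a" let ?D' = "coord_scale k (\<lambda>i. inverse (\<sigma> i)) :: 'a \<Rightarrow> 'a"
  obtain G where G: "G \<in> sets borel" "B \<subseteq> G" "hausdorff_outer k G = hausdorff_outer k B"
    using hausdorff_borel_hull[OF True] .
  let ?P = "coord_space k :: 'a set"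
  have cm: "coord_scale k \<tau> \<in> borel_measurable (borel :: 'a measure)" for \<tau>
    unfolding coord_scale_def by measurable
  have Gp: "G \<inter> ?P \<in> sets borel" using G(1) closed_coord_space[of k, where 'a='a] by simp
  have im: "?D ` (G \<inter> ?P) = ?D' -` (G \<inter> ?P)"
  proof (intro set_eqI iffI)
    fix y assume "y \<in> ?D ` (G \<inter> ?P)"
    then show "y \<in> ?D' -` (G \<inter> ?P)" using coord_scale_inverse(2)[OF \<sigma>, where 'a='a] by auto
  next
    fix y assume "y \<in> ?D' -` (G \<inter> ?P)"
    then show "y \<in> ?D ` (G \<inter> ?P)"
      using coord_scale_inverse(1)[OF \<sigma>, where x=y] by (intro image_eqI[of _ _ "?D' y"]) auto
  qed
  have Db: "?D' -` (G \<inter> ?P) \<in> sets borel" using measurable_sets[OF cm Gp] by simp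
  have pre: "?D -` (?D' -` (G \<inter> ?P)) = G \<inter> ?P" using coord_scale_inverse[OF \<sigma>, where 'a='a] by auto
  obtain c where c: "0 < c" "c < \<infinity>"
    "\<And>B. B \<in> sets borel \<Longrightarrow> hausdorff_outer k (coord_space k \<inter> B) = c * emeasure (slab_measure k) (B :: 'a set)"
    using coord_space_hausdorff_eq_slab[OF k] by blast
  have sub: "?D' -` (G \<inter> ?P) \<subseteq> ?P" using coord_scale_coord_space by blast
  have "hausdorff_outer k (?D ` B) \<le> hausdorff_outer k (?D' -` (G \<inter> ?P))"
    unfolding im[symmetric] using B G(2) by (intro hausdorff_outer_mono image_mono) auto
  also have "\<dots> = c * emeasure (slab_measure k) (?D' -` (G \<inter> ?P))" using c(3)[OF Db] sub by (simp add: Int_absorb1)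
  also have "emeasure (slab_measure k) (?D' -` (G \<inter> ?P)) = ennreal (\<Prod>i<k. \<sigma> i) * emeasure (slab_measure k) (G \<inter> ?P)"
    using slab_measure_scale[where \<sigma>=\<sigma>, OF k \<sigma> Db] Gp unfolding pre by blast
  also have "c * (ennreal (\<Prod>i<k. \<sigma> i) * emeasure (slab_measure k) (G \<inter> ?P))
      = ennreal (\<Prod>i<k. \<sigma> i) * hausdorff_outer k (?P \<inter> (G \<inter> ?P))"
    using c(3)[OF Gp] by (simp add: mult.left_commute)
  also have "\<dots> \<le> ennreal (\<Prod>i<k. \<sigma> i) * hausdorff_outer k B"
    unfolding G(3)[symmetric] by (intro mult_left_mono hausdorff_outer_mono) auto
  finally show ?thesis .
qed

text \<open>The missing inequality is the previous lemma for the inverse scaling.\<close>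

lemma hausdorff_coord_scale:
  assumes k: "k \<le> DIM('a::euclidean_space)" and \<sigma>: "\<And>i. i < k \<Longrightarrow> 0 < \<sigma> i" and B: "B \<subseteq> (coord_space k :: 'a set)"
  shows "hausdorff_outer k (coord_scale k \<sigma> ` B) = ennreal (\<Prod>i<k. \<sigma> i) * hausdorff_outer k B"
proof (rule antisym)
  show "hausdorff_outer k (coord_scale k \<sigma> ` B) \<le> ennreal (\<Prod>i<k. \<sigma> i) * hausdorff_outer k B"
    by (rule hausdorff_coord_scale_le[OF k \<sigma> B])
  have p: "0 < (\<Prod>i<k. \<sigma> i)" using \<sigma> by (intro prod_pos) auto
  have "coord_scale k (\<lambda>i. inverse (\<sigma> i)) ` coord_scale k \<sigma> ` B = B"
    using coord_scale_inverse(2)[OF \<sigma>, where 'a='a] by (simp add: image_image)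
  then have "hausdorff_outer k B \<le> ennreal (\<Prod>i<k. inverse (\<sigma> i)) * hausdorff_outer k (coord_scale k \<sigma> ` B)"
    using hausdorff_coord_scale_le[OF k, of "\<lambda>i. inverse (\<sigma> i)" "coord_scale k \<sigma> ` B"] \<sigma> B coord_scale_coord_space[of k \<sigma>, where 'a='a]
    by (metis (no_types, lifting) image_subset_iff inverse_positive_iff_positive subsetD)
  then have "ennreal (\<Prod>i<k. \<sigma> i) * hausdorff_outer k B
      \<le> ennreal (\<Prod>i<k. \<sigma> i) * (ennreal (\<Prod>i<k. inverse (\<sigma> i)) * hausdorff_outer k (coord_scale k \<sigma> ` B))"
    by (rule mult_left_mono) simp
  also have "\<dots> = ennreal ((\<Prod>i<k. \<sigma> i) * (\<Prod>i<k. inverse (\<sigma> i))) * hausdorff_outer k (coord_scale k \<sigma> ` B)"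
    using p by (simp add: ennreal_mult' mult.assoc)
  also have "(\<Prod>i<k. \<sigma> i) * (\<Prod>i<k. inverse (\<sigma> i)) = 1"
  proof -
    have "(\<Prod>i<k. \<sigma> i) * (\<Prod>i<k. inverse (\<sigma> i)) = (\<Prod>i<k. \<sigma> i * inverse (\<sigma> i))" by (rule prod.distrib[symmetric])
    also have "\<dots> = 1"
    proof (rule prod.neutral, rule ballI)
      fix i assume "i \<in> {..<k}"
      then show "\<sigma> i * inverse (\<sigma> i) = 1" using \<sigma>[of i] by auto
    qed
    finally show ?thesis .
  qed
  finally show "ennreal (\<Prod>i<k. \<sigma> i) * hausdorff_outer k B \<le> hausdorff_outer k (coord_scale k \<sigma> ` B)" by simp
qed

subsection \<open>Linear maps on k-planes\<close>

lemma frame_isometry: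
  assumes u: "orthonormal_on {..<k} u" and v: "orthonormal_on {..<k} v"
    and x: "x \<in> span (u ` {..<k})" "y \<in> span (u ` {..<k})"
  shows "dist (\<Sum>i<k. (x \<bullet> u i) *\<^sub>R v i) (\<Sum>i<k. (y \<bullet> u i) *\<^sub>R v i) = dist x y"
proof -
  have "(\<Sum>i<k. (x \<bullet> u i) *\<^sub>R v i) - (\<Sum>i<k. (y \<bullet> u i) *\<^sub>R v i) = (\<Sum>i<k. ((x - y) \<bullet> u i) *\<^sub>R v i)"
    by (simp add: sum_subtractf inner_diff_left scaleR_diff_left)
  then have "(norm ((\<Sum>i<k. (x \<bullet> u i) *\<^sub>R v i) - (\<Sum>i<k. (y \<bullet> u i) *\<^sub>R v i)))\<^sup>2 = (\<Sum>i<k. ((x - y) \<bullet> u i)\<^sup>2)"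
    by (simp add: orthonormal_on_sum_norm[OF v])
  also have "\<dots> = (norm (\<Sum>i<k. ((x - y) \<bullet> u i) *\<^sub>R u i))\<^sup>2" by (rule orthonormal_on_sum_norm[OF u, symmetric])
  also have "(\<Sum>i<k. ((x - y) \<bullet> u i) *\<^sub>R u i) = x - y"
    using x by (intro orthonormal_on_expand[OF u, symmetric] span_diff)
  finally show ?thesis by (simp add: dist_norm power2_eq_iff_nonneg)
qed

lemma orthonormal_frame_le_DIM:
  "orthonormal_frame k (f :: nat \<Rightarrow> 'a::euclidean_space) \<Longrightarrow> k \<le> DIM('a)"
  using orthonormal_on_dim[of "{..<k}" f] dim_subset_UNIV[of "span (f ` {..<k})"]
  by (simp add: orthonormal_frame_on)

lemma bas_frame: "k \<le> DIM('a) \<Longrightarrow> orthonormal_on {..<k} (bas :: nat \<Rightarrow> 'a::euclidean_space)"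
  by (rule orthonormal_on_subset[OF bas_orthonormal]) auto

lemma span_bas: "k \<le> DIM('a) \<Longrightarrow> span (bas ` {..<k}) = (coord_space k :: 'a::euclidean_space set)"
proof (intro subset_antisym span_minimal subspace_coord_space)
  assume k: "k \<le> DIM('a)"
  then show "bas ` {..<k} \<subseteq> (coord_space k :: 'a set)" by (auto simp: coord_space_def bas_inner)
  show "(coord_space k :: 'a set) \<subseteq> span (bas ` {..<k})"
  proof
    fix x :: 'a assume "x \<in> coord_space k"
    then have "x = (\<Sum>i<k. (x \<bullet> bas i) *\<^sub>R bas i)" using coord_proj_id[OF k] by (simp add: coord_proj_def)
    also have "\<dots> \<in> span (bas ` {..<k})" by (intro span_sum span_scale span_base) auto
    finally show "x \<in> span (bas ` {..<k})" .
  qed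
qed

text \<open>A singular value decomposition on the plane: \<open>A\<close> is an isometry onto the
  coordinate plane, a diagonal scaling there, and an isometry onto the image plane. Only the scaling
  changes the measure.\<close>

lemma hausdorff_linear_image:
  fixes A :: "'a::euclidean_space \<Rightarrow> 'a"
  assumes A: "linear A" "inj A" and f: "orthonormal_frame k f" and B: "B \<subseteq> span (f ` {..<k})"
  shows "hausdorff_outer k (A ` B) = ennreal (jac k A f) * hausdorff_outer k B"
proof -
  have k: "k \<le> DIM('a)" by (rule orthonormal_frame_le_DIM[OF f])
  obtain v where v: "svd_frame k A v" "span (v ` {..<k}) = span (f ` {..<k})" "jac k A f = (\<Prod>i<k. norm (A (v i)))"
    using jac_svd_obtain[OF A(1) f] by blast
  have ov: "orthonormal_on {..<k} v" using v(1) by (simp add: svd_frame_def)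
  have pos: "0 < norm (A (v i))" if "i < k" for i
  proof -
    have "v i \<noteq> 0" using ov that by (auto simp: orthonormal_onD)
    then show ?thesis using A by (metis injD linear_0 zero_less_norm_iff)
  qed
  define u where "u = (\<lambda>i. A (v i) /\<^sub>R norm (A (v i)))"
  have ou: "orthonormal_on {..<k} u" unfolding orthonormal_on_def
  proof (intro ballI)
    fix i j assume "i \<in> {..<k}" "j \<in> {..<k}"
    then show "u i \<bullet> u j = (if i = j then 1 else 0)"
      using pos[of i] v(1) by (cases "i = j")
        (simp_all add: u_def svd_frame_def power2_norm_eq_inner[symmetric] power2_eq_square)
  qed
  let ?b = "bas :: nat \<Rightarrow> 'a"
  have ob: "orthonormal_on {..<k} ?b" by (rule bas_frame[OF k])
  define O1 where "O1 = (\<lambda>x. \<Sum>i<k. (x \<bullet> v i) *\<^sub>R ?b i)"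
  define O2 where "O2 = (\<lambda>x. \<Sum>i<k. (x \<bullet> ?b i) *\<^sub>R u i)"
  let ?D = "coord_scale k (\<lambda>i. norm (A (v i))) :: 'a \<Rightarrow> 'a"
  have Bv: "B \<subseteq> span (v ` {..<k})" using B v(2) by simp
  have O1: "O1 x \<in> coord_space k" for x
    unfolding O1_def span_bas[OF k, symmetric] by (intro span_sum span_scale span_base) auto
  have O1i: "O1 x \<bullet> ?b i = x \<bullet> v i" if "i < k" for x i
    using that k unfolding O1_def by (subst bas_sum_inner) auto
  have eq: "A x = O2 (?D (O1 x))" if "x \<in> B" for x
  proof -
    have "A x = A (\<Sum>i<k. (x \<bullet> v i) *\<^sub>R v i)" using orthonormal_on_expand[OF ov, of x] Bv that by auto
    also have "\<dots> = (\<Sum>i<k. (x \<bullet> v i) *\<^sub>R A (v i))" using A(1) by (simp add: linear_sum linear_cmul)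
    also have "\<dots> = (\<Sum>i<k. (norm (A (v i)) * (x \<bullet> v i)) *\<^sub>R u i)"
      using pos by (intro sum.cong) (auto simp: u_def)
    also have "\<dots> = O2 (?D (O1 x))" unfolding O2_def
      using k by (intro sum.cong) (auto simp: coord_scale_inner O1i)
    finally show ?thesis .
  qed
  have "A ` B = O2 ` ?D ` O1 ` B" using eq by (simp add: image_image cong: image_cong)
  also have "hausdorff_outer k \<dots> = hausdorff_outer k (?D ` O1 ` B)"
  proof (rule hausdorff_outer_isometry)
    fix x y assume "x \<in> ?D ` O1 ` B" "y \<in> ?D ` O1 ` B"
    then have "x \<in> span (?b ` {..<k})" "y \<in> span (?b ` {..<k})"
      using O1 coord_scale_coord_space unfolding span_bas[OF k] by blast+
    then show "dist (O2 x) (O2 y) = dist x y" unfolding O2_def by (rule frame_isometry[OF ob ou])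
  qed
  also have "\<dots> = ennreal (\<Prod>i<k. norm (A (v i))) * hausdorff_outer k (O1 ` B)"
    using O1 pos by (intro hausdorff_coord_scale[OF k]) auto
  also have "hausdorff_outer k (O1 ` B) = hausdorff_outer k B"
  proof (rule hausdorff_outer_isometry)
    fix x y assume "x \<in> B" "y \<in> B"
    then have "x \<in> span (v ` {..<k})" "y \<in> span (v ` {..<k})" using Bv by blast+
    then show "dist (O1 x) (O1 y) = dist x y" unfolding O1_def by (rule frame_isometry[OF ov ob])
  qed
  finally show ?thesis by (simp only: v(3))
qed

lemma plane_to_coord_space:
  fixes f :: "nat \<Rightarrow> 'a::euclidean_space"
  assumes f: "orthonormal_frame k f" and B: "B \<subseteq> span (f ` {..<k})"
  obtains C :: "'a set" where "C \<subseteq> coord_space k" "hausdorff_outer k B = hausdorff_outer k C"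
    "C = (\<lambda>x. \<Sum>i<k. (x \<bullet> f i) *\<^sub>R bas i) ` B" "B = (\<lambda>x. \<Sum>i<k. (x \<bullet> bas i) *\<^sub>R f i) ` C"
proof -
  have k: "k \<le> DIM('a)" by (rule orthonormal_frame_le_DIM[OF f])
  have onf: "orthonormal_on {..<k} f" using f by (simp add: orthonormal_frame_on)
  let ?C = "(\<lambda>x. \<Sum>i<k. (x \<bullet> f i) *\<^sub>R (bas i :: 'a)) ` B"
  show ?thesis
  proof (rule that[of ?C])
    show "?C \<subseteq> coord_space k"
    proof (rule image_subsetI)
      fix x show "(\<Sum>i<k. (x \<bullet> f i) *\<^sub>R (bas i :: 'a)) \<in> coord_space k"
        unfolding span_bas[OF k, symmetric] by (intro span_sum span_scale span_base) auto
    qed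
    show "hausdorff_outer k B = hausdorff_outer k ?C"
      using frame_isometry[OF onf bas_frame[OF k]] B
      by (intro hausdorff_outer_isometry[symmetric]) blast
    have recover: "(\<Sum>i<k. ((\<Sum>j<k. (x \<bullet> f j) *\<^sub>R (bas j :: 'a)) \<bullet> bas i) *\<^sub>R f i) = x" if "x \<in> B" for x
    proof -
      have "(\<Sum>i<k. ((\<Sum>j<k. (x \<bullet> f j) *\<^sub>R (bas j :: 'a)) \<bullet> bas i) *\<^sub>R f i) = (\<Sum>i<k. (x \<bullet> f i) *\<^sub>R f i)"
        using k by (intro sum.cong refl arg_cong2[where f=scaleR]) (subst bas_sum_inner, auto)
      also have "\<dots> = x" using orthonormal_on_expand[OF onf, of x] B that by auto
      finally show ?thesis .
    qed
    show "B = (\<lambda>x. \<Sum>i<k. (x \<bullet> bas i) *\<^sub>R f i) ` ?C"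
      using recover by (simp add: image_image)
  qed simp
qed

lemma plane_bounded_finite:
  assumes f: "orthonormal_frame k (f :: nat \<Rightarrow> 'a::euclidean_space)" and B: "B \<subseteq> span (f ` {..<k})" "bounded B"
  shows "hausdorff_outer k B < \<infinity>"
proof -
  have k: "k \<le> DIM('a)" by (rule orthonormal_frame_le_DIM[OF f])
  obtain C :: "'a set" where C: "C \<subseteq> coord_space k" "hausdorff_outer k B = hausdorff_outer k C"
    "C = (\<lambda>x. \<Sum>i<k. (x \<bullet> f i) *\<^sub>R bas i) ` B" "B = (\<lambda>x. \<Sum>i<k. (x \<bullet> bas i) *\<^sub>R f i) ` C"
    by (rule plane_to_coord_space[OF f B(1)])
  have "bounded C" unfolding C(3)
    by (intro bounded_linear_image[OF B(2)] linear_conv_bounded_linear[THEN iffD1] linearI)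
      (auto simp: inner_add_left scaleR_add_left sum.distrib scaleR_sum_right)
  then show ?thesis using coord_space_bounded_finite[OF k _ C(1)] C(2) by simp
qed

text \<open>Were the disc null, so would be its image under an isometry followed by a dilation, and
  that image contains the cube.\<close>

lemma plane_ball_pos:
  assumes f: "orthonormal_frame k (f :: nat \<Rightarrow> 'a::euclidean_space)" and r: "0 < r"
  shows "0 < hausdorff_outer k (span (f ` {..<k}) \<inter> ball 0 r)"
proof (rule ccontr)
  assume "\<not> 0 < hausdorff_outer k (span (f ` {..<k}) \<inter> ball 0 r)"
  then have z: "hausdorff_outer k (span (f ` {..<k}) \<inter> ball 0 r) = 0" by simp
  have k: "k \<le> DIM('a)" by (rule orthonormal_frame_le_DIM[OF f])
  have onf: "orthonormal_on {..<k} f" using f by (simp add: orthonormal_frame_on)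
  let ?g = "\<lambda>x. \<Sum>i<k. (x \<bullet> f i) *\<^sub>R (bas i :: 'a)"
  \<comment> \<open>Points of the cube in the coordinate plane have norm at most \<open>k\<close>,
    so dilating the disc of radius \<open>r\<close> by \<open>(k + 1) / r\<close> covers them, with
    the strict inequality an open ball requires.\<close>
  define s where "s = (real k + 1) / r"
  have s: "s > 0" using r by (simp add: s_def)
  have "coord_space k \<inter> coord_cube k \<subseteq> (\<lambda>x. s *\<^sub>R ?g x) ` (span (f ` {..<k}) \<inter> ball 0 r)"
  proof
    fix y :: 'a assume y: "y \<in> coord_space k \<inter> coord_cube k"
    then have "norm y \<le> real k * 1" by (intro coord_space_norm_le[OF k]) (auto simp: coord_cube_def abs_le_iff)
    then have ny: "norm y < real k + 1" by simp
    define x where "x = (\<Sum>i<k. ((y /\<^sub>R s) \<bullet> bas i) *\<^sub>R f i)"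
    have "x \<in> span (f ` {..<k})" unfolding x_def by (intro span_sum span_scale span_base) auto
    moreover have "norm x = norm (y /\<^sub>R s)"
      using frame_isometry[OF bas_frame[OF k] onf, of "y /\<^sub>R s" 0] y subspace_scale[OF subspace_coord_space]
      unfolding span_bas[OF k] x_def by (auto simp: subspace_0[OF subspace_coord_space])
    then have "norm x = norm y / s" using s by (simp add: divide_inverse mult.commute)
    then have "norm x < r" using ny r s by (simp add: pos_divide_less_eq s_def)
    moreover have "?g x = y /\<^sub>R s"
    proof (rule bas_eqI)
      fix i assume i: "i < DIM('a)"
      have "x \<bullet> f i = (y /\<^sub>R s) \<bullet> bas i" if "i < k"
      proof -
        have "x \<bullet> f i = (\<Sum>j<k. ((y /\<^sub>R s) \<bullet> bas j) * (if j = i then 1 else 0))"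
          unfolding x_def inner_sum_left inner_scaleR_left[of _ "f _"] using onf that
          by (intro sum.cong) (auto simp: orthonormal_on_def)
        then show ?thesis using that by (simp add: if_distrib[of "\<lambda>z. _ * z"] cong: if_cong)
      qed
      moreover have "?g x \<bullet> bas i = (if i < k then x \<bullet> f i else 0)"
        using i k by (subst bas_sum_inner) auto
      ultimately show "?g x \<bullet> bas i = (y /\<^sub>R s) \<bullet> bas i"
        using y i by (auto simp: coord_space_def)
    qed
    ultimately show "y \<in> (\<lambda>x. s *\<^sub>R ?g x) ` (span (f ` {..<k}) \<inter> ball 0 r)"
      using s by (intro image_eqI[of _ _ x]) auto
  qed
  moreover have "hausdorff_outer k ((\<lambda>x. s *\<^sub>R ?g x) ` (span (f ` {..<k}) \<inter> ball 0 r)) = 0"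
  proof (rule hausdorff_outer_Lipschitz_null[OF _ _ z])
    fix x y assume "x \<in> span (f ` {..<k}) \<inter> ball 0 r" "y \<in> span (f ` {..<k}) \<inter> ball 0 r"
    then have "dist (?g x) (?g y) = dist x y" by (intro frame_isometry[OF onf bas_frame[OF k]]) auto
    then show "dist (s *\<^sub>R ?g x) (s *\<^sub>R ?g y) \<le> s * dist x y"
      using s by (simp add: dist_norm scaleR_diff_right[symmetric])
  qed (use s in simp)
  ultimately have "hausdorff_outer k (coord_space k \<inter> coord_cube k :: 'a set) = 0"
    by (rule hausdorff_outer_null_subset[rotated])
  then show False using hausdorff_cube_pos[OF k] by simp
qed

subsection \<open>Orthogonal projections onto frames\<close>

definition frame_proj :: "nat \<Rightarrow> (nat \<Rightarrow> 'a::euclidean_space) \<Rightarrow> 'a \<Rightarrow> 'a" where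
  "frame_proj k f x = (\<Sum>i<k. (x \<bullet> f i) *\<^sub>R f i)"

lemma linear_frame_proj: "linear (frame_proj k f)"
  unfolding frame_proj_def by (intro linearI) (auto simp: inner_add_left scaleR_add_left sum.distrib scaleR_sum_right)

lemma continuous_on_frame_proj [continuous_intros]:
  "continuous_on X g \<Longrightarrow> continuous_on X (\<lambda>x. frame_proj k f (g x))"
  unfolding frame_proj_def by (intro continuous_intros)

lemma frame_proj_in_span: "frame_proj k f x \<in> span (f ` {..<k})"
  unfolding frame_proj_def by (intro span_sum span_scale span_base) auto

lemma frame_proj_id: "orthonormal_frame k f \<Longrightarrow> x \<in> span (f ` {..<k}) \<Longrightarrow> frame_proj k f x = x"
  unfolding frame_proj_def orthonormal_frame_on by (rule orthonormal_on_expand[symmetric])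

lemma frame_proj_Pythagoras:
  assumes f: "orthonormal_frame k f"
  shows "(norm x)\<^sup>2 = (norm (frame_proj k f x))\<^sup>2 + (norm (x - frame_proj k f x))\<^sup>2"
proof -
  let ?p = "frame_proj k f x"
  have o: "orthonormal_on {..<k} f" using f by (simp add: orthonormal_frame_on)
  have "x \<bullet> ?p = (\<Sum>i<k. (x \<bullet> f i)\<^sup>2)"
    unfolding frame_proj_def by (simp add: inner_sum_right power2_eq_square)
  also have "\<dots> = ?p \<bullet> ?p"
    unfolding frame_proj_def power2_norm_eq_inner[symmetric] by (rule orthonormal_on_sum_norm[OF o, symmetric])
  finally show ?thesis
    unfolding power2_norm_eq_inner by (simp add: inner_diff_left inner_diff_right inner_commute[of ?p x])
qed

lemma norm_frame_proj_le:
  assumes f: "orthonormal_frame k f"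
  shows "norm (frame_proj k f x) \<le> norm x" "norm (x - frame_proj k f x) \<le> norm x"
proof -
  have "(norm (frame_proj k f x))\<^sup>2 \<le> (norm x)\<^sup>2" "(norm (x - frame_proj k f x))\<^sup>2 \<le> (norm x)\<^sup>2"
    using frame_proj_Pythagoras[OF f, of x] by auto
  then show "norm (frame_proj k f x) \<le> norm x" "norm (x - frame_proj k f x) \<le> norm x"
    by (auto intro: power2_le_imp_le)
qed

text \<open>Each \<open>g i\<close> is within \<open>d\<close> of the plane of \<open>f\<close>,
  since \<open>f i\<close> is in it and the residual of a projection does not increase norms; the
  \<open>k\<close> coefficients of \<open>v\<close> are bounded by \<open>norm v\<close>.\<close>

lemma near_frame_cone:
  assumes f: "orthonormal_frame k f" and g: "orthonormal_frame k g"
    and near: "\<And>i. i < k \<Longrightarrow> norm (g i - f i) \<le> d" and v: "v \<in> span (g ` {..<k})"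
  shows "norm (v - frame_proj k f v) \<le> real k * d * norm v"
proof -
  have og: "orthonormal_on {..<k} g" using g by (simp add: orthonormal_frame_on)
  have e: "v = (\<Sum>i<k. (v \<bullet> g i) *\<^sub>R g i)" by (rule orthonormal_on_expand[OF og v])
  have lin: "linear (\<lambda>x. x - frame_proj k f x)" by (intro linear_compose_sub linear_ident linear_frame_proj)
  have "v - frame_proj k f v = (\<lambda>x. x - frame_proj k f x) (\<Sum>i<k. (v \<bullet> g i) *\<^sub>R g i)"
    using e by simp
  also have "\<dots> = (\<Sum>i<k. (v \<bullet> g i) *\<^sub>R (g i - frame_proj k f (g i)))"
    by (simp only: linear_sum[OF lin] linear_cmul[OF lin])
  also have "norm \<dots> \<le> (\<Sum>i<k. norm ((v \<bullet> g i) *\<^sub>R (g i - frame_proj k f (g i))))" by (rule norm_sum)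
  also have "\<dots> \<le> (\<Sum>i<k. norm v * d)"
  proof (rule sum_mono)
    fix i assume i: "i \<in> {..<k}"
    have "frame_proj k f (f i) = f i" using i by (intro frame_proj_id[OF f] span_base) auto
    then have "g i - frame_proj k f (g i) = (g i - f i) - frame_proj k f (g i - f i)"
      by (simp add: linear_diff[OF linear_frame_proj])
    then have "norm (g i - frame_proj k f (g i)) \<le> d"
      using order_trans[OF norm_frame_proj_le(2)[OF f, of "g i - f i"] near] i by (simp only: lessThan_iff)
    moreover have "\<bar>v \<bullet> g i\<bar> \<le> norm v"
      using Cauchy_Schwarz_ineq2[of v "g i"] orthonormal_onD(1)[OF og i] by simp
    ultimately show "norm ((v \<bullet> g i) *\<^sub>R (g i - frame_proj k f (g i))) \<le> norm v * d"
      by (auto intro: mult_mono)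
  qed
  finally show ?thesis by (simp add: mult_ac)
qed

subsection \<open>The area formula on nearly flat pieces\<close>

text \<open>The hypothesis makes \<open>p\<close> constant on the fibres of \<open>q\<close>, so
  \<open>p\<close> factors through \<open>q\<close> by an \<open>L\<close>-Lipschitz map;
  \<open>q\<close> may fail to be injective.\<close>

lemma hausdorff_outer_compare:
  fixes p q :: "'a::euclidean_space \<Rightarrow> 'a"
  assumes L: "0 \<le> L" and pq: "\<And>x y. x \<in> B \<Longrightarrow> y \<in> B \<Longrightarrow> dist (p x) (p y) \<le> L * dist (q x) (q y)"
  shows "hausdorff_outer k (p ` B) \<le> ennreal (L ^ k) * hausdorff_outer k (q ` B)"
proof -
  let ?g = "\<lambda>u. p (inv_into B q u)"
  have i: "inv_into B q (q x) \<in> B" "q (inv_into B q (q x)) = q x" if "x \<in> B" for x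
    using that by (auto intro: inv_into_into f_inv_into_f)
  have "?g (q x) = p x" if "x \<in> B" for x
    using pq[OF i(1)[OF that] that] i(2)[OF that] by simp
  then have "?g ` q ` B = p ` B" by (simp add: image_image cong: image_cong)
  moreover have "hausdorff_outer k (?g ` q ` B) \<le> ennreal (L ^ k) * hausdorff_outer k (q ` B)"
  proof (rule hausdorff_outer_Lipschitz[OF L])
    fix u v assume "u \<in> q ` B" "v \<in> q ` B"
    then obtain x y where xy: "x \<in> B" "u = q x" "y \<in> B" "v = q y" by blast
    then show "dist (?g u) (?g v) \<le> L * dist u v"
      using pq[OF i(1)[OF xy(1)] i(1)[OF xy(3)]] i(2) by simp
  qed
  ultimately show ?thesis by simp
qed

definition cone_flat :: "nat \<Rightarrow> (nat \<Rightarrow> 'a::euclidean_space) \<Rightarrow> real \<Rightarrow> 'a set \<Rightarrow> bool" where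
  "cone_flat k f \<epsilon> F \<longleftrightarrow> (\<forall>x\<in>F. \<forall>y\<in>F. norm ((x - y) - frame_proj k f (x - y)) \<le> \<epsilon> * norm (x - y))"

definition linear_flat :: "('a::euclidean_space \<Rightarrow> 'a) \<Rightarrow> ('a \<Rightarrow> 'a) \<Rightarrow> real \<Rightarrow> 'a set \<Rightarrow> bool" where
  "linear_flat \<phi> A \<epsilon> F \<longleftrightarrow> (\<forall>x\<in>F. \<forall>y\<in>F. norm (\<phi> x - \<phi> y - A (x - y)) \<le> \<epsilon> * norm (x - y))"

text \<open>On a flat piece the projection to the plane is nearly isometric, and \<phi> differs from
  \<open>A\<close> after the projection by a small multiple of the latter. Comparing distances at
  each stage compares the measures. The tolerance depends on \<open>A\<close>, \<open>f\<close> and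
  \<theta> alone, so it can be fixed before the pieces are cut.\<close>

lemma flat_piece_area:
  fixes A :: "'a::euclidean_space \<Rightarrow> 'a"
  assumes A: "linear A" "inj A" and f: "orthonormal_frame k f" and \<theta>: "1 < \<theta>"
  obtains \<epsilon> where "0 < \<epsilon>" "\<epsilon> \<le> 1"
    "\<And>F \<phi> B. cone_flat k f \<epsilon> F \<Longrightarrow> linear_flat \<phi> A \<epsilon> F \<Longrightarrow> B \<subseteq> F \<Longrightarrow>
       hausdorff_outer k (\<phi> ` B) \<le> ennreal (\<theta> * jac k A f) * hausdorff_outer k B \<and>
       ennreal (jac k A f) * hausdorff_outer k B \<le> ennreal \<theta> * hausdorff_outer k (\<phi> ` B)"
proof -
  obtain M where M: "0 < M" "\<And>x. norm (A x) \<le> M * norm x"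
    using linear_bounded_pos[OF A(1)] by blast
  obtain m where m: "0 < m" "\<And>x. m * norm x \<le> norm (A x)"
    using linear_inj_bounded_below_pos[OF A] by blast
  \<comment> \<open>For a difference \<open>v\<close> of two points, \<phi> deviates from
    \<open>A\<close> of the projection of \<open>v\<close> by at most
    \<open>\<epsilon> * (1 + M) * norm v\<close>, while that image has norm at least
    \<open>m * (1 - \<epsilon>) * norm v\<close>. Their quotient is the relative error, and it tends
    to 0.\<close>
  let ?\<eta> = "\<lambda>\<epsilon>. \<epsilon> * (1 + M) / (m * (1 - \<epsilon>))"
  have e\<eta>: "(?\<eta> \<longlongrightarrow> 0 * (1 + M) / (m * (1 - 0))) (at_right 0)"
    using m by (intro tendsto_intros) auto
  have "((\<lambda>\<epsilon>. (1 + ?\<eta> \<epsilon>) ^ k) \<longlongrightarrow> (1 + 0 * (1 + M) / (m * (1 - 0))) ^ k) (at_right 0)"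
    by (intro tendsto_intros e\<eta>)
  then have 1: "eventually (\<lambda>\<epsilon>. (1 + ?\<eta> \<epsilon>) ^ k < \<theta>) (at_right 0)"
    using \<theta> by (intro order_tendstoD) auto
  \<comment> \<open>The lower estimate loses twice: once from the image to the linear model, once
    from the projection back to the piece.\<close>
  have "((\<lambda>\<epsilon>. (1 / (1 - ?\<eta> \<epsilon>)) ^ k * (1 / (1 - \<epsilon>)) ^ k) \<longlongrightarrow>
      (1 / (1 - 0 * (1 + M) / (m * (1 - 0)))) ^ k * (1 / (1 - 0)) ^ k) (at_right 0)"
    by (intro tendsto_intros e\<eta>) auto
  then have 2: "eventually (\<lambda>\<epsilon>. (1 / (1 - ?\<eta> \<epsilon>)) ^ k * (1 / (1 - \<epsilon>)) ^ k < \<theta>) (at_right 0)"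
    using \<theta> by (intro order_tendstoD) auto
  have 3: "eventually (\<lambda>\<epsilon>. ?\<eta> \<epsilon> < 1) (at_right 0)"
    using order_tendstoD(2)[OF e\<eta>, of 1] by simp
  have 4: "eventually (\<lambda>\<epsilon>::real. 0 < \<epsilon> \<and> \<epsilon> < 1) (at_right 0)"
    using eventually_at_right_real[of 0 1] by (auto elim: eventually_mono)
  have "\<exists>\<epsilon>. (1 + ?\<eta> \<epsilon>) ^ k < \<theta> \<and> (1 / (1 - ?\<eta> \<epsilon>)) ^ k * (1 / (1 - \<epsilon>)) ^ k < \<theta> \<and> ?\<eta> \<epsilon> < 1 \<and> 0 < \<epsilon> \<and> \<epsilon> < 1"
    using eventually_happens[OF eventually_conj[OF 1 eventually_conj[OF 2 eventually_conj[OF 3 4]]]] by simp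
  then obtain \<epsilon> where \<epsilon>: "(1 + ?\<eta> \<epsilon>) ^ k < \<theta>" "(1 / (1 - ?\<eta> \<epsilon>)) ^ k * (1 / (1 - \<epsilon>)) ^ k < \<theta>"
    "?\<eta> \<epsilon> < 1" "0 < \<epsilon>" "\<epsilon> < 1" by blast
  define \<eta> where "\<eta> = ?\<eta> \<epsilon>"
  have \<eta>: "0 \<le> \<eta>" "\<eta> < 1" using \<epsilon> m M by (auto simp: \<eta>_def)
  show ?thesis
  proof (rule that[of \<epsilon>])
    fix F \<phi> B assume F: "cone_flat k f \<epsilon> F" and \<phi>: "linear_flat \<phi> A \<epsilon> F" and B: "B \<subseteq> F"
    let ?\<pi> = "frame_proj k f" let ?J = "jac k A f"
    have J: "0 < ?J" by (rule jac_pos[OF A f])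
    have key: "(1 - \<epsilon>) * norm (x - y) \<le> norm (?\<pi> (x - y))"
        "norm (\<phi> x - \<phi> y - A (?\<pi> (x - y))) \<le> \<eta> * norm (A (?\<pi> (x - y)))"
      if xy: "x \<in> B" "y \<in> B" for x y
    proof -
      let ?v = "x - y"
      have c: "norm (?v - ?\<pi> ?v) \<le> \<epsilon> * norm ?v" using F xy B unfolding cone_flat_def by blast
      have l: "norm (\<phi> x - \<phi> y - A ?v) \<le> \<epsilon> * norm ?v" using \<phi> xy B unfolding linear_flat_def by blast
      have "norm ?v \<le> norm (?\<pi> ?v) + norm (?v - ?\<pi> ?v)" using norm_triangle_ineq[of "?\<pi> ?v" "?v - ?\<pi> ?v"] by simp
      then show a: "(1 - \<epsilon>) * norm ?v \<le> norm (?\<pi> ?v)" using c by (simp add: algebra_simps)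
      have "\<phi> x - \<phi> y - A (?\<pi> ?v) = (\<phi> x - \<phi> y - A ?v) + A (?v - ?\<pi> ?v)" by (simp add: linear_diff[OF A(1)])
      then have "norm (\<phi> x - \<phi> y - A (?\<pi> ?v)) \<le> norm (\<phi> x - \<phi> y - A ?v) + norm (A (?v - ?\<pi> ?v))"
        by (simp only: norm_triangle_ineq)
      also have "\<dots> \<le> \<epsilon> * norm ?v + M * (\<epsilon> * norm ?v)"
        using l c M by (intro add_mono order_trans[OF M(2)] mult_left_mono) auto
      also have "\<dots> = \<eta> * (m * ((1 - \<epsilon>) * norm ?v))" using m \<epsilon> by (simp add: \<eta>_def field_simps)
      also have "\<dots> \<le> \<eta> * norm (A (?\<pi> ?v))"
        using a m \<eta> by (intro mult_left_mono order_trans[OF _ m(2)]) auto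
      finally show "norm (\<phi> x - \<phi> y - A (?\<pi> ?v)) \<le> \<eta> * norm (A (?\<pi> ?v))" .
    qed
    let ?q = "\<lambda>x. A (?\<pi> x)"
    have qd: "dist (?q x) (?q y) = norm (A (?\<pi> (x - y)))" for x y
      by (simp add: dist_norm linear_diff[OF A(1)] linear_diff[OF linear_frame_proj])
    have up: "dist (\<phi> x) (\<phi> y) \<le> (1 + \<eta>) * dist (?q x) (?q y)"
      and lo: "dist (?q x) (?q y) \<le> 1 / (1 - \<eta>) * dist (\<phi> x) (\<phi> y)"
      and pl: "dist x y \<le> 1 / (1 - \<epsilon>) * dist (?\<pi> x) (?\<pi> y)"
      and pu: "dist (?\<pi> x) (?\<pi> y) \<le> 1 * dist x y"
      if "x \<in> B" "y \<in> B" for x y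
    proof -
      note k = key[OF that]
      have "norm (\<phi> x - \<phi> y) \<le> norm (A (?\<pi> (x - y))) + norm (\<phi> x - \<phi> y - A (?\<pi> (x - y)))"
        by (metis norm_triangle_sub)
      then show "dist (\<phi> x) (\<phi> y) \<le> (1 + \<eta>) * dist (?q x) (?q y)"
        using k(2) unfolding qd by (simp add: dist_norm algebra_simps)
      have "norm (A (?\<pi> (x - y))) \<le> norm (\<phi> x - \<phi> y) + norm (\<phi> x - \<phi> y - A (?\<pi> (x - y)))"
        by (metis norm_minus_commute norm_triangle_sub)
      then have "(1 - \<eta>) * norm (A (?\<pi> (x - y))) \<le> norm (\<phi> x - \<phi> y)"
        using k(2) by (simp add: algebra_simps)
      then show "dist (?q x) (?q y) \<le> 1 / (1 - \<eta>) * dist (\<phi> x) (\<phi> y)"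
        using \<eta>(2) unfolding qd by (simp add: dist_norm field_simps)
      have "dist (?\<pi> x) (?\<pi> y) = norm (?\<pi> (x - y))" by (simp add: dist_norm linear_diff[OF linear_frame_proj])
      then show "dist x y \<le> 1 / (1 - \<epsilon>) * dist (?\<pi> x) (?\<pi> y)" "dist (?\<pi> x) (?\<pi> y) \<le> 1 * dist x y"
        using k(1) \<epsilon>(5) norm_frame_proj_le(1)[OF f, of "x - y"] by (simp_all add: dist_norm field_simps)
    qed
    have lin: "hausdorff_outer k (?q ` B) = ennreal ?J * hausdorff_outer k (?\<pi> ` B)"
      using hausdorff_linear_image[OF A f, of "?\<pi> ` B"] frame_proj_in_span by (force simp: image_image)
    have p1: "hausdorff_outer k (?\<pi> ` B) \<le> hausdorff_outer k B"
      using hausdorff_outer_compare[of 1 B ?\<pi> "\<lambda>x. x" k] pu by simp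
    have p2: "hausdorff_outer k B \<le> ennreal ((1 / (1 - \<epsilon>)) ^ k) * hausdorff_outer k (?\<pi> ` B)"
      using hausdorff_outer_compare[of "1 / (1 - \<epsilon>)" B "\<lambda>x. x" ?\<pi> k] pl \<epsilon>(5) by simp
    have "hausdorff_outer k (\<phi> ` B) \<le> ennreal ((1 + \<eta>) ^ k) * hausdorff_outer k (?q ` B)"
      using \<eta> up by (intro hausdorff_outer_compare) auto
    also have "\<dots> \<le> ennreal \<theta> * (ennreal ?J * hausdorff_outer k B)"
      unfolding lin using \<epsilon>(1) p1 by (intro mult_mono mult_left_mono ennreal_leI) (auto simp: \<eta>_def)
    finally have r1: "hausdorff_outer k (\<phi> ` B) \<le> ennreal (\<theta> * ?J) * hausdorff_outer k B"
      using \<theta> by (simp add: ennreal_mult' mult.assoc)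
    have "ennreal ?J * hausdorff_outer k B \<le> ennreal ?J * (ennreal ((1 / (1 - \<epsilon>)) ^ k) * hausdorff_outer k (?\<pi> ` B))"
      using p2 by (rule mult_left_mono) simp
    also have "\<dots> = ennreal ((1 / (1 - \<epsilon>)) ^ k) * hausdorff_outer k (?q ` B)"
      unfolding lin by (rule mult.left_commute)
    also have "\<dots> \<le> ennreal ((1 / (1 - \<epsilon>)) ^ k) * (ennreal ((1 / (1 - \<eta>)) ^ k) * hausdorff_outer k (\<phi> ` B))"
      using \<eta> lo by (intro mult_left_mono hausdorff_outer_compare) auto
    also have "\<dots> = ennreal ((1 / (1 - \<eta>)) ^ k * (1 / (1 - \<epsilon>)) ^ k) * hausdorff_outer k (\<phi> ` B)"
    proof -
      have "0 \<le> (1 / (1 - \<epsilon>)) ^ k" using \<epsilon>(5) by simp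
      then have "ennreal ((1 / (1 - \<epsilon>)) ^ k * (1 / (1 - \<eta>)) ^ k) = ennreal ((1 / (1 - \<epsilon>)) ^ k) * ennreal ((1 / (1 - \<eta>)) ^ k)"
        by (rule ennreal_mult')
      then show ?thesis by (simp only: mult.assoc[symmetric] mult.commute[of "(1 / (1 - \<eta>)) ^ k"])
    qed
    also have "\<dots> \<le> ennreal \<theta> * hausdorff_outer k (\<phi> ` B)"
      using \<epsilon>(2) by (intro mult_right_mono ennreal_leI) (auto simp: \<eta>_def)
    finally show "hausdorff_outer k (\<phi> ` B) \<le> ennreal (\<theta> * ?J) * hausdorff_outer k B \<and>
       ennreal ?J * hausdorff_outer k B \<le> ennreal \<theta> * hausdorff_outer k (\<phi> ` B)"
      using r1 by blast
  qed (use \<epsilon> in auto)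
qed

subsection \<open>Approximate tangent planes force flatness\<close>

lemma hausdorff_set_integrable:
  assumes S: "S \<in> sets (hausdorff_measure k)" "hausdorff_outer k S < \<infinity>"
    and h: "h \<in> borel_measurable (hausdorff_measure k)" and b: "\<And>x. x \<in> S \<Longrightarrow> \<bar>h x\<bar> \<le> (C::real)"
  shows "set_integrable (hausdorff_measure k) S h"
  unfolding set_integrable_def using S emeasure_hausdorff[OF S(1)]
  by (intro integrableI_bounded_set_indicator[where B=C] h) (auto intro!: AE_I2 b)

lemma measure_hausdorff: "S \<in> sets (hausdorff_measure k) \<Longrightarrow> measure (hausdorff_measure k) S = enn2real (hausdorff_outer k S)"
  by (simp add: measure_def emeasure_hausdorff)

lemma hausdorff_set_integral_le:
  assumes S: "S \<in> sets (hausdorff_measure k)" "hausdorff_outer k S < \<infinity>"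
    and h: "h \<in> borel_measurable (hausdorff_measure k)" and D: "D \<in> sets (hausdorff_measure k)"
    and b: "\<And>x. x \<in> S \<Longrightarrow> \<bar>h x\<bar> \<le> (C::real) * indicator D x" and C: "0 \<le> C"
  shows "\<bar>set_lebesgue_integral (hausdorff_measure k) S h\<bar> \<le> C * measure (hausdorff_measure k) (S \<inter> D)"
proof -
  let ?H = "hausdorff_measure k"
  have SD: "S \<inter> D \<in> sets ?H" "emeasure ?H (S \<inter> D) < \<infinity>"
    using S D emeasure_hausdorff[of "S \<inter> D" k] hausdorff_outer_mono[of "S \<inter> D" S k] by (auto intro: le_less_trans)
  have i1: "integrable ?H (\<lambda>x. C * indicator (S \<inter> D) x)" using SD by simp
  have "\<bar>h x\<bar> \<le> C" if "x \<in> S" for x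
    using b[OF that] C by (auto simp: indicator_def split: if_splits intro: order_trans)
  then have "set_integrable ?H S h" by (intro hausdorff_set_integrable[OF S h])
  then have i2: "integrable ?H (\<lambda>x. indicator S x *\<^sub>R h x)" unfolding set_integrable_def .
  have "\<bar>set_lebesgue_integral ?H S h\<bar> \<le> (\<integral>x. norm (indicator S x *\<^sub>R h x) \<partial>?H)"
    unfolding set_lebesgue_integral_def using integral_norm_bound[of ?H "\<lambda>x. indicator S x *\<^sub>R h x"] by simp
  also have "\<dots> \<le> (\<integral>x. C * indicator (S \<inter> D) x \<partial>?H)"
  proof (intro integral_mono integrable_norm i1 i2)
    fix x show "norm (indicator S x *\<^sub>R h x) \<le> C * indicator (S \<inter> D) x"
      using b[of x] by (cases "x \<in> S") (auto simp: indicator_def)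
  qed
  also have "\<dots> = C * measure ?H (S \<inter> D)" using SD by simp
  finally show ?thesis .
qed

lemma hausdorff_set_integral_ge:
  assumes S: "S \<in> sets (hausdorff_measure k)" "hausdorff_outer k S < \<infinity>"
    and h: "h \<in> borel_measurable (hausdorff_measure k)" "\<And>x. x \<in> S \<Longrightarrow> \<bar>h x\<bar> \<le> (C::real)"
    and D: "D \<in> sets (hausdorff_measure k)"
    and b: "\<And>x. x \<in> S \<Longrightarrow> c * indicator D x \<le> h x"
  shows "c * measure (hausdorff_measure k) (S \<inter> D) \<le> set_lebesgue_integral (hausdorff_measure k) S h"
proof -
  let ?H = "hausdorff_measure k"
  have SD: "S \<inter> D \<in> sets ?H" "emeasure ?H (S \<inter> D) < \<infinity>"
    using S D emeasure_hausdorff[of "S \<inter> D" k] hausdorff_outer_mono[of "S \<inter> D" S k] by (auto intro: le_less_trans)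
  have i1: "integrable ?H (\<lambda>x. c * indicator (S \<inter> D) x)" using SD by simp
  have i2: "integrable ?H (\<lambda>x. indicator S x *\<^sub>R h x)"
    using hausdorff_set_integrable[OF S h] unfolding set_integrable_def .
  have "c * measure ?H (S \<inter> D) = (\<integral>x. c * indicator (S \<inter> D) x \<partial>?H)" using SD by simp
  also have "\<dots> \<le> set_lebesgue_integral ?H S h"
    unfolding set_lebesgue_integral_def using i1 i2 b by (intro integral_mono) (auto simp: indicator_def)
  finally show ?thesis .
qed

text \<open>Flatness is a closed condition on pairs of points, so pieces may be replaced by their
  closures and are then measurable.\<close>

lemma cone_flat_closure:
  assumes "cone_flat k f \<epsilon> F" shows "cone_flat k f \<epsilon> (closure F)"
proof -
  let ?R = "{z. norm ((fst z - snd z) - frame_proj k f (fst z - snd z)) \<le> \<epsilon> * norm (fst z - snd z)}"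
  have "closed ?R" by (intro closed_Collect_le continuous_intros)
  moreover have "F \<times> F \<subseteq> ?R" using assms by (auto simp: cone_flat_def)
  ultimately have "closure (F \<times> F) \<subseteq> ?R" by (rule closure_minimal[rotated])
  then have "closure F \<times> closure F \<subseteq> ?R" by (simp add: closure_Times)
  then show ?thesis unfolding cone_flat_def by fastforce
qed

definition bump :: "'a::euclidean_space \<Rightarrow> real" where "bump v = max 0 (1 - norm v)"

lemma bump_integral_pos:
  assumes f: "orthonormal_frame k (f :: nat \<Rightarrow> 'a::euclidean_space)"
  shows "0 < set_lebesgue_integral (hausdorff_measure k) (span (f ` {..<k})) bump"
proof -
  let ?H = "hausdorff_measure k :: 'a measure" let ?P = "span (f ` {..<k})"
  let ?P1 = "?P \<inter> ball 0 1"
  have P1: "?P1 \<in> sets ?H" by (intro borel_hausdorffD) (auto intro: borel_closed closed_span)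
  have fin: "hausdorff_outer k ?P1 < \<infinity>" by (rule plane_bounded_finite[OF f]) auto
  have bm: "bump \<in> borel_measurable ?H"
    unfolding bump_def by (intro borel_measurable_hausdorffI borel_measurable_continuous_onI continuous_intros)
  have e1: "set_lebesgue_integral ?H ?P bump = set_lebesgue_integral ?H ?P1 bump"
    unfolding set_lebesgue_integral_def by (intro Bochner_Integration.integral_cong) (auto simp: indicator_def bump_def)
  have "1/2 * measure ?H (?P1 \<inter> ball 0 (1/2)) \<le> set_lebesgue_integral ?H ?P1 bump"
    by (rule hausdorff_set_integral_ge[OF P1 fin bm, of 1]) (auto simp: bump_def indicator_def intro!: borel_hausdorffD)
  moreover have "?P1 \<inter> ball 0 (1/2) = ?P \<inter> ball 0 (1/2)" by auto
  ultimately have "1/2 * measure ?H (?P \<inter> ball 0 (1/2)) \<le> set_lebesgue_integral ?H ?P bump"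
    by (simp only: e1)
  moreover have "0 < measure ?H (?P \<inter> ball 0 (1/2))"
  proof -
    have "?P \<inter> ball 0 (1/2) \<in> sets ?H" by (intro borel_hausdorffD) (auto intro: borel_closed closed_span)
    moreover have "0 < hausdorff_outer k (?P \<inter> ball 0 (1/2))" by (rule plane_ball_pos[OF f]) simp
    moreover have "hausdorff_outer k (?P \<inter> ball 0 (1/2)) < \<infinity>" by (rule plane_bounded_finite[OF f]) auto
    ultimately show ?thesis by (simp add: measure_hausdorff enn2real_positive_iff)
  qed
  ultimately show ?thesis by linarith
qed

lemma norm_rescale: "0 < r \<Longrightarrow> norm ((1 / r) *\<^sub>R (y - x)) = dist x y / r"
  by (simp only: norm_scaleR dist_norm norm_minus_commute) simp

text \<open>Blow-up against \<open>bump\<close>: the function is at most the indicator of the unit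
  ball, and its integral over the tangent plane is positive.\<close>

lemma tangent_density_lower:
  assumes S: "S \<in> sets (hausdorff_measure k)" "hausdorff_outer k S < \<infinity>"
    and f: "orthonormal_frame k (f :: nat \<Rightarrow> 'a::euclidean_space)" and T: "approx_tangent k S x (span (f ` {..<k}))"
  obtains c where "0 < c" "eventually (\<lambda>r. c * r ^ k \<le> measure (hausdorff_measure k) (S \<inter> ball x r)) (at_right 0)"
proof -
  let ?H = "hausdorff_measure k :: 'a measure" let ?P = "span (f ` {..<k})"
  define c where "c = set_lebesgue_integral ?H ?P bump"
  have c: "0 < c" unfolding c_def by (rule bump_integral_pos[OF f])
  have cb: "continuous_on UNIV bump" unfolding bump_def by (intro continuous_intros)
  have "{v. bump v \<noteq> 0} \<subseteq> ball 0 (1::real)" by (auto simp: bump_def)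
  then have bb: "bounded {v::'a. bump v \<noteq> 0}" by (auto simp: bump_def intro!: bounded_subset[OF bounded_ball[of 0 1]])
  have "((\<lambda>r. set_lebesgue_integral ?H S (\<lambda>y. bump ((1 / r) *\<^sub>R (y - x)) / r ^ k)) \<longlongrightarrow> c) (at_right 0)"
    unfolding c_def using T cb bb unfolding approx_tangent_def by blast
  then have "eventually (\<lambda>r. c / 2 < set_lebesgue_integral ?H S (\<lambda>y. bump ((1 / r) *\<^sub>R (y - x)) / r ^ k)) (at_right 0)"
    using c by (intro order_tendstoD) auto
  moreover have "eventually (\<lambda>r::real. 0 < r) (at_right 0)" by (rule eventually_at_right_less)
  ultimately have "eventually (\<lambda>r. (c/2) * r ^ k \<le> measure ?H (S \<inter> ball x r)) (at_right 0)"
  proof eventually_elim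
    case (elim r)
    have "\<bar>set_lebesgue_integral ?H S (\<lambda>y. bump ((1 / r) *\<^sub>R (y - x)) / r ^ k)\<bar> \<le> (1 / r ^ k) * measure ?H (S \<inter> ball x r)"
    proof (rule hausdorff_set_integral_le[OF S])
      show "(\<lambda>y. bump ((1 / r) *\<^sub>R (y - x)) / r ^ k) \<in> borel_measurable ?H"
        unfolding bump_def using elim by (intro borel_measurable_hausdorffI borel_measurable_continuous_onI continuous_intros) auto
      fix y
      show "\<bar>bump ((1 / r) *\<^sub>R (y - x)) / r ^ k\<bar> \<le> 1 / r ^ k * indicator (ball x r) y"
      proof (cases "y \<in> ball x r")
        case True
        then show ?thesis using elim by (auto simp: bump_def divide_right_mono)
      next
        case False
        then have "1 \<le> norm ((1 / r) *\<^sub>R (y - x))" unfolding norm_rescale[OF elim(2)] using elim by (simp add: field_simps)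
        then show ?thesis using False by (simp add: bump_def)
      qed
    qed (use elim in \<open>auto intro!: borel_hausdorffD\<close>)
    then have "c / 2 < 1 / r ^ k * measure ?H (S \<inter> ball x r)" using elim by linarith
    then show ?case using elim by (simp add: field_simps)
  qed
  then show ?thesis using that[of "c/2"] c by simp
qed

text \<open>Blow-up against a cutoff that equals 1 on the unit ball and vanishes outside radius 2;
  its limiting integral, increased by 1, bounds the density.\<close>

lemma tangent_density_upper:
  assumes S: "S \<in> sets (hausdorff_measure k)" "hausdorff_outer k S < \<infinity>"
    and T: "approx_tangent k S x (P :: 'a::euclidean_space set)"
  obtains C where "0 < C" "eventually (\<lambda>r. measure (hausdorff_measure k) (S \<inter> ball x r) \<le> C * r ^ k) (at_right 0)"
proof -
  let ?H = "hausdorff_measure k :: 'a measure"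
  define g where "g = (\<lambda>v::'a. max 0 (min 1 (2 - norm v)))"
  define L where "L = set_lebesgue_integral ?H P g"
  have cb: "continuous_on UNIV g" unfolding g_def by (intro continuous_intros)
  have "{v. g v \<noteq> 0} \<subseteq> ball 0 2" by (auto simp: g_def)
  then have bb: "bounded {v. g v \<noteq> 0}" by (rule bounded_subset[OF bounded_ball])
  have "((\<lambda>r. set_lebesgue_integral ?H S (\<lambda>y. g ((1 / r) *\<^sub>R (y - x)) / r ^ k)) \<longlongrightarrow> L) (at_right 0)"
    unfolding L_def using T cb bb unfolding approx_tangent_def by blast
  then have "eventually (\<lambda>r. set_lebesgue_integral ?H S (\<lambda>y. g ((1 / r) *\<^sub>R (y - x)) / r ^ k) < \<bar>L\<bar> + 1) (at_right 0)"
    by (intro order_tendstoD) auto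
  moreover have "eventually (\<lambda>r::real. 0 < r) (at_right 0)" by (rule eventually_at_right_less)
  ultimately have "eventually (\<lambda>r. measure ?H (S \<inter> ball x r) \<le> (\<bar>L\<bar> + 1) * r ^ k) (at_right 0)"
  proof eventually_elim
    case (elim r)
    have "(1 / r ^ k) * measure ?H (S \<inter> ball x r) \<le> set_lebesgue_integral ?H S (\<lambda>y. g ((1 / r) *\<^sub>R (y - x)) / r ^ k)"
    proof (rule hausdorff_set_integral_ge[OF S, of _ "1 / r ^ k"])
      show "(\<lambda>y. g ((1 / r) *\<^sub>R (y - x)) / r ^ k) \<in> borel_measurable ?H"
        unfolding g_def using elim by (intro borel_measurable_hausdorffI borel_measurable_continuous_onI continuous_intros) auto
      fix y
      show "\<bar>g ((1 / r) *\<^sub>R (y - x)) / r ^ k\<bar> \<le> 1 / r ^ k"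
        using elim by (auto simp: g_def divide_right_mono)
      show "1 / r ^ k * indicator (ball x r) y \<le> g ((1 / r) *\<^sub>R (y - x)) / r ^ k"
      proof (cases "y \<in> ball x r")
        case True
        then have "norm ((1 / r) *\<^sub>R (y - x)) \<le> 1" unfolding norm_rescale[OF elim(2)] using elim by (simp add: field_simps)
        then show ?thesis using True by (simp add: g_def)
      next
        case False
        then show ?thesis using elim by (simp add: g_def)
      qed
    qed (auto intro!: borel_hausdorffD)
    then have "(1 / r ^ k) * measure ?H (S \<inter> ball x r) \<le> \<bar>L\<bar> + 1" using elim by linarith
    then show ?case using elim by (simp add: field_simps)
  qed
  then show ?thesis using that[of "\<bar>L\<bar> + 1"] by simp
qed

text \<open>Points at distance about \<open>r\<close> from \<open>x\<close> outside the cone of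
  aperture \<open>\<epsilon> / 2\<close>. The halved aperture and the wide annulus leave room for a
  small ball about a point that violates aperture \<epsilon> at distance exactly
  \<open>r\<close>.\<close>

definition off_cone :: "nat \<Rightarrow> (nat \<Rightarrow> 'a::euclidean_space) \<Rightarrow> real \<Rightarrow> 'a \<Rightarrow> real \<Rightarrow> 'a set" where
  "off_cone k f \<epsilon> x r = {y. r / 2 \<le> norm (y - x) \<and> norm (y - x) \<le> 3 * r / 2 \<and>
     \<epsilon> / 2 * norm (y - x) \<le> norm ((y - x) - frame_proj k f (y - x))}"

lemma closed_off_cone: "closed (off_cone k f \<epsilon> x r)"
proof -
  have "off_cone k f \<epsilon> x r = {y. r / 2 \<le> norm (y - x)} \<inter> {y. norm (y - x) \<le> 3 * r / 2} \<inter>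
     {y. \<epsilon> / 2 * norm (y - x) \<le> norm ((y - x) - frame_proj k f (y - x))}"
    by (auto simp: off_cone_def)
  also have "closed \<dots>" by (intro closed_Int closed_Collect_le continuous_intros)
  finally show ?thesis .
qed

text \<open>The test function is built to vanish on \<open>P\<close>, which lies in the cone of
  aperture \<open>\<epsilon> / 4\<close>, and to be bounded below on the rescaled off-cone region;
  its blow-up integrals tend to 0.\<close>

lemma tangent_off_cone_null:
  assumes S: "S \<in> sets (hausdorff_measure k)" "hausdorff_outer k S < \<infinity>"
    and T: "approx_tangent k S x (P :: 'a::euclidean_space set)" and \<epsilon>: "0 < \<epsilon>"
    and f: "orthonormal_frame k f"
    and near: "\<And>v. v \<in> P \<Longrightarrow> norm (v - frame_proj k f v) \<le> \<epsilon> / 4 * norm v" and \<tau>: "0 < \<tau>"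
  shows "eventually (\<lambda>r. measure (hausdorff_measure k) (S \<inter> off_cone k f \<epsilon> x r) < \<tau> * r ^ k) (at_right 0)"
proof -
  let ?H = "hausdorff_measure k :: 'a measure"
  define g where "g = (\<lambda>v::'a. max 0 (2 - norm v) * max 0 (norm (v - frame_proj k f v) - \<epsilon> / 4 * norm v))"
  have cb: "continuous_on UNIV g" unfolding g_def by (intro continuous_intros)
  have "{v. g v \<noteq> 0} \<subseteq> ball 0 2" by (auto simp: g_def)
  then have bb: "bounded {v. g v \<noteq> 0}" by (rule bounded_subset[OF bounded_ball])
  have gP: "g v = 0" if "v \<in> P" for v using near[OF that] by (simp add: g_def)
  have "set_lebesgue_integral ?H P g = set_lebesgue_integral ?H P (\<lambda>_. 0)"
    unfolding set_lebesgue_integral_def by (intro Bochner_Integration.integral_cong) (auto simp: indicator_def gP)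
  then have z: "set_lebesgue_integral ?H P g = 0" by (simp add: set_lebesgue_integral_def)
  have "((\<lambda>r. set_lebesgue_integral ?H S (\<lambda>y. g ((1 / r) *\<^sub>R (y - x)) / r ^ k)) \<longlongrightarrow> 0) (at_right 0)"
    using T cb bb unfolding approx_tangent_def z[symmetric] by blast
  then have "eventually (\<lambda>r. set_lebesgue_integral ?H S (\<lambda>y. g ((1 / r) *\<^sub>R (y - x)) / r ^ k) < \<epsilon> / 16 * \<tau>) (at_right 0)"
    using \<epsilon> \<tau> by (intro order_tendstoD) auto
  moreover have "eventually (\<lambda>r::real. 0 < r) (at_right 0)" by (rule eventually_at_right_less)
  ultimately show ?thesis
  proof eventually_elim
    case (elim r)
    have gb: "\<bar>g v\<bar> \<le> 4" for v
    proof (cases "norm v \<le> 2")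
      case True
      have "0 \<le> \<epsilon> / 4 * norm v" using \<epsilon> by simp
      then have "max 0 (norm (v - frame_proj k f v) - \<epsilon> / 4 * norm v) \<le> 2"
        using norm_frame_proj_le(2)[OF f, of v] True by linarith
      moreover have "max 0 (2 - norm v) \<le> 2" by simp
      ultimately have "g v \<le> 2 * 2" unfolding g_def by (intro mult_mono) auto
      moreover have "0 \<le> g v" unfolding g_def by (intro mult_nonneg_nonneg) auto
      ultimately show ?thesis by simp
    qed (simp add: g_def)
    have "\<epsilon> / 16 / r ^ k * measure ?H (S \<inter> off_cone k f \<epsilon> x r) \<le> set_lebesgue_integral ?H S (\<lambda>y. g ((1 / r) *\<^sub>R (y - x)) / r ^ k)"
    proof (rule hausdorff_set_integral_ge[OF S, of _ "4 / r ^ k"])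
      have "continuous_on UNIV (\<lambda>y. g ((1 / r) *\<^sub>R (y - x)) / r ^ k)"
        unfolding g_def using elim by (intro continuous_intros) auto
      then show "(\<lambda>y. g ((1 / r) *\<^sub>R (y - x)) / r ^ k) \<in> borel_measurable ?H"
        by (intro borel_measurable_hausdorffI borel_measurable_continuous_onI)
      fix y
      show "\<bar>g ((1 / r) *\<^sub>R (y - x)) / r ^ k\<bar> \<le> 4 / r ^ k"
        using elim gb by (simp add: divide_right_mono)
      show "\<epsilon> / 16 / r ^ k * indicator (off_cone k f \<epsilon> x r) y \<le> g ((1 / r) *\<^sub>R (y - x)) / r ^ k"
      proof (cases "y \<in> off_cone k f \<epsilon> x r")
        case True
        define v where "v = (1 / r) *\<^sub>R (y - x)"
        have yv: "y - x = r *\<^sub>R v" using elim by (simp add: v_def)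
        have t: "r / 2 \<le> norm (y - x)" "norm (y - x) \<le> 3 * r / 2"
          "\<epsilon> / 2 * norm (y - x) \<le> norm ((y - x) - frame_proj k f (y - x))"
          using True unfolding off_cone_def by blast+
        have nv: "norm (y - x) = r * norm v" unfolding yv using elim by simp
        have 1: "1 / 2 \<le> norm v" "norm v \<le> 3 / 2"
          using t(1,2) elim unfolding nv by (auto simp: field_simps)
        have "(y - x) - frame_proj k f (y - x) = r *\<^sub>R (v - frame_proj k f v)"
          unfolding yv by (simp only: linear_cmul[OF linear_frame_proj] scaleR_diff_right)
        then have "\<epsilon> / 2 * (r * norm v) \<le> r * norm (v - frame_proj k f v)"
          using t(3) elim unfolding nv by simp
        then have 2: "\<epsilon> / 2 * norm v \<le> norm (v - frame_proj k f v)" using elim by simp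
        have "\<epsilon> / 8 \<le> \<epsilon> / 4 * norm v" using 1 \<epsilon> by simp
        also have "\<dots> \<le> norm (v - frame_proj k f v) - \<epsilon> / 4 * norm v" using 2 by simp
        \<comment> \<open>The first factor of \<open>g\<close> is at least \<open>1 / 2\<close> as
          \<open>norm v \<le> 3 / 2\<close>; the second is at least
          \<open>\<epsilon> / 4 * norm v\<close> with \<open>norm v \<ge> 1 / 2\<close>.\<close>
        finally have "1 / 2 * (\<epsilon> / 8) \<le> g v" unfolding g_def using 1 \<epsilon> by (intro mult_mono) auto
        then have "\<epsilon> / 16 \<le> g v" by simp
        then have "\<epsilon> / 16 / r ^ k \<le> g v / r ^ k" using elim by (intro divide_right_mono) auto
        moreover have "indicator (off_cone k f \<epsilon> x r) y = (1::real)" using True by simp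
        ultimately show ?thesis unfolding v_def by (simp only: mult_1_right)
      next
        case False
        then show ?thesis using elim by (simp add: g_def)
      qed
    qed (use elim in \<open>auto intro!: closed_hausdorff_measurable closed_off_cone\<close>)
    then have "\<epsilon> / 16 / r ^ k * measure ?H (S \<inter> off_cone k f \<epsilon> x r) < \<epsilon> / 16 * \<tau>" using elim by linarith
    then show ?case using elim \<epsilon> by (simp add: field_simps)
  qed
qed

text \<open>Two points of a piece at distance \<open>r\<close> cannot be in off-cone position: the ball of radius
  \<open>\<epsilon>r/4\<close> about one of them would lie in the off-cone region of the other, where the measure is
  too small for the lower density bound.\<close>

lemma tangent_cone_cover:
  fixes S :: "'a::euclidean_space set"
  assumes S: "S \<in> sets (hausdorff_measure k)" "hausdorff_outer k S < \<infinity>"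
    and f0: "orthonormal_frame k f0" and \<epsilon>: "0 < \<epsilon>" "\<epsilon> \<le> 1"
    and fr: "\<And>x. x \<in> G \<Longrightarrow> orthonormal_frame k (f x)"
    and T: "\<And>x. x \<in> G \<Longrightarrow> approx_tangent k S x (span (f x ` {..<k}))"
    and near: "\<And>x v. x \<in> G \<Longrightarrow> v \<in> span (f x ` {..<k}) \<Longrightarrow> norm (v - frame_proj k f0 v) \<le> \<epsilon> / 4 * norm v"
  obtains \<C> where "countable \<C>" "G \<subseteq> \<Union>\<C>" "\<And>E. E \<in> \<C> \<Longrightarrow> closed E \<and> cone_flat k f0 \<epsilon> E"
proof -
  let ?H = "hausdorff_measure k :: 'a measure"
  let ?m = "\<lambda>A. measure ?H (S \<inter> A)"
  \<comment> \<open>\<open>j\<close> fixes the lower density constant together with its range of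
    radii. \<open>i\<close> gives the range in which the off-cone measure falls below the mass that
    this constant guarantees to a ball of radius \<open>\<epsilon> / 4 * r\<close>; the two
    estimates are made to collide.\<close>
  define D where "D = (\<lambda>j i::nat. {x\<in>G. (\<forall>r. 0 < r \<longrightarrow> r < 1 / Suc j \<longrightarrow> r ^ k / Suc j \<le> ?m (ball x r)) \<and>
     (\<forall>r. 0 < r \<longrightarrow> r < 1 / Suc i \<longrightarrow> ?m (off_cone k f0 \<epsilon> x r) < (\<epsilon> / 4 * r) ^ k / Suc j)})"
  have cov: "\<exists>j i. x \<in> D j i" if x: "x \<in> G" for x
  proof -
    obtain c where c: "0 < c" "eventually (\<lambda>r. c * r ^ k \<le> ?m (ball x r)) (at_right 0)"
      using tangent_density_lower[OF S fr[OF x] T[OF x]] .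
    obtain r0 where r0: "0 < r0" "\<And>r. 0 < r \<Longrightarrow> r < r0 \<Longrightarrow> c * r ^ k \<le> ?m (ball x r)"
      using c(2) unfolding eventually_at_right_field by auto
    obtain j :: nat where j: "1 / Suc j < min c r0" using c(1) r0(1) by (metis min_less_iff_conj nat_approx_posE)
    have 1: "r ^ k / Suc j \<le> ?m (ball x r)" if "0 < r" "r < 1 / Suc j" for r
    proof -
      have "r ^ k / Suc j = (1 / Suc j) * r ^ k" by simp
      also have "\<dots> \<le> c * r ^ k" using j that by (intro mult_right_mono) auto
      also have "\<dots> \<le> ?m (ball x r)" using r0(2)[of r] that j by auto
      finally show ?thesis .
    qed
    have "eventually (\<lambda>r. ?m (off_cone k f0 \<epsilon> x r) < ((\<epsilon> / 4) ^ k / Suc j) * r ^ k) (at_right 0)"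
      using near[OF x] \<epsilon> by (intro tangent_off_cone_null[OF S T[OF x] \<epsilon>(1) f0]) auto
    then obtain r1 where r1: "0 < r1" "\<And>r. 0 < r \<Longrightarrow> r < r1 \<Longrightarrow> ?m (off_cone k f0 \<epsilon> x r) < ((\<epsilon> / 4) ^ k / Suc j) * r ^ k"
      unfolding eventually_at_right_field by auto
    obtain i :: nat where i: "1 / Suc i < r1" using r1(1) nat_approx_posE by blast
    have 2: "?m (off_cone k f0 \<epsilon> x r) < (\<epsilon> / 4 * r) ^ k / Suc j" if "0 < r" "r < 1 / Suc i" for r
    proof -
      have "?m (off_cone k f0 \<epsilon> x r) < ((\<epsilon> / 4) ^ k / Suc j) * r ^ k" using r1(2)[of r] that i by auto
      moreover have "(\<epsilon> / 4 * r) ^ k = (\<epsilon> / 4) ^ k * r ^ k" by (rule power_mult_distrib)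
      ultimately show ?thesis by (simp only: times_divide_eq_left)
    qed
    have "x \<in> D j i" using x 1 2 unfolding D_def by simp
    then show ?thesis by blast
  qed
  have sep: "norm ((y - x) - frame_proj k f0 (y - x)) \<le> \<epsilon> * norm (y - x)"
    if x: "x \<in> D j i" and y: "y \<in> D j i" and d: "norm (y - x) < 1 / Suc j" "norm (y - x) < 1 / Suc i" for x y j i
  proof (rule ccontr)
    assume not: "\<not> norm ((y - x) - frame_proj k f0 (y - x)) \<le> \<epsilon> * norm (y - x)"
    define r where "r = norm (y - x)"
    have r: "0 < r"
    proof (rule ccontr)
      assume "\<not> 0 < r"
      then have "y - x = 0" by (simp add: r_def)
      then show False using not by (simp add: linear_0[OF linear_frame_proj])
    qed
    have sub: "ball y (\<epsilon> / 4 * r) \<subseteq> off_cone k f0 \<epsilon> x r"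
    proof
      fix z assume "z \<in> ball y (\<epsilon> / 4 * r)"
      then have z: "norm (z - y) < \<epsilon> / 4 * r" by (simp add: dist_norm norm_minus_commute)
      have e4: "\<epsilon> / 4 * r \<le> r / 4" using \<epsilon> r by simp
      have zx: "z - x = (z - y) + (y - x)" by simp
      have a: "norm (z - x) \<le> norm (z - y) + r" unfolding zx r_def by (rule norm_triangle_ineq)
      have b: "r - norm (z - y) \<le> norm (z - x)"
        using norm_triangle_ineq4[of "z - x" "z - y"] unfolding r_def by (simp add: norm_minus_commute)
      let ?q = "\<lambda>v. v - frame_proj k f0 v"
      have "?q (y - x) = ?q (z - x) - ?q (z - y)" by (simp add: linear_diff[OF linear_frame_proj])
      then have "norm (?q (y - x)) \<le> norm (?q (z - x)) + norm (?q (z - y))" by (simp only: norm_triangle_ineq4)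
      moreover have "norm (?q (z - y)) \<le> norm (z - y)" by (rule norm_frame_proj_le(2)[OF f0])
      moreover have "\<epsilon> * r < norm (?q (y - x))" using not by (simp add: r_def)
      ultimately have c: "\<epsilon> * r - \<epsilon> / 4 * r \<le> norm (?q (z - x))" using z by linarith
      \<comment> \<open>Here the halved aperture pays off: \<open>5/8 * \<epsilon> * r\<close> is
        needed and \<open>3/4 * \<epsilon> * r\<close> is available.\<close>
      have "\<epsilon> / 2 * norm (z - x) \<le> \<epsilon> / 2 * (r / 4 + r)" using a z e4 \<epsilon> by (intro mult_left_mono) auto
      also have "\<dots> \<le> \<epsilon> * r - \<epsilon> / 4 * r" using \<epsilon> r by (simp add: field_simps)
      finally have "\<epsilon> / 2 * norm (z - x) \<le> norm (?q (z - x))" using c by linarith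
      moreover have "r / 2 \<le> norm (z - x)" "norm (z - x) \<le> 3 * r / 2" using a b z e4 r by linarith+
      ultimately show "z \<in> off_cone k f0 \<epsilon> x r" unfolding off_cone_def by blast
    qed
    have Sm: "S \<inter> off_cone k f0 \<epsilon> x r \<in> fmeasurable ?H"
    proof (rule fmeasurableI)
      show m: "S \<inter> off_cone k f0 \<epsilon> x r \<in> sets ?H"
        by (intro sets.Int S(1) closed_hausdorff_measurable closed_off_cone)
      show "emeasure ?H (S \<inter> off_cone k f0 \<epsilon> x r) < \<infinity>"
        using S(2) hausdorff_outer_mono[of "S \<inter> off_cone k f0 \<epsilon> x r" S k] by (simp add: emeasure_hausdorff[OF m] order_le_less_trans)
    qed
    have s1: "\<epsilon> / 4 * r < 1 / Suc j"
    proof -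
      have "\<epsilon> / 4 * r \<le> 1 * r" using \<epsilon> r by (intro mult_right_mono) auto
      then show ?thesis using d(1) by (simp add: r_def)
    qed
    have "(\<epsilon> / 4 * r) ^ k / Suc j \<le> ?m (ball y (\<epsilon> / 4 * r))"
      using y s1 \<epsilon> r unfolding D_def by simp
    also have "\<dots> \<le> ?m (off_cone k f0 \<epsilon> x r)"
    proof (rule measure_mono_fmeasurable[OF _ _ Sm])
      show "S \<inter> ball y (\<epsilon> / 4 * r) \<subseteq> S \<inter> off_cone k f0 \<epsilon> x r" using sub by (rule Int_mono[OF order_refl])
      show "S \<inter> ball y (\<epsilon> / 4 * r) \<in> sets ?H" by (intro sets.Int S(1) borel_hausdorffD borel_open open_ball)
    qed
    also have "\<dots> < (\<epsilon> / 4 * r) ^ k / Suc j"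
      using x d(2) r unfolding D_def r_def[symmetric] by simp
    finally show False by simp
  qed
  obtain X :: "'a set" where X: "countable X" "\<And>U. open U \<Longrightarrow> U \<noteq> {} \<Longrightarrow> \<exists>d\<in>X. d \<in> U"
    using countable_dense_setE by blast
  \<comment> \<open>Balls centred in a countable dense set cut each \<open>D j i\<close> into parts
    of diameter below both scales, so that the separation estimate covers every pair of points of a
    part.\<close>
  define E where "E = (\<lambda>(j, i, q). closure (D j i \<inter> ball q (min (1 / Suc j) (1 / Suc i) / 2)))"
  show ?thesis
  proof (rule that[of "E ` (UNIV \<times> UNIV \<times> X)"])
    show "countable (E ` (UNIV \<times> UNIV \<times> X))" using X(1) by (intro countable_image countable_SIGMA) auto
    show "G \<subseteq> \<Union> (E ` (UNIV \<times> UNIV \<times> X))"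
    proof
      fix x assume "x \<in> G"
      then obtain j i where ji: "x \<in> D j i" using cov by blast
      define \<rho> where "\<rho> = min (1 / Suc j) (1 / Suc i) / 2"
      have "0 < \<rho>" by (simp add: \<rho>_def)
      then have "ball x \<rho> \<noteq> {}" by simp
      then obtain q where q: "q \<in> X" "q \<in> ball x \<rho>" using X(2)[OF open_ball] by blast
      have "x \<in> D j i \<inter> ball q \<rho>" using ji q(2) by (simp add: dist_commute)
      then have "x \<in> closure (D j i \<inter> ball q \<rho>)" by (rule closure_subset[THEN subsetD])
      then have "x \<in> E (j, i, q)" unfolding E_def \<rho>_def by simp
      then show "x \<in> \<Union> (E ` (UNIV \<times> UNIV \<times> X))" using q(1) by blast
    qed
    fix F assume "F \<in> E ` (UNIV \<times> UNIV \<times> X)"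
    then obtain j i q where F: "F = closure (D j i \<inter> ball q (min (1 / Suc j) (1 / Suc i) / 2))"
      unfolding E_def by auto
    have "cone_flat k f0 \<epsilon> (D j i \<inter> ball q (min (1 / Suc j) (1 / Suc i) / 2))"
      unfolding cone_flat_def
    proof (intro ballI)
      fix x y assume x: "x \<in> D j i \<inter> ball q (min (1 / Suc j) (1 / Suc i) / 2)"
        and y: "y \<in> D j i \<inter> ball q (min (1 / Suc j) (1 / Suc i) / 2)"
      have "dist x y \<le> dist q x + dist q y" by (metis dist_commute dist_triangle)
      then have "norm (x - y) < min (1 / Suc j) (1 / Suc i)" using x y by (simp add: dist_norm)
      then show "norm (x - y - frame_proj k f0 (x - y)) \<le> \<epsilon> * norm (x - y)"
        using x y by (intro sep[of y j i x]) auto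
    qed
    then show "closed F \<and> cone_flat k f0 \<epsilon> F" unfolding F by (auto intro: cone_flat_closure)
  qed
qed

subsection \<open>Diffeomorphisms near a compact set\<close>

text \<open>Continuity is needed jointly in the point and the frame, with frames as sequences in the
  product topology.\<close>

lemma continuous_on_jac:
  assumes "continuous_on U \<phi>'"
  shows "continuous_on (U \<times> UNIV) (\<lambda>z :: 'a::euclidean_space \<times> (nat \<Rightarrow> 'a). jac k (blinfun_apply (\<phi>' (fst z))) (snd z))"
proof -
  have "continuous_on (U \<times> UNIV) (\<lambda>z :: 'a \<times> (nat \<Rightarrow> 'a). blinfun_apply (\<phi>' (fst z)) (snd z i))" for i
  proof (rule bounded_bilinear.continuous_on[OF bounded_bilinear_blinfun_apply])
    show "continuous_on (U \<times> UNIV) (\<lambda>z :: 'a \<times> (nat \<Rightarrow> 'a). \<phi>' (fst z))"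
      by (rule continuous_on_compose2[OF assms continuous_on_fst[OF continuous_on_id]]) auto
    show "continuous_on (U \<times> UNIV) (\<lambda>z :: 'a \<times> (nat \<Rightarrow> 'a). snd z i)"
      by (rule continuous_on_product_then_coordinatewise[OF continuous_on_snd[OF continuous_on_id]])
  qed
  then show ?thesis unfolding jac_def by (intro continuous_on_real_sqrt continuous_on_gram)
qed

lemma jac_cong: "(\<And>i. i < k \<Longrightarrow> f i = g i) \<Longrightarrow> jac k A f = jac k A g"
  unfolding jac_def by (intro arg_cong[where f = sqrt] gram_cong) auto

lemma jac_le_power:
  assumes A: "linear A" and f: "orthonormal_frame k f" and c: "\<And>x. norm (A x) \<le> c * norm x"
  shows "jac k A f \<le> c ^ k"
proof -
  obtain v where v: "svd_frame k A v" "jac k A f = (\<Prod>i<k. norm (A (v i)))" using jac_svd_obtain[OF A f] by blast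
  have "(\<Prod>i<k. norm (A (v i))) \<le> (\<Prod>i<k. c)"
  proof (intro prod_mono conjI)
    fix i assume "i \<in> {..<k}"
    then have "norm (v i) = 1" using v(1) by (auto simp: svd_frame_def orthonormal_onD)
    then show "norm (A (v i)) \<le> c" using c[of "v i"] by simp
  qed simp
  then show ?thesis using v(2) by simp
qed

lemma ennreal_le_all_factors:
  assumes "\<And>t::real. 1 < t \<Longrightarrow> a \<le> ennreal t * b" shows "a \<le> b"
proof (rule ennreal_le_epsilon)
  fix e :: real assume b: "b < top" and e: "0 < e"
  obtain r where r: "b = ennreal r" "0 \<le> r" using b by (cases b) auto
  have "a \<le> ennreal (1 + e / (r + 1)) * b" using e r by (intro assms) simp
  also have "\<dots> = ennreal ((1 + e / (r + 1)) * r)" using e r by (simp add: ennreal_mult')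
  also have "(1 + e / (r + 1)) * r \<le> r + e" using e r by (simp add: field_simps)
  finally show "a \<le> b + ennreal e" using e r by (simp add: ennreal_plus[symmetric] ennreal_leI del: ennreal_plus)
qed

text \<open>The inverse and its derivative belong to the data, which makes the assumptions
  symmetric: through \<open>swap\<close> every result about \<phi> on \<open>K\<close> becomes one
  about \<psi> on the image of \<open>K\<close>. The compact \<open>K\<close> is where Lipschitz
  bounds are uniform.\<close>

locale C1_pair =
  fixes U W K :: "'a::euclidean_space set" and \<phi> \<psi> :: "'a \<Rightarrow> 'a" and \<phi>' \<psi>' :: "'a \<Rightarrow> 'a \<Rightarrow>\<^sub>L 'a"
  assumes open_U: "open U" and open_W: "open W" and image_U: "\<phi> ` U = W"
    and left_inverse: "\<And>x. x \<in> U \<Longrightarrow> \<psi> (\<phi> x) = x"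
    and deriv: "\<And>x. x \<in> U \<Longrightarrow> (\<phi> has_derivative blinfun_apply (\<phi>' x)) (at x)"
    and deriv_inverse: "\<And>y. y \<in> W \<Longrightarrow> (\<psi> has_derivative blinfun_apply (\<psi>' y)) (at y)"
    and cont_deriv: "continuous_on U \<phi>'" and cont_deriv_inverse: "continuous_on W \<psi>'"
    and compact_K: "compact K" and K_U: "K \<subseteq> U"
begin

lemma right_inverse: assumes "y \<in> W" shows "\<phi> (\<psi> y) = y"
proof -
  obtain x where "x \<in> U" "y = \<phi> x" using assms image_U by blast
  then show ?thesis using left_inverse by simp
qed

lemma image_W: "\<psi> ` W = U"
  unfolding image_U[symmetric] using left_inverse by (simp add: image_image cong: image_cong)

lemma continuous_on_U: "continuous_on U \<phi>"
  by (rule has_derivative_continuous_on[of U \<phi> "\<lambda>x. blinfun_apply (\<phi>' x)"]) (simp add: deriv has_derivative_at_withinI)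

lemma compact_image_K: "compact (\<phi> ` K)"
  by (rule compact_continuous_image[OF continuous_on_subset[OF continuous_on_U K_U] compact_K])

lemma swap: "C1_pair W U (\<phi> ` K) \<psi> \<phi> \<psi>' \<phi>'"
proof
  show "\<phi> ` K \<subseteq> W" using K_U image_U by blast
qed (use open_U open_W image_W right_inverse deriv deriv_inverse cont_deriv cont_deriv_inverse compact_image_K in auto)

lemma image_K_inverse: "\<psi> ` \<phi> ` K = K"
proof -
  have "\<psi> (\<phi> x) = x" if "x \<in> K" for x using left_inverse that K_U by blast
  then show ?thesis by (simp add: image_image)
qed

lemma inj_on_U: "inj_on \<phi> U"
  using left_inverse by (rule inj_on_inverseI)

lemma deriv_left_inverse:
  assumes x: "x \<in> U" shows "blinfun_apply (\<psi>' (\<phi> x)) (blinfun_apply (\<phi>' x) v) = v"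
proof -
  have "\<phi> x \<in> W" using x image_U by blast
  then have "(\<psi> \<circ> \<phi> has_derivative blinfun_apply (\<psi>' (\<phi> x)) \<circ> blinfun_apply (\<phi>' x)) (at x)"
    by (intro diff_chain_at deriv[OF x] deriv_inverse)
  then have "((\<lambda>x. x) has_derivative blinfun_apply (\<psi>' (\<phi> x)) \<circ> blinfun_apply (\<phi>' x)) (at x)"
    by (rule has_derivative_transform_within_open[OF _ open_U x]) (simp add: left_inverse)
  moreover have "((\<lambda>x. x) has_derivative (\<lambda>x. x)) (at x)" by (rule has_derivative_ident)
  ultimately have "blinfun_apply (\<psi>' (\<phi> x)) \<circ> blinfun_apply (\<phi>' x) = (\<lambda>x. x)" by (rule has_derivative_unique)
  then show ?thesis by (metis comp_apply)
qed

lemma linear_deriv: "linear (blinfun_apply (\<phi>' x))"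
  by (simp add: blinfun.bounded_linear_right bounded_linear.linear)

lemma inj_deriv: "x \<in> U \<Longrightarrow> inj (blinfun_apply (\<phi>' x))"
  by (rule inj_on_inverseI) (rule deriv_left_inverse)

text \<open>\<open>K\<close> may be far from convex, so the mean value inequality is used only
  locally and compactness provides the global constant.\<close>

lemma lipschitz_K:
  obtains L where "0 < L" "\<And>x y. x \<in> K \<Longrightarrow> y \<in> K \<Longrightarrow> dist (\<phi> x) (\<phi> y) \<le> L * dist x y"
proof -
  \<comment> \<open>\<open>local_lipschitz\<close> concerns time-dependent maps; the real parameter
    is a dummy and is later confined to the single time 0.\<close>
  have "local_lipschitz (UNIV :: real set) U (\<lambda>_. \<phi>)"
  proof (rule c1_implies_local_lipschitz[where f' = "\<lambda>(t, x). \<phi>' x"])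
    show "continuous_on ((UNIV :: real set) \<times> U) (\<lambda>(t, x). \<phi>' x)"
      unfolding case_prod_beta by (rule continuous_on_compose2[OF cont_deriv continuous_on_snd[OF continuous_on_id]]) auto
  qed (use deriv open_U in auto)
  then have ll: "local_lipschitz {0::real} K (\<lambda>_. \<phi>)" by (rule local_lipschitz_subset[OF _ subset_UNIV K_U])
  obtain L where L: "\<And>t. t \<in> {0::real} \<Longrightarrow> L-lipschitz_on K \<phi>"
    by (rule local_lipschitz_compact_implies_lipschitz[OF ll compact_K]) auto
  then have L': "dist (\<phi> x) (\<phi> y) \<le> L * dist x y" if "x \<in> K" "y \<in> K" for x y
    using that by (auto simp: lipschitz_on_def)
  show ?thesis
  proof (rule that[of "\<bar>L\<bar> + 1"])
    fix x y assume "x \<in> K" "y \<in> K"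
    then have "dist (\<phi> x) (\<phi> y) \<le> L * dist x y" by (rule L')
    also have "\<dots> \<le> (\<bar>L\<bar> + 1) * dist x y" by (intro mult_right_mono) auto
    finally show "dist (\<phi> x) (\<phi> y) \<le> (\<bar>L\<bar> + 1) * dist x y" .
  qed simp
qed

text \<open>The mean value inequality for \<phi> minus its linearisation, on a convex ball where the
  derivative varies by at most \<epsilon>.\<close>

lemma linear_flat_ball:
  assumes x0: "x0 \<in> U" and \<epsilon>: "0 < \<epsilon>"
  obtains \<delta> where "0 < \<delta>" "ball x0 \<delta> \<subseteq> U" "linear_flat \<phi> (blinfun_apply (\<phi>' x0)) \<epsilon> (ball x0 \<delta>)"
proof -
  obtain d1 where d1: "0 < d1" "ball x0 d1 \<subseteq> U" using open_U x0 open_contains_ball by blast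
  have "continuous (at x0 within U) \<phi>'" using cont_deriv x0 by (simp add: continuous_on_eq_continuous_within)
  then obtain d2 where d2: "0 < d2" "\<And>x. x \<in> U \<Longrightarrow> dist x x0 < d2 \<Longrightarrow> dist (\<phi>' x) (\<phi>' x0) < \<epsilon>"
    using \<epsilon> unfolding continuous_within_eps_delta by blast
  define \<delta> where "\<delta> = min d1 d2"
  have \<delta>: "0 < \<delta>" "ball x0 \<delta> \<subseteq> U" using d1 d2(1) by (auto simp: \<delta>_def)
  have "linear_flat \<phi> (blinfun_apply (\<phi>' x0)) \<epsilon> (ball x0 \<delta>)"
    unfolding linear_flat_def
  proof (intro ballI)
    fix x y assume xy: "x \<in> ball x0 \<delta>" "y \<in> ball x0 \<delta>"
    have "norm (\<phi> x - \<phi> y - blinfun_apply (\<phi>' x0) (x - y)) \<le> norm (x - y) * \<epsilon>"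
    proof (rule differentiable_bound_linearization[where S = "ball x0 \<delta>" and f' = "\<lambda>x. blinfun_apply (\<phi>' x)" and ?x0.0 = x0])
      fix t :: real assume "t \<in> {0..1}"
      then have "(1 - t) *\<^sub>R y + t *\<^sub>R x \<in> ball x0 \<delta>"
        using convexD[OF convex_ball xy(2,1), of "1 - t" t] by simp
      then show "y + t *\<^sub>R (x - y) \<in> ball x0 \<delta>" by (simp add: algebra_simps)
    next
      fix z assume z: "z \<in> ball x0 \<delta>"
      then show "(\<phi> has_derivative blinfun_apply (\<phi>' z)) (at z within ball x0 \<delta>)"
        using \<delta>(2) deriv by (blast intro: has_derivative_at_withinI)
      have "onorm (blinfun_apply (\<phi>' z) - blinfun_apply (\<phi>' x0)) = norm (\<phi>' z - \<phi>' x0)"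
        by (simp add: norm_blinfun.rep_eq minus_blinfun.rep_eq fun_diff_def)
      also have "\<dots> \<le> \<epsilon>"
        using d2(2)[of z] z \<delta>(2) by (auto simp: \<delta>_def dist_norm norm_minus_commute less_imp_le)
      finally show "onorm (blinfun_apply (\<phi>' z) - blinfun_apply (\<phi>' x0)) \<le> \<epsilon>" .
    qed (use \<delta> in simp)
    then show "norm (\<phi> x - \<phi> y - blinfun_apply (\<phi>' x0) (x - y)) \<le> \<epsilon> * norm (x - y)" by (simp add: mult.commute)
  qed
  then show ?thesis using that \<delta> by blast
qed

lemma image_measurable:
  assumes A: "A \<in> sets (hausdorff_measure k)" "hausdorff_outer k A < \<infinity>" "A \<subseteq> K"
  shows "\<phi> ` A \<in> sets (hausdorff_measure k)"
proof -
  obtain L where L: "0 < L" "\<And>x y. x \<in> K \<Longrightarrow> y \<in> K \<Longrightarrow> dist (\<phi> x) (\<phi> y) \<le> L * dist x y" by (rule lipschitz_K) blast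
  show ?thesis
    by (rule Lipschitz_image_hausdorff_measurable[OF A(1,2), of L]) (use L A(3) in auto)
qed

lemma image_finite:
  assumes "hausdorff_outer k A < \<infinity>" "A \<subseteq> K"
  shows "hausdorff_outer k (\<phi> ` A) < \<infinity>"
proof -
  obtain L where L: "0 < L" "\<And>x y. x \<in> K \<Longrightarrow> y \<in> K \<Longrightarrow> dist (\<phi> x) (\<phi> y) \<le> L * dist x y" by (rule lipschitz_K) blast
  have "hausdorff_outer k (\<phi> ` A) \<le> ennreal (L ^ k) * hausdorff_outer k A"
    by (rule hausdorff_outer_Lipschitz) (use L assms(2) in auto)
  also have "\<dots> < \<infinity>" using assms(1) by (simp add: ennreal_mult_less_top)
  finally show ?thesis .
qed

lemma image_null:
  assumes "hausdorff_outer k A = 0" "A \<subseteq> K"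
  shows "hausdorff_outer k (\<phi> ` A) = 0"
proof -
  obtain L where L: "0 < L" "\<And>x y. x \<in> K \<Longrightarrow> y \<in> K \<Longrightarrow> dist (\<phi> x) (\<phi> y) \<le> L * dist x y" by (rule lipschitz_K) blast
  show ?thesis by (rule hausdorff_outer_Lipschitz_null[OF _ _ assms(1), of _ L]) (use L assms(2) in auto)
qed

end

text \<open>The point paired with its frame, padded by zeros because only the first \<open>k\<close>
  entries are known to be measurable. Open sets of this product control position and tangent plane
  together.\<close>

definition frame_point :: "nat \<Rightarrow> ('a::euclidean_space \<Rightarrow> nat \<Rightarrow> 'a) \<Rightarrow> 'a \<Rightarrow> 'a \<times> (nat \<Rightarrow> 'a)" where
  "frame_point k f x = (x, \<lambda>i. if i < k then f x i else 0)"

lemma borel_measurable_frame_point: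
  assumes "\<And>i. i < k \<Longrightarrow> (\<lambda>x. f x i) \<in> borel_measurable (hausdorff_measure k)"
  shows "frame_point k f \<in> borel_measurable (hausdorff_measure k)"
proof -
  have "(\<lambda>x. \<lambda>i. if i < k then f x i else 0) \<in> borel_measurable (hausdorff_measure k)"
  proof (rule measurable_coordinatewise_then_product)
    fix i show "(\<lambda>x. if i < k then f x i else 0) \<in> borel_measurable (hausdorff_measure k)"
      using assms by (cases "i < k") simp_all
  qed
  moreover have "(\<lambda>x. x) \<in> borel_measurable (hausdorff_measure k)"
    by (rule borel_measurable_hausdorffI) simp
  ultimately show ?thesis unfolding frame_point_def[abs_def] by (intro borel_measurable_Pair)
qed

subsection \<open>The area formula\<close>

locale C1_tangent = C1_pair U W K \<phi> \<psi> \<phi>' \<psi>'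
  for U W K :: "'a::euclidean_space set" and \<phi> \<psi> :: "'a \<Rightarrow> 'a" and \<phi>' \<psi>' :: "'a \<Rightarrow> 'a \<Rightarrow>\<^sub>L 'a" +
  fixes k :: nat and S :: "'a set" and f :: "'a \<Rightarrow> nat \<Rightarrow> 'a"
  assumes S: "S \<in> sets (hausdorff_measure k)" "hausdorff_outer k S < \<infinity>" and S_K: "S \<subseteq> K"
    and f_meas: "\<And>i. i < k \<Longrightarrow> (\<lambda>x. f x i) \<in> borel_measurable (hausdorff_measure k)"
    and frame: "\<And>x. x \<in> S \<Longrightarrow> orthonormal_frame k (f x)"
    and tangent: "AE x in hausdorff_measure k. x \<in> S \<longrightarrow> approx_tangent k S x (span (f x ` {..<k}))"
begin

abbreviation "H \<equiv> hausdorff_measure k :: 'a measure"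

definition J :: "'a \<Rightarrow> real" where
  "J x = (if x \<in> S then jac k (blinfun_apply (\<phi>' x)) (f x) else 0)"

lemma frame_point_meas: "frame_point k f \<in> borel_measurable H"
  by (rule borel_measurable_frame_point) (rule f_meas)

lemma S_U: "S \<subseteq> U" using S_K K_U by blast

lemma J_pos: "x \<in> S \<Longrightarrow> 0 < J x"
  unfolding J_def using S_U by (auto intro!: jac_pos linear_deriv inj_deriv frame)

lemma J_nonneg: "0 \<le> J x" using J_pos[of x] by (cases "x \<in> S") (auto simp: J_def)

text \<open>On \<open>S\<close> the Jacobian is a continuous function of the point and frame, so its
  measurability is inherited from \<open>frame_point\<close>.\<close>

lemma J_meas [measurable]: "J \<in> borel_measurable H"
proof -
  let ?j = "\<lambda>z :: 'a \<times> (nat \<Rightarrow> 'a). jac k (blinfun_apply (\<phi>' (fst z))) (snd z)"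
  have "open (U \<times> (UNIV :: (nat \<Rightarrow> 'a) set))" using open_U by (intro open_Times) auto
  then have "(\<lambda>z. indicator (U \<times> UNIV) z *\<^sub>R ?j z) \<in> borel_measurable borel"
    by (intro borel_measurable_continuous_on_indicator continuous_on_jac cont_deriv) auto
  then have "(\<lambda>x. indicator (U \<times> UNIV) (frame_point k f x) *\<^sub>R ?j (frame_point k f x)) \<in> borel_measurable H"
    by (rule measurable_compose[OF frame_point_meas])
  then have "(\<lambda>x. if x \<in> S then indicator (U \<times> UNIV) (frame_point k f x) *\<^sub>R ?j (frame_point k f x) else 0) \<in> borel_measurable H"
    using S(1) by (intro measurable_If_set) auto
  moreover have "J x = (if x \<in> S then indicator (U \<times> UNIV) (frame_point k f x) *\<^sub>R ?j (frame_point k f x) else 0)" for x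
    using S_U by (auto simp: J_def frame_point_def indicator_def intro: jac_cong)
  ultimately show ?thesis by (simp cong: measurable_cong)
qed

lemma J_bounded: obtains M where "0 < M" "\<And>x. J x \<le> M"
proof -
  have "compact (\<phi>' ` K)" by (rule compact_continuous_image[OF continuous_on_subset[OF cont_deriv K_U] compact_K])
  then obtain B where B: "0 < B" "\<And>x. x \<in> K \<Longrightarrow> norm (\<phi>' x) \<le> B"
    using compact_imp_bounded bounded_pos by (metis imageI)
  have "J x \<le> B ^ k" for x
  proof (cases "x \<in> S")
    case True
    have "norm (blinfun_apply (\<phi>' x) v) \<le> B * norm v" for v
      using norm_blinfun[of "\<phi>' x" v] B(2)[of x] True S_K mult_right_mono[of "norm (\<phi>' x)" B "norm v"] by fastforce
    then have "jac k (blinfun_apply (\<phi>' x)) (f x) \<le> B ^ k" by (intro jac_le_power linear_deriv frame True)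
    then show ?thesis using True by (simp add: J_def)
  qed (use B in \<open>simp add: J_def\<close>)
  then show ?thesis using that[of "B ^ k"] B(1) by simp
qed

definition N :: "'a set" where "N = {x \<in> S. \<not> approx_tangent k S x (span (f x ` {..<k}))}"

lemma N_null: "hausdorff_outer k N = 0"
proof -
  have "N = {x. \<not> (x \<in> S \<longrightarrow> approx_tangent k S x (span (f x ` {..<k})))}" by (auto simp: N_def)
  then show ?thesis using tangent unfolding AE_hausdorff_iff by simp
qed

text \<open>\<open>a\<close> is a nearly constant value of the Jacobian on \<open>Q\<close>. The
  estimates are demanded for all subsets of \<open>Q\<close>, so they survive when the pieces are
  made disjoint.\<close>

definition good_piece :: "real \<Rightarrow> 'a set \<Rightarrow> real \<Rightarrow> bool" where
  "good_piece \<theta> Q a \<longleftrightarrow> Q \<in> sets H \<and> Q \<subseteq> S \<and> 0 < a \<and>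
     (\<forall>B. B \<subseteq> Q \<longrightarrow> hausdorff_outer k (\<phi> ` B) \<le> ennreal (\<theta> * a) * hausdorff_outer k B \<and>
        ennreal a * hausdorff_outer k B \<le> ennreal \<theta> * hausdorff_outer k (\<phi> ` B)) \<and>
     (\<forall>x\<in>Q. a \<le> \<theta> * J x \<and> J x \<le> \<theta> * a)"

text \<open>Close to \<open>x0\<close> and its frame, three conditions hold at once: \<phi> is
  nearly linear (\<open>O1\<close>), tangent planes are close to that at \<open>x0\<close>
  (\<open>O2\<close>), and the Jacobian is within a factor \<theta> of its value there
  (\<open>O3\<close>). \<open>tangent_cone_cover\<close> then cuts this neighbourhood into flat
  closed pieces.\<close>

lemma local_pieces:
  assumes x0: "x0 \<in> S" and \<theta>: "1 < \<theta>"
  shows "\<exists>V \<C>. open V \<and> frame_point k f x0 \<in> V \<and> countable \<C> \<and>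
     {x \<in> S - N. frame_point k f x \<in> V} \<subseteq> \<Union>\<C> \<and>
     (\<forall>E\<in>\<C>. good_piece \<theta> ({x \<in> S. frame_point k f x \<in> V} \<inter> E) (J x0))"
proof -
  let ?A = "blinfun_apply (\<phi>' x0)" let ?F = "frame_point k f"
  have x0U: "x0 \<in> U" using x0 S_U by blast
  have f0: "orthonormal_frame k (f x0)" by (rule frame[OF x0])
  have J0: "J x0 = jac k ?A (f x0)" "0 < J x0" using x0 J_pos by (auto simp: J_def)
  obtain \<epsilon> where \<epsilon>: "0 < \<epsilon>" "\<epsilon> \<le> 1" and area: "\<And>F \<phi> B. cone_flat k (f x0) \<epsilon> F \<Longrightarrow> linear_flat \<phi> ?A \<epsilon> F \<Longrightarrow> B \<subseteq> F \<Longrightarrow>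
       hausdorff_outer k (\<phi> ` B) \<le> ennreal (\<theta> * jac k ?A (f x0)) * hausdorff_outer k B \<and>
       ennreal (jac k ?A (f x0)) * hausdorff_outer k B \<le> ennreal \<theta> * hausdorff_outer k (\<phi> ` B)"
    using flat_piece_area[OF linear_deriv inj_deriv[OF x0U] f0 \<theta>] by metis
  obtain \<delta> where \<delta>: "0 < \<delta>" "ball x0 \<delta> \<subseteq> U" "linear_flat \<phi> ?A \<epsilon> (ball x0 \<delta>)"
    using linear_flat_ball[OF x0U \<epsilon>(1)] .
  \<comment> \<open>\<open>near_frame_cone\<close> turns a frame distance \<open>d\<close> into the
    aperture \<open>k * d\<close>, which must be at most \<open>\<epsilon> / 4\<close>; the summand
    1 covers \<open>k = 0\<close>.\<close>
  define d where "d = \<epsilon> / (4 * (real k + 1))"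
  have d: "0 < d" "real k * d \<le> \<epsilon> / 4" using \<epsilon> by (auto simp: d_def field_simps)
  let ?j = "\<lambda>z :: 'a \<times> (nat \<Rightarrow> 'a). jac k (blinfun_apply (\<phi>' (fst z))) (snd z)"
  define O1 where "O1 = ball x0 \<delta> \<times> (UNIV :: (nat \<Rightarrow> 'a) set)"
  define O2 where "O2 = (\<Inter>i\<in>{..<k}. {z :: 'a \<times> (nat \<Rightarrow> 'a). dist (snd z i) (f x0 i) < d})"
  define O3 where "O3 = (U \<times> UNIV) \<inter> ?j -` {J x0 / \<theta><..<\<theta> * J x0}"
  define V where "V = O1 \<inter> O2 \<inter> O3"
  have "open O1" unfolding O1_def by (intro open_Times) auto
  moreover have "open O2" unfolding O2_def
    by (intro open_INT ballI open_Collect_less continuous_on_dist continuous_on_const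
        continuous_on_product_then_coordinatewise[OF continuous_on_snd[OF continuous_on_id]]) auto
  moreover have "open O3" unfolding O3_def
    by (intro continuous_open_preimage continuous_on_jac cont_deriv open_Times open_U) auto
  ultimately have V: "open V" by (simp add: V_def open_Int)
  have jF: "?j (?F x) = J x" if "x \<in> S" for x
    using that by (auto simp: J_def frame_point_def intro: jac_cong)
  have "J x0 / \<theta> < J x0" "J x0 < \<theta> * J x0" using J0(2) \<theta> by (auto simp: field_simps)
  then have "?F x0 \<in> V"
    using \<delta>(1) d(1) x0U jF[OF x0] by (auto simp: V_def O1_def O2_def O3_def) (auto simp: frame_point_def)
  define G where "G = {x \<in> S - N. ?F x \<in> V}"
  have G: "orthonormal_frame k (f x)" "approx_tangent k S x (span (f x ` {..<k}))"
    "\<And>v. v \<in> span (f x ` {..<k}) \<Longrightarrow> norm (v - frame_proj k (f x0) v) \<le> \<epsilon> / 4 * norm v" if x: "x \<in> G" for x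
  proof -
    show fx: "orthonormal_frame k (f x)" using x frame by (simp add: G_def)
    show "approx_tangent k S x (span (f x ` {..<k}))" using x by (auto simp: G_def N_def)
    fix v assume v: "v \<in> span (f x ` {..<k})"
    have "norm (f x i - f x0 i) \<le> d" if "i < k" for i
    proof -
      have "?F x \<in> O2" using x by (simp add: G_def V_def)
      then have "dist (snd (?F x) i) (f x0 i) < d" using that unfolding O2_def by blast
      then show ?thesis using that by (simp add: frame_point_def dist_norm)
    qed
    then have "norm (v - frame_proj k (f x0) v) \<le> real k * d * norm v" by (rule near_frame_cone[OF f0 fx _ v])
    also have "\<dots> \<le> \<epsilon> / 4 * norm v" using d(2) by (intro mult_right_mono) auto
    finally show "norm (v - frame_proj k (f x0) v) \<le> \<epsilon> / 4 * norm v" .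
  qed
  obtain \<C> where C: "countable \<C>" "G \<subseteq> \<Union>\<C>" "\<And>E. E \<in> \<C> \<Longrightarrow> closed E \<and> cone_flat k (f x0) \<epsilon> E"
    by (rule tangent_cone_cover[OF S f0 \<epsilon> G]) blast+
  have "good_piece \<theta> ({x \<in> S. ?F x \<in> V} \<inter> E) (J x0)" if E: "E \<in> \<C>" for E
    unfolding good_piece_def
  proof (intro conjI allI impI ballI)
    have "?F -` V \<inter> space H \<in> sets H"
      using V by (intro measurable_sets[OF frame_point_meas]) auto
    moreover have "{x \<in> S. ?F x \<in> V} = S \<inter> (?F -` V \<inter> space H)" by auto
    ultimately show "{x \<in> S. ?F x \<in> V} \<inter> E \<in> sets H"
      using S(1) C(3)[OF E] closed_hausdorff_measurable by (metis sets.Int)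
    fix B assume B: "B \<subseteq> {x \<in> S. ?F x \<in> V} \<inter> E"
    have "B \<subseteq> ball x0 \<delta>"
    proof
      fix x assume "x \<in> B"
      then have "?F x \<in> O1" using B by (auto simp: V_def)
      then show "x \<in> ball x0 \<delta>" by (simp add: O1_def frame_point_def)
    qed
    then have "linear_flat \<phi> ?A \<epsilon> B" "cone_flat k (f x0) \<epsilon> B"
      using \<delta>(3) C(3)[OF E] B unfolding linear_flat_def cone_flat_def by blast+
    then show "hausdorff_outer k (\<phi> ` B) \<le> ennreal (\<theta> * J x0) * hausdorff_outer k B"
      "ennreal (J x0) * hausdorff_outer k B \<le> ennreal \<theta> * hausdorff_outer k (\<phi> ` B)"
      unfolding J0(1) using area by blast+
  next
    fix x assume "x \<in> {x \<in> S. ?F x \<in> V} \<inter> E"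
    then have "?j (?F x) \<in> {J x0 / \<theta><..<\<theta> * J x0}" "x \<in> S" by (auto simp: V_def O3_def)
    then have "J x \<in> {J x0 / \<theta><..<\<theta> * J x0}" using jF by simp
    then show "J x0 \<le> \<theta> * J x" "J x \<le> \<theta> * J x0" using \<theta> by (auto simp: field_simps)
  qed (use J0 in auto)
  then show ?thesis using V \<open>?F x0 \<in> V\<close> C(1,2) unfolding G_def by blast
qed

text \<open>The neighbourhoods lie in the second countable space of points with frames, so by
  Lindelof countably many of them suffice, each with its countable family of pieces.\<close>

lemma countable_pieces:
  assumes \<theta>: "1 < \<theta>"
  obtains Q a where "\<And>n::nat. good_piece \<theta> (Q n) (a n)" "S - N \<subseteq> (\<Union>n. Q n)"
proof -
  let ?F = "frame_point k f"
  define good where "good = (\<lambda>x0 V \<C>. open V \<and> ?F x0 \<in> V \<and> countable \<C> \<and>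
     {x \<in> S - N. ?F x \<in> V} \<subseteq> \<Union>\<C> \<and> (\<forall>E\<in>\<C>. good_piece \<theta> ({x \<in> S. ?F x \<in> V} \<inter> E) (J x0)))"
  have "\<forall>x0\<in>S. \<exists>p. good x0 (fst p) (snd p)"
  proof
    fix x0 assume "x0 \<in> S"
    then have "\<exists>V \<C>. good x0 V \<C>" unfolding good_def by (rule local_pieces[OF _ \<theta>])
    then obtain V \<C> where "good x0 V \<C>" by (elim exE)
    then show "\<exists>p. good x0 (fst p) (snd p)" by (intro exI[of _ "(V, \<C>)"]) simp
  qed
  then obtain p where p: "\<forall>x0\<in>S. good x0 (fst (p x0)) (snd (p x0))" by (rule bchoice[THEN exE])
  define V where "V = (\<lambda>x. fst (p x))"
  define C where "C = (\<lambda>x. snd (p x))"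
  have g: "good x0 (V x0) (C x0)" if "x0 \<in> S" for x0 unfolding V_def C_def by (rule bspec[OF p that])
  note g' = g[unfolded good_def]
  note VC = conjunct1[OF g'] conjunct1[OF conjunct2[OF g']] conjunct1[OF conjunct2[OF conjunct2[OF g']]]
    conjunct1[OF conjunct2[OF conjunct2[OF conjunct2[OF g']]]] conjunct2[OF conjunct2[OF conjunct2[OF conjunct2[OF g']]]]
  have oV: "open T" if "T \<in> V ` S" for T using that VC(1) by auto
  obtain \<F> where F: "\<F> \<subseteq> V ` S" "countable \<F>" "\<Union>\<F> = \<Union>(V ` S)"
    by (rule Lindelof[OF oV])
  have "\<exists>X. countable X \<and> X \<subseteq> S \<and> \<F> = V ` X"
    by (rule iffD1[OF countable_subset_image conjI[OF F(2,1)]])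
  then obtain X where X: "countable X" "X \<subseteq> S" "\<F> = V ` X" by (elim exE conjE)
  define Q where "Q = (\<lambda>x0 E. {x \<in> S. ?F x \<in> V x0} \<inter> E)"
  \<comment> \<open>The empty piece, with the dummy value 1, keeps the family nonempty so that it
    can be enumerated by the natural numbers even if \<open>S\<close> is empty.\<close>
  define \<D> where "\<D> = insert ({}, 1) ((\<lambda>z. (Q (fst z) (snd z), J (fst z))) ` (SIGMA x0:X. C x0))"
  have "countable (SIGMA x0:X. C x0)"
    by (rule countable_SIGMA[OF X(1)]) (rule VC(3), rule subsetD[OF X(2)])
  then have cD: "countable \<D>" unfolding \<D>_def by (intro countable_insert countable_image)
  have neD: "\<D> \<noteq> {}" by (simp add: \<D>_def)
  have gD: "good_piece \<theta> (fst p) (snd p)" if pD: "p \<in> \<D>" for p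
  proof (cases "p = ({}, 1)")
    case True
    then show ?thesis by (simp add: good_piece_def)
  next
    case False
    then have "p \<in> (\<lambda>z. (Q (fst z) (snd z), J (fst z))) ` (SIGMA x0:X. C x0)" using pD by (simp add: \<D>_def)
    then obtain x0 E where "x0 \<in> X" "E \<in> C x0" "p = (Q x0 E, J x0)" by (elim imageE SigmaE) simp
    then show ?thesis using bspec[OF VC(5)[OF subsetD[OF X(2)]]] by (simp add: Q_def)
  qed
  define q where "q = from_nat_into \<D>"
  have q: "range q = \<D>" unfolding q_def by (rule range_from_nat_into[OF neD cD])
  show ?thesis
  proof (rule that[of "\<lambda>n. fst (q n)" "\<lambda>n. snd (q n)"])
    fix n
    have "q n \<in> \<D>" unfolding q[symmetric] by (rule rangeI)
    then show "good_piece \<theta> (fst (q n)) (snd (q n))" by (rule gD)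
  next
    show "S - N \<subseteq> (\<Union>n. fst (q n))"
    proof
      fix x assume x: "x \<in> S - N"
      then have xS: "x \<in> S" by (rule DiffD1)
      have "?F x \<in> \<Union>(V ` S)" by (rule UN_I[of x S], rule xS, rule VC(2)[OF xS])
      then have "?F x \<in> \<Union>(V ` X)" using F(3) X(3) by simp
      then obtain x0 where x0: "x0 \<in> X" "?F x \<in> V x0" by (elim UN_E)
      have "x \<in> \<Union>(C x0)" by (rule subsetD[OF VC(4)[OF subsetD[OF X(2) x0(1)]]]) (use x x0(2) in simp)
      then obtain E where E: "E \<in> C x0" "x \<in> E" by (elim UnionE)
      have "(x0, E) \<in> (SIGMA x0:X. C x0)" using x0(1) E(1) by simp
      then have "(Q x0 E, J x0) \<in> \<D>" unfolding \<D>_def by (intro insertI2 image_eqI[of _ _ "(x0, E)"]) simp_all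
      then have "(Q x0 E, J x0) \<in> range q" by (simp only: q)
      then obtain n where "(Q x0 E, J x0) = q n" by (elim rangeE)
      then have "fst (q n) = Q x0 E" by (metis fst_conv)
      then have "x \<in> fst (q n)" using xS x0(2) E(2) by (simp add: Q_def)
      then show "x \<in> (\<Union>n. fst (q n))" by (rule UN_I[OF UNIV_I])
    qed
  qed
qed

lemma sub_measurable: "B \<in> sets H \<Longrightarrow> B \<subseteq> S \<Longrightarrow> \<phi> ` B \<in> sets H"
  using S(2) S_K hausdorff_outer_mono[of B S k] by (intro image_measurable) auto

text \<open>One factor \<theta> comes from comparing measures on a piece, the other from exchanging
  the Jacobian for the constant \<open>a n\<close>. The exceptional set \<open>N\<close> contributes
  nothing on either side because \<phi> maps null subsets of \<open>K\<close> to null sets.\<close>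

lemma area_formula_approx:
  assumes \<theta>: "1 < \<theta>" and B: "B \<in> sets H" "B \<subseteq> S"
  shows "hausdorff_outer k (\<phi> ` B) \<le> ennreal (\<theta> * \<theta>) * emeasure (density H J) B"
    and "emeasure (density H J) B \<le> ennreal (\<theta> * \<theta>) * hausdorff_outer k (\<phi> ` B)"
proof -
  let ?D = "density H (\<lambda>x. ennreal (J x))"
  obtain Q a where Q: "\<And>n::nat. good_piece \<theta> (Q n) (a n)" "S - N \<subseteq> (\<Union>n. Q n)" by (rule countable_pieces[OF \<theta>]) blast
  have Qm: "Q n \<in> sets H" for n using Q(1)[of n] by (simp add: good_piece_def)
  have Nm: "N \<in> sets H" by (rule hausdorff_null_sets[OF N_null])
  define P where "P = (\<lambda>n. (B - N) \<inter> disjointed Q n)"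
  have Pm: "P n \<in> sets H" for n
    unfolding P_def using B(1) Nm sets.range_disjointed_sets[of Q H] Qm by blast
  have PQ: "P n \<subseteq> Q n" for n using disjointed_subset[of Q n] by (auto simp: P_def)
  have PB: "P n \<subseteq> B" for n by (auto simp: P_def)
  have disj: "disjoint_family P" using disjoint_family_disjointed[of Q] by (auto simp: P_def disjoint_family_on_def)
  have UP: "(\<Union>n. P n) = B - N"
  proof -
    have "(\<Union>n. P n) = (B - N) \<inter> (\<Union>n. disjointed Q n)" by (auto simp: P_def)
    then show ?thesis using Q(2) B(2) by (auto simp: UN_disjointed_eq)
  qed
  have g: "hausdorff_outer k (\<phi> ` P n) \<le> ennreal (\<theta> * a n) * hausdorff_outer k (P n)"
    "ennreal (a n) * hausdorff_outer k (P n) \<le> ennreal \<theta> * hausdorff_outer k (\<phi> ` P n)"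
    "0 < a n" "\<And>x. x \<in> P n \<Longrightarrow> a n \<le> \<theta> * J x" "\<And>x. x \<in> P n \<Longrightarrow> J x \<le> \<theta> * a n" for n
    using Q(1)[of n] PQ[of n] unfolding good_piece_def by blast+
  have eP: "emeasure ?D (P n) = (\<integral>\<^sup>+x. ennreal (J x) * indicator (P n) x \<partial>H)" for n
    using Pm by (intro emeasure_density) auto
  have const: "ennreal c * hausdorff_outer k (P n) = (\<integral>\<^sup>+x. ennreal c * indicator (P n) x \<partial>H)" for c n
    using Pm[of n] by (simp add: nn_integral_cmult_indicator emeasure_hausdorff)
  have lo: "ennreal (a n) * hausdorff_outer k (P n) \<le> ennreal \<theta> * emeasure ?D (P n)" for n
  proof -
    have "(\<integral>\<^sup>+x. ennreal (a n) * indicator (P n) x \<partial>H) \<le> (\<integral>\<^sup>+x. ennreal \<theta> * (ennreal (J x) * indicator (P n) x) \<partial>H)"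
    proof (rule nn_integral_mono)
      fix x
      show "ennreal (a n) * indicator (P n) x \<le> ennreal \<theta> * (ennreal (J x) * indicator (P n) x)"
        using g(4)[of x n] \<theta> J_nonneg[of x] by (auto simp: indicator_def ennreal_mult[symmetric] intro!: ennreal_leI)
    qed
    also have "\<dots> = ennreal \<theta> * emeasure ?D (P n)"
      unfolding eP using Pm[of n] by (intro nn_integral_cmult) auto
    finally show ?thesis unfolding const .
  qed
  have up: "emeasure ?D (P n) \<le> ennreal \<theta> * (ennreal (a n) * hausdorff_outer k (P n))" for n
  proof -
    have "emeasure ?D (P n) \<le> (\<integral>\<^sup>+x. ennreal (\<theta> * a n) * indicator (P n) x \<partial>H)"
      unfolding eP using g(5) by (intro nn_integral_mono) (auto simp: indicator_def intro!: ennreal_leI)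
    also have "\<dots> = ennreal (\<theta> * a n) * hausdorff_outer k (P n)" by (rule const[symmetric])
    also have "\<dots> = ennreal \<theta> * (ennreal (a n) * hausdorff_outer k (P n))"
      using \<theta> by (simp add: ennreal_mult' mult.assoc)
    finally show ?thesis .
  qed
  have tt: "ennreal (\<theta> * \<theta>) = ennreal \<theta> * ennreal \<theta>" using \<theta> by (simp add: ennreal_mult')
  have sumD: "(\<Sum>n. emeasure ?D (P n)) = emeasure ?D (B - N)"
    using Pm disj UP by (subst suminf_emeasure) auto
  have DN: "emeasure ?D (B \<inter> N) = 0"
  proof -
    have "B \<inter> N \<in> null_sets H" using null_sets_hausdorff_iff[of "B \<inter> N" k] hausdorff_outer_null_subset[OF N_null, of "B \<inter> N"] by simp
    then show ?thesis
      using nn_integral_null_set[of "B \<inter> N" H "\<lambda>x. ennreal (J x)"] by (subst emeasure_density) auto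
  qed
  have DB: "emeasure ?D (B - N) = emeasure ?D B"
  proof (rule antisym)
    have "emeasure ?D B \<le> emeasure ?D (B - N) + emeasure ?D (B \<inter> N)"
      using B(1) Nm by (intro order_trans[OF eq_refl[OF arg_cong[where f = "emeasure ?D"]] emeasure_subadditive]) auto
    then show "emeasure ?D B \<le> emeasure ?D (B - N)" using DN by simp
  qed (use B(1) in \<open>auto intro!: emeasure_mono\<close>)
  have sub: "B - N \<subseteq> B" by blast
  have "hausdorff_outer k (\<phi> ` B) \<le> hausdorff_outer k (\<phi> ` (B - N)) + hausdorff_outer k (\<phi> ` N)"
  proof -
    have "\<phi> ` B \<subseteq> \<phi> ` (B - N) \<union> \<phi> ` N" by blast
    then show ?thesis by (meson hausdorff_outer_Un hausdorff_outer_mono order_trans)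
  qed
  also have "hausdorff_outer k (\<phi> ` N) = 0"
    using S_K by (intro image_null N_null) (auto simp: N_def)
  also have "hausdorff_outer k (\<phi> ` (B - N)) + 0 \<le> (\<Sum>n. hausdorff_outer k (\<phi> ` P n))"
    unfolding UP[symmetric] image_UN add_0_right by (rule hausdorff_outer_countable_subadditive)
  also have "\<dots> \<le> (\<Sum>n. ennreal (\<theta> * \<theta>) * emeasure ?D (P n))"
  proof (intro suminf_le summableI)
    fix n
    have "hausdorff_outer k (\<phi> ` P n) \<le> ennreal \<theta> * (ennreal (a n) * hausdorff_outer k (P n))"
      using g(1)[of n] \<theta> by (simp add: ennreal_mult' mult.assoc)
    also have "\<dots> \<le> ennreal \<theta> * (ennreal \<theta> * emeasure ?D (P n))" by (intro mult_left_mono lo) simp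
    finally show "hausdorff_outer k (\<phi> ` P n) \<le> ennreal (\<theta> * \<theta>) * emeasure ?D (P n)" by (simp only: tt mult.assoc)
  qed
  also have "\<dots> = ennreal (\<theta> * \<theta>) * emeasure ?D B" by (simp only: ennreal_suminf_cmult sumD DB)
  finally show "hausdorff_outer k (\<phi> ` B) \<le> ennreal (\<theta> * \<theta>) * emeasure ?D B" .
  have im: "\<phi> ` P n \<in> sets H" for n using Pm PB B(2) by (intro sub_measurable) blast+
  have "emeasure ?D B = (\<Sum>n. emeasure ?D (P n))" by (simp only: sumD DB)
  also have "\<dots> \<le> (\<Sum>n. ennreal (\<theta> * \<theta>) * emeasure H (\<phi> ` P n))"
  proof (intro suminf_le summableI)
    fix n
    have "emeasure ?D (P n) \<le> ennreal \<theta> * (ennreal (a n) * hausdorff_outer k (P n))" by (rule up)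
    also have "\<dots> \<le> ennreal \<theta> * (ennreal \<theta> * hausdorff_outer k (\<phi> ` P n))" by (intro mult_left_mono g(2)) simp
    finally show "emeasure ?D (P n) \<le> ennreal (\<theta> * \<theta>) * emeasure H (\<phi> ` P n)"
      by (simp only: tt mult.assoc emeasure_hausdorff[OF im])
  qed
  also have "\<dots> = ennreal (\<theta> * \<theta>) * emeasure H (\<Union>n. \<phi> ` P n)"
  proof -
    \<comment> \<open>The upper bound needed only subadditivity. The lower one adds up the images of
      the pieces and so depends on their measurability and, through injectivity of \<phi>, on their
      disjointness.\<close>
    have "disjoint_family (\<lambda>n. \<phi> ` P n)"
      unfolding disjoint_family_on_def
    proof (intro ballI impI)
      fix m n :: nat assume "m \<noteq> n"
      then have "P m \<inter> P n = {}" using disj by (auto simp: disjoint_family_on_def)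
      moreover have "P m \<subseteq> U" "P n \<subseteq> U" using PB B(2) S_U by blast+
      ultimately show "\<phi> ` P m \<inter> \<phi> ` P n = {}" using inj_on_image_Int[OF inj_on_U] by (metis image_empty)
    qed
    then show ?thesis using im by (simp only: ennreal_suminf_cmult) (subst suminf_emeasure, auto)
  qed
  also have "\<dots> \<le> ennreal (\<theta> * \<theta>) * hausdorff_outer k (\<phi> ` B)"
  proof (intro mult_left_mono)
    have "emeasure H (\<Union>n. \<phi> ` P n) = hausdorff_outer k (\<Union>n. \<phi> ` P n)"
      by (rule emeasure_hausdorff, rule sets.countable_UN) (use im in blast)
    also have "\<dots> \<le> hausdorff_outer k (\<phi> ` B)" using PB by (intro hausdorff_outer_mono) blast
    finally show "emeasure H (\<Union>n. \<phi> ` P n) \<le> hausdorff_outer k (\<phi> ` B)" .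
  qed simp
  finally show "emeasure ?D B \<le> ennreal (\<theta> * \<theta>) * hausdorff_outer k (\<phi> ` B)" .
qed

theorem area_formula:
  assumes B: "B \<in> sets H" "B \<subseteq> S"
  shows "hausdorff_outer k (\<phi> ` B) = emeasure (density H J) B"
proof -
  \<comment> \<open>The approximate formula carries the factor \<open>\<theta> * \<theta>\<close>,
    hence \<open>\<theta> = sqrt t\<close>.\<close>
  have sq: "1 < sqrt t" "sqrt t * sqrt t = t" if "1 < t" for t :: real using that by auto
  show ?thesis
  proof (rule antisym; rule ennreal_le_all_factors)
    fix t :: real assume t: "1 < t"
    show "hausdorff_outer k (\<phi> ` B) \<le> ennreal t * emeasure (density H J) B"
      using area_formula_approx(1)[OF sq(1)[OF t] B] sq(2)[OF t] by simp
    show "emeasure (density H J) B \<le> ennreal t * hausdorff_outer k (\<phi> ` B)"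
      using area_formula_approx(2)[OF sq(1)[OF t] B] sq(2)[OF t] by simp
  qed
qed

end

subsection \<open>Change of variables for Hausdorff integrals\<close>

text \<open>Preimages under \<phi> are images under \<psi>, so measurability of one map follows from
  the other preserving measurable sets.\<close>

lemma measurable_hausdorff_inverse_image:
  assumes inv: "\<And>x. x \<in> S \<Longrightarrow> \<psi> (\<phi> x) = x"
    and im: "\<And>X. X \<in> sets (hausdorff_measure k) \<Longrightarrow> X \<subseteq> \<phi> ` S \<Longrightarrow> \<psi> ` X \<in> sets (hausdorff_measure k)"
    and S: "S \<in> sets (hausdorff_measure k)" "\<phi> ` S \<in> sets (hausdorff_measure k)"
  shows "\<phi> \<in> measurable (restrict_space (hausdorff_measure k) S) (restrict_space (hausdorff_measure k) (\<phi> ` S))"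
proof (rule measurableI)
  fix X assume "X \<in> sets (restrict_space (hausdorff_measure k) (\<phi> ` S))"
  then have X: "X \<in> sets (hausdorff_measure k)" "X \<subseteq> \<phi> ` S" using S(2) by (auto simp: sets_restrict_space_iff)
  have "\<phi> -` X \<inter> S = \<psi> ` X"
  proof (intro set_eqI iffI)
    fix x assume "x \<in> \<phi> -` X \<inter> S"
    then show "x \<in> \<psi> ` X" using inv by (intro image_eqI[of _ _ "\<phi> x"]) auto
  next
    fix x assume "x \<in> \<psi> ` X"
    then obtain s where "s \<in> S" "\<phi> s \<in> X" "x = \<psi> (\<phi> s)" using X(2) by blast
    then show "x \<in> \<phi> -` X \<inter> S" using inv by simp
  qed
  then show "\<phi> -` X \<inter> space (restrict_space (hausdorff_measure k) S) \<in> sets (restrict_space (hausdorff_measure k) S)"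
    using im[OF X] S(1) by (simp add: space_restrict_space sets_restrict_space_iff) blast
qed (simp add: space_restrict_space)

text \<open>The area formula says that \<phi> pushes the density \<open>J\<close> on
  \<open>S\<close> forward to Hausdorff measure on the image. It is kept abstract because it serves
  the diffeomorphism, linear maps between planes, and dilations of discs.\<close>

lemma hausdorff_change_of_variables:
  fixes \<phi> \<psi> :: "'a::euclidean_space \<Rightarrow> 'a" and h :: "'a \<Rightarrow> real"
  assumes inv: "\<And>x. x \<in> S \<Longrightarrow> \<psi> (\<phi> x) = x"
    and S: "S \<in> sets (hausdorff_measure k)"
    and im: "\<And>B. B \<in> sets (hausdorff_measure k) \<Longrightarrow> B \<subseteq> S \<Longrightarrow> \<phi> ` B \<in> sets (hausdorff_measure k)"
    and im': "\<And>X. X \<in> sets (hausdorff_measure k) \<Longrightarrow> X \<subseteq> \<phi> ` S \<Longrightarrow> \<psi> ` X \<in> sets (hausdorff_measure k)"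
    and J: "J \<in> borel_measurable (hausdorff_measure k)" "\<And>x. 0 \<le> J x"
    and area: "\<And>B. B \<in> sets (hausdorff_measure k) \<Longrightarrow> B \<subseteq> S \<Longrightarrow>
       hausdorff_outer k (\<phi> ` B) = emeasure (density (hausdorff_measure k) (\<lambda>x. ennreal (J x))) B"
    and h: "(\<lambda>x. h (\<phi> x)) \<in> borel_measurable (restrict_space (hausdorff_measure k) S)"
  shows "set_lebesgue_integral (hausdorff_measure k) (\<phi> ` S) h
     = set_lebesgue_integral (hausdorff_measure k) S (\<lambda>x. J x * h (\<phi> x))"
proof -
  let ?H = "hausdorff_measure k :: 'a measure"
  let ?M = "restrict_space ?H S" let ?N = "restrict_space ?H (\<phi> ` S)"
  have \<phi>S: "\<phi> ` S \<in> sets ?H" using im S by blast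
  have m\<phi>: "\<phi> \<in> measurable ?M ?N" by (rule measurable_hausdorff_inverse_image[OF inv im' S \<phi>S])
  have \<psi>\<phi>S: "\<psi> ` \<phi> ` S = S" using inv by (simp add: image_image)
  have m\<psi>: "\<psi> \<in> measurable ?N ?M"
  proof -
    have r: "\<And>y. y \<in> \<phi> ` S \<Longrightarrow> \<phi> (\<psi> y) = y" using inv by auto
    show ?thesis
      using measurable_hausdorff_inverse_image[of "\<phi> ` S" \<phi> \<psi> k, OF r] im S \<phi>S unfolding \<psi>\<phi>S by blast
  qed
  have J': "J \<in> borel_measurable ?M" by (rule measurable_restrict_space1[OF J(1)])
  have N: "distr (density ?M (\<lambda>x. ennreal (J x))) ?N \<phi> = ?N"
  proof (rule measure_eqI)
    fix X assume "X \<in> sets (distr (density ?M (\<lambda>x. ennreal (J x))) ?N \<phi>)"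
    then have XN: "X \<in> sets ?N" by simp
    then have X: "X \<in> sets ?H" "X \<subseteq> \<phi> ` S" using \<phi>S by (auto simp: sets_restrict_space_iff)
    let ?B = "\<phi> -` X \<inter> S"
    have "?B \<in> sets ?M" using measurable_sets[OF m\<phi> XN] by (simp add: space_restrict_space)
    then have B: "?B \<in> sets ?H" "?B \<subseteq> S" using S by (auto simp: sets_restrict_space_iff)
    have XB: "\<phi> ` ?B = X" using X(2) by blast
    have "emeasure (distr (density ?M (\<lambda>x. ennreal (J x))) ?N \<phi>) X = emeasure (density ?M (\<lambda>x. ennreal (J x))) ?B"
      using m\<phi> XN by (subst emeasure_distr) (auto simp: space_restrict_space)
    also have "\<dots> = (\<integral>\<^sup>+x. ennreal (J x) * indicator ?B x \<partial>?M)"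
      using J' \<open>?B \<in> sets ?M\<close> by (intro emeasure_density) auto
    also have "\<dots> = (\<integral>\<^sup>+x. (ennreal (J x) * indicator ?B x) * indicator S x \<partial>?H)"
      using S by (intro nn_integral_restrict_space) auto
    also have "\<dots> = (\<integral>\<^sup>+x. ennreal (J x) * indicator ?B x \<partial>?H)"
      by (intro nn_integral_cong) (auto simp: indicator_def)
    also have "\<dots> = emeasure (density ?H (\<lambda>x. ennreal (J x))) ?B"
      using J(1) B(1) by (intro emeasure_density[symmetric]) auto
    also have "\<dots> = hausdorff_outer k X" using area[OF B] XB by simp
    also have "\<dots> = emeasure ?N X"
      using emeasure_hausdorff[OF X(1)] X \<phi>S by (subst emeasure_restrict_space) auto
    finally show "emeasure (distr (density ?M (\<lambda>x. ennreal (J x))) ?N \<phi>) X = emeasure ?N X" .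
  qed simp
  \<comment> \<open>Measurability is assumed for the composite with \<phi> only; composing once more
    with \<psi> returns \<open>h\<close> on the image.\<close>
  have hN: "h \<in> borel_measurable ?N"
  proof -
    have "(\<lambda>y. h (\<phi> (\<psi> y))) \<in> borel_measurable ?N" by (rule measurable_compose[OF m\<psi> h])
    moreover have "(\<lambda>y. h (\<phi> (\<psi> y))) \<in> borel_measurable ?N \<longleftrightarrow> h \<in> borel_measurable ?N"
    proof (rule measurable_cong)
      fix y assume "y \<in> space ?N"
      then have "y \<in> \<phi> ` S" by (simp add: space_restrict_space)
      then show "h (\<phi> (\<psi> y)) = h y" using inv by auto
    qed
    ultimately show ?thesis by blast
  qed
  have "set_lebesgue_integral ?H (\<phi> ` S) h = integral\<^sup>L ?N h"
    unfolding set_lebesgue_integral_def using \<phi>S by (intro integral_restrict_space[symmetric]) auto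
  also have "\<dots> = integral\<^sup>L (distr (density ?M (\<lambda>x. ennreal (J x))) ?N \<phi>) h" by (simp only: N)
  also have "\<dots> = (\<integral>x. h (\<phi> x) \<partial>density ?M (\<lambda>x. ennreal (J x)))"
    using m\<phi> hN by (intro integral_distr) auto
  also have "\<dots> = (\<integral>x. J x *\<^sub>R h (\<phi> x) \<partial>?M)"
    using J' J(2) h by (intro integral_density) auto
  also have "\<dots> = set_lebesgue_integral ?H S (\<lambda>x. J x * h (\<phi> x))"
    unfolding set_lebesgue_integral_def using S by (subst integral_restrict_space) auto
  finally show ?thesis .
qed

context C1_tangent
begin

lemma image_S_finite: "hausdorff_outer k (\<phi> ` S) < \<infinity>"
  by (rule image_finite[OF S(2) S_K])

lemma inverse_sub_measurable:
  assumes "X \<in> sets H" "X \<subseteq> \<phi> ` S" shows "\<psi> ` X \<in> sets H"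
proof -
  interpret inv: C1_pair W U "\<phi> ` K" \<psi> \<phi> \<psi>' \<phi>' by (rule swap)
  show ?thesis
    using assms image_S_finite S_K hausdorff_outer_mono[of X "\<phi> ` S" k]
    by (intro inv.image_measurable) (auto intro: le_less_trans)
qed

lemma S_left_inverse: "x \<in> S \<Longrightarrow> \<psi> (\<phi> x) = x"
  using left_inverse S_U by blast

lemma change_of_variables:
  assumes "(\<lambda>x. h (\<phi> x)) \<in> borel_measurable (restrict_space H S)"
  shows "set_lebesgue_integral H (\<phi> ` S) h = set_lebesgue_integral H S (\<lambda>x. J x * h (\<phi> x))"
  by (rule hausdorff_change_of_variables[where \<psi>=\<psi>])
    (use S_left_inverse S(1) sub_measurable inverse_sub_measurable J_nonneg area_formula assms in auto)

lemma measurable_inverse: "\<psi> \<in> measurable (restrict_space H (\<phi> ` S)) (restrict_space H S)"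
proof -
  have e: "\<psi> ` \<phi> ` S = S" using S_left_inverse by (simp add: image_image)
  have r: "\<And>y. y \<in> \<phi> ` S \<Longrightarrow> \<phi> (\<psi> y) = y" using S_left_inverse by auto
  show ?thesis
    using measurable_hausdorff_inverse_image[of "\<phi> ` S" \<phi> \<psi> k, OF r] sub_measurable S(1)
    unfolding e by blast
qed

end

subsection \<open>Densities of subsets\<close>

lemma hausdorff_pre_countable_cover:
  fixes C :: "'i \<Rightarrow> 'a::euclidean_space set"
  assumes I: "countable I" and A: "A \<subseteq> (\<Union>i\<in>I. C i)" and \<delta>: "0 \<le> \<delta>"
    and C: "\<And>i. i \<in> I \<Longrightarrow> bounded (C i) \<and> diameter (C i) \<le> \<delta>"
  shows "hausdorff_pre k \<delta> A \<le> (\<integral>\<^sup>+i. hausdorff_weight k (C i) \<partial>count_space I)"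
proof -
  define n where "n = to_nat_on I"
  have n: "inj_on n I" unfolding n_def using I by (rule inj_on_to_nat_on)
  define D where "D = (\<lambda>m. if m \<in> n ` I then C (inv_into I n m) else {})"
  have Dn: "D (n i) = C i" if "i \<in> I" for i using that n by (simp add: D_def)
  have "A \<subseteq> (\<Union>m. D m)"
  proof
    fix x assume "x \<in> A"
    then obtain i where i: "i \<in> I" "x \<in> C i" using A by blast
    then have "x \<in> D (n i)" using Dn by simp
    then show "x \<in> (\<Union>m. D m)" by blast
  qed
  moreover have "bounded (D m) \<and> diameter (D m) \<le> \<delta>" for m
  proof (cases "m \<in> n ` I")
    case True
    then have "inv_into I n m \<in> I" by (rule inv_into_into)
    then show ?thesis using C True by (simp add: D_def)
  qed (use \<delta> in \<open>simp add: D_def\<close>)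
  ultimately have "delta_cover \<delta> A D" unfolding delta_cover_def by blast
  then have "hausdorff_pre k \<delta> A \<le> (\<Sum>m. hausdorff_weight k (D m))" by (rule hausdorff_pre_le)
  also have "\<dots> = (\<integral>\<^sup>+m. hausdorff_weight k (D m) \<partial>count_space UNIV)" by (rule nn_integral_count_space_nat[symmetric])
  also have "\<dots> = (\<integral>\<^sup>+m. hausdorff_weight k (D m) \<partial>count_space (n ` I))"
    by (rule nn_integral_count_space_eq) (auto simp: D_def)
  also have "\<dots> = (\<integral>\<^sup>+i. hausdorff_weight k (D (n i)) \<partial>count_space I)"
    by (rule nn_integral_bij_count_space[symmetric]) (use n in \<open>simp add: bij_betw_def\<close>)
  also have "\<dots> = (\<integral>\<^sup>+i. hausdorff_weight k (C i) \<partial>count_space I)"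
    by (rule nn_integral_cong) (simp add: Dn)
  finally show ?thesis .
qed

text \<open>\<open>R\<close> has no mass off \<open>G\<close>, so by outer regularity
  \<open>- G\<close> lies in an open \<open>V\<close> carrying little of it. Around points of
  \<open>D\<close> there are balls inside \<open>V\<close> with mass above \<open>t * r ^ k\<close>;
  Vitali selects disjoint ones whose fivefold enlargements cover \<open>D\<close>, and their weights
  are paid for by the mass of \<open>V\<close>.\<close>

lemma upper_density_null:
  fixes R D :: "'a::euclidean_space set"
  assumes R: "R \<in> sets (hausdorff_measure k)" "hausdorff_outer k R < \<infinity>" and G: "G \<in> sets borel" "R \<subseteq> G" "D \<inter> G = {}"
    and t: "0 < t" and dens: "\<And>x \<delta>. x \<in> D \<Longrightarrow> 0 < \<delta> \<Longrightarrow> \<exists>r. 0 < r \<and> r < \<delta> \<and> t * r ^ k < measure (hausdorff_measure k) (R \<inter> ball x r)"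
  shows "hausdorff_outer k D = 0"
proof -
  let ?\<rho> = "hausdorff_on k R"
  have \<rho>: "emeasure ?\<rho> X = hausdorff_outer k (R \<inter> X)" if "X \<in> sets borel" for X
    by (rule emeasure_hausdorff_on[OF R(1) that])
  have Gc: "- G \<in> sets borel" using G(1) by simp
  have "R \<inter> - G = {}" using G(2) by blast
  then have z: "emeasure ?\<rho> (- G) = 0" using \<rho>[OF Gc] by simp
  have fin: "emeasure ?\<rho> (space ?\<rho>) \<noteq> \<infinity>" using \<rho>[of UNIV] R(2) by simp
  have inf: "emeasure ?\<rho> (- G) = (INF V\<in>{V. - G \<subseteq> V \<and> open V}. emeasure ?\<rho> V)"
    by (rule outer_regular[OF _ fin Gc]) simp
  \<comment> \<open>A ball of radius \<open>5 * r\<close> has weight at most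
    \<open>unit_ball_vol k * (5 * r) ^ k\<close>, and \<open>r ^ k\<close> costs
    \<open>1 / t\<close> times the mass in the ball of radius \<open>r\<close>.\<close>
  define c where "c = unit_ball_vol (real k) * 5 ^ k / t"
  have c: "0 \<le> c" using t by (simp add: c_def)
  have pre: "hausdorff_pre k \<delta> D \<le> ennreal c * ennreal \<eta>" if \<delta>: "0 < \<delta>" and \<eta>: "0 < \<eta>" for \<delta> \<eta> :: real
  proof -
    have "\<exists>V\<in>{V. - G \<subseteq> V \<and> open V}. emeasure ?\<rho> V < emeasure ?\<rho> (- G) + ennreal \<eta>"
      by (rule INF_approx_ennreal[OF \<eta> inf]) (use z in simp)
    then obtain V where V: "- G \<subseteq> V" "open V" "emeasure ?\<rho> V < ennreal \<eta>" using z by auto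
    \<comment> \<open>The bound \<open>\<delta> / 10\<close> keeps the diameter of the enlarged
      balls below \<delta>.\<close>
    define I where "I = {(x, r). x \<in> D \<and> 0 < r \<and> r < \<delta> / 10 \<and> ball x r \<subseteq> V \<and> t * r ^ k < measure (hausdorff_measure k) (R \<inter> ball x r)}"
    have cov: "D \<subseteq> (\<Union>i\<in>I. ball (fst i) (snd i))"
    proof
      fix x assume x: "x \<in> D"
      then have "x \<in> V" using V(1) G(3) by blast
      then obtain e where e: "0 < e" "ball x e \<subseteq> V" using V(2) open_contains_ball by blast
      obtain r where r: "0 < r" "r < min e (\<delta> / 10)" "t * r ^ k < measure (hausdorff_measure k) (R \<inter> ball x r)"
        using dens[OF x, of "min e (\<delta> / 10)"] e(1) \<delta> by auto
      have "ball x r \<subseteq> V" using r(2) e(2) by (meson min_less_iff_conj less_imp_le order_trans subset_ball)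
      then have "(x, r) \<in> I" using x r by (simp add: I_def)
      then show "x \<in> (\<Union>i\<in>I. ball (fst i) (snd i))" using r(1) by (intro UN_I[of "(x, r)"]) auto
    qed
    have Ir: "0 < snd i \<and> snd i \<le> \<delta>" if "i \<in> I" for i using that \<delta> by (auto simp: I_def)
    obtain C where C: "countable C" "C \<subseteq> I" "pairwise (\<lambda>i j. disjnt (ball (fst i) (snd i)) (ball (fst j) (snd j))) C"
      "D \<subseteq> (\<Union>i\<in>C. ball (fst i) (5 * snd i))"
      by (rule Vitali_covering_lemma_balls[OF cov Ir])
    have CI: "0 < snd i" "snd i < \<delta> / 10" "ball (fst i) (snd i) \<subseteq> V"
      "t * snd i ^ k < measure (hausdorff_measure k) (R \<inter> ball (fst i) (snd i))" if "i \<in> C" for i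
      using subsetD[OF C(2) that] unfolding I_def by (simp_all add: case_prod_unfold)
    have dia: "diameter (ball (fst i) (5 * snd i)) \<le> 10 * snd i" if "i \<in> C" for i :: "'a \<times> real"
    proof (rule diameter_le)
      show "ball (fst i) (5 * snd i) \<noteq> {} \<or> 0 \<le> 10 * snd i" using CI(1)[OF that] by simp
      fix x y assume "x \<in> ball (fst i) (5 * snd i)" "y \<in> ball (fst i) (5 * snd i)"
      then show "norm (x - y) \<le> 10 * snd i"
        using dist_triangle[of x y "fst i"] by (simp add: dist_norm norm_minus_commute)
    qed
    have "hausdorff_pre k \<delta> D \<le> (\<integral>\<^sup>+i. hausdorff_weight k (ball (fst i) (5 * snd i)) \<partial>count_space C)"
    proof (rule hausdorff_pre_countable_cover[OF C(1,4)])
      fix i assume i: "i \<in> C"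
      show "bounded (ball (fst i) (5 * snd i)) \<and> diameter (ball (fst i) (5 * snd i)) \<le> \<delta>"
        using dia[OF i] CI(2)[OF i] by simp
    qed (use \<delta> in simp)
    also have "\<dots> \<le> (\<integral>\<^sup>+i. ennreal c * emeasure ?\<rho> (ball (fst i) (snd i)) \<partial>count_space C)"
    proof (rule nn_integral_mono)
      fix i assume "i \<in> space (count_space C)"
      then have i: "i \<in> C" by simp
      let ?r = "snd i" let ?m = "measure (hausdorff_measure k) (R \<inter> ball (fst i) ?r)"
      have "diameter (ball (fst i) (5 * ?r)) ^ k \<le> (10 * ?r) ^ k"
        by (intro power_mono dia[OF i] diameter_ge_0 bounded_ball)
      then have "unit_ball_vol (real k) / 2 ^ k * diameter (ball (fst i) (5 * ?r)) ^ k \<le> unit_ball_vol (real k) / 2 ^ k * (10 * ?r) ^ k"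
        by (intro mult_left_mono) auto
      also have "\<dots> = unit_ball_vol (real k) * 5 ^ k * ?r ^ k"
      proof -
        have "10 * ?r = 2 * (5 * ?r)" by simp
        then have eq: "(10 * ?r) ^ k = 2 ^ k * (5 ^ k * ?r ^ k)" by (simp only: power_mult_distrib)
        have "u / 2 ^ k * (2 ^ k * (5 ^ k * ?r ^ k)) = u * 5 ^ k * ?r ^ k" for u :: real by (simp add: field_simps)
        then show ?thesis unfolding eq .
      qed
      also have "\<dots> = c * (t * ?r ^ k)" using t by (simp add: c_def)
      also have "\<dots> \<le> c * ?m" using CI(4)[OF i] c by (intro mult_left_mono) auto
      finally have le: "unit_ball_vol (real k) / 2 ^ k * diameter (ball (fst i) (5 * ?r)) ^ k \<le> c * ?m" .
      have Rb: "R \<inter> ball (fst i) ?r \<in> sets (hausdorff_measure k)" by (intro sets.Int R(1) borel_hausdorffD) simp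
      have "hausdorff_outer k (R \<inter> ball (fst i) ?r) < \<infinity>"
        using hausdorff_outer_mono[of "R \<inter> ball (fst i) ?r" R k] R(2) by (auto intro: le_less_trans)
      then have "ennreal ?m = emeasure ?\<rho> (ball (fst i) ?r)"
        using \<rho>[of "ball (fst i) ?r"] measure_hausdorff[OF Rb] by (simp add: less_top[symmetric])
      then have eq: "ennreal (c * ?m) = ennreal c * emeasure ?\<rho> (ball (fst i) ?r)" using c by (simp add: ennreal_mult')
      then show "hausdorff_weight k (ball (fst i) (5 * ?r)) \<le> ennreal c * emeasure ?\<rho> (ball (fst i) ?r)"
      proof -
        have "hausdorff_weight k (ball (fst i) (5 * ?r)) \<le> ennreal (unit_ball_vol (real k) / 2 ^ k * diameter (ball (fst i) (5 * ?r)) ^ k)"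
          unfolding hausdorff_weight_def by (split if_split) (simp only: zero_le order_refl simp_thms)
        also note ennreal_leI[OF le]
        finally show ?thesis using eq by simp
      qed
    qed
    also have "\<dots> = ennreal c * (\<integral>\<^sup>+i. emeasure ?\<rho> (ball (fst i) (snd i)) \<partial>count_space C)"
      by (rule nn_integral_cmult) simp
    also have "(\<integral>\<^sup>+i. emeasure ?\<rho> (ball (fst i) (snd i)) \<partial>count_space C) = emeasure ?\<rho> (\<Union>i\<in>C. ball (fst i) (snd i))"
    proof (rule emeasure_UN_countable[symmetric])
      show "disjoint_family_on (\<lambda>i. ball (fst i) (snd i)) C"
        using C(3) by (auto simp: disjoint_family_on_def pairwise_def disjnt_def)
    qed (use C(1) in auto)
    also have "\<dots> \<le> emeasure ?\<rho> V" using CI(3) V(2) by (intro emeasure_mono) auto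
    also have "\<dots> \<le> ennreal \<eta>" using V(3) by simp
    finally show ?thesis by (simp add: mult_left_mono)
  qed
  have "hausdorff_pre k \<delta> D \<le> 0" if \<delta>: "0 < \<delta>" for \<delta>
  proof (rule ennreal_le_epsilon)
    fix e :: real assume e: "0 < e"
    have "hausdorff_pre k \<delta> D \<le> ennreal c * ennreal (e / (c + 1))" using e c by (intro pre \<delta>) simp
    also have "\<dots> = ennreal (c * (e / (c + 1)))" using e c by (intro ennreal_mult[symmetric]) simp_all
    also have "\<dots> \<le> ennreal e" using e c by (intro ennreal_leI) (simp add: field_simps)
    finally show "hausdorff_pre k \<delta> D \<le> 0 + ennreal e" by simp
  qed
  then have "hausdorff_outer k D \<le> 0" by (rule hausdorff_outer_least)
  then show ?thesis by simp
qed

text \<open>\<open>upper_density_null\<close> is applied to \<open>S - A\<close> with thresholds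
  \<open>1 / Suc n\<close>, at points outside a Borel hull \<open>G\<close> of \<open>S - A\<close>.
  The points of \<open>A\<close> inside the hull form a null set.\<close>

lemma complement_density_zero:
  fixes S A :: "'a::euclidean_space set"
  assumes S: "S \<in> sets (hausdorff_measure k)" "hausdorff_outer k S < \<infinity>" and A: "A \<in> sets (hausdorff_measure k)"
  shows "AE x in hausdorff_measure k. x \<in> A \<inter> S \<longrightarrow>
     ((\<lambda>r. measure (hausdorff_measure k) ((S - A) \<inter> ball x r) / r ^ k) \<longlongrightarrow> 0) (at_right 0)"
proof -
  let ?R = "S - A"
  let ?m = "\<lambda>x r. measure (hausdorff_measure k) (?R \<inter> ball x r)"
  have R: "?R \<in> sets (hausdorff_measure k)" using S(1) A by auto
  have Rfin: "hausdorff_outer k ?R < \<infinity>" using hausdorff_outer_mono[of ?R S k] S(2) by (auto intro: le_less_trans)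
  obtain G where G: "G \<in> sets borel" "?R \<subseteq> G" "hausdorff_outer k G = hausdorff_outer k ?R"
    using hausdorff_borel_hull[OF Rfin] .
  have GR: "hausdorff_outer k (G - ?R) = 0" by (rule hausdorff_diff_null[OF R G(2,3) Rfin])
  define D where "D = (\<lambda>n::nat. {x \<in> A \<inter> S - G. \<forall>\<delta>>0. \<exists>r. 0 < r \<and> r < \<delta> \<and> (1 / Suc n) * r ^ k < ?m x r})"
  have Dn: "hausdorff_outer k (D n) = 0" for n
    by (rule upper_density_null[OF R Rfin G(1,2), of _ "1 / Suc n"]) (auto simp: D_def)
  have sub: "{x. \<not> (x \<in> A \<inter> S \<longrightarrow> ((\<lambda>r. ?m x r / r ^ k) \<longlongrightarrow> 0) (at_right 0))} \<subseteq> (G - ?R) \<union> (\<Union>n. D n)"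
  proof
    fix x assume "x \<in> {x. \<not> (x \<in> A \<inter> S \<longrightarrow> ((\<lambda>r. ?m x r / r ^ k) \<longlongrightarrow> 0) (at_right 0))}"
    then have x: "x \<in> A \<inter> S" "\<not> ((\<lambda>r. ?m x r / r ^ k) \<longlongrightarrow> 0) (at_right 0)" by auto
    show "x \<in> (G - ?R) \<union> (\<Union>n. D n)"
    proof (rule ccontr)
      assume n: "x \<notin> (G - ?R) \<union> (\<Union>n. D n)"
      then have xG: "x \<notin> G" using x(1) by blast
      have "((\<lambda>r. ?m x r / r ^ k) \<longlongrightarrow> 0) (at_right 0)"
      proof (rule tendstoI)
        fix e :: real assume "0 < e"
        then obtain n :: nat where ne: "1 / Suc n < e" using nat_approx_posE by blast
        have "x \<notin> D n" using n by blast
        then have "\<exists>\<delta>>0. \<forall>r. 0 < r \<longrightarrow> r < \<delta> \<longrightarrow> ?m x r \<le> (1 / Suc n) * r ^ k"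
          using x(1) xG unfolding D_def mem_Collect_eq Diff_iff by (meson not_less)
        then obtain \<delta> where \<delta>: "0 < \<delta>" "\<And>r. 0 < r \<Longrightarrow> r < \<delta> \<Longrightarrow> ?m x r \<le> (1 / Suc n) * r ^ k" by blast
        have "eventually (\<lambda>r. r \<in> {0<..<\<delta>}) (at_right 0)" by (rule eventually_at_right_real[OF \<delta>(1)])
        then show "eventually (\<lambda>r. dist (?m x r / r ^ k) 0 < e) (at_right 0)"
        proof eventually_elim
          case (elim r)
          then have "?m x r / r ^ k \<le> 1 / Suc n" using \<delta>(2)[of r] by (simp add: field_simps)
          moreover have "0 \<le> ?m x r / r ^ k" using elim by simp
          ultimately show ?case using ne by (simp only: dist_real_def abs_of_nonneg diff_zero)
        qed
      qed
      then show False using x(2) by contradiction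
    qed
  qed
  show ?thesis unfolding AE_hausdorff_iff
    by (rule hausdorff_outer_null_subset[OF hausdorff_outer_Un_null[OF GR hausdorff_outer_null_UN[OF Dn]] sub])
qed

lemma hausdorff_set_integral_le_sum:
  assumes S: "S \<in> sets (hausdorff_measure k)" "hausdorff_outer k S < \<infinity>"
    and F: "F \<in> borel_measurable (hausdorff_measure k)"
    and h: "h \<in> borel_measurable (hausdorff_measure k)" "\<And>x. \<bar>h x\<bar> \<le> (c::real)"
    and D: "D \<in> sets (hausdorff_measure k)" and ab: "0 \<le> a" "0 \<le> b"
    and le: "\<And>x. x \<in> S \<Longrightarrow> \<bar>F x\<bar> \<le> a * indicator D x + b * h x"
  shows "\<bar>set_lebesgue_integral (hausdorff_measure k) S F\<bar>
    \<le> a * measure (hausdorff_measure k) (S \<inter> D) + b * set_lebesgue_integral (hausdorff_measure k) S h"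
proof -
  let ?H = "hausdorff_measure k"
  have SD: "S \<inter> D \<in> sets ?H" "emeasure ?H (S \<inter> D) < \<infinity>"
    using S D emeasure_hausdorff[of "S \<inter> D" k] hausdorff_outer_mono[of "S \<inter> D" S k] by (auto intro: le_less_trans)
  have i1: "integrable ?H (\<lambda>x. a * indicator (S \<inter> D) x)" using SD by simp
  have i2: "integrable ?H (\<lambda>x. indicator S x *\<^sub>R h x)"
    using hausdorff_set_integrable[OF S h(1), of c] h(2) unfolding set_integrable_def by blast
  have "\<bar>F x\<bar> \<le> a + b * c" if "x \<in> S" for x
  proof -
    have "h x \<le> c" using h(2)[of x] by linarith
    then have "b * h x \<le> b * c" using ab by (intro mult_left_mono)
    moreover have "a * indicator D x \<le> a" using ab by (auto simp: indicator_def)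
    ultimately show ?thesis using le[OF that] by linarith
  qed
  then have i3: "integrable ?H (\<lambda>x. indicator S x *\<^sub>R F x)"
    using hausdorff_set_integrable[OF S F, of "a + b * c"] unfolding set_integrable_def by blast
  have "\<bar>set_lebesgue_integral ?H S F\<bar> \<le> (\<integral>x. norm (indicator S x *\<^sub>R F x) \<partial>?H)"
    unfolding set_lebesgue_integral_def using integral_norm_bound[of ?H "\<lambda>x. indicator S x *\<^sub>R F x"] by simp
  also have "\<dots> \<le> (\<integral>x. a * indicator (S \<inter> D) x + b * (indicator S x *\<^sub>R h x) \<partial>?H)"
  proof (intro integral_mono integrable_norm i3 Bochner_Integration.integrable_add i1 integrable_mult_right i2)
    fix x show "norm (indicator S x *\<^sub>R F x) \<le> a * indicator (S \<inter> D) x + b * (indicator S x *\<^sub>R h x)"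
      using le[of x] by (cases "x \<in> S") (auto simp: indicator_def)
  qed
  also have "\<dots> = (\<integral>x. a * indicator (S \<inter> D) x \<partial>?H) + (\<integral>x. b * (indicator S x *\<^sub>R h x) \<partial>?H)"
    by (intro Bochner_Integration.integral_add i1 integrable_mult_right i2)
  also have "\<dots> = a * measure ?H (S \<inter> D) + b * set_lebesgue_integral ?H S h"
    using SD by (simp add: set_lebesgue_integral_def)
  finally show ?thesis .
qed

lemma hausdorff_set_integral_indicator:
  assumes S: "S \<in> sets (hausdorff_measure k)" and D: "D \<in> sets (hausdorff_measure k)"
  shows "set_lebesgue_integral (hausdorff_measure k) S (indicator D) = measure (hausdorff_measure k) (S \<inter> D)"
proof -
  have "(\<lambda>x. indicator S x *\<^sub>R (indicator D x :: real)) = indicator (S \<inter> D)"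
    by (rule ext) (auto simp: indicator_def)
  then show ?thesis using S D by (simp add: set_lebesgue_integral_def)
qed

text \<open>\<open>S\<close> is cut into the level bands \<open>A n m\<close> of \<open>J\<close>.
  At almost every point of a band the rest of \<open>S\<close> has density zero; inside the band
  \<open>J\<close> oscillates by at most \<open>1 / Suc n\<close>, outside it by at most
  \<open>2 * M\<close>. The upper density bound from the tangent plane keeps the first error
  proportional to \<open>r ^ k\<close>.\<close>

lemma lebesgue_points:
  fixes S :: "'a::euclidean_space set"
  assumes S: "S \<in> sets (hausdorff_measure k)" "hausdorff_outer k S < \<infinity>"
    and J: "J \<in> borel_measurable (hausdorff_measure k)" "\<And>x. \<bar>J x\<bar> \<le> (M::real)" and M: "0 < M"
  shows "AE x in hausdorff_measure k. x \<in> S \<longrightarrow> (\<forall>P. approx_tangent k S x P \<longrightarrow>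
     ((\<lambda>r. set_lebesgue_integral (hausdorff_measure k) S (\<lambda>y. \<bar>J y - J x\<bar> * indicator (ball x r) y) / r ^ k) \<longlongrightarrow> 0) (at_right 0))"
proof -
  let ?H = "hausdorff_measure k :: 'a measure"
  define A where "A = (\<lambda>(n::nat) (m::int). {y. m / Suc n \<le> J y \<and> J y < (m + 1) / Suc n})"
  have Am: "A n m \<in> sets ?H" for n m
  proof -
    have "A n m = J -` {m / Suc n..<(m + 1) / Suc n} \<inter> space ?H" by (auto simp: A_def)
    also have "\<dots> \<in> sets ?H" by (rule measurable_sets[OF J(1)]) simp
    finally show ?thesis .
  qed
  have "AE x in ?H. \<forall>n m. x \<in> A n m \<inter> S \<longrightarrow>
     ((\<lambda>r. measure ?H ((S - A n m) \<inter> ball x r) / r ^ k) \<longlongrightarrow> 0) (at_right 0)"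
    unfolding AE_all_countable by (intro allI complement_density_zero S Am)
  then show ?thesis
  proof eventually_elim
    case (elim x)
    show ?case
    proof (intro impI allI)
      fix P assume x: "x \<in> S" and T: "approx_tangent k S x P"
      obtain C where C: "0 < C" "eventually (\<lambda>r. measure ?H (S \<inter> ball x r) \<le> C * r ^ k) (at_right 0)"
        using tangent_density_upper[OF S T] .
      show "((\<lambda>r. set_lebesgue_integral ?H S (\<lambda>y. \<bar>J y - J x\<bar> * indicator (ball x r) y) / r ^ k) \<longlongrightarrow> 0) (at_right 0)"
      proof (rule tendstoI)
        fix e :: real assume e: "0 < e"
        \<comment> \<open>Half of \<open>e\<close> is spent on the band,
          \<open>C / Suc n < e / 2\<close>; the other half on its complement, whose density below
          \<open>e / (4 * M)\<close> meets the oscillation \<open>2 * M\<close>.\<close>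
        have "0 < e / (2 * C)" using e C(1) by simp
        then obtain n :: nat where n: "1 / Suc n < e / (2 * C)" using nat_approx_posE by blast
        define m where "m = \<lfloor>J x * Suc n\<rfloor>"
        have "of_int m \<le> J x * Suc n" "J x * Suc n < of_int m + 1" unfolding m_def by linarith+
        then have xA: "x \<in> A n m" by (simp add: A_def field_simps)
        then have "eventually (\<lambda>r. dist (measure ?H ((S - A n m) \<inter> ball x r) / r ^ k) 0 < e / (4 * M)) (at_right 0)"
          using elim x e M by (intro tendstoD) auto
        moreover have "eventually (\<lambda>r::real. 0 < r) (at_right 0)" by (rule eventually_at_right_less)
        ultimately show "eventually (\<lambda>r. dist (set_lebesgue_integral ?H S (\<lambda>y. \<bar>J y - J x\<bar> * indicator (ball x r) y) / r ^ k) 0 < e) (at_right 0)"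
          using C(2)
        proof eventually_elim
          case (elim r)
          have rk: "0 < r ^ k" using elim by simp
          have Bm: "ball x r \<in> sets ?H" by (intro borel_hausdorffD) simp
          have BA: "ball x r - A n m \<in> sets ?H" using Bm Am by auto
          have "\<bar>set_lebesgue_integral ?H S (\<lambda>y. \<bar>J y - J x\<bar> * indicator (ball x r) y)\<bar>
            \<le> (1 / Suc n) * measure ?H (S \<inter> ball x r) + (2 * M) * set_lebesgue_integral ?H S (indicator (ball x r - A n m))"
          proof (rule hausdorff_set_integral_le_sum[OF S _ _ _ Bm, of _ _ 1])
            show "(\<lambda>y. \<bar>J y - J x\<bar> * indicator (ball x r) y) \<in> borel_measurable ?H" using J(1) Bm by measurable
            show "indicator (ball x r - A n m) \<in> borel_measurable ?H" using BA by measurable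
            fix y
            show "\<bar>\<bar>J y - J x\<bar> * indicator (ball x r) y\<bar>
              \<le> 1 / Suc n * indicator (ball x r) y + 2 * M * indicator (ball x r - A n m) y"
            proof (cases "y \<in> ball x r")
              case True
              show ?thesis
              proof (cases "y \<in> A n m")
                case yA: True
                have "(of_int m + 1) / real (Suc n) = of_int m / Suc n + 1 / Suc n" by (rule add_divide_distrib)
                then have "\<bar>J y - J x\<bar> \<le> 1 / Suc n" using yA xA unfolding A_def by (auto simp: abs_le_iff)
                then show ?thesis using True yA by simp
              next
                case False
                have "\<bar>J y - J x\<bar> \<le> 2 * M" using J(2)[of x] J(2)[of y] by linarith
                moreover have "0 \<le> 1 / real (Suc n)" by simp
                ultimately have "\<bar>J y - J x\<bar> \<le> 1 / Suc n + 2 * M" by linarith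
                then show ?thesis using True False by simp
              qed
            qed simp
          qed (use M in \<open>auto simp: indicator_def\<close>)
          also have "set_lebesgue_integral ?H S (indicator (ball x r - A n m)) = measure ?H ((S - A n m) \<inter> ball x r)"
          proof -
            have "S \<inter> (ball x r - A n m) = (S - A n m) \<inter> ball x r" by blast
            then show ?thesis using hausdorff_set_integral_indicator[OF S(1) BA] by simp
          qed
          finally have le: "\<bar>set_lebesgue_integral ?H S (\<lambda>y. \<bar>J y - J x\<bar> * indicator (ball x r) y)\<bar>
            \<le> (1 / Suc n) * measure ?H (S \<inter> ball x r) + (2 * M) * measure ?H ((S - A n m) \<inter> ball x r)" .
          have "(1 / Suc n) * measure ?H (S \<inter> ball x r) \<le> (1 / Suc n) * (C * r ^ k)"
            using elim by (intro mult_left_mono) auto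
          also have "\<dots> < e / (2 * C) * (C * r ^ k)" using n C(1) rk by (intro mult_strict_right_mono) auto
          also have "\<dots> = e / 2 * r ^ k" using C(1) by simp
          finally have 1: "(1 / Suc n) * measure ?H (S \<inter> ball x r) < e / 2 * r ^ k" .
          have "measure ?H ((S - A n m) \<inter> ball x r) / r ^ k < e / (4 * M)"
            using elim(1) by (simp only: dist_real_def diff_zero)
          then have "measure ?H ((S - A n m) \<inter> ball x r) < e / (4 * M) * r ^ k" using rk by (simp add: pos_divide_less_eq)
          then have "(2 * M) * measure ?H ((S - A n m) \<inter> ball x r) < (2 * M) * (e / (4 * M) * r ^ k)"
            using M by (intro mult_strict_left_mono) auto
          also have "\<dots> = e / 2 * r ^ k" using M by simp
          finally have 2: "(2 * M) * measure ?H ((S - A n m) \<inter> ball x r) < e / 2 * r ^ k" .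
          have "\<bar>set_lebesgue_integral ?H S (\<lambda>y. \<bar>J y - J x\<bar> * indicator (ball x r) y)\<bar> < e * r ^ k"
          proof -
            have "e / 2 * r ^ k = e * r ^ k / 2" by simp
            then show ?thesis using le 1 2 by linarith
          qed
          then show ?case using rk by (simp add: dist_real_def abs_divide pos_divide_less_eq)
        qed
      qed
    qed
  qed
qed

subsection \<open>Tangent planes of the image\<close>

text \<open>Planes have infinite measure in general, but \<open>g\<close> has bounded support: both
  integrals reduce to the bounded part \<open>S\<close> of the plane, where the change of variables
  is available.\<close>

lemma plane_linear_change:
  fixes A :: "'a::euclidean_space \<Rightarrow> 'a" and g :: "'a \<Rightarrow> real"
  assumes A: "linear A" "inj A" and f: "orthonormal_frame k f"
    and g: "continuous_on UNIV g" "bounded {v. g v \<noteq> 0}"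
  shows "set_lebesgue_integral (hausdorff_measure k) (A ` span (f ` {..<k})) g
     = jac k A f * set_lebesgue_integral (hausdorff_measure k) (span (f ` {..<k})) (\<lambda>v. g (A v))"
proof -
  let ?H = "hausdorff_measure k :: 'a measure" let ?P = "span (f ` {..<k})"
  obtain R where R: "0 < R" "\<And>v. g v \<noteq> 0 \<Longrightarrow> norm v < R" using g(2) unfolding bounded_pos_less by auto
  obtain m where m: "0 < m" "\<And>x. m * norm x \<le> norm (A x)" using linear_inj_bounded_below_pos[OF A] by blast
  obtain B where B: "0 < B" "\<And>x. norm (A x) \<le> B * norm x" using linear_bounded_pos[OF A(1)] by blast
  obtain A' where A': "linear A'" "\<And>x. A' (A x) = x"
    using linear_injective_left_inverse[OF A] by (metis comp_apply id_apply)
  have cA: "continuous_on UNIV A" using A(1) by (intro linear_continuous_on) (simp add: linear_conv_bounded_linear)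
  define S where "S = ?P \<inter> {v. norm (A v) < R}"
  have oS: "open {v. norm (A v) < R}" using cA by (intro open_Collect_less continuous_intros)
  have S: "S \<in> sets ?H" unfolding S_def using oS by (intro borel_hausdorffD sets.Int borel_closed closed_span borel_open)
  have "bounded S"
  proof (rule boundedI)
    fix v assume "v \<in> S"
    then have "m * norm v < R" using m(2)[of v] by (auto simp: S_def)
    then show "norm v \<le> R / m" using m(1) by (simp add: field_simps)
  qed
  then have Sfin: "hausdorff_outer k S < \<infinity>" by (intro plane_bounded_finite[OF f]) (auto simp: S_def)
  have im: "A ` X \<in> sets ?H" if X: "X \<in> sets ?H" "X \<subseteq> S" for X
  proof (rule Lipschitz_image_hausdorff_measurable[OF X(1), of B])
    show "hausdorff_outer k X < \<infinity>" using hausdorff_outer_mono[OF X(2)] Sfin by (auto intro: le_less_trans)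
    fix x y show "dist (A x) (A y) \<le> B * dist x y"
      using B(2)[of "x - y"] by (simp add: dist_norm linear_diff[OF A(1)])
  qed (use B in simp)
  have im': "A' ` X \<in> sets ?H" if X: "X \<in> sets ?H" "X \<subseteq> A ` S" for X
  proof (rule Lipschitz_image_hausdorff_measurable[OF X(1), of "1 / m"])
    have "hausdorff_outer k (A ` S) = ennreal (jac k A f) * hausdorff_outer k S"
      by (rule hausdorff_linear_image[OF A f]) (simp add: S_def)
    also have "\<dots> < \<infinity>" using Sfin by (simp add: ennreal_mult_less_top)
    finally show "hausdorff_outer k X < \<infinity>" using hausdorff_outer_mono[OF X(2), of k] by (auto intro: le_less_trans)
    fix x y assume "x \<in> X" "y \<in> X"
    then obtain u v where "x = A u" "y = A v" using X(2) by blast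
    then show "dist (A' x) (A' y) \<le> 1 / m * dist x y"
      using m(2)[of "u - v"] m(1) by (simp add: dist_norm linear_diff[OF A(1)] A'(2) field_simps)
  qed (use m in simp)
  have "set_lebesgue_integral ?H (A ` S) g = set_lebesgue_integral ?H S (\<lambda>x. jac k A f * g (A x))"
  proof (rule hausdorff_change_of_variables[where \<psi> = A'])
    fix X assume X: "X \<in> sets ?H" "X \<subseteq> S"
    then have "hausdorff_outer k (A ` X) = ennreal (jac k A f) * hausdorff_outer k X"
      by (intro hausdorff_linear_image[OF A f]) (auto simp: S_def)
    then show "hausdorff_outer k (A ` X) = emeasure (density ?H (\<lambda>x. ennreal (jac k A f))) X"
      using X(1) by (simp add: emeasure_density_const emeasure_hausdorff)
  next
    have "(\<lambda>x. g (A x)) \<in> borel_measurable ?H"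
      by (intro borel_measurable_hausdorffI borel_measurable_continuous_onI continuous_on_compose2[OF g(1) cA]) auto
    then show "(\<lambda>x. g (A x)) \<in> borel_measurable (restrict_space ?H S)" by (rule measurable_restrict_space1)
  qed (use A' S im im' jac_pos[OF A f] in auto)
  moreover have "set_lebesgue_integral ?H (A ` S) g = set_lebesgue_integral ?H (A ` ?P) g"
    unfolding set_lebesgue_integral_def using R(2) by (intro Bochner_Integration.integral_cong) (auto simp: indicator_def S_def)
  moreover have "set_lebesgue_integral ?H S (\<lambda>x. jac k A f * g (A x)) = set_lebesgue_integral ?H ?P (\<lambda>x. jac k A f * g (A x))"
    unfolding set_lebesgue_integral_def using R(2) by (intro Bochner_Integration.integral_cong) (auto simp: indicator_def S_def)
  ultimately show ?thesis by simp
qed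

context C1_tangent
begin

lemma measurable_image: "\<phi> \<in> measurable (restrict_space H S) (restrict_space H (\<phi> ` S))"
  by (rule measurable_hausdorff_inverse_image[where \<psi> = \<psi>])
    (use S_left_inverse inverse_sub_measurable S(1) sub_measurable in auto)

text \<open>The blow-up integral of the image becomes \<open>q r\<close>, an integral over
  \<open>S\<close> weighted by \<open>J\<close>. Freezing \<open>J\<close> at \<open>x\<close> and
  linearising \<phi> turns it into \<open>J x * p r\<close>, whose limit is given by the tangent
  plane of \<open>S\<close>. The first error is controlled at a Lebesgue point, the second by
  uniform continuity of \<open>g\<close>.\<close>

lemma image_tangent_at:
  assumes x: "x \<in> S" and T: "approx_tangent k S x (span (f x ` {..<k}))"
    and LP: "((\<lambda>r. set_lebesgue_integral H S (\<lambda>y. \<bar>J y - J x\<bar> * indicator (ball x r) y) / r ^ k) \<longlongrightarrow> 0) (at_right 0)"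
  shows "approx_tangent k (\<phi> ` S) (\<phi> x) (blinfun_apply (\<phi>' x) ` span (f x ` {..<k}))"
proof -
  let ?A = "blinfun_apply (\<phi>' x)" let ?P = "span (f x ` {..<k})"
  have xU: "x \<in> U" using x S_U by blast
  note A = linear_deriv[of x] inj_deriv[OF xU]
  have fx: "orthonormal_frame k (f x)" by (rule frame[OF x])
  have Jx: "J x = jac k ?A (f x)" using x by (simp add: J_def)
  have cA: "continuous_on UNIV ?A" by (intro continuous_intros)
  interpret inv: C1_pair W U "\<phi> ` K" \<psi> \<phi> \<psi>' \<phi>' by (rule swap)
  obtain L where L: "0 < L" and L0: "\<And>u v. u \<in> \<phi> ` K \<Longrightarrow> v \<in> \<phi> ` K \<Longrightarrow> dist (\<psi> u) (\<psi> v) \<le> L * dist u v"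
    by (rule inv.lipschitz_K) blast
  have Lw: "dist w x \<le> L * dist (\<phi> w) (\<phi> x)" if "w \<in> S" for w
    using L0[of "\<phi> w" "\<phi> x"] that x S_K S_left_inverse by auto
  obtain m where m: "0 < m" "\<And>v. m * norm v \<le> norm (?A v)" using linear_inj_bounded_below_pos[OF A] by blast
  obtain B where B: "0 < B" "\<And>v. norm (?A v) \<le> B * norm v" using linear_bounded_pos[OF A(1)] by blast
  obtain M where M: "0 < M" "\<And>y. J y \<le> M" using J_bounded by blast
  have JM: "\<bar>J y\<bar> \<le> M" for y using M(2)[of y] J_nonneg[of y] by simp
  obtain C where C: "0 < C" "eventually (\<lambda>r. measure H (S \<inter> ball x r) \<le> C * r ^ k) (at_right 0)"
    using tangent_density_upper[OF S T] .
  show ?thesis unfolding approx_tangent_def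
  proof (intro conjI allI impI)
    show "subspace (?A ` ?P)" by (intro linear_subspace_image A(1) subspace_span)
    have "dim (?A ` ?P) = dim ?P" by (rule dim_image_eq[OF A(1)]) (use A(2) in \<open>auto intro: inj_on_subset\<close>)
    then show "dim (?A ` ?P) = k" using T by (simp add: approx_tangent_def)
    fix g :: "'a \<Rightarrow> real" assume "continuous_on UNIV g \<and> bounded {y. g y \<noteq> 0}"
    then have g: "continuous_on UNIV g" "bounded {y. g y \<noteq> 0}" by auto
    obtain R where R: "0 < R" "\<And>v. g v \<noteq> 0 \<Longrightarrow> norm v < R" using g(2) unfolding bounded_pos_less by auto
    have "compact (g ` cball 0 R)" by (intro compact_continuous_image continuous_on_subset[OF g(1)]) auto
    then obtain G where G: "0 < G" "\<And>v. v \<in> cball 0 R \<Longrightarrow> \<bar>g v\<bar> \<le> G"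
      using compact_imp_bounded bounded_pos by (metis imageI real_norm_def)
    have Gb: "\<bar>g v\<bar> \<le> G" for v
      using R(2)[of v] G by (cases "g v = 0") auto
    \<comment> \<open>Outside the ball of radius \<open>R' * r\<close> both integrands vanish:
      \<open>R * L\<close> serves the image term through the Lipschitz inverse, \<open>R / m\<close>
      the linear term through the lower bound of the derivative.\<close>
    define R' where "R' = R * (L + 1 / m) + 1"
    have R': "0 < R'" "R * L \<le> R'" "R / m \<le> R'" using R(1) L m(1) by (auto simp: R'_def algebra_simps intro!: add_pos_pos)
    define q where "q = (\<lambda>r. set_lebesgue_integral H S (\<lambda>w. J w * (g ((1 / r) *\<^sub>R (\<phi> w - \<phi> x)) / r ^ k)))"
    define p where "p = (\<lambda>r. set_lebesgue_integral H S (\<lambda>w. g (?A ((1 / r) *\<^sub>R (w - x))) / r ^ k))"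
    define I where "I = set_lebesgue_integral H ?P (\<lambda>v. g (?A v))"
    have gA: "continuous_on UNIV (\<lambda>v. g (?A v))" by (rule continuous_on_compose2[OF g(1) cA]) simp
    have "bounded {v. g (?A v) \<noteq> 0}"
    proof (rule boundedI)
      fix v assume "v \<in> {v. g (?A v) \<noteq> 0}"
      then have "m * norm v < R" using R(2)[of "?A v"] m(2)[of v] by auto
      then show "norm v \<le> R / m" using m(1) by (simp add: field_simps)
    qed
    then have p: "(p \<longlongrightarrow> I) (at_right 0)"
      using T gA unfolding p_def I_def approx_tangent_def by blast
    have \<phi>m: "(\<lambda>w. h (\<phi> w)) \<in> borel_measurable (restrict_space H S)" if "h \<in> borel_measurable H" for h :: "'a \<Rightarrow> real"
      by (rule measurable_compose[OF measurable_image measurable_restrict_space1[OF that]])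
    have hm: "(\<lambda>z. g ((1 / r) *\<^sub>R (z - \<phi> x)) / r ^ k) \<in> borel_measurable H" if "0 < r" for r
    proof -
      have "continuous_on UNIV (\<lambda>z. g ((1 / r) *\<^sub>R (z - \<phi> x)))"
        by (rule continuous_on_compose2[OF g(1)]) (auto intro!: continuous_intros)
      then show ?thesis using that by (intro borel_measurable_hausdorffI borel_measurable_continuous_onI continuous_intros) auto
    qed
    have q_eq: "set_lebesgue_integral H (\<phi> ` S) (\<lambda>z. g ((1 / r) *\<^sub>R (z - \<phi> x)) / r ^ k) = q r" if "0 < r" for r
      unfolding q_def by (rule change_of_variables) (rule \<phi>m[OF hm[OF that]])
    have diff: "((\<lambda>r. q r - J x * p r) \<longlongrightarrow> 0) (at_right 0)"
    proof (rule tendstoI)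
      fix e :: real assume e: "0 < e"
      \<comment> \<open>Half of \<open>e\<close> goes to the linearisation error, which
        \<open>M\<close>, the density constant \<open>C\<close> and the rescaling factor
        \<open>R' ^ k\<close> multiply; \<open>e2\<close> below is the same for freezing the
        Jacobian, with the bound \<open>G\<close> of \<open>g\<close>. The added 1 avoids division
        by zero.\<close>
      define e1 where "e1 = e / (2 * (M * C * R' ^ k + 1))"
      have MC: "0 \<le> M * C * R' ^ k" using M C R' by simp
      have e1: "0 < e1" "M * C * R' ^ k * e1 < e / 2"
      proof -
        show "0 < e1" using e MC by (auto simp: e1_def intro!: divide_pos_pos)
        then have "M * C * R' ^ k * e1 < (M * C * R' ^ k + 1) * e1" by simp
        also have "\<dots> = e / 2" using MC by (simp add: e1_def add_nonneg_eq_0_iff divide_simps)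
        finally show "M * C * R' ^ k * e1 < e / 2" .
      qed
      have "uniformly_continuous_on (cball 0 (B * R' + 1)) g"
        by (intro compact_uniformly_continuous continuous_on_subset[OF g(1)]) auto
      then obtain d where d: "0 < d" "\<And>u v. u \<in> cball 0 (B * R' + 1) \<Longrightarrow> v \<in> cball 0 (B * R' + 1) \<Longrightarrow> dist v u < d \<Longrightarrow> dist (g v) (g u) < e1"
        using e1(1) unfolding uniformly_continuous_on_def by metis
      \<comment> \<open>Capping at 1 keeps the true increment in the ball of radius
        \<open>B * R' + 1\<close>, where uniform continuity was invoked.\<close>
      define d' where "d' = min d 1"
      have d': "0 < d'" "d' \<le> d" "d' \<le> 1" using d(1) by (auto simp: d'_def)
      have "0 < d' / (2 * R')" using d' R' by simp
      then obtain \<delta> where \<delta>: "0 < \<delta>" "linear_flat \<phi> ?A (d' / (2 * R')) (ball x \<delta>)"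
        using linear_flat_ball[OF xU] by metis
      obtain b1 where b1: "0 < b1" "\<And>s. 0 < s \<Longrightarrow> s < b1 \<Longrightarrow> measure H (S \<inter> ball x s) \<le> C * s ^ k"
        using C(2) unfolding eventually_at_right_field by auto
      let ?LP = "\<lambda>r. set_lebesgue_integral H S (\<lambda>y. \<bar>J y - J x\<bar> * indicator (ball x r) y)"
      define e2 where "e2 = e / (2 * (G * R' ^ k + 1))"
      have GR: "0 \<le> G * R' ^ k" using G R' by simp
      have e2: "0 < e2" "G * R' ^ k * e2 < e / 2"
      proof -
        show "0 < e2" using e GR by (auto simp: e2_def intro!: divide_pos_pos)
        then have "G * R' ^ k * e2 < (G * R' ^ k + 1) * e2" by simp
        also have "\<dots> = e / 2" using GR by (simp add: e2_def add_nonneg_eq_0_iff divide_simps)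
        finally show "G * R' ^ k * e2 < e / 2" .
      qed
      have "eventually (\<lambda>r. dist (?LP r / r ^ k) 0 < e2) (at_right 0)" by (rule tendstoD[OF LP e2(1)])
      then obtain b2 where b2: "0 < b2" "\<And>s. 0 < s \<Longrightarrow> s < b2 \<Longrightarrow> dist (?LP s / s ^ k) 0 < e2"
        unfolding eventually_at_right_field by auto
      have "0 < min (min b1 b2) \<delta> / R'" using b1(1) b2(1) \<delta>(1) R'(1) by simp
      then have "eventually (\<lambda>r. r \<in> {0<..<min (min b1 b2) \<delta> / R'}) (at_right 0)" by (rule eventually_at_right_real)
      then show "eventually (\<lambda>r. dist (q r - J x * p r) 0 < e) (at_right 0)"
      proof eventually_elim
        case (elim r)
        then have r: "0 < r" "R' * r < b1" "R' * r < b2" "R' * r < \<delta>"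
          using R'(1) by (auto simp: pos_less_divide_eq mult.commute)
        have rk: "0 < r ^ k" using r by simp
        let ?s = "R' * r"
        have s: "0 < ?s" using R' r by simp
        let ?v = "\<lambda>w. (1 / r) *\<^sub>R (\<phi> w - \<phi> x)" let ?u = "\<lambda>w. ?A ((1 / r) *\<^sub>R (w - x))"
        let ?F = "\<lambda>w. J w * (g (?v w) / r ^ k) - J x * (g (?u w) / r ^ k)"
        \<comment> \<open>Extension by 0: composites with \<phi> are known to be measurable only on
          \<open>S\<close>.\<close>
        let ?Fi = "\<lambda>w. if w \<in> S then ?F w else 0"
        have outside: "g (?v w) = 0" "g (?u w) = 0" if w: "w \<in> S" "w \<notin> ball x ?s" for w
        proof -
          have dw: "R' * r \<le> dist w x" using w(2) by (simp add: dist_commute)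
          show "g (?v w) = 0"
          proof (rule ccontr)
            assume "g (?v w) \<noteq> 0"
            then have "norm (?v w) < R" by (rule R(2))
            then have "dist (\<phi> w) (\<phi> x) < R * r" unfolding norm_rescale[OF r(1)] using r(1) by (simp add: dist_commute pos_divide_less_eq)
            then have "L * dist (\<phi> w) (\<phi> x) < L * (R * r)" using L by (intro mult_strict_left_mono)
            also have "L * (R * r) = R * L * r" by simp
            also have "\<dots> \<le> R' * r" using R'(2) r(1) by (intro mult_right_mono) auto
            finally show False using Lw[OF w(1)] dw by linarith
          qed
          show "g (?u w) = 0"
          proof (rule ccontr)
            assume "g (?u w) \<noteq> 0"
            then have "norm (?u w) < R" by (rule R(2))
            then have "m * norm ((1 / r) *\<^sub>R (w - x)) < R" using m(2)[of "(1 / r) *\<^sub>R (w - x)"] by linarith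
            then have "m * (dist x w / r) < R" unfolding norm_rescale[OF r(1)] .
            then have "dist x w < R / m * r" using r(1) m(1) by (simp add: field_simps)
            also have "\<dots> \<le> R' * r" using R'(3) r(1) by (intro mult_right_mono) auto
            finally show False using dw by (simp add: dist_commute)
          qed
        qed
        have inside: "\<bar>g (?v w) - g (?u w)\<bar> \<le> e1" if w: "w \<in> S" "w \<in> ball x ?s" for w
        proof -
          have dwx: "dist w x < ?s" using w(2) by (simp add: dist_commute)
          have "w \<in> ball x \<delta>" "x \<in> ball x \<delta>" using w(2) r(4) \<delta>(1) by auto
          then have "norm (\<phi> w - \<phi> x - ?A (w - x)) \<le> d' / (2 * R') * norm (w - x)"
            using \<delta>(2) unfolding linear_flat_def by blast
          also have "\<dots> \<le> d' / (2 * R') * (R' * r)"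
            using dwx d' R' by (intro mult_left_mono) (auto simp: dist_norm)
          also have "\<dots> = d' / 2 * r" using R' by simp
          finally have 1: "norm (\<phi> w - \<phi> x - ?A (w - x)) \<le> d' / 2 * r" .
          have "?v w - ?u w = (1 / r) *\<^sub>R (\<phi> w - \<phi> x - ?A (w - x))"
            by (simp only: linear_cmul[OF A(1)] scaleR_diff_right[symmetric])
          then have "norm (?v w - ?u w) = norm (\<phi> w - \<phi> x - ?A (w - x)) / r" using r(1) by (simp only: norm_scaleR) simp
          also have "\<dots> \<le> d' / 2" using 1 r(1) by (simp add: pos_divide_le_eq)
          finally have vu: "norm (?v w - ?u w) \<le> d' / 2" .
          have "norm (?u w) \<le> B * norm ((1 / r) *\<^sub>R (w - x))" by (rule B(2))
          also have "\<dots> \<le> B * R'"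
            unfolding norm_rescale[OF r(1)] using dwx r(1) B(1)
            by (intro mult_left_mono) (auto simp: dist_commute pos_divide_le_eq less_imp_le)
          finally have u: "norm (?u w) \<le> B * R'" .
          have "norm (?v w) \<le> norm (?u w) + norm (?v w - ?u w)" by (metis norm_triangle_sub)
          then have "?v w \<in> cball 0 (B * R' + 1)" "?u w \<in> cball 0 (B * R' + 1)" using u vu d' by auto
          moreover have "dist (?v w) (?u w) < d" using vu d' by (simp only: dist_norm)
          ultimately have "dist (g (?v w)) (g (?u w)) < e1" by (intro d(2))
          then show ?thesis by (simp only: dist_real_def less_imp_le)
        qed
        have Bm: "ball x ?s \<in> sets H" by (intro borel_hausdorffD) simp
        have m1: "(\<lambda>w. if w \<in> S then g (?v w) / r ^ k else 0) \<in> borel_measurable H"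
          using \<phi>m[OF hm[OF r(1)]] S(1) by (subst measurable_restrict_space_iff[symmetric]) auto
        have m2: "(\<lambda>w. g (?u w) / r ^ k) \<in> borel_measurable H"
        proof -
          have "continuous_on UNIV (\<lambda>w. g (?A ((1 / r) *\<^sub>R (w - x))))"
            by (rule continuous_on_compose2[OF gA]) (auto intro!: continuous_intros)
          then show ?thesis using r(1) by (intro borel_measurable_hausdorffI borel_measurable_continuous_onI continuous_intros) auto
        qed
        have "(\<lambda>w. J w * (if w \<in> S then g (?v w) / r ^ k else 0) - J x * (indicator S w * (g (?u w) / r ^ k))) \<in> borel_measurable H"
          using m1 m2 S(1) J_meas by measurable
        moreover have "J w * (if w \<in> S then g (?v w) / r ^ k else 0) - J x * (indicator S w * (g (?u w) / r ^ k)) = ?Fi w" for w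
          by simp
        ultimately have mF: "?Fi \<in> borel_measurable H" by simp
        have bS: "\<bar>g (?v w) / r ^ k\<bar> \<le> G / r ^ k" "\<bar>g (?u w) / r ^ k\<bar> \<le> G / r ^ k" for w
          using Gb rk by (auto simp: abs_divide divide_right_mono)
        have int1: "integrable H (\<lambda>w. indicator S w *\<^sub>R (J w * (if w \<in> S then g (?v w) / r ^ k else 0)))"
        proof -
          have "set_integrable H S (\<lambda>w. J w * (if w \<in> S then g (?v w) / r ^ k else 0))"
          proof (rule hausdorff_set_integrable[OF S, of _ "M * (G / r ^ k)"])
            show "(\<lambda>w. J w * (if w \<in> S then g (?v w) / r ^ k else 0)) \<in> borel_measurable H" using m1 J_meas by measurable
            fix w assume "w \<in> S"
            then show "\<bar>J w * (if w \<in> S then g (?v w) / r ^ k else 0)\<bar> \<le> M * (G / r ^ k)"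
              unfolding abs_mult using JM[of w] bS(1)[of w] M(1) by (intro mult_mono) auto
          qed
          then show ?thesis by (simp add: set_integrable_def)
        qed
        have int2: "integrable H (\<lambda>w. indicator S w *\<^sub>R (g (?u w) / r ^ k))"
          using hausdorff_set_integrable[OF S m2 bS(2)] by (simp add: set_integrable_def)
        have qp: "q r - J x * p r = set_lebesgue_integral H S ?Fi"
        proof -
          have "q r = (\<integral>w. indicator S w *\<^sub>R (J w * (if w \<in> S then g (?v w) / r ^ k else 0)) \<partial>H)"
            unfolding q_def set_lebesgue_integral_def by (intro Bochner_Integration.integral_cong) (auto simp: indicator_def)
          moreover have "J x * p r = (\<integral>w. J x * (indicator S w *\<^sub>R (g (?u w) / r ^ k)) \<partial>H)"
            unfolding p_def set_lebesgue_integral_def by simp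
          ultimately have "q r - J x * p r = (\<integral>w. indicator S w *\<^sub>R (J w * (if w \<in> S then g (?v w) / r ^ k else 0))
              - J x * (indicator S w *\<^sub>R (g (?u w) / r ^ k)) \<partial>H)"
            using int1 int2 by (simp only: Bochner_Integration.integral_diff[OF int1 integrable_mult_right[OF int2]])
          also have "\<dots> = set_lebesgue_integral H S ?Fi"
            unfolding set_lebesgue_integral_def by (intro Bochner_Integration.integral_cong) (auto simp: indicator_def)
          finally show ?thesis .
        qed
        have "\<bar>set_lebesgue_integral H S ?Fi\<bar> \<le> (M * e1 / r ^ k) * measure H (S \<inter> ball x ?s) + (G / r ^ k) * ?LP ?s"
        proof (rule hausdorff_set_integral_le_sum[OF S mF _ _ Bm, of _ "2 * M"])
          show "(\<lambda>y. \<bar>J y - J x\<bar> * indicator (ball x ?s) y) \<in> borel_measurable H" using J_meas Bm by measurable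
          fix y show "\<bar>\<bar>J y - J x\<bar> * indicator (ball x ?s) y\<bar> \<le> 2 * M"
            using JM[of x] JM[of y] M(1) by (auto simp: indicator_def)
        next
          fix w assume w: "w \<in> S"
          show "\<bar>?Fi w\<bar> \<le> M * e1 / r ^ k * indicator (ball x ?s) w + G / r ^ k * (\<bar>J w - J x\<bar> * indicator (ball x ?s) w)"
          proof (cases "w \<in> ball x ?s")
            case True
            have "?F w = (J w * (g (?v w) - g (?u w)) + (J w - J x) * g (?u w)) / r ^ k"
              by (simp add: algebra_simps diff_divide_distrib add_divide_distrib)
            then have "\<bar>?F w\<bar> = \<bar>J w * (g (?v w) - g (?u w)) + (J w - J x) * g (?u w)\<bar> / r ^ k"
              using rk by (simp only: abs_divide abs_of_pos)
            also have "\<dots> \<le> (M * e1 + \<bar>J w - J x\<bar> * G) / r ^ k"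
            proof (rule divide_right_mono)
              have "\<bar>J w * (g (?v w) - g (?u w))\<bar> \<le> M * e1"
                unfolding abs_mult using JM[of w] inside[OF w True] M(1) by (intro mult_mono) auto
              moreover have "\<bar>(J w - J x) * g (?u w)\<bar> \<le> \<bar>J w - J x\<bar> * G"
                unfolding abs_mult using Gb by (intro mult_left_mono) auto
              ultimately show "\<bar>J w * (g (?v w) - g (?u w)) + (J w - J x) * g (?u w)\<bar> \<le> M * e1 + \<bar>J w - J x\<bar> * G" by linarith
            qed (use rk in simp)
            also have "\<dots> = M * e1 / r ^ k * 1 + G / r ^ k * (\<bar>J w - J x\<bar> * 1)"
              by (simp add: add_divide_distrib mult.commute)
            finally show ?thesis using True w by (simp only: indicator_simps if_True)
          next
            case False
            then show ?thesis using outside[OF w False] by simp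
          qed
        qed (use M e1 G rk in auto)
        also have "\<dots> < e"
        proof -
          have "(M * e1 / r ^ k) * measure H (S \<inter> ball x ?s) \<le> (M * e1 / r ^ k) * (C * ?s ^ k)"
            using b1(2)[OF s r(2)] M e1 rk by (intro mult_left_mono) auto
          also have "\<dots> = M * C * R' ^ k * e1" using rk r(1) by (simp add: power_mult_distrib)
          finally have 1: "(M * e1 / r ^ k) * measure H (S \<inter> ball x ?s) < e / 2" using e1(2) by linarith
          have "\<bar>?LP ?s / ?s ^ k\<bar> < e2" using b2(2)[OF s r(3)] by (simp only: dist_real_def diff_zero)
          then have "?LP ?s / ?s ^ k < e2" by linarith
          moreover have "0 < ?s ^ k" using s by (rule zero_less_power)
          ultimately have "?LP ?s \<le> e2 * ?s ^ k" by (simp only: pos_divide_less_eq less_imp_le)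
          then have "(G / r ^ k) * ?LP ?s \<le> (G / r ^ k) * (e2 * ?s ^ k)" using G rk by (intro mult_left_mono) auto
          also have "\<dots> = G * R' ^ k * e2" using rk r(1) by (simp add: power_mult_distrib)
          finally show ?thesis using 1 e2(2) by linarith
        qed
        finally show ?case by (simp only: qp dist_real_def diff_zero)
      qed
    qed
    have "((\<lambda>r. (q r - J x * p r) + J x * p r) \<longlongrightarrow> 0 + J x * I) (at_right 0)"
      by (intro tendsto_add tendsto_mult tendsto_const diff p)
    then have "(q \<longlongrightarrow> J x * I) (at_right 0)" by simp
    moreover have "set_lebesgue_integral H (?A ` ?P) g = J x * I"
      unfolding I_def Jx by (rule plane_linear_change[OF A fx g])
    ultimately have lim: "(q \<longlongrightarrow> set_lebesgue_integral H (?A ` ?P) g) (at_right 0)" by simp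
    have "eventually (\<lambda>r. q r = set_lebesgue_integral H (\<phi> ` S) (\<lambda>z. g ((1 / r) *\<^sub>R (z - \<phi> x)) / r ^ k)) (at_right 0)"
      using eventually_at_right_less[of 0] by eventually_elim (rule q_eq[symmetric])
    then show "((\<lambda>r. set_lebesgue_integral H (\<phi> ` S) (\<lambda>z. g ((1 / r) *\<^sub>R (z - \<phi> x)) / r ^ k))
        \<longlongrightarrow> set_lebesgue_integral H (?A ` ?P) g) (at_right 0)"
      using lim by (rule Lim_transform_eventually[rotated])
  qed
qed

lemma image_tangent:
  "AE x in H. x \<in> S \<longrightarrow> approx_tangent k (\<phi> ` S) (\<phi> x) (blinfun_apply (\<phi>' x) ` span (f x ` {..<k}))"
proof -
  obtain M where M: "0 < M" "\<And>y. J y \<le> M" using J_bounded by blast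
  have JM: "\<bar>J y\<bar> \<le> M" for y using M(2)[of y] J_nonneg[of y] by simp
  show ?thesis
    using tangent lebesgue_points[OF S J_meas JM M(1)]
    by eventually_elim (auto intro: image_tangent_at)
qed

end

subsection \<open>Forms\<close>

lemma covector_cong: "covector k c \<Longrightarrow> (\<And>i. i < k \<Longrightarrow> v i = w i) \<Longrightarrow> c v = c w"
  unfolding covector_def by blast

lemma covector_expand:
  fixes c :: "(nat \<Rightarrow> 'a::euclidean_space) \<Rightarrow> real"
  assumes c: "covector k c" and m: "m < k"
  shows "c (u(m := y)) = (\<Sum>b\<in>Basis. (y \<bullet> b) * c (u(m := b)))"
proof -
  have l: "linear (\<lambda>y. c (u(m := y)))" using c m unfolding covector_def by blast
  have "c (u(m := y)) = c (u(m := (\<Sum>b\<in>Basis. (y \<bullet> b) *\<^sub>R b)))" by (simp only: euclidean_representation)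
  also have "\<dots> = (\<Sum>b\<in>Basis. c (u(m := (y \<bullet> b) *\<^sub>R b)))" by (rule linear_sum[OF l])
  also have "\<dots> = (\<Sum>b\<in>Basis. (y \<bullet> b) * c (u(m := b)))"
    by (intro sum.cong refl) (simp only: linear_cmul[OF l] real_scaleR_def)
  finally show ?thesis .
qed

lemma covector_linear_compose:
  fixes A :: "'a::euclidean_space \<Rightarrow> 'a"
  assumes c: "covector k c" and A: "linear A"
  shows "covector k (\<lambda>v. c (\<lambda>i. A (v i)))"
  unfolding covector_def
proof (intro conjI allI impI)
  fix v w :: "nat \<Rightarrow> 'a" assume "\<forall>i<k. v i = w i"
  then show "c (\<lambda>i. A (v i)) = c (\<lambda>i. A (w i))" by (intro covector_cong[OF c]) simp
next
  fix i and v :: "nat \<Rightarrow> 'a" assume i: "i < k"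
  have l: "linear (\<lambda>y. c ((\<lambda>i. A (v i))(i := y)))" using c i unfolding covector_def by blast
  have "(\<lambda>j. A ((v(i := y)) j)) = (\<lambda>i. A (v i))(i := A y)" for y by auto
  then show "linear (\<lambda>y. c (\<lambda>j. A ((v(i := y)) j)))"
    using linear_compose[OF A l] by (simp add: o_def)
next
  fix i j and v :: "nat \<Rightarrow> 'a" assume "i < k" "j < k" "i \<noteq> j \<and> v i = v j"
  then show "c (\<lambda>i. A (v i)) = 0" using c unfolding covector_def by (metis (no_types, lifting))
qed

lemma is_form_covector: "is_form k E \<omega> \<Longrightarrow> x \<in> E \<Longrightarrow> covector k (\<omega> x)"
  and is_form_continuous: "is_form k E \<omega> \<Longrightarrow> continuous_on E (\<lambda>x. \<omega> x v)"
  unfolding is_form_def by auto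

lemma partial_slots_Suc:
  "(\<lambda>i. if i < Suc m then w i else v i) = (\<lambda>i. if i < m then w i else v i)(m := w m)"
  "(\<lambda>i. if i < m then w i else v i)(m := b) = (\<lambda>i. if i < m then w i else (v(m := b)) i)"
  by (auto simp: less_Suc_eq)

text \<open>\<open>is_form\<close> asserts continuity for constant vectors only. Expanding one slot
  after another in the standard basis reaches vectors that vary with the point.\<close>

lemma form_continuous:
  fixes \<omega> :: "'a::euclidean_space kform" and p :: "'b::topological_space \<Rightarrow> 'a"
  assumes \<omega>: "is_form k E \<omega>" and p: "continuous_on X p" "p ` X \<subseteq> E"
    and w: "\<And>i. i < k \<Longrightarrow> continuous_on X (\<lambda>x. w x i)"
  shows "continuous_on X (\<lambda>x. \<omega> (p x) (w x))"
proof -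
  have "m \<le> k \<Longrightarrow> continuous_on X (\<lambda>x. \<omega> (p x) (\<lambda>i. if i < m then w x i else v i))" for m v
  proof (induction m arbitrary: v)
    case 0
    show ?case using continuous_on_compose2[OF is_form_continuous[OF \<omega>] p] by simp
  next
    case (Suc m)
    then have mk: "m < k" by simp
    have "continuous_on X (\<lambda>x. \<Sum>b\<in>Basis. (w x m \<bullet> b) * \<omega> (p x) (\<lambda>i. if i < m then w x i else (v(m := b)) i))"
      using Suc by (intro continuous_intros w) auto
    then show ?case
    proof (rule continuous_on_eq)
      fix x assume "x \<in> X"
      then have c: "covector k (\<omega> (p x))" using p(2) is_form_covector[OF \<omega>] by blast
      then show "(\<Sum>b\<in>Basis. (w x m \<bullet> b) * \<omega> (p x) (\<lambda>i. if i < m then w x i else (v(m := b)) i))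
          = \<omega> (p x) (\<lambda>i. if i < Suc m then w x i else v i)"
        unfolding partial_slots_Suc(1) by (subst covector_expand[OF c mk]) (simp only: partial_slots_Suc(2))
    qed
  qed
  then have "continuous_on X (\<lambda>x. \<omega> (p x) (\<lambda>i. if i < k then w x i else 0))" by simp
  then show ?thesis
  proof (rule continuous_on_eq)
    fix x assume "x \<in> X"
    then have "covector k (\<omega> (p x))" using p(2) is_form_covector[OF \<omega>] by blast
    then show "\<omega> (p x) (\<lambda>i. if i < k then w x i else 0) = \<omega> (p x) (w x)" by (rule covector_cong) simp
  qed
qed

text \<open>The same slotwise expansion: unit-bounded vectors have coordinates at most 1, and for
  basis vectors compactness bounds the form.\<close>

lemma form_bounded:
  fixes \<omega> :: "'a::euclidean_space kform"
  assumes \<omega>: "is_form k E \<omega>" and E: "compact E"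
  obtains B where "0 < B" "\<And>x v. x \<in> E \<Longrightarrow> (\<And>i. i < k \<Longrightarrow> norm (v i) \<le> 1) \<Longrightarrow> \<bar>\<omega> x v\<bar> \<le> B"
proof -
  have "m \<le> k \<Longrightarrow> \<exists>B. \<forall>x\<in>E. \<forall>w. (\<forall>i<m. norm (w i) \<le> 1) \<longrightarrow> \<bar>\<omega> x (\<lambda>i. if i < m then w i else v i)\<bar> \<le> B" for m v
  proof (induction m arbitrary: v)
    case 0
    have "compact ((\<lambda>x. \<omega> x v) ` E)" by (rule compact_continuous_image[OF is_form_continuous[OF \<omega>] E])
    then obtain B where "\<forall>y\<in>(\<lambda>x. \<omega> x v) ` E. norm y \<le> B" using compact_imp_bounded bounded_iff by metis
    then show ?case by (intro exI[of _ B]) simp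
  next
    case (Suc m)
    then have mk: "m < k" by simp
    from Suc have "\<forall>b. \<exists>B. \<forall>x\<in>E. \<forall>w. (\<forall>i<m. norm (w i) \<le> 1) \<longrightarrow> \<bar>\<omega> x (\<lambda>i. if i < m then w i else (v(m := b)) i)\<bar> \<le> B"
      by simp
    then obtain B where B: "\<And>b x w. x \<in> E \<Longrightarrow> \<forall>i<m. norm (w i) \<le> 1 \<Longrightarrow> \<bar>\<omega> x (\<lambda>i. if i < m then w i else (v(m := b)) i)\<bar> \<le> B b"
      by metis
    show ?case
    proof (intro exI[of _ "\<Sum>b\<in>Basis. B b"] ballI allI impI)
      fix x :: 'a and w :: "nat \<Rightarrow> 'a" assume x: "x \<in> E" and w: "\<forall>i<Suc m. norm (w i) \<le> 1"
      have "\<omega> x (\<lambda>i. if i < Suc m then w i else v i)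
          = (\<Sum>b\<in>Basis. (w m \<bullet> b) * \<omega> x (\<lambda>i. if i < m then w i else (v(m := b)) i))"
        unfolding partial_slots_Suc(1)
        by (subst covector_expand[OF is_form_covector[OF \<omega> x] mk]) (simp only: partial_slots_Suc(2))
      also have "\<bar>\<dots>\<bar> \<le> (\<Sum>b\<in>Basis. \<bar>(w m \<bullet> b) * \<omega> x (\<lambda>i. if i < m then w i else (v(m := b)) i)\<bar>)" by (rule sum_abs)
      also have "\<dots> \<le> (\<Sum>b\<in>Basis. B b)"
      proof (rule sum_mono)
        fix b :: 'a assume b: "b \<in> Basis"
        have "\<bar>w m \<bullet> b\<bar> \<le> 1" using Basis_le_norm[OF b, of "w m"] w by force
        then have "\<bar>(w m \<bullet> b) * \<omega> x (\<lambda>i. if i < m then w i else (v(m := b)) i)\<bar> \<le> 1 * B b"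
          unfolding abs_mult using B[OF x, of w b] w by (intro mult_mono) auto
        then show "\<bar>(w m \<bullet> b) * \<omega> x (\<lambda>i. if i < m then w i else (v(m := b)) i)\<bar> \<le> B b" by simp
      qed
      finally show "\<bar>\<omega> x (\<lambda>i. if i < Suc m then w i else v i)\<bar> \<le> (\<Sum>b\<in>Basis. B b)" .
    qed
  qed
  from this[OF order_refl, of "\<lambda>_. 0"] obtain B where B: "\<And>x w. x \<in> E \<Longrightarrow> \<forall>i<k. norm (w i) \<le> 1 \<Longrightarrow> \<bar>\<omega> x (\<lambda>i. if i < k then w i else 0)\<bar> \<le> B"
    by blast
  show ?thesis
  proof (rule that[of "\<bar>B\<bar> + 1"])
    fix x v assume x: "x \<in> E" and v: "\<And>i. i < k \<Longrightarrow> norm (v i :: 'a) \<le> 1"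
    have "\<omega> x (\<lambda>i. if i < k then v i else 0) = \<omega> x v" by (rule covector_cong[OF is_form_covector[OF \<omega> x]]) simp
    then show "\<bar>\<omega> x v\<bar> \<le> \<bar>B\<bar> + 1" using B[OF x, of v] v by simp
  qed simp
qed

text \<open>Evaluation of a form is continuous on the closed set of points of \<open>E\<close> with
  arbitrary vectors; extended by 0 it is Borel, and it can be composed with measurable data. Vectors
  from index \<open>k\<close> on are replaced by 0, which a covector ignores.\<close>

lemma form_measurable:
  fixes \<omega> :: "'a::euclidean_space kform"
  assumes \<omega>: "is_form k E \<omega>" and E: "closed E" and p: "p \<in> borel_measurable M" "\<And>x. x \<in> space M \<Longrightarrow> p x \<in> E"
    and w: "\<And>i. i < k \<Longrightarrow> (\<lambda>x. w x i) \<in> borel_measurable M"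
  shows "(\<lambda>x. \<omega> (p x) (w x)) \<in> borel_measurable M"
proof -
  let ?z = "\<lambda>x. (p x, \<lambda>i. if i < k then w x i else 0)"
  have E': "E \<times> (UNIV :: (nat \<Rightarrow> 'a) set) \<in> sets borel" using E by (intro borel_closed closed_Times) auto
  have "continuous_on (E \<times> UNIV) (\<lambda>z. \<omega> (fst z) (snd z))"
    by (rule form_continuous[OF \<omega>])
      (auto intro!: continuous_intros continuous_on_product_then_coordinatewise[OF continuous_on_snd[OF continuous_on_id]])
  then have "(\<lambda>z. indicator (E \<times> UNIV) z *\<^sub>R \<omega> (fst z) (snd z)) \<in> borel_measurable borel"
    by (rule borel_measurable_continuous_on_indicator[OF E'])
  moreover have "?z \<in> borel_measurable M"
  proof (rule borel_measurable_Pair[OF p(1)])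
    show "(\<lambda>x i. if i < k then w x i else 0) \<in> borel_measurable M"
    proof (rule measurable_coordinatewise_then_product)
      fix i show "(\<lambda>x. if i < k then w x i else 0) \<in> borel_measurable M" using w[of i] by (cases "i < k") auto
    qed
  qed
  ultimately have "(\<lambda>x. indicator (E \<times> UNIV) (?z x) *\<^sub>R \<omega> (fst (?z x)) (snd (?z x))) \<in> borel_measurable M"
    by (rule measurable_compose[rotated])
  moreover have "indicator (E \<times> UNIV) (?z x) *\<^sub>R \<omega> (fst (?z x)) (snd (?z x)) = \<omega> (p x) (w x)" if "x \<in> space M" for x
    using p(2)[OF that] covector_cong[OF is_form_covector[OF \<omega> p(2)[OF that]], of "\<lambda>i. if i < k then w x i else 0" "w x"] by simp
  ultimately show ?thesis by (simp cong: measurable_cong)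
qed

subsection \<open>Oriented rectifiable sets\<close>

lemma oriented_rectD:
  assumes "oriented_rect k S s f"
  shows "is_rectifiable k S" "S \<in> sets (hausdorff_measure k)" "0 < hausdorff_outer k S" "hausdorff_outer k S < \<infinity>"
    "s \<in> borel_measurable (hausdorff_measure k)" "\<And>i. i < k \<Longrightarrow> (\<lambda>x. f x i) \<in> borel_measurable (hausdorff_measure k)"
    "\<And>x. x \<in> S \<Longrightarrow> s x \<in> {-1, 1}" "\<And>x. x \<in> S \<Longrightarrow> orthonormal_frame k (f x)"
    "AE x in hausdorff_measure k. x \<in> S \<longrightarrow> approx_tangent k S x (span (f x ` {..<k}))"
    "S \<noteq> {}" "0 < measure (hausdorff_measure k) S" "ennreal (measure (hausdorff_measure k) S) = hausdorff_outer k S"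
proof -
  show r: "is_rectifiable k S" and "s \<in> borel_measurable (hausdorff_measure k)" "\<And>i. i < k \<Longrightarrow> (\<lambda>x. f x i) \<in> borel_measurable (hausdorff_measure k)"
    "\<And>x. x \<in> S \<Longrightarrow> s x \<in> {-1, 1}" "\<And>x. x \<in> S \<Longrightarrow> orthonormal_frame k (f x)"
    "AE x in hausdorff_measure k. x \<in> S \<longrightarrow> approx_tangent k S x (span (f x ` {..<k}))"
    using assms unfolding oriented_rect_def by auto
  show S: "S \<in> sets (hausdorff_measure k)" using r unfolding is_rectifiable_def by blast
  show p: "0 < hausdorff_outer k S" and q: "hausdorff_outer k S < \<infinity>"
    using assms emeasure_hausdorff[OF S] unfolding oriented_rect_def by auto
  show "S \<noteq> {}" using p by (auto simp: hausdorff_outer_empty)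
  show "0 < measure (hausdorff_measure k) S" "ennreal (measure (hausdorff_measure k) S) = hausdorff_outer k S"
    using p q unfolding measure_hausdorff[OF S] by (auto simp: enn2real_positive_iff)
qed

text \<open>Frame vectors have norm 1 and the sign has modulus 1, so a bound of the form on
  unit-bounded vectors bounds the integrand. The second part is what makes the Lebesgue sums
  finite.\<close>

lemma oriented_integrand:
  fixes \<omega> :: "'a::euclidean_space kform"
  assumes o: "oriented_rect k S s f" and SE: "S \<subseteq> E" and E: "compact E" and \<omega>: "is_form k E \<omega>"
  shows "set_integrable (hausdorff_measure k) S (\<lambda>x. s x * \<omega> x (f x))"
    and "\<And>B. (\<And>x v. x \<in> E \<Longrightarrow> (\<And>i. i < k \<Longrightarrow> norm (v i) \<le> 1) \<Longrightarrow> \<bar>\<omega> x v\<bar> \<le> B) \<Longrightarrow>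
      \<bar>integ_form k S s f \<omega>\<bar> \<le> B * measure (hausdorff_measure k) S"
proof -
  let ?H = "hausdorff_measure k :: 'a measure"
  note D = oriented_rectD[OF o]
  let ?h = "\<lambda>x. if x \<in> S then s x * \<omega> x (f x) else 0"
  have 1: "norm (f x i) \<le> 1" if "x \<in> S" "i < k" for x i
    using D(8)[OF that(1)] that(2) by (simp add: orthonormal_frame_def norm_eq_sqrt_inner)
  have m: "(\<lambda>x. \<omega> x (f x)) \<in> borel_measurable (restrict_space ?H S)"
  proof (rule form_measurable[OF \<omega> compact_imp_closed[OF E]])
    show "(\<lambda>x. x) \<in> borel_measurable (restrict_space ?H S)"
      by (rule measurable_restrict_space1[OF borel_measurable_hausdorffI]) simp
    show "x \<in> E" if "x \<in> space (restrict_space ?H S)" for x using that SE by (auto simp: space_restrict_space)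
    show "(\<lambda>x. f x i) \<in> borel_measurable (restrict_space ?H S)" if "i < k" for i
      by (rule measurable_restrict_space1[OF D(6)[OF that]])
  qed
  have "(\<lambda>x. s x * \<omega> x (f x)) \<in> borel_measurable (restrict_space ?H S)"
    by (rule borel_measurable_times[OF measurable_restrict_space1[OF D(5)] m])
  then have hm: "?h \<in> borel_measurable ?H" using D(2) by (subst measurable_restrict_space_iff[symmetric]) auto
  have b: "\<bar>?h x\<bar> \<le> B" if x: "x \<in> S" and B: "\<And>x v. x \<in> E \<Longrightarrow> (\<And>i. i < k \<Longrightarrow> norm (v i) \<le> 1) \<Longrightarrow> \<bar>\<omega> x v\<bar> \<le> B" for x B
  proof -
    have "\<bar>s x\<bar> = 1" using D(7)[OF x] by auto
    then have "\<bar>?h x\<bar> = \<bar>\<omega> x (f x)\<bar>" using x by (simp add: abs_mult)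
    also have "\<dots> \<le> B" using x SE 1 by (intro B) auto
    finally show ?thesis .
  qed
  obtain B where B: "0 < B" "\<And>x v. x \<in> E \<Longrightarrow> (\<And>i. i < k \<Longrightarrow> norm (v i) \<le> 1) \<Longrightarrow> \<bar>\<omega> x v\<bar> \<le> B"
    by (rule form_bounded[OF \<omega> E]) blast
  have "set_integrable ?H S ?h" by (rule hausdorff_set_integrable[OF D(2,4) hm b[OF _ B(2)]])
  then show "set_integrable ?H S (\<lambda>x. s x * \<omega> x (f x))"
    unfolding set_integrable_def by (rule Bochner_Integration.integrable_cong[THEN iffD1, rotated 2]) (auto simp: indicator_def)
  fix B assume B: "\<And>x v. x \<in> E \<Longrightarrow> (\<And>i. i < k \<Longrightarrow> norm (v i) \<le> 1) \<Longrightarrow> \<bar>\<omega> x v\<bar> \<le> B"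
  obtain x0 where x0: "x0 \<in> S" using D(10) by blast
  have bB: "\<bar>?h x\<bar> \<le> B" if "x \<in> S" for x by (rule b[OF that]) (rule B)
  have B0: "0 \<le> B" using bB[OF x0] by linarith
  have "\<bar>set_lebesgue_integral ?H S ?h\<bar> \<le> B * measure ?H (S \<inter> UNIV)"
    by (rule hausdorff_set_integral_le[OF D(2,4) hm]) (use bB B0 in \<open>auto intro: borel_hausdorffD\<close>)
  moreover have "set_lebesgue_integral ?H S ?h = integ_form k S s f \<omega>"
    unfolding integ_form_def set_lebesgue_integral_def by (intro Bochner_Integration.integral_cong) (auto simp: indicator_def)
  ultimately show "\<bar>integ_form k S s f \<omega>\<bar> \<le> B * measure ?H S" by simp
qed

lemma integ_form_sum:
  fixes \<beta> :: "nat \<Rightarrow> 'a::euclidean_space kform"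
  assumes o: "oriented_rect k S s f" "S \<subseteq> E" "compact E" and \<beta>: "\<And>j. j < n \<Longrightarrow> is_form k E (\<beta> j)"
  shows "integ_form k S s f (\<lambda>x v. \<Sum>j<n. c j * \<beta> j x v) = (\<Sum>j<n. c j * integ_form k S s f (\<beta> j))"
proof -
  let ?H = "hausdorff_measure k :: 'a measure"
  have i: "integrable ?H (\<lambda>x. indicator S x *\<^sub>R (s x * \<beta> j x (f x)))" if "j < n" for j
    using oriented_integrand(1)[OF o \<beta>[OF that]] unfolding set_integrable_def .
  have "integ_form k S s f (\<lambda>x v. \<Sum>j<n. c j * \<beta> j x v) = (\<integral>x. (\<Sum>j<n. c j * (indicator S x *\<^sub>R (s x * \<beta> j x (f x)))) \<partial>?H)"
    unfolding integ_form_def set_lebesgue_integral_def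
    by (intro Bochner_Integration.integral_cong refl) (simp add: sum_distrib_left mult.left_commute)
  also have "\<dots> = (\<Sum>j<n. (\<integral>x. c j * (indicator S x *\<^sub>R (s x * \<beta> j x (f x))) \<partial>?H))"
    using i by (intro Bochner_Integration.integral_sum integrable_mult_right) auto
  also have "\<dots> = (\<Sum>j<n. c j * integ_form k S s f (\<beta> j))"
    unfolding integ_form_def set_lebesgue_integral_def by simp
  finally show ?thesis .
qed

lemma integ_form_cong:
  "(\<And>x. x \<in> S \<Longrightarrow> \<omega> x (f x) = \<eta> x (f x)) \<Longrightarrow> integ_form k S s f \<omega> = integ_form k S s f \<eta>"
  unfolding integ_form_def set_lebesgue_integral_def
  by (intro Bochner_Integration.integral_cong refl) (auto simp: indicator_def)

section \<open>Lipschitz extension and images of oriented rectifiable sets\<close>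

text \<open>The lower envelope of the cones \<open>g z + L * dist x z\<close> with vertices over
  \<open>X\<close>.\<close>

lemma McShane_extension_real:
  fixes g :: "'a::metric_space \<Rightarrow> real"
  assumes X: "X \<noteq> {}" and L: "0 \<le> L" and g: "\<And>x y. x \<in> X \<Longrightarrow> y \<in> X \<Longrightarrow> \<bar>g x - g y\<bar> \<le> L * dist x y"
  obtains h where "\<And>x. x \<in> X \<Longrightarrow> h x = g x" "\<And>x y. \<bar>h x - h y\<bar> \<le> L * dist x y"
proof -
  define h where "h x = (INF z\<in>X. g z + L * dist x z)" for x
  have bdd: "bdd_below ((\<lambda>z. g z + L * dist x z) ` X)" for x
  proof -
    obtain z0 where z0: "z0 \<in> X" using X by blast
    have "g z0 - L * dist x z0 \<le> g z + L * dist x z" if "z \<in> X" for z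
    proof -
      have "L * dist z0 z \<le> L * (dist x z0 + dist x z)"
        using dist_triangle[of z0 z x] L by (intro mult_left_mono) (auto simp: dist_commute)
      moreover have "g z0 - g z \<le> L * dist z0 z" using g[OF z0 that] by linarith
      ultimately show ?thesis by (simp add: distrib_left)
    qed
    then show ?thesis by (intro bdd_belowI2)
  qed
  have le: "h x \<le> h y + L * dist x y" for x y
  proof -
    have "h x - L * dist x y \<le> (INF z\<in>X. g z + L * dist y z)"
    proof (rule cINF_greatest[OF X])
      fix z assume z: "z \<in> X"
      have "h x \<le> g z + L * dist x z" unfolding h_def by (rule cINF_lower[OF bdd z])
      moreover have "L * dist x z \<le> L * (dist x y + dist y z)" using L by (intro mult_left_mono dist_triangle)
      ultimately show "h x - L * dist x y \<le> g z + L * dist y z" by (simp add: distrib_left)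
    qed
    then show ?thesis by (simp add: h_def)
  qed
  show ?thesis
  proof (rule that)
    fix x assume x: "x \<in> X"
    have "h x \<le> g x + L * dist x x" unfolding h_def by (rule cINF_lower[OF bdd x])
    moreover have "g x \<le> h x" unfolding h_def
    proof (rule cINF_greatest[OF X])
      fix z assume "z \<in> X"
      then show "g x \<le> g z + L * dist x z" using g[OF x, of z] by linarith
    qed
    ultimately show "h x = g x" by simp
  next
    fix x y show "\<bar>h x - h y\<bar> \<le> L * dist x y" using le[of x y] le[of y x] by (simp add: dist_commute abs_le_iff)
  qed
qed

text \<open>The scalar extension in each coordinate; summing the coordinates inflates the constant
  by the dimension.\<close>

lemma McShane_extension:
  fixes g :: "'a::metric_space \<Rightarrow> 'b::euclidean_space"
  assumes X: "X \<noteq> {}" and L: "0 \<le> L" and g: "\<And>x y. x \<in> X \<Longrightarrow> y \<in> X \<Longrightarrow> dist (g x) (g y) \<le> L * dist x y"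
  obtains h M where "\<forall>x\<in>X. h x = g x" "lipschitz_on M UNIV h"
proof -
  have "\<exists>h. (\<forall>x\<in>X. h x = g x \<bullet> b) \<and> (\<forall>x y. \<bar>h x - h y\<bar> \<le> L * dist x y)" if b: "b \<in> Basis" for b
  proof (rule McShane_extension_real[OF X L])
    fix x y assume "x \<in> X" "y \<in> X"
    then show "\<bar>g x \<bullet> b - g y \<bullet> b\<bar> \<le> L * dist x y"
      using Basis_le_norm[OF b, of "g x - g y"] g[of x y] by (simp add: inner_diff_left dist_norm)
  qed blast
  then obtain h where h: "\<And>b x. b \<in> Basis \<Longrightarrow> x \<in> X \<Longrightarrow> h b x = g x \<bullet> b"
    "\<And>b x y. b \<in> Basis \<Longrightarrow> \<bar>h b x - h b y\<bar> \<le> L * dist x y" by metis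
  show ?thesis
  proof (rule that[of "\<lambda>x. \<Sum>b\<in>Basis. h b x *\<^sub>R b" "real DIM('b) * L"])
    show "\<forall>x\<in>X. (\<Sum>b\<in>Basis. h b x *\<^sub>R b) = g x" using h(1) by (simp add: euclidean_representation)
  next
    show "lipschitz_on (real DIM('b) * L) UNIV (\<lambda>x. \<Sum>b\<in>Basis. h b x *\<^sub>R b)"
    proof (rule lipschitz_onI)
      fix x y
      have "dist (\<Sum>b\<in>Basis. h b x *\<^sub>R b) (\<Sum>b\<in>Basis. h b y *\<^sub>R b :: 'b) = norm (\<Sum>b\<in>Basis. (h b x - h b y) *\<^sub>R b)"
        by (simp only: dist_norm sum_subtractf scaleR_diff_left)
      also have "\<dots> \<le> (\<Sum>b\<in>Basis. norm ((h b x - h b y) *\<^sub>R b))" by (rule norm_sum)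
      also have "\<dots> \<le> (\<Sum>b\<in>(Basis :: 'b set). L * dist x y)" by (intro sum_mono) (use h(2) in simp)
      finally show "dist (\<Sum>b\<in>Basis. h b x *\<^sub>R b) (\<Sum>b\<in>Basis. h b y *\<^sub>R b) \<le> real DIM('b) * L * dist x y" by simp
    qed (use L in simp)
  qed
qed

context C1_pair
begin

text \<open>The parametrisations \<open>g i\<close> may leave \<open>K\<close>, where \<phi> is
  uncontrolled. Composing them with a Lipschitz extension \<open>h\<close> of \<phi> from
  \<open>K\<close> gives parametrisations on the whole plane that still cover the image up to a null
  set.\<close>

lemma image_rectifiable:
  assumes r: "is_rectifiable k S" and fin: "hausdorff_outer k S < \<infinity>" and S: "S \<subseteq> K" "S \<noteq> {}"
  shows "is_rectifiable k (\<phi> ` S)"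
proof -
  have Sm: "S \<in> sets (hausdorff_measure k)" using r unfolding is_rectifiable_def by blast
  obtain V and g :: "nat \<Rightarrow> 'a \<Rightarrow> 'a" where V: "subspace V" "dim V = k" and g: "\<And>i. \<exists>L. lipschitz_on L V (g i)"
    and n: "hausdorff_outer k (S - (\<Union>i. g i ` V)) = 0"
    using r unfolding is_rectifiable_def by blast
  obtain L where L: "0 < L" "\<And>x y. x \<in> K \<Longrightarrow> y \<in> K \<Longrightarrow> dist (\<phi> x) (\<phi> y) \<le> L * dist x y" by (rule lipschitz_K) blast
  have "K \<noteq> {}" "0 \<le> L" using S L by auto
  then obtain h M where h: "\<forall>x\<in>K. h x = \<phi> x" "lipschitz_on M UNIV h"
    by (rule McShane_extension[OF _ _ L(2)]) blast
  have sub: "\<phi> ` S - (\<Union>i. (h \<circ> g i) ` V) \<subseteq> \<phi> ` (S - (\<Union>i. g i ` V))"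
  proof
    fix y assume y: "y \<in> \<phi> ` S - (\<Union>i. (h \<circ> g i) ` V)"
    then obtain x where x: "x \<in> S" "y = \<phi> x" by blast
    have "x \<notin> (\<Union>i. g i ` V)"
    proof
      assume "x \<in> (\<Union>i. g i ` V)"
      then obtain i v where "v \<in> V" "x = g i v" by blast
      then have "y = (h \<circ> g i) v" using x h(1) S(1) by auto
      then show False using y \<open>v \<in> V\<close> by blast
    qed
    then show "y \<in> \<phi> ` (S - (\<Union>i. g i ` V))" using x by blast
  qed
  have "hausdorff_outer k (\<phi> ` S - (\<Union>i. (h \<circ> g i) ` V)) = 0"
    by (rule hausdorff_outer_null_subset[OF image_null[OF n] sub]) (use S in blast)
  moreover have "\<exists>L. lipschitz_on L V (h \<circ> g i)" for i
  proof -
    obtain L where "lipschitz_on L V (g i)" using g by blast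
    then have "lipschitz_on (M * L) V (h \<circ> g i)"
      by (rule lipschitz_on_compose) (rule lipschitz_on_subset[OF h(2)], simp)
    then show ?thesis by blast
  qed
  ultimately show ?thesis
    unfolding is_rectifiable_def using V image_measurable[OF Sm fin S(1)]
    by (intro conjI exI[of _ V] exI[of _ "\<lambda>i. h \<circ> g i"] allI)
qed

lemma oriented_rect_C1_tangent:
  assumes o: "oriented_rect k S s f" and S: "S \<subseteq> K"
  shows "C1_tangent U W K \<phi> \<psi> \<phi>' \<psi>' k S f"
  using oriented_rectD[OF o] S by unfold_locales auto

lemma derivative_along_measurable:
  assumes S: "S \<subseteq> U" and g: "g \<in> borel_measurable (hausdorff_measure k)"
  shows "(\<lambda>x. blinfun_apply (\<phi>' x) (g x)) \<in> borel_measurable (restrict_space (hausdorff_measure k) S)"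
proof -
  let ?H = "hausdorff_measure k :: 'a measure" let ?z = "\<lambda>x. (x, g x)"
  have "open (U \<times> (UNIV :: 'a set))" using open_U by (intro open_Times) auto
  moreover have "continuous_on (U \<times> UNIV) (\<lambda>z :: 'a \<times> 'a. blinfun_apply (\<phi>' (fst z)) (snd z))"
    by (intro blinfun.continuous_on continuous_on_compose2[OF cont_deriv] continuous_intros) auto
  ultimately have "(\<lambda>z. indicator (U \<times> UNIV) z *\<^sub>R blinfun_apply (\<phi>' (fst z)) (snd z)) \<in> borel_measurable borel"
    by (intro borel_measurable_continuous_on_indicator) auto
  moreover have "?z \<in> borel_measurable ?H"
    by (rule borel_measurable_Pair[OF borel_measurable_hausdorffI g]) simp
  ultimately have "(\<lambda>x. indicator (U \<times> UNIV) (?z x) *\<^sub>R blinfun_apply (\<phi>' (fst (?z x))) (snd (?z x))) \<in> borel_measurable ?H"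
    by (rule measurable_compose[rotated])
  then have "(\<lambda>x. indicator (U \<times> UNIV) (?z x) *\<^sub>R blinfun_apply (\<phi>' (fst (?z x))) (snd (?z x))) \<in> borel_measurable (restrict_space ?H S)"
    by (rule measurable_restrict_space1)
  moreover have "indicator (U \<times> UNIV) (?z x) *\<^sub>R blinfun_apply (\<phi>' (fst (?z x))) (snd (?z x)) = blinfun_apply (\<phi>' x) (g x)"
    if "x \<in> space (restrict_space ?H S)" for x using that S by (auto simp: space_restrict_space)
  ultimately show ?thesis by (simp cong: measurable_cong)
qed

text \<open>The image frame is orthonormalised by Gram-Schmidt, which preserves its span, depends
  measurably on the point and needs no change of sign.\<close>

lemma image_oriented_rect:
  assumes o: "oriented_rect k S s f" and SK: "S \<subseteq> K"
  obtains s' f' where "oriented_rect k (\<phi> ` S) s' f'" "\<And>x. x \<in> S \<Longrightarrow> s' (\<phi> x) = s x"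
    "\<And>x. x \<in> S \<Longrightarrow> f' (\<phi> x) = gram_schmidt (\<lambda>i. blinfun_apply (\<phi>' x) (f x i))"
proof -
  interpret C1_tangent U W K \<phi> \<psi> \<phi>' \<psi>' k S f by (rule oriented_rect_C1_tangent[OF o SK])
  note D = oriented_rectD[OF o]
  define gs where "gs = (\<lambda>x. gram_schmidt (\<lambda>i. blinfun_apply (\<phi>' x) (f x i)))"
  \<comment> \<open>Off the image the values are set to 0, which makes measurability relative to the
    image enough.\<close>
  define s' where "s' = (\<lambda>y. if y \<in> \<phi> ` S then s (\<psi> y) else 0)"
  define f' where "f' = (\<lambda>y i. if y \<in> \<phi> ` S then gs (\<psi> y) i else 0)"
  have s': "s' (\<phi> x) = s x" and f': "f' (\<phi> x) = gs x" if "x \<in> S" for x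
    using that S_left_inverse by (auto simp: s'_def f'_def)
  have gs: "orthonormal_frame k (gs x)" "span (gs x ` {..<k}) = blinfun_apply (\<phi>' x) ` span (f x ` {..<k})" if x: "x \<in> S" for x
  proof -
    have xU: "x \<in> U" using x S_U by blast
    have "orthonormal_on {..<k} (gs x) \<and> span (gs x ` {..<k}) = span ((\<lambda>i. blinfun_apply (\<phi>' x) (f x i)) ` {..<k})"
      unfolding gs_def
      using gram_schmidt_frame[OF independent_images[OF D(8)[OF x] linear_deriv inj_deriv[OF xU]] order_refl] by blast
    moreover have "(\<lambda>i. blinfun_apply (\<phi>' x) (f x i)) ` {..<k} = blinfun_apply (\<phi>' x) ` f x ` {..<k}" by (simp add: image_image)
    ultimately show "orthonormal_frame k (gs x)" "span (gs x ` {..<k}) = blinfun_apply (\<phi>' x) ` span (f x ` {..<k})"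
      by (simp_all add: orthonormal_frame_on linear_span_image[OF linear_deriv])
  qed
  have im: "\<phi> ` S \<in> sets H" by (rule sub_measurable[OF S(1) order_refl])
  have r: "is_rectifiable k (\<phi> ` S)" by (rule image_rectifiable[OF D(1,4) SK D(10)])
  \<comment> \<open>A null image would be carried by \<psi> back to \<open>S\<close>, which has
    positive measure.\<close>
  have pos: "0 < hausdorff_outer k (\<phi> ` S)"
  proof -
    interpret inv: C1_pair W U "\<phi> ` K" \<psi> \<phi> \<psi>' \<phi>' by (rule swap)
    have "\<psi> ` \<phi> ` S = S" using S_left_inverse by (force simp: image_image)
    then have "hausdorff_outer k (\<phi> ` S) \<noteq> 0" using inv.image_null[of k "\<phi> ` S", OF _ image_mono[OF SK]] D(3) by auto
    then show ?thesis by (simp add: zero_less_iff_neq_zero)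
  qed
  have pull: "(\<lambda>y. if y \<in> \<phi> ` S then u (\<psi> y) else 0) \<in> borel_measurable H"
    if u: "u \<in> borel_measurable (restrict_space H S)" for u :: "'a \<Rightarrow> 'b::{topological_space, zero}"
    using measurable_compose[OF measurable_inverse u] im
    by (subst measurable_restrict_space_iff[symmetric]) auto
  have "oriented_rect k (\<phi> ` S) s' f'"
    unfolding oriented_rect_def
  proof (intro conjI allI impI ballI)
    show "s' \<in> borel_measurable H" unfolding s'_def by (rule pull[OF measurable_restrict_space1[OF D(5)]])
    fix i assume i: "i < k"
    have "(\<lambda>x. gs x i) \<in> borel_measurable (restrict_space H S)"
      unfolding gs_def by (rule borel_measurable_gram_schmidt, rule derivative_along_measurable[OF S_U D(6)]) (use i in simp)
    then show "(\<lambda>y. f' y i) \<in> borel_measurable H" unfolding f'_def by (rule pull)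
  next
    fix y assume "y \<in> \<phi> ` S"
    then obtain x where x: "x \<in> S" "y = \<phi> x" by blast
    then show "s' y \<in> {-1, 1}" "orthonormal_frame k (f' y)" using D(7)[OF x(1)] s' f' gs by simp_all
  next
    let ?N = "{x. \<not> (x \<in> S \<longrightarrow> approx_tangent k (\<phi> ` S) (\<phi> x) (blinfun_apply (\<phi>' x) ` span (f x ` {..<k})))}"
    have N: "hausdorff_outer k ?N = 0" using image_tangent unfolding AE_hausdorff_iff .
    have "?N \<subseteq> K" using SK by blast
    then have 0: "hausdorff_outer k (\<phi> ` ?N) = 0" by (rule image_null[OF N])
    have "{y. \<not> (y \<in> \<phi> ` S \<longrightarrow> approx_tangent k (\<phi> ` S) y (span (f' y ` {..<k})))} \<subseteq> \<phi> ` ?N"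
    proof
      fix y assume "y \<in> {y. \<not> (y \<in> \<phi> ` S \<longrightarrow> approx_tangent k (\<phi> ` S) y (span (f' y ` {..<k})))}"
      then obtain x where x: "x \<in> S" "y = \<phi> x" "\<not> approx_tangent k (\<phi> ` S) y (span (f' y ` {..<k}))" by blast
      then have "x \<in> ?N" using f' gs(2) by simp
      then show "y \<in> \<phi> ` ?N" using x(2) by blast
    qed
    then show "AE y in H. y \<in> \<phi> ` S \<longrightarrow> approx_tangent k (\<phi> ` S) y (span (f' y ` {..<k}))"
      unfolding AE_hausdorff_iff by (rule hausdorff_outer_null_subset[OF 0])
  qed (use r pos image_S_finite emeasure_hausdorff[OF im] in auto)
  then show ?thesis using that s' f' unfolding gs_def by blast
qed

text \<open>Every competitor on the image side arises from one in \<open>K\<close>: its preimage is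
  oriented by orthonormalising the frame pulled back by the derivative of \<psi>. Gram-Schmidt
  alters the k-vector by the product \<open>R\<close> of residual norms, so the given orientation is
  the induced one with factor \<open>1 / R\<close>.\<close>

lemma pulled_back_orientation:
  assumes o: "oriented_rect k T s f" and T: "T \<subseteq> \<phi> ` K"
  obtains S s0 f0 where "S \<subseteq> K" "\<phi> ` S = T" "oriented_rect k S s0 f0" "induced_orient k S s0 f0 \<phi> \<phi>' s f"
proof -
  interpret inv: C1_pair W U "\<phi> ` K" \<psi> \<phi> \<psi>' \<phi>' by (rule swap)
  note D = oriented_rectD[OF o]
  obtain s0 f0 where o0: "oriented_rect k (\<psi> ` T) s0 f0" and s0: "\<And>y. y \<in> T \<Longrightarrow> s0 (\<psi> y) = s y"
    and f0: "\<And>y. y \<in> T \<Longrightarrow> f0 (\<psi> y) = gram_schmidt (\<lambda>i. blinfun_apply (\<psi>' y) (f y i))"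
    by (rule inv.image_oriented_rect[OF o T]) blast
  have TW: "y \<in> W" if "y \<in> T" for y using that T K_U image_U by blast
  show ?thesis
  proof (rule that[OF _ _ o0])
    show "\<psi> ` T \<subseteq> K" using T image_K_inverse by blast
    show "\<phi> ` \<psi> ` T = T" using right_inverse TW by (force simp: image_image)
    show "induced_orient k (\<psi> ` T) s0 f0 \<phi> \<phi>' s f"
      unfolding induced_orient_def
    proof (intro ballI)
      fix x assume "x \<in> \<psi> ` T"
      then obtain y where y: "y \<in> T" "x = \<psi> y" by blast
      have \<phi>x: "\<phi> x = y" using y right_inverse TW by simp
      let ?w = "\<lambda>i. blinfun_apply (\<psi>' y) (f y i)"
      define R where "R = (\<Prod>i<k. norm (gs_residual ?w i))"
      have "0 < R" unfolding R_def
        using gram_schmidt_frame[OF independent_images[OF D(8)[OF y(1)] inv.linear_deriv inv.inj_deriv[OF TW[OF y(1)]]] order_refl]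
        by (intro prod_pos) blast
      have "s y * c (f y) = s0 x * c (\<lambda>i. blinfun_apply (\<phi>' x) (f0 x i)) / (1 / R)" if c: "covector k c" for c
      proof -
        have "c (\<lambda>i. blinfun_apply (\<phi>' x) (?w i)) = R * c (\<lambda>i. blinfun_apply (\<phi>' x) (gram_schmidt ?w i))"
          unfolding R_def by (rule covector_gram_schmidt[OF covector_linear_compose[OF c linear_deriv]])
        moreover have "blinfun_apply (\<phi>' x) (?w i) = f y i" for i
          using inv.deriv_left_inverse[OF TW[OF y(1)]] y(2) by simp
        ultimately show ?thesis using s0[OF y(1)] f0[OF y(1)] y(2) by simp
      qed
      then show "s (\<phi> x) \<in> {-1, 1} \<and> orthonormal_frame k (f (\<phi> x)) \<and>
        (\<exists>J>0. \<forall>c. covector k c \<longrightarrow> s (\<phi> x) * c (f (\<phi> x)) = s0 x * c (\<lambda>i. blinfun_apply (\<phi>' x) (f0 x i)) / J)"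
        using D(7,8)[OF y(1)] \<open>0 < R\<close> unfolding \<phi>x by (intro conjI exI[of _ "1 / R"]) auto
    qed
  qed
qed

lemma pullback_form:
  assumes \<omega>: "is_form k (\<phi> ` K) \<omega>"
  shows "is_form k K (pullback \<phi> \<phi>' \<omega>)"
  unfolding is_form_def
proof (intro conjI ballI allI)
  fix x assume "x \<in> K"
  then have "covector k (\<omega> (\<phi> x))" using is_form_covector[OF \<omega>] by blast
  then show "covector k (pullback \<phi> \<phi>' \<omega> x)" unfolding pullback_def by (rule covector_linear_compose[OF _ linear_deriv])
next
  fix v show "continuous_on K (\<lambda>x. pullback \<phi> \<phi>' \<omega> x v)" unfolding pullback_def
    by (rule form_continuous[OF \<omega>])
      (auto intro!: blinfun.continuous_on continuous_intros continuous_on_subset[OF continuous_on_U K_U] continuous_on_subset[OF cont_deriv K_U])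
qed

text \<open>The normalising factor in \<open>induced_orient\<close> must be the Jacobian, so it
  cancels the Jacobian produced by the change of variables.\<close>

lemma integ_form_image:
  assumes o: "oriented_rect k S s f" and SK: "S \<subseteq> K" and i: "induced_orient k S s f \<phi> \<phi>' s' f'" and \<omega>: "is_form k (\<phi> ` K) \<omega>"
  shows "integ_form k (\<phi> ` S) s' f' \<omega> = integ_form k S s f (pullback \<phi> \<phi>' \<omega>)"
proof -
  interpret C1_tangent U W K \<phi> \<psi> \<phi>' \<psi>' k S f by (rule oriented_rect_C1_tangent[OF o SK])
  note D = oriented_rectD[OF o]
  let ?p = "pullback \<phi> \<phi>' \<omega>"
  have eq: "s' (\<phi> x) * \<omega> (\<phi> x) (f' (\<phi> x)) = s x * ?p x (f x) / J x" if x: "x \<in> S" for x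
  proof -
    obtain j where j: "s' (\<phi> x) \<in> {-1, 1}" "orthonormal_frame k (f' (\<phi> x))" "0 < j"
      "\<And>c. covector k c \<Longrightarrow> s' (\<phi> x) * c (f' (\<phi> x)) = s x * c (\<lambda>i. blinfun_apply (\<phi>' x) (f x i)) / j"
      using i x unfolding induced_orient_def by metis
    have "j = jac k (blinfun_apply (\<phi>' x)) (f x)" by (rule induced_orientation_factor[where A = "blinfun_apply (\<phi>' x)" and f = "f x", OF j(2) D(7)[OF x] j(1,3,4)])
    then have "j = J x" using x by (simp add: J_def)
    moreover have "covector k (\<omega> (\<phi> x))" using is_form_covector[OF \<omega>] x SK by blast
    ultimately show ?thesis using j(4) by (simp add: pullback_def)
  qed
  have sp: "(\<lambda>x. s x * ?p x (f x)) \<in> borel_measurable (restrict_space H S)"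
  proof (rule borel_measurable_times[OF measurable_restrict_space1[OF D(5)] form_measurable[OF pullback_form[OF \<omega>] compact_imp_closed[OF compact_K]]])
    show "(\<lambda>x. x) \<in> borel_measurable (restrict_space H S)"
      by (rule measurable_restrict_space1[OF borel_measurable_hausdorffI]) simp
    show "x \<in> K" if "x \<in> space (restrict_space H S)" for x using that SK by (auto simp: space_restrict_space)
    show "(\<lambda>x. f x i) \<in> borel_measurable (restrict_space H S)" if "i < k" for i
      by (rule measurable_restrict_space1[OF D(6)[OF that]])
  qed
  have "(\<lambda>x. s x * ?p x (f x) / J x) \<in> borel_measurable (restrict_space H S)"
    by (rule borel_measurable_divide[OF sp measurable_restrict_space1[OF J_meas]])
  then have "(\<lambda>x. s' (\<phi> x) * \<omega> (\<phi> x) (f' (\<phi> x))) \<in> borel_measurable (restrict_space H S)"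
    by (rule measurable_cong[THEN iffD1, rotated]) (auto simp: eq space_restrict_space)
  then have "integ_form k (\<phi> ` S) s' f' \<omega> = set_lebesgue_integral H S (\<lambda>x. J x * (s' (\<phi> x) * \<omega> (\<phi> x) (f' (\<phi> x))))"
    unfolding integ_form_def by (rule change_of_variables)
  also have "\<dots> = integ_form k S s f ?p"
    unfolding integ_form_def set_lebesgue_integral_def
  proof (intro Bochner_Integration.integral_cong refl)
    fix x show "indicator S x *\<^sub>R (J x * (s' (\<phi> x) * \<omega> (\<phi> x) (f' (\<phi> x)))) = indicator S x *\<^sub>R (s x * ?p x (f x))"
      using eq[of x] J_pos[of x] by (cases "x \<in> S") auto
  qed
  finally show ?thesis .
qed

end

subsection \<open>Flat discs\<close>

lemma jac_scale:
  assumes f: "orthonormal_frame k f" and c: "0 < c"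
  shows "jac k (\<lambda>v. c *\<^sub>R v) f = c ^ k"
proof -
  obtain v where v: "svd_frame k (\<lambda>v. c *\<^sub>R v) v" "span (v ` {..<k}) = span (f ` {..<k})" "jac k (\<lambda>v. c *\<^sub>R v) f = (\<Prod>i<k. norm (c *\<^sub>R v i))"
    by (rule jac_svd_obtain[OF linear_scale_self f])
  have "norm (v i) = 1" if "i < k" for i
    by (rule orthonormal_onD(1)[of "{..<k}"]) (use v(1) that in \<open>simp_all add: svd_frame_def\<close>)
  then have "(\<Prod>i<k. norm (c *\<^sub>R v i)) = (\<Prod>i<k. c)" using c by (intro prod.cong) auto
  then show ?thesis unfolding v(3) by simp
qed

text \<open>At each point of the open disc, sufficiently small blow-ups already contain the support
  of the test function within the plane, so the integrals equal their limit.\<close>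

lemma flat_disc_tangent:
  fixes f :: "nat \<Rightarrow> 'a::euclidean_space"
  assumes f: "orthonormal_frame k f" and x: "x \<in> ball c \<rho> \<inter> (\<lambda>y. y - c) -` span (f ` {..<k})"
  shows "approx_tangent k (ball c \<rho> \<inter> (\<lambda>y. y - c) -` span (f ` {..<k})) x (span (f ` {..<k}))"
  unfolding approx_tangent_def
proof (intro conjI allI impI)
  let ?P = "span (f ` {..<k})"
  let ?D = "ball c \<rho> \<inter> (\<lambda>y. y - c) -` ?P"
  let ?H = "hausdorff_measure k :: 'a measure"
  show "subspace ?P" by (rule subspace_span)
  show "dim ?P = k" using orthonormal_on_dim[of "{..<k}" f] f by (simp add: orthonormal_frame_on)
  fix g :: "'a \<Rightarrow> real" assume g: "continuous_on UNIV g \<and> bounded {y. g y \<noteq> 0}"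
  then obtain R where R: "0 < R" "\<And>v. g v \<noteq> 0 \<Longrightarrow> norm v < R" unfolding bounded_pos_less by auto
  define u where "u = x - c"
  have u: "u \<in> ?P" "norm u < \<rho>" using x by (auto simp: u_def dist_norm norm_minus_commute)
  define Q where "Q = ?P \<inter> ball 0 R"
  have Q: "Q \<in> sets ?H" unfolding Q_def by (intro borel_hausdorffD sets.Int borel_closed closed_span borel_open open_ball)
  have Qf: "hausdorff_outer k Q < \<infinity>"
    by (rule plane_bounded_finite[OF f]) (auto simp: Q_def intro: bounded_subset[OF bounded_ball])
  \<comment> \<open>\<open>norm u\<close> is the distance of \<open>x\<close> from the centre; for
    such \<open>r\<close> the planar ball of radius \<open>r * R\<close> about \<open>x\<close>
    stays in the disc.\<close>
  have eq: "set_lebesgue_integral ?H ?D (\<lambda>y. g ((1 / r) *\<^sub>R (y - x)) / r ^ k) = set_lebesgue_integral ?H ?P g"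
    if r: "0 < r" "r < (\<rho> - norm u) / R" for r
  proof -
    let ?\<phi> = "\<lambda>v. r *\<^sub>R v + x" and ?h = "\<lambda>y. g ((1 / r) *\<^sub>R (y - x)) / r ^ k" and ?\<psi> = "\<lambda>y. (1 / r) *\<^sub>R (y - x)"
    have h\<phi>: "?h (?\<phi> v) = g v / r ^ k" for v using r(1) by simp
    have area: "hausdorff_outer k (?\<phi> ` B) = ennreal (r ^ k) * hausdorff_outer k B" if "B \<subseteq> Q" for B
    proof -
      have "?\<phi> ` B = (\<lambda>z. z + x) ` (\<lambda>v. r *\<^sub>R v) ` B" by (simp add: image_image)
      then have "hausdorff_outer k (?\<phi> ` B) = hausdorff_outer k ((\<lambda>v. r *\<^sub>R v) ` B)" by (simp only: hausdorff_outer_translate)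
      also have "\<dots> = ennreal (jac k (\<lambda>v. r *\<^sub>R v) f) * hausdorff_outer k B"
        by (rule hausdorff_linear_image[OF linear_scale_self _ f]) (use that r(1) in \<open>auto simp: Q_def inj_on_def\<close>)
      finally show ?thesis by (simp only: jac_scale[OF f r(1)])
    qed
    have fin: "hausdorff_outer k (?\<phi> ` Q) < \<infinity>" using Qf by (simp add: area ennreal_mult_less_top)
    have sub: "?\<phi> ` Q \<subseteq> ?D"
    proof
      fix y assume "y \<in> ?\<phi> ` Q"
      then obtain v where v: "v \<in> ?P" "norm v < R" "y = r *\<^sub>R v + x" by (auto simp: Q_def)
      have yc: "y - c = r *\<^sub>R v + u" using v(3) by (simp add: u_def)
      have "norm (y - c) \<le> norm (r *\<^sub>R v) + norm u" unfolding yc by (rule norm_triangle_ineq)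
      also have "\<dots> \<le> r * R + norm u" using v(2) r(1) by simp
      also have "\<dots> < \<rho>" using r(2) R(1) by (simp add: pos_less_divide_eq)
      finally have "y \<in> ball c \<rho>" by (simp add: dist_norm norm_minus_commute)
      moreover have "y - c \<in> ?P" unfolding yc by (intro span_add span_scale v(1) u(1))
      ultimately show "y \<in> ?D" by simp
    qed
    have "set_lebesgue_integral ?H ?D ?h = set_lebesgue_integral ?H (?\<phi> ` Q) ?h"
      unfolding set_lebesgue_integral_def
    proof (intro Bochner_Integration.integral_cong refl)
      fix y
      have "y \<in> ?\<phi> ` Q" if y: "y \<in> ?D" "?h y \<noteq> 0"
      proof (rule image_eqI)
        show "y = ?\<phi> (?\<psi> y)" using r(1) by simp
        have "y - x = (y - c) - u" by (simp add: u_def)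
        then have "y - x \<in> ?P" using y(1) u(1) by (simp only: span_diff Int_iff vimage_eq)
        then have "?\<psi> y \<in> ?P" by (rule span_scale)
        moreover have "norm (?\<psi> y) < R" using y(2) by (intro R(2)) auto
        ultimately show "?\<psi> y \<in> Q" by (simp add: Q_def)
      qed
      then show "indicat_real ?D y *\<^sub>R ?h y = indicat_real (?\<phi> ` Q) y *\<^sub>R ?h y"
        using sub by (cases "?h y = 0") (auto simp: indicator_def)
    qed
    also have "\<dots> = set_lebesgue_integral ?H Q (\<lambda>v. r ^ k * ?h (?\<phi> v))"
    proof (rule hausdorff_change_of_variables[where \<psi> = ?\<psi>])
      show "?\<psi> (?\<phi> v) = v" for v using r(1) by simp
      show "?\<phi> ` B \<in> sets ?H" if B: "B \<in> sets ?H" "B \<subseteq> Q" for B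
      proof (rule Lipschitz_image_hausdorff_measurable[OF B(1), of r])
        show "hausdorff_outer k B < \<infinity>" using hausdorff_outer_mono[OF B(2)] Qf by (auto intro: le_less_trans)
        show "dist (?\<phi> v) (?\<phi> w) \<le> r * dist v w" for v w
          using r(1) by (simp add: dist_norm scaleR_diff_right[symmetric] del: scaleR_diff_right)
      qed (use r in simp)
      show "?\<psi> ` X \<in> sets ?H" if X: "X \<in> sets ?H" "X \<subseteq> ?\<phi> ` Q" for X
      proof (rule Lipschitz_image_hausdorff_measurable[OF X(1), of "1 / r"])
        show "hausdorff_outer k X < \<infinity>" using hausdorff_outer_mono[OF X(2), of k] fin by (rule le_less_trans)
        show "dist (?\<psi> v) (?\<psi> w) \<le> 1 / r * dist v w" for v w
        proof -
          have "?\<psi> v - ?\<psi> w = (1 / r) *\<^sub>R (v - w)" by (simp add: algebra_simps)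
          then show ?thesis using r(1) by (simp only: dist_norm norm_scaleR) simp
        qed
      qed (use r in simp)
      show "hausdorff_outer k (?\<phi> ` B) = emeasure (density ?H (\<lambda>x. ennreal (r ^ k))) B" if "B \<in> sets ?H" "B \<subseteq> Q" for B
        using area[OF that(2)] that(1) by (simp add: emeasure_density_const emeasure_hausdorff)
      have "g \<in> borel_measurable ?H" using g by (intro borel_measurable_hausdorffI borel_measurable_continuous_onI) blast
      then show "(\<lambda>v. ?h (?\<phi> v)) \<in> borel_measurable (restrict_space ?H Q)"
        unfolding h\<phi> by (intro measurable_restrict_space1) simp
    qed (use r Q in auto)
    also have "\<dots> = set_lebesgue_integral ?H ?P g"
      unfolding set_lebesgue_integral_def h\<phi> using R(2) r(1)
      by (intro Bochner_Integration.integral_cong) (auto simp: indicator_def Q_def)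
    finally show ?thesis .
  qed
  have "0 < (\<rho> - norm u) / R" using u(2) R(1) by simp
  then have "eventually (\<lambda>r. r \<in> {0<..<(\<rho> - norm u) / R}) (at_right 0)" by (rule eventually_at_right_real)
  then have "eventually (\<lambda>r. set_lebesgue_integral ?H ?D (\<lambda>y. g ((1 / r) *\<^sub>R (y - x)) / r ^ k) = set_lebesgue_integral ?H ?P g) (at_right 0)"
    by eventually_elim (rule eq, simp_all)
  then show "((\<lambda>r. set_lebesgue_integral ?H ?D (\<lambda>y. g ((1 / r) *\<^sub>R (y - x)) / r ^ k)) \<longlongrightarrow> set_lebesgue_integral ?H ?P g) (at_right 0)"
    by (rule tendsto_eventually)
qed

text \<open>Supplies a competitor, so that the real supremum defining a Lebesgue constant is taken
  over a nonempty set.\<close>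

lemma exists_oriented_rect:
  fixes \<Omega> :: "'a::euclidean_space set"
  assumes k: "k \<le> DIM('a)" and \<Omega>: "open \<Omega>" "\<Omega> \<noteq> {}"
  obtains S s f where "S \<subseteq> \<Omega>" "oriented_rect k S s f"
proof -
  let ?H = "hausdorff_measure k :: 'a measure"
  obtain c where "c \<in> \<Omega>" using \<Omega>(2) by blast
  then obtain \<rho> where \<rho>: "0 < \<rho>" "ball c \<rho> \<subseteq> \<Omega>" using \<Omega>(1) open_contains_ball by blast
  let ?P = "span (bas ` {..<k}) :: 'a set"
  have f: "orthonormal_frame k (bas :: nat \<Rightarrow> 'a)" using bas_frame[OF k] by (simp add: orthonormal_frame_on)
  define D where "D = ball c \<rho> \<inter> (\<lambda>y. y - c) -` ?P"
  have "closed ((\<lambda>y. y - c) -` ?P)" by (intro closed_vimage closed_span continuous_intros)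
  then have D: "D \<in> sets ?H" unfolding D_def by (intro borel_hausdorffD sets.Int borel_closed borel_open open_ball)
  have "D = (\<lambda>z. z + c) ` (?P \<inter> ball 0 \<rho>)"
  proof (intro equalityI subsetI)
    fix y assume "y \<in> D"
    then show "y \<in> (\<lambda>z. z + c) ` (?P \<inter> ball 0 \<rho>)"
      by (intro image_eqI[of _ _ "y - c"]) (auto simp: D_def dist_norm norm_minus_commute)
  qed (auto simp: D_def dist_norm)
  then have HD: "hausdorff_outer k D = hausdorff_outer k (?P \<inter> ball 0 \<rho>)" by (simp only: hausdorff_outer_translate)
  have pos: "0 < hausdorff_outer k D" unfolding HD by (rule plane_ball_pos[OF f \<rho>(1)])
  have fin: "hausdorff_outer k D < \<infinity>" unfolding HD
    by (rule plane_bounded_finite[OF f]) (auto intro: bounded_subset[OF bounded_ball])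
  have "is_rectifiable k D" unfolding is_rectifiable_def
  proof (intro conjI D exI[of _ ?P] exI[of _ "\<lambda>i v. v + c"] allI)
    show "dim ?P = k" using orthonormal_on_dim[OF bas_frame[OF k]] by simp
    show "\<exists>L. lipschitz_on L ?P (\<lambda>v. v + c)" by (intro exI[of _ 1] lipschitz_onI) auto
    have "D \<subseteq> (\<lambda>v. v + c) ` ?P" unfolding D_def by (auto intro!: image_eqI[of _ _ "_ - c"])
    then have "D - (\<Union>i::nat. (\<lambda>v. v + c) ` ?P) = {}" by blast
    then show "hausdorff_outer k (D - (\<Union>i::nat. (\<lambda>v. v + c) ` ?P)) = 0" by (simp only: hausdorff_outer_empty)
  qed (rule subspace_span)
  then have "oriented_rect k D (\<lambda>_. 1) (\<lambda>_. bas)"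
    unfolding oriented_rect_def using pos fin emeasure_hausdorff[OF D] f flat_disc_tangent[OF f, of _ c \<rho>]
    by (auto simp: D_def)
  moreover have "D \<subseteq> \<Omega>" using \<rho>(2) by (auto simp: D_def)
  ultimately show ?thesis using that by blast
qed

subsection \<open>Lagrange bases and Lebesgue constants\<close>

text \<open>Unisolvence and independence of \<open>\<beta>\<close> say that the evaluation matrix
  \<open>T i (\<beta> j)\<close> has trivial kernel; the columns of a right inverse are the
  coefficients of the basis.\<close>

lemma lagrange_basis_exists:
  assumes V: "V = range (\<lambda>c x v. \<Sum>j<N. c j * \<beta> j x v)"
    and ind: "\<And>c. (\<forall>x\<in>E. \<forall>v. (\<Sum>j<N. c j * \<beta> j x v) = 0) \<Longrightarrow> \<forall>i<N. c i = 0"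
    and lin: "\<And>i c. i < N \<Longrightarrow> T i (\<lambda>x v. \<Sum>j<N. c j * \<beta> j x v) = (\<Sum>j<N. c j * T i (\<beta> j))"
    and u: "unisolvent E N T V"
  shows "\<exists>\<omega>. lagrange_basis N T V \<omega>"
proof -
  have "\<forall>j<N. c j = 0" if "\<forall>i<N. (\<Sum>j<N. T i (\<beta> j) * c j) = 0" for c
  proof (rule ind)
    have "\<forall>i<N. T i (\<lambda>x v. \<Sum>j<N. c j * \<beta> j x v) = 0" using that by (simp add: lin mult.commute)
    then show "\<forall>x\<in>E. \<forall>v. (\<Sum>j<N. c j * \<beta> j x v) = 0" using u unfolding unisolvent_def V by blast
  qed
  then obtain b where b: "\<And>i j. i < N \<Longrightarrow> j < N \<Longrightarrow> (\<Sum>l<N. T i (\<beta> l) * b l j) = (if i = j then 1 else 0)"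
    by (rule real_matrix_left_kernel_trivial[of N "\<lambda>i j. T i (\<beta> j)"]) blast+
  have "lagrange_basis N T V (\<lambda>j x v. \<Sum>l<N. b l j * \<beta> l x v)"
    unfolding lagrange_basis_def
  proof (intro conjI allI impI)
    fix j show "(\<lambda>x v. \<Sum>l<N. b l j * \<beta> l x v) \<in> V" unfolding V by (rule range_eqI) (rule refl)
    fix i assume "i < N" "j < N"
    then show "T i (\<lambda>x v. \<Sum>l<N. b l j * \<beta> l x v) = (if i = j then 1 else 0)"
      using b[of i j] lin[of i "\<lambda>l. b l j"] by (simp add: mult.commute)
  qed
  then show ?thesis by blast
qed

context C1_pair
begin

text \<open>By the area formula the ratio of measures is the average of the Jacobian over
  \<open>S\<close>. The bounds are extended reals because the suprema they stand for may be
  infinite; a point of \<open>S\<close> rules out minus infinity.\<close>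

lemma image_measure_bounds:
  assumes o: "oriented_rect k S s f" and SK: "S \<subseteq> K"
  shows "(\<And>x. x \<in> S \<Longrightarrow> ereal (jac k (blinfun_apply (\<phi>' x)) (f x)) \<le> X) \<Longrightarrow>
      ereal (measure (hausdorff_measure k) (\<phi> ` S) / measure (hausdorff_measure k) S) \<le> X"
    and "(\<And>x. x \<in> S \<Longrightarrow> ereal (inverse (jac k (blinfun_apply (\<phi>' x)) (f x))) \<le> X) \<Longrightarrow>
      ereal (measure (hausdorff_measure k) S / measure (hausdorff_measure k) (\<phi> ` S)) \<le> X"
    and "0 < measure (hausdorff_measure k) (\<phi> ` S)"
proof -
  interpret C1_tangent U W K \<phi> \<psi> \<phi>' \<psi>' k S f by (rule oriented_rect_C1_tangent[OF o SK])
  let ?le1 = "ereal (measure H (\<phi> ` S) / measure H S) \<le> X" and ?le2 = "ereal (measure H S / measure H (\<phi> ` S)) \<le> X"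
  note D = oriented_rectD[OF o]
  obtain s' f' where o': "oriented_rect k (\<phi> ` S) s' f'" by (rule image_oriented_rect[OF o SK]) (rule that)
  note D' = oriented_rectD[OF o']
  show pos: "0 < measure H (\<phi> ` S)" by (rule D'(11))
  have "emeasure (density H (\<lambda>x. ennreal (J x))) S = (\<integral>\<^sup>+x. ennreal (J x) * indicator S x \<partial>H)"
    by (rule emeasure_density) (use J_meas S in auto)
  then have area: "ennreal (measure H (\<phi> ` S)) = (\<integral>\<^sup>+x. ennreal (J x) * indicator S x \<partial>H)"
    using area_formula[OF S(1) order_refl] D'(12) by simp
  have const: "(\<integral>\<^sup>+x. ennreal c * indicator S x \<partial>H) = ennreal (c * measure H S)" if "0 \<le> c" for c
    using that S(1) D(12) emeasure_hausdorff[OF S(1)] by (simp add: nn_integral_cmult ennreal_mult')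
  obtain x0 where x0: "x0 \<in> S" using D(10) by blast
  have J: "J x = jac k (blinfun_apply (\<phi>' x)) (f x)" if "x \<in> S" for x using that by (simp add: J_def)
  show ?le1 if b: "\<And>x. x \<in> S \<Longrightarrow> ereal (jac k (blinfun_apply (\<phi>' x)) (f x)) \<le> X"
  proof (cases X)
    case (real M)
    then have JM: "J x \<le> M" if "x \<in> S" for x using b[OF that] J[OF that] by simp
    have M: "0 \<le> M" using JM[OF x0] J_pos[OF x0] by linarith
    have "ennreal (measure H (\<phi> ` S)) \<le> ennreal (M * measure H S)"
      unfolding area const[OF M, symmetric] using JM
      by (intro nn_integral_mono) (auto simp: indicator_def intro: ennreal_leI)
    then have "measure H (\<phi> ` S) \<le> M * measure H S" using M by (simp add: ennreal_le_iff)
    then show ?thesis using real D(11) by (simp add: pos_divide_le_eq)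
  qed (use b[OF x0] in auto)
  show ?le2 if b: "\<And>x. x \<in> S \<Longrightarrow> ereal (inverse (jac k (blinfun_apply (\<phi>' x)) (f x))) \<le> X"
  proof (cases X)
    case (real M)
    then have iJM: "inverse (J x) \<le> M" if "x \<in> S" for x using b[OF that] J[OF that] by simp
    have M: "0 < M" using iJM[OF x0] J_pos[OF x0] by (meson less_le_trans positive_imp_inverse_positive)
    have JM: "inverse M \<le> J x" if "x \<in> S" for x
      using iJM[OF that] J_pos[OF that] M by (metis inverse_le_imp_le inverse_inverse_eq le_imp_inverse_le positive_imp_inverse_positive)
    have "ennreal (inverse M * measure H S) \<le> ennreal (measure H (\<phi> ` S))"
      unfolding area const[OF less_imp_le[OF positive_imp_inverse_positive[OF M]], symmetric] using JM
      by (intro nn_integral_mono) (auto simp: indicator_def intro: ennreal_leI)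
    then have "inverse M * measure H S \<le> measure H (\<phi> ` S)" by (simp add: ennreal_le_iff)
    then have "measure H S \<le> M * measure H (\<phi> ` S)" using M by (simp add: field_simps)
    then show ?thesis using real pos by (simp add: pos_divide_le_eq)
  qed (use b[OF x0] in auto)
qed

end

lemma C1_diffeo_pair:
  assumes "C1_diffeo U \<phi> \<phi>'" "compact K" "K \<subseteq> U"
  obtains \<psi> \<psi>' where "C1_pair U (\<phi> ` U) K \<phi> \<psi> \<phi>' \<psi>'"
proof -
  obtain \<psi> \<psi>' where \<psi>: "\<And>x. x \<in> U \<Longrightarrow> \<psi> (\<phi> x) = x"
    "\<And>y. y \<in> \<phi> ` U \<Longrightarrow> (\<psi> has_derivative blinfun_apply (\<psi>' y)) (at y)" "continuous_on (\<phi> ` U) \<psi>'"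
    using assms(1) unfolding C1_diffeo_def by blast
  have "C1_pair U (\<phi> ` U) K \<phi> \<psi> \<phi>' \<psi>'"
  proof
    show "open U" "open (\<phi> ` U)" "continuous_on U \<phi>'" "\<And>x. x \<in> U \<Longrightarrow> (\<phi> has_derivative blinfun_apply (\<phi>' x)) (at x)"
      using assms(1) unfolding C1_diffeo_def by blast+
  qed (use \<psi> assms in auto)
  then show ?thesis by (rule that)
qed

section \<open>Comparison of the two Lebesgue constants\<close>

theorem mainTheorem5:
  fixes k N :: nat
    and \<Omega>h \<Omega> Eh U :: "'a::euclidean_space set"
    and \<phi> :: "'a \<Rightarrow> 'a" and \<phi>' :: "'a \<Rightarrow> 'a \<Rightarrow>\<^sub>L 'a"
    and V :: "'a kform set"
    and S :: "nat \<Rightarrow> 'a set"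
    and s s' :: "nat \<Rightarrow> 'a \<Rightarrow> real" and f f' :: "nat \<Rightarrow> 'a \<Rightarrow> nat \<Rightarrow> 'a"
  assumes "k \<le> DIM('a)"
    and "lipschitz_domain \<Omega>h" and "Eh = closure \<Omega>h"
    and "open U" and "Eh \<subseteq> U" and "C1_diffeo U \<phi> \<phi>'"
    and "lipschitz_domain \<Omega>" and "\<phi> ` Eh = closure \<Omega>"
    and "form_subspace_dim k (\<phi> ` Eh) V N"
    and "\<forall>i<N. S i \<subseteq> Eh \<and> oriented_rect k (S i) (s i) (f i)"
    and "\<forall>i<N. induced_orient k (S i) (s i) (f i) \<phi> \<phi>' (s' i) (f' i)"
    and "unisolvent (\<phi> ` Eh) N (\<lambda>i. avg_current k (\<phi> ` S i) (s' i) (f' i)) V"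
  shows "ereal (lebesgue_const k (\<phi> ` Eh) N (\<lambda>i. avg_current k (\<phi> ` S i) (s' i) (f' i)) V)
         \<le> ((SUP x\<in>U. ereal (\<Prod>j<k. sing_vals (\<phi>' x) ! j))
             / inverse (SUP x\<in>U. ereal (\<Prod>j\<in>{DIM('a) - k..<DIM('a)}. inverse (sing_vals (\<phi>' x) ! j))))
           * ereal (lebesgue_const k Eh N (\<lambda>i. avg_current k (S i) (s i) (f i)) (pullback \<phi> \<phi>' ` V))"
proof -
  let ?H = "hausdorff_measure k :: 'a measure" and ?E = "\<phi> ` Eh" and ?pb = "pullback \<phi> \<phi>'"
  let ?T = "\<lambda>i. avg_current k (\<phi> ` S i) (s' i) (f' i)" and ?Th = "\<lambda>i. avg_current k (S i) (s i) (f i)"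
  define X where "X = (SUP x\<in>U. ereal (\<Prod>j<k. sing_vals (\<phi>' x) ! j))"
  define Y where "Y = (SUP x\<in>U. ereal (\<Prod>j\<in>{DIM('a) - k..<DIM('a)}. inverse (sing_vals (\<phi>' x) ! j)))"
  have cEh: "compact Eh" using assms(2,3) by (simp add: lipschitz_domain_def compact_eq_bounded_closed bounded_closure)
  obtain \<psi> \<psi>' where pair: "C1_pair U (\<phi> ` U) Eh \<phi> \<psi> \<phi>' \<psi>'" by (rule C1_diffeo_pair[OF assms(6) cEh assms(5)])
  interpret C1_pair U "\<phi> ` U" Eh \<phi> \<psi> \<phi>' \<psi>' by (rule pair)
  note cE = compact_image_K
  have o: "S i \<subseteq> Eh" "oriented_rect k (S i) (s i) (f i)" "induced_orient k (S i) (s i) (f i) \<phi> \<phi>' (s' i) (f' i)"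
    if "i < N" for i using assms(10,11) that by auto

  have jX: "ereal (jac k (blinfun_apply (\<phi>' x)) g) \<le> X" and jY: "ereal (inverse (jac k (blinfun_apply (\<phi>' x)) g)) \<le> Y"
    if x: "x \<in> Eh" and g: "orthonormal_frame k g" for x g
  proof -
    have xU: "x \<in> U" using x assms(5) by blast
    note j = jac_le_sing_vals[OF inj_deriv[OF xU] g assms(1)]
    have "ereal (jac k (blinfun_apply (\<phi>' x)) g) \<le> ereal (\<Prod>j<k. sing_vals (\<phi>' x) ! j)" using j(1) by simp
    also have "\<dots> \<le> X" unfolding X_def by (rule SUP_upper[OF xU])
    finally show "ereal (jac k (blinfun_apply (\<phi>' x)) g) \<le> X" .
    have "ereal (inverse (jac k (blinfun_apply (\<phi>' x)) g)) \<le> ereal (\<Prod>j\<in>{DIM('a) - k..<DIM('a)}. inverse (sing_vals (\<phi>' x) ! j))"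
      using j(2) by simp
    also have "\<dots> \<le> Y" unfolding Y_def by (rule SUP_upper[OF xU])
    finally show "ereal (inverse (jac k (blinfun_apply (\<phi>' x)) g)) \<le> Y" .
  qed
  \<comment> \<open>One point and one frame suffice to see that \<open>X\<close> is nonnegative and
    \<open>Y\<close> positive, which the extended-real products below require.\<close>
  have "Eh \<noteq> {}" using assms(2,3) by (simp add: lipschitz_domain_def)
  then obtain x0 where x0: "x0 \<in> Eh" by blast
  have f0: "orthonormal_frame k (bas :: nat \<Rightarrow> 'a)" using bas_frame[OF assms(1)] by (simp add: orthonormal_frame_on)
  have j0: "0 < jac k (blinfun_apply (\<phi>' x0)) bas" using x0 assms(5) by (intro jac_pos linear_deriv inj_deriv f0) auto
  have X0: "0 \<le> X" by (rule order_trans[OF _ jX[OF x0 f0]]) (use j0 in simp)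
  have Y0: "0 < Y" by (rule less_le_trans[OF _ jY[OF x0 f0]]) (use j0 in simp)
  \<comment> \<open>For infinite \<open>Y\<close> this relies on the conventions that the inverse of
    infinity is 0 and the inverse of 0 is infinity.\<close>
  have XY: "X / inverse Y = X * Y" using Y0 unfolding divide_ereal_def by (cases Y) auto

  define \<theta> where "\<theta> = (\<lambda>i. measure ?H (\<phi> ` S i) / measure ?H (S i))"
  have \<theta>: "0 < \<theta> i" "ereal (\<theta> i) \<le> X" if i: "i < N" for i
  proof -
    note D = oriented_rectD[OF o(2)[OF i]]
    show "0 < \<theta> i" unfolding \<theta>_def using image_measure_bounds(3)[OF o(2,1)[OF i]] D(11) by simp
    show "ereal (\<theta> i) \<le> X" unfolding \<theta>_def
      by (rule image_measure_bounds(1)[OF o(2,1)[OF i]], rule jX) (use D(8) o(1)[OF i] in auto)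
  qed
  \<comment> \<open>Pulling back preserves integrals and changes only the normalisation, so the two
    families of functionals differ by the factors \<open>\<theta> i\<close>.\<close>
  have Th: "?Th i (?pb \<omega>) = \<theta> i * ?T i \<omega>" if i: "i < N" and \<omega>: "is_form k ?E \<omega>" for i \<omega>
    unfolding avg_current_def integ_form_image[OF o(2,1,3)[OF i] \<omega>] \<theta>_def
    using image_measure_bounds(3)[OF o(2,1)[OF i]] by simp

  obtain \<beta> where \<beta>0: "\<forall>i<N. is_form k ?E (\<beta> i)"
    and ind0: "\<forall>c. (\<forall>x\<in>?E. \<forall>v. (\<Sum>i<N. c i * \<beta> i x v) = 0) \<longrightarrow> (\<forall>i<N. c i = 0)"
    and V0: "V = {\<omega>. \<exists>c. \<omega> = (\<lambda>x v. \<Sum>i<N. c i * \<beta> i x v)}"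
    using assms(9) unfolding form_subspace_dim_def by (elim exE conjE)
  have \<beta>: "is_form k ?E (\<beta> i)" if "i < N" for i using \<beta>0 that by blast
  have ind: "\<forall>i<N. c i = 0" if "\<forall>x\<in>?E. \<forall>v. (\<Sum>i<N. c i * \<beta> i x v) = 0" for c
    by (rule mp[OF spec[OF ind0, of c] that])
  define comb where "comb = (\<lambda>c x v. \<Sum>j<N. c j * \<beta> j x v)"
  have V: "V = range comb" unfolding V0 comb_def by blast
  have covector_comb: "covector k (\<lambda>v. \<Sum>j<N. c j * \<beta> j x v)" if x: "x \<in> ?E" for c x
  proof -
    note cv = is_form_covector[OF \<beta> x]
    show ?thesis unfolding covector_def
    proof (intro conjI allI impI)
      fix v w :: "nat \<Rightarrow> 'a" assume "\<forall>i<k. v i = w i"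
      then show "(\<Sum>j<N. c j * \<beta> j x v) = (\<Sum>j<N. c j * \<beta> j x w)"
        by (intro sum.cong refl arg_cong2[where f = "(*)"] covector_cong[OF cv]) auto
    next
      fix i and v :: "nat \<Rightarrow> 'a" assume "i < k"
      then have "linear (\<lambda>y. \<beta> j x (v(i := y)))" if "j < N" for j using cv[OF that] unfolding covector_def by blast
      then have "linear (\<lambda>y. c j *\<^sub>R \<beta> j x (v(i := y)))" if "j < N" for j using that by (intro linear_compose_scale_right) auto
      then show "linear (\<lambda>y. \<Sum>j<N. c j * \<beta> j x (v(i := y)))" by (intro linear_compose_sum) auto
    next
      fix i j and v :: "nat \<Rightarrow> 'a" assume "i < k" "j < k" "i \<noteq> j \<and> v i = v j"
      then have "\<beta> l x v = 0" if "l < N" for l using cv[OF that] unfolding covector_def by blast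
      then show "(\<Sum>l<N. c l * \<beta> l x v) = 0" by simp
    qed
  qed
  have form: "is_form k ?E (comb c)" for c
    unfolding is_form_def comb_def
    by (intro conjI ballI allI covector_comb continuous_on_sum continuous_on_mult continuous_on_const is_form_continuous[OF \<beta>]) auto
  have lin: "?T i (comb c) = (\<Sum>j<N. c j * ?T i (\<beta> j))" if i: "i < N" for i c
  proof -
    have "?pb (comb c) = (\<lambda>x v. \<Sum>j<N. c j * ?pb (\<beta> j) x v)" by (simp add: pullback_def comb_def)
    then have "integ_form k (\<phi> ` S i) (s' i) (f' i) (comb c) = (\<Sum>j<N. c j * integ_form k (S i) (s i) (f i) (?pb (\<beta> j)))"
      using integ_form_image[OF o(2,1,3)[OF i] form] integ_form_sum[OF o(2,1)[OF i] cEh pullback_form[OF \<beta>]] by simp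
    also have "\<dots> = (\<Sum>j<N. c j * integ_form k (\<phi> ` S i) (s' i) (f' i) (\<beta> j))"
      by (intro sum.cong refl) (simp add: integ_form_image[OF o(2,1,3)[OF i] \<beta>])
    finally show ?thesis by (simp add: avg_current_def sum_divide_distrib)
  qed

  \<comment> \<open>Existence is what gives the choice inside \<open>lebesgue_const\<close> its
    defining property; the same is done below on the reference set.\<close>
  have "\<exists>\<omega>. lagrange_basis N ?T V \<omega>"
    by (rule lagrange_basis_exists[OF V[unfolded comb_def] ind lin[unfolded comb_def] assms(12)]) auto
  then have "lagrange_basis N ?T V (SOME \<omega>. lagrange_basis N ?T V \<omega>)" by (rule someI_ex)
  moreover define \<omega> where "\<omega> = (SOME \<omega>. lagrange_basis N ?T V \<omega>)"
  ultimately have \<omega>: "\<And>j. j < N \<Longrightarrow> \<omega> j \<in> V" "\<And>i j. i < N \<Longrightarrow> j < N \<Longrightarrow> ?T i (\<omega> j) = (if i = j then 1 else 0)"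
    unfolding lagrange_basis_def by auto
  have "\<forall>j. \<exists>c. j < N \<longrightarrow> \<omega> j = comb c" using \<omega>(1) unfolding V by blast
  then obtain C where C: "\<And>j. j < N \<Longrightarrow> \<omega> j = comb (C j)" by metis

  have lin_comb: "?T i (comb (\<lambda>l. a * c l + b * d l)) = a * ?T i (comb c) + b * ?T i (comb d)" if "i < N" for i a b c d
    unfolding lin[OF that] by (simp add: sum.distrib sum_distrib_left algebra_simps)
  \<comment> \<open>Dividing the j-th pulled-back basis form by \<open>\<theta> j\<close> restores
    the value 1. The summand with coefficient 0 only brings the combination into the shape of
    \<open>lin_comb\<close>.\<close>
  have "lagrange_basis N ?Th (?pb ` V) (\<lambda>j. ?pb (comb (\<lambda>l. inverse (\<theta> j) * C j l + 0 * C j l)))"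
    unfolding lagrange_basis_def
  proof (intro conjI allI impI)
    fix i j assume ij: "i < N" "j < N"
    show "?Th i (?pb (comb (\<lambda>l. inverse (\<theta> j) * C j l + 0 * C j l))) = (if i = j then 1 else 0)"
      unfolding Th[OF ij(1) form] lin_comb[OF ij(1)] using \<omega>(2)[OF ij] C[OF ij(2)] \<theta>(1)[OF ij(1)] by auto
  qed (auto simp: V)
  then have "lagrange_basis N ?Th (?pb ` V) (SOME \<omega>. lagrange_basis N ?Th (?pb ` V) \<omega>)" by (rule someI[where P = "lagrange_basis N ?Th (?pb ` V)"])
  moreover define \<omega>h where "\<omega>h = (SOME \<omega>. lagrange_basis N ?Th (?pb ` V) \<omega>)"
  ultimately have \<omega>h: "\<And>j. j < N \<Longrightarrow> \<omega>h j \<in> ?pb ` V" "\<And>i j. i < N \<Longrightarrow> j < N \<Longrightarrow> ?Th i (\<omega>h j) = (if i = j then 1 else 0)"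
    unfolding lagrange_basis_def by auto
  have "\<forall>j. \<exists>c. j < N \<longrightarrow> \<omega>h j = ?pb (comb c)" using \<omega>h(1) unfolding V by blast
  then obtain D where D: "\<And>j. j < N \<Longrightarrow> \<omega>h j = ?pb (comb (D j))" by metis
  \<comment> \<open>The chosen reference basis is pulled back from some combinations
    \<open>comb (D j)\<close>. All functionals vanish on
    \<open>\<omega> j - \<theta> j * comb (D j)\<close>, so unisolvence makes the two agree at
    points of the image, which is all that integrals see.\<close>
  have \<omega>_eq: "\<omega> j x v = \<theta> j * comb (D j) x v" if j: "j < N" and x: "x \<in> ?E" for j x v
  proof -
    let ?d = "comb (\<lambda>l. 1 * C j l + (- \<theta> j) * D j l)"
    have "?T i ?d = 0" if i: "i < N" for i
    proof -
      have "\<theta> i * ?T i (comb (D j)) = (if i = j then 1 else 0)" using \<omega>h(2)[OF i j] D[OF j] Th[OF i form] by simp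
      then show ?thesis unfolding lin_comb[OF i] using \<omega>(2)[OF i j] C[OF j] \<theta>(1)[OF i] by (auto split: if_splits)
    qed
    then have "?d x v = 0" using assms(12) x unfolding unisolvent_def V by blast
    then show ?thesis unfolding C[OF j] comb_def by (simp add: algebra_simps sum_subtractf sum_distrib_left)
  qed

  define A where "A = {(\<Sum>i<N. \<bar>avg_current k T t g (\<omega> i)\<bar>) | T t g. T \<subseteq> ?E \<and> oriented_rect k T t g}"
  define B where "B = {(\<Sum>i<N. \<bar>avg_current k T t g (\<omega>h i)\<bar>) | T t g. T \<subseteq> Eh \<and> oriented_rect k T t g}"
  have L: "lebesgue_const k ?E N ?T V = Sup A" "lebesgue_const k Eh N ?Th (?pb ` V) = Sup B"
    unfolding lebesgue_const_def A_def B_def \<omega>_def \<omega>h_def Let_def by simp_all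
  \<comment> \<open>A real supremum dominates its members only if they are bounded; finitely many
    continuous forms on a compact set provide a common bound.\<close>
  have "bdd_above B"
  proof -
    have "\<forall>i. \<exists>b. i < N \<longrightarrow> (\<forall>x\<in>Eh. \<forall>v. (\<forall>l<k. norm (v l) \<le> 1) \<longrightarrow> \<bar>\<omega>h i x v\<bar> \<le> b)"
    proof
      fix i show "\<exists>b. i < N \<longrightarrow> (\<forall>x\<in>Eh. \<forall>v. (\<forall>l<k. norm (v l) \<le> 1) \<longrightarrow> \<bar>\<omega>h i x v\<bar> \<le> b)"
      proof (cases "i < N")
        case True
        obtain b where "0 < b" "\<And>x v. x \<in> Eh \<Longrightarrow> (\<And>l. l < k \<Longrightarrow> norm (v l) \<le> 1) \<Longrightarrow> \<bar>?pb (comb (D i)) x v\<bar> \<le> b"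
          by (rule form_bounded[OF pullback_form[OF form[of "D i"]] cEh]) blast
        then show ?thesis unfolding D[OF True] by (intro exI[of _ b] impI ballI allI) simp
      qed simp
    qed
    from choice[OF this] obtain b where b0: "\<forall>i. i < N \<longrightarrow> (\<forall>x\<in>Eh. \<forall>v. (\<forall>l<k. norm (v l) \<le> 1) \<longrightarrow> \<bar>\<omega>h i x v\<bar> \<le> b i)" ..
    then have b: "\<bar>\<omega>h i x v\<bar> \<le> b i" if "i < N" "x \<in> Eh" "\<And>l. l < k \<Longrightarrow> norm (v l) \<le> 1" for i x v
      using that by simp
    have "a \<le> (\<Sum>i<N. b i)" if aB: "a \<in> B" for a
    proof -
      obtain T t g where a: "a = (\<Sum>i<N. \<bar>avg_current k T t g (\<omega>h i)\<bar>)" and T: "T \<subseteq> Eh" "oriented_rect k T t g"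
        using aB unfolding B_def mem_Collect_eq by (elim exE conjE)
      have "\<bar>avg_current k T t g (\<omega>h i)\<bar> \<le> b i" if i: "i < N" for i
      proof -
        have "is_form k Eh (\<omega>h i)" unfolding D[OF i] by (rule pullback_form[OF form])
        then have "\<bar>integ_form k T t g (\<omega>h i)\<bar> \<le> b i * measure ?H T"
          by (rule oriented_integrand(2)[OF T(2,1) cEh]) (rule b[OF i])
        then show ?thesis using oriented_rectD(11)[OF T(2)] by (simp add: avg_current_def pos_divide_le_eq)
      qed
      then show ?thesis unfolding a by (intro sum_mono) auto
    qed
    then show ?thesis by (intro bdd_aboveI)
  qed
  then have upper: "a \<le> Sup B" if "a \<in> B" for a using that by (rule cSup_upper[rotated])

  have key: "ereal a \<le> X * Y * ereal (Sup B)" if "a \<in> A" for a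
  proof -
    obtain T t g where a: "a = (\<Sum>i<N. \<bar>avg_current k T t g (\<omega> i)\<bar>)" and T: "T \<subseteq> ?E" "oriented_rect k T t g"
      using \<open>a \<in> A\<close> unfolding A_def mem_Collect_eq by (elim exE conjE)
    obtain R r h where R: "R \<subseteq> Eh" "\<phi> ` R = T" "oriented_rect k R r h" "induced_orient k R r h \<phi> \<phi>' t g"
      by (rule pulled_back_orientation[OF T(2,1)])
    define \<rho> where "\<rho> = measure ?H R / measure ?H T"
    have mR: "0 < measure ?H R" and mT: "0 < measure ?H T" using R(3) T(2) by (auto intro: oriented_rectD(11))
    have \<rho>: "0 \<le> \<rho>" "ereal \<rho> \<le> Y"
    proof -
      show "0 \<le> \<rho>" by (simp add: \<rho>_def)
      show "ereal \<rho> \<le> Y" unfolding \<rho>_def R(2)[symmetric]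
        by (rule image_measure_bounds(2)[OF R(3,1)], rule jY) (use R(1) oriented_rectD(8)[OF R(3)] in auto)
    qed
    \<comment> \<open>The sum on the image equals the reference sum of \<open>R\<close> term by
      term, up to \<open>\<theta> i * \<rho>\<close>: \<open>\<theta> i\<close> is at most
      \<open>X\<close>, the inverse ratio \<rho> at most \<open>Y\<close>.\<close>
    have summand: "\<bar>avg_current k T t g (\<omega> i)\<bar> = \<theta> i * \<rho> * \<bar>avg_current k R r h (\<omega>h i)\<bar>" if i: "i < N" for i
    proof -
      have "integ_form k T t g (\<omega> i) = integ_form k T t g (\<lambda>x v. \<theta> i * comb (D i) x v)"
        by (rule integ_form_cong) (use T(1) \<omega>_eq[OF i] in auto)
      also have "\<dots> = \<theta> i * integ_form k T t g (comb (D i))"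
        unfolding integ_form_def set_lebesgue_integral_def by (simp add: mult.left_commute[of _ "\<theta> i"])
      also have "integ_form k T t g (comb (D i)) = integ_form k R r h (\<omega>h i)"
        using integ_form_image[OF R(3,1,4) form[of "D i"]] R(2) D[OF i] by simp
      finally show ?thesis using \<theta>(1)[OF i] \<rho>(1) mR mT by (simp add: avg_current_def \<rho>_def abs_mult)
    qed
    have mem: "(\<Sum>i<N. \<bar>avg_current k R r h (\<omega>h i)\<bar>) \<in> B"
      unfolding B_def using R(1,3) by (intro CollectI exI[of _ R] exI[of _ r] exI[of _ h] conjI) simp_all
    have "ereal a = (\<Sum>i<N. ereal (\<theta> i * \<rho>) * ereal \<bar>avg_current k R r h (\<omega>h i)\<bar>)"
      unfolding a using summand by simp
    also have "\<dots> \<le> (\<Sum>i<N. X * Y * ereal \<bar>avg_current k R r h (\<omega>h i)\<bar>)"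
    proof (rule sum_mono)
      fix i assume "i \<in> {..<N}"
      then have i: "i < N" by simp
      have "ereal (\<theta> i) * ereal \<rho> \<le> X * Y"
        by (intro ereal_mult_mono) (use \<theta>[OF i] \<rho> X0 Y0 in auto)
      then show "ereal (\<theta> i * \<rho>) * ereal \<bar>avg_current k R r h (\<omega>h i)\<bar> \<le> X * Y * ereal \<bar>avg_current k R r h (\<omega>h i)\<bar>"
        by (intro ereal_mult_right_mono) auto
    qed
    also have "\<dots> = X * Y * (\<Sum>i<N. ereal \<bar>avg_current k R r h (\<omega>h i)\<bar>)"
      by (rule sum_ereal_right_distrib[symmetric]) simp
    also have "\<dots> = X * Y * ereal (\<Sum>i<N. \<bar>avg_current k R r h (\<omega>h i)\<bar>)" by simp
    also have "\<dots> \<le> X * Y * ereal (Sup B)"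
      by (intro ereal_mult_left_mono) (use upper[OF mem] X0 Y0 in auto)
    finally show ?thesis .
  qed
  \<comment> \<open>Nonemptiness of \<open>A\<close>, from a flat disc in the open domain whose
    closure is the image of \<open>Eh\<close>.\<close>
  obtain T t g where "T \<subseteq> \<Omega>" "oriented_rect k T t g"
    by (rule exists_oriented_rect[OF assms(1), of \<Omega>]) (use assms(7) in \<open>auto simp: lipschitz_domain_def\<close>)
  then have "(\<Sum>i<N. \<bar>avg_current k T t g (\<omega> i)\<bar>) \<in> A"
    using closure_subset[of \<Omega>] unfolding A_def assms(8) by (intro CollectI exI[of _ T] exI[of _ t] exI[of _ g] conjI) auto
  then obtain a0 where a0: "a0 \<in> A" ..
  \<comment> \<open>The bound may be infinite, so the real least upper bound property applies only
    for finite \<open>z\<close>; the member \<open>a0\<close> excludes minus infinity.\<close>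
  have "ereal (Sup A) \<le> z" if z: "\<And>a. a \<in> A \<Longrightarrow> ereal a \<le> z" for z :: ereal
  proof (cases z)
    case (real m)
    then have "Sup A \<le> m" using z a0 by (intro cSup_least) auto
    then show ?thesis using real by simp
  qed (use z[OF a0] in auto)
  from this[OF key] show ?thesis unfolding L X_def[symmetric] Y_def[symmetric] XY .
qed

end
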